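(* Let $K\subset\mathbb R$ denote a self-similar set for the iterated function system $\Phi$ acting on $X$ which satisfies the open set condition with feasible open set $\operatorname{int}X$. Let $\delta$ denote its Minkowski dimension, let $\mathcal U\supset X$ be a connected open neighbourhood of $X$ in $\mathbb R$ and let $g\colon\mathcal U\to\mathbb R$ be a $\mathcal C^{1+\alpha}(\mathcal U)$ map, $\alpha>0$, for which $|g'|$ is bounded away from $0$. Assume that $\lambda^1(K)=0$ and set $F:=g(K)$. (i) The average fractal curvature measures of both $K$ and $F$ exist. Moreover, for $k\in\{0,1\}$, the measure $\widetilde C_k^f(F,\cdot)$ is absolutely continuous with respect to $\widetilde C_k^f(K,\cdot)\circ g^{-1}$, with Radon–Nikodym derivative $$\frac{d\widetilde C_k^f(F,\cdot)}{d\widetilde C_k^f(K,\cdot)\circ g^{-1}}=|g'\circ g^{-1}|^\delta.$$ (ii) If $\Phi$ is nonlattice, then the fractal curvature measures of both $K$ and $F$ exist and, for $k\in\{0,1\}$, $C_k^f(F,\cdot)$ is absolutely continuous with respect to $C_k^f(K,\cdot)\circ g^{-1}$, with Radon–Nikodym derivative $$\frac{dC_k^f(F,\cdot)}{dC_k^f(K,\cdot)\circ g^{-1}}=|g'\circ g^{-1}|^\delta.$$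
   Context: **Iterated function systems.** $X\subset\mathbb R$ is a nonempty compact interval, $\Phi=\{R_1,\dots,R_N\}$, $N\ge2$, consists of similarities $R_i\colon X\to X$ with similarity ratios $r_i=|R_i'|\in(0,1)$, and $K$ is the unique nonempty compact set with $K=\bigcup_iR_i(K)$. $\Phi$ satisfies the open set condition with feasible open set $O$ if $O\subset\mathbb R$ is nonempty, open and bounded, $\bigcup_iR_i(O)\subseteq O$ and $R_i(O)\cap R_j(O)=\emptyset$ for $i\ne j$. $\mathcal C^{1+\alpha}$ is the class of real valued differentiable functions whose derivative is ($\alpha$-)Hölder continuous. The Minkowski dimension is $\delta=1-\lim_{\varepsilon\searrow0}\ln\lambda^1(K_\varepsilon)/\ln\varepsilon$, which exists. **Lattice property.** Let $\Sigma^\infty$ be the set of infinite words over $\{1,\dots,N\}$ with the topology of pointwise convergence, with left shift $\sigma$. The geometric potential function is $\xi(\omega)=-\ln r_{\omega_1}$. $\Phi$ is lattice if there are continuous $\zeta,\psi\colon\Sigma^\infty\to\mathbb R$ with $\xi-\zeta=\psi-\psi\circ\sigma$ and the range of $\zeta$ contained in a discrete subgroup of $\mathbb R$; otherwise $\Phi$ is nonlattice. **Curvature measures.** $\lambda^0$ is counting measure, $\lambda^1$ Lebesgue measure on $\mathbb R$, $Y_\varepsilon=\{x\in\mathbb R:\inf_{y\in Y}|x-y|\le\varepsilon\}$ and $\partial$ is the boundary. For $Y\subset\mathbb R$ nonempty compact, $s_0(Y)=\inf\{t\in\mathbb R:\varepsilon^t\lambda^0(\partial Y_\varepsilon)\to0\text{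 as }\varepsilon\to0\}$ and $s_1(Y)=\inf\{t\in\mathbb R:\varepsilon^t\lambda^1(Y_\varepsilon)\to0\text{ as }\varepsilon\to0\}$. The fractal curvature measures are the weak limits (of finite Borel measures), if they exist, $$C_0^f(Y,\cdot)=\operatorname*{w-lim}_{\varepsilon\to0}\varepsilon^{s_0(Y)}\lambda^0(\partial Y_\varepsilon\cap\cdot)/2,\qquad C_1^f(Y,\cdot)=\operatorname*{w-lim}_{\varepsilon\to0}\varepsilon^{s_1(Y)}\lambda^1(Y_\varepsilon\cap\cdot).$$ The average fractal curvature measures are the weak limits, if they exist, $$\widetilde C_0^f(Y,\cdot)=\operatorname*{w-lim}_{T\searrow0}\frac1{2|\ln T|}\int_T^1\varepsilon^{s_0(Y)-1}\lambda^0(\partial Y_\varepsilon\cap\cdot)\,d\varepsilon,\qquad \widetilde C_1^f(Y,\cdot)=\operatorname*{w-lim}_{T\searrow0}\frac1{|\ln T|}\int_T^1\varepsilon^{s_1(Y)-1}\lambda^1(Y_\varepsilon\cap\cdot)\,d\varepsilon.$$ For a measure $m$ supported on $K$, $m\circ g^{-1}$ denotes its push-forward $B\mapsto m(g^{-1}(B))$ under $g$. *)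

theory Defs
  imports "HOL-Analysis.Analysis"
begin

(* The maps are R 1, ..., R N with similarity ratios r 1, ..., r N; only the values of R i
   on X are constrained. *)
definition similarity_ifs ::
    "nat \<Rightarrow> (nat \<Rightarrow> real \<Rightarrow> real) \<Rightarrow> (nat \<Rightarrow> real) \<Rightarrow> real set \<Rightarrow> bool" where
  "similarity_ifs N R r X \<longleftrightarrow>
     2 \<le> N \<and> X \<noteq> {} \<and> compact X \<and> is_interval X \<and>
     (\<forall>i\<in>{1..N}. 0 < r i \<and> r i < 1 \<and> R i ` X \<subseteq> X \<and>
        (\<forall>x\<in>X. \<forall>y\<in>X. dist (R i x) (R i y) = r i * dist x y))"

definition self_similar_set :: "nat \<Rightarrow> (nat \<Rightarrow> real \<Rightarrow> real) \<Rightarrow> real set \<Rightarrow> real set \<Rightarrow> bool" where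
  "self_similar_set N R X K \<longleftrightarrow>
     K \<subseteq> X \<and> K \<noteq> {} \<and> compact K \<and> K = (\<Union>i\<in>{1..N}. R i ` K)"

definition open_set_condition :: "nat \<Rightarrow> (nat \<Rightarrow> real \<Rightarrow> real) \<Rightarrow> real set \<Rightarrow> bool" where
  "open_set_condition N R U \<longleftrightarrow>
     U \<noteq> {} \<and> open U \<and> bounded U \<and> (\<Union>i\<in>{1..N}. R i ` U) \<subseteq> U \<and>
     (\<forall>i\<in>{1..N}. \<forall>j\<in>{1..N}. i \<noteq> j \<longrightarrow> R i ` U \<inter> R j ` U = {})"

(* Infinite words; \<omega> 0 is the first letter.  The type nat \<Rightarrow> nat carries the product topology
   of discrete spaces, whose restriction to this set is the topology of pointwise convergence. *)
definition words :: "nat \<Rightarrow> (nat \<Rightarrow> nat) set" where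
  "words N = {\<omega>. \<forall>n. \<omega> n \<in> {1..N}}"

definition left_shift :: "(nat \<Rightarrow> nat) \<Rightarrow> nat \<Rightarrow> nat" where
  "left_shift \<omega> = (\<lambda>n. \<omega> (Suc n))"

definition geometric_potential :: "(nat \<Rightarrow> real) \<Rightarrow> (nat \<Rightarrow> nat) \<Rightarrow> real" where
  "geometric_potential r \<omega> = - ln (r (\<omega> 0))"

definition discrete_subgroup :: "real set \<Rightarrow> bool" where
  "discrete_subgroup H \<longleftrightarrow> 0 \<in> H \<and> (\<forall>x\<in>H. \<forall>y\<in>H. x - y \<in> H) \<and> discrete H"

definition lattice_ifs :: "nat \<Rightarrow> (nat \<Rightarrow> real) \<Rightarrow> bool" where
  "lattice_ifs N r \<longleftrightarrow>
     (\<exists>\<zeta> \<psi> H. continuous_on (words N) \<zeta> \<and> continuous_on (words N) \<psi> \<and>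
        (\<forall>\<omega>\<in>words N. geometric_potential r \<omega> - \<zeta> \<omega> = \<psi> \<omega> - \<psi> (left_shift \<omega>)) \<and>
        discrete_subgroup H \<and> \<zeta> ` words N \<subseteq> H)"

definition parallel_set :: "real set \<Rightarrow> real \<Rightarrow> real set" where
  "parallel_set Y \<epsilon> = {x. infdist x Y \<le> \<epsilon>}"

definition minkowski_dim :: "real set \<Rightarrow> real" where
  "minkowski_dim Y =
     1 - Lim (at_right 0) (\<lambda>\<epsilon>. ln (measure lborel (parallel_set Y \<epsilon>)) / ln \<epsilon>)"

(* The Borel measure B \<mapsto> \<lambda>^k(S \<inter> B), with S the boundary of the parallel set and \<lambda>^0 the
   counting measure if k = 0, and S the parallel set and \<lambda>^1 Lebesgue measure if k = 1.
   Only k = 0 and k = 1 are meaningful. *)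
definition curvature_measure :: "nat \<Rightarrow> real set \<Rightarrow> real \<Rightarrow> real measure" where
  "curvature_measure k Y \<epsilon> = measure_of UNIV (sets borel)
     (\<lambda>B. if k = 0 then emeasure (count_space UNIV) (frontier (parallel_set Y \<epsilon>) \<inter> B)
          else emeasure lborel (parallel_set Y \<epsilon> \<inter> B))"

lemma sets_curvature_measure [simp]: "sets (curvature_measure k Y \<epsilon>) = sets borel"
  unfolding curvature_measure_def
  by (metis sets.sigma_sets_eq sets_measure_of_conv space_borel subset_UNIV Pow_UNIV top_greatest)

lemma closed_parallel_set: "closed (parallel_set Y \<epsilon>)"
  unfolding parallel_set_def by (intro closed_Collect_le continuous_intros)

lemma emeasure_curvature_measure:
  assumes "B \<in> sets borel"
  shows "emeasure (curvature_measure k Y \<epsilon>) B =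
    (if k = 0 then emeasure (count_space UNIV) (frontier (parallel_set Y \<epsilon>) \<inter> B)
     else emeasure lborel (parallel_set Y \<epsilon> \<inter> B))"
proof -
  let ?f = "\<lambda>B. if k = 0 then emeasure (count_space UNIV) (frontier (parallel_set Y \<epsilon>) \<inter> B)
     else emeasure lborel (parallel_set Y \<epsilon> \<inter> B)"
  have P: "parallel_set Y \<epsilon> \<in> sets borel"
    using closed_parallel_set by (rule borel_closed)
  have "positive (sets borel) ?f"
    by (simp add: positive_def)
  moreover have "countably_additive (sets borel) ?f"
  proof (rule countably_additiveI)
    fix A :: "nat \<Rightarrow> real set"
    assume A: "range A \<subseteq> sets borel" and d: "disjoint_family A"
    show "(\<Sum>i. ?f (A i)) = ?f (\<Union> (range A))"
    proof (cases "k = 0")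
      case True
      have "(\<Sum>i. emeasure (count_space UNIV) (frontier (parallel_set Y \<epsilon>) \<inter> A i)) =
          emeasure (count_space UNIV) (\<Union>i. frontier (parallel_set Y \<epsilon>) \<inter> A i)"
        using d by (intro suminf_emeasure) (auto simp: disjoint_family_on_def)
      then show ?thesis
        using True by simp
    next
      case False
      have "(\<Sum>i. emeasure lborel (parallel_set Y \<epsilon> \<inter> A i)) =
          emeasure lborel (\<Union>i. parallel_set Y \<epsilon> \<inter> A i)"
        using d A P by (intro suminf_emeasure) (auto simp: disjoint_family_on_def)
      then show ?thesis
        using False by simp
    qed
  qed
  moreover have "sigma_algebra UNIV (sets (borel :: real measure))"
    by (metis sets.sigma_algebra_axioms space_borel)
  ultimately show ?thesis
    using assms unfolding curvature_measure_def by (intro emeasure_measure_of_sigma) auto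
qed

(* The exponents s_0 and s_1.  For nonempty compact Y the set is nonempty and bounded below,
   so the real infimum is the intended one. *)
definition scaling_exponent :: "nat \<Rightarrow> real set \<Rightarrow> real" where
  "scaling_exponent k Y =
     Inf {t. ((\<lambda>\<epsilon>. ennreal (\<epsilon> powr t) * emeasure (curvature_measure k Y \<epsilon>) UNIV) \<longlongrightarrow> 0)
             (at_right 0)}"

definition curvature_factor :: "nat \<Rightarrow> real" where
  "curvature_factor k = (if k = 0 then 1 / 2 else 1)"

(* The library's weak convergence is formulated through distribution functions and meant for
   sequences of probability measures; here the total masses may vary. *)
definition is_weak_limit :: "('b \<Rightarrow> real measure) \<Rightarrow> real measure \<Rightarrow> 'b filter \<Rightarrow> bool" where
  "is_weak_limit \<mu> m F \<longleftrightarrow>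
     sets m = sets borel \<and> finite_measure m \<and>
     (\<forall>\<^sub>F t in F. sets (\<mu> t) = sets borel \<and> finite_measure (\<mu> t)) \<and>
     (\<forall>f::real \<Rightarrow> real. continuous_on UNIV f \<longrightarrow> bounded (range f) \<longrightarrow>
        ((\<lambda>t. \<integral>x. f x \<partial>\<mu> t) \<longlongrightarrow> (\<integral>x. f x \<partial>m)) F)"

definition weakly_convergent :: "('b \<Rightarrow> real measure) \<Rightarrow> 'b filter \<Rightarrow> bool" where
  "weakly_convergent \<mu> F \<longleftrightarrow> (\<exists>m. is_weak_limit \<mu> m F)"

definition weak_limit :: "('b \<Rightarrow> real measure) \<Rightarrow> 'b filter \<Rightarrow> real measure" where
  "weak_limit \<mu> F = (THE m. is_weak_limit \<mu> m F)"

definition rescaled_curvature_measure :: "nat \<Rightarrow> real set \<Rightarrow> real \<Rightarrow> real measure" where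
  "rescaled_curvature_measure k Y \<epsilon> =
     scale_measure (ennreal (curvature_factor k * \<epsilon> powr scaling_exponent k Y))
       (curvature_measure k Y \<epsilon>)"

definition frac_curv_exists :: "nat \<Rightarrow> real set \<Rightarrow> bool" where
  "frac_curv_exists k Y \<longleftrightarrow> weakly_convergent (rescaled_curvature_measure k Y) (at_right 0)"

definition frac_curv :: "nat \<Rightarrow> real set \<Rightarrow> real measure" where
  "frac_curv k Y = weak_limit (rescaled_curvature_measure k Y) (at_right 0)"

(* For compact nonempty Y and 0 < T the set function is countably additive: the integrand is
   Borel measurable in \<epsilon>, since for k = 0 it is a countable sum over the gaps of Y. *)
definition averaged_curvature_measure :: "nat \<Rightarrow> real set \<Rightarrow> real \<Rightarrow> real measure" where
  "averaged_curvature_measure k Y T =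
     scale_measure (ennreal (curvature_factor k / \<bar>ln T\<bar>))
       (measure_of UNIV (sets borel)
         (\<lambda>B. \<integral>\<^sup>+\<epsilon>\<in>{T..1}. (ennreal (\<epsilon> powr (scaling_exponent k Y - 1)) *
                 emeasure (curvature_measure k Y \<epsilon>) B) \<partial>lborel))"

definition avg_frac_curv_exists :: "nat \<Rightarrow> real set \<Rightarrow> bool" where
  "avg_frac_curv_exists k Y \<longleftrightarrow> weakly_convergent (averaged_curvature_measure k Y) (at_right 0)"

definition avg_frac_curv :: "nat \<Rightarrow> real set \<Rightarrow> real measure" where
  "avg_frac_curv k Y = weak_limit (averaged_curvature_measure k Y) (at_right 0)"

definition C1_hoelder :: "real \<Rightarrow> real set \<Rightarrow> (real \<Rightarrow> real) \<Rightarrow> bool" where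
  "C1_hoelder \<alpha> U g \<longleftrightarrow>
     (\<forall>x\<in>U. g differentiable (at x)) \<and>
     (\<exists>C. \<forall>x\<in>U. \<forall>y\<in>U. \<bar>deriv g x - deriv g y\<bar> \<le> C * \<bar>x - y\<bar> powr \<alpha>)"

(* B \<mapsto> m (g\<^sup>-\<^sup>1(B)) for a map g defined on U; restricting to U makes the values of the total
   function g outside U irrelevant. *)
definition push_forward :: "real set \<Rightarrow> (real \<Rightarrow> real) \<Rightarrow> real measure \<Rightarrow> real measure" where
  "push_forward U g m = distr (restrict_space m U) borel g"

definition ac_with_RN_derivative :: "'a measure \<Rightarrow> 'a measure \<Rightarrow> ('a \<Rightarrow> real) \<Rightarrow> bool" where
  "ac_with_RN_derivative \<nu> \<mu> h \<longleftrightarrow>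
     absolutely_continuous \<mu> \<nu> \<and> (AE y in \<mu>. RN_deriv \<mu> \<nu> y = ennreal (h y))"

end

theory Submission
  imports Defs "HOL-Probability.Probability" "HOL-Real_Asymp.Real_Asymp"
begin

text \<open>
  For a null set the boundary of the parallel set at distance \<open>t\<close> consists of the two outer points and
  of two points for every gap longer than \<open>2 t\<close>, and the volume of the parallel set is the integral of the
  number of boundary points over the distances \<open>0 < t \<le> \<epsilon>\<close>. So everything is governed by the gaps, and
  the case \<open>k = 1\<close> is an average over scales of the case \<open>k = 0\<close>.

  Up to finitely many primary gaps, the gaps of \<open>K\<close> are the disjoint union of their images under the maps
  of the system. Hence \<open>\<epsilon>\<^sup>\<delta>\<close> times the number of gaps longer than \<open>2 \<epsilon>\<close> solves a renewal equation, which
  gives its logarithmic average limit and, if the ratios are not multiplicatively lattice, its limit. On a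
  cylinder of high level \<open>g\<close> is almost a similarity of ratio \<open>|g'|\<close>, so counting the gaps of \<open>g(K)\<close> cylinder
  by cylinder shows that the limits exist and integrate \<open>f\<close> to a constant times the integral of
  \<open>(f \<circ> g) |g'|\<^sup>\<delta>\<close> against the self-similar measure. Taking \<open>g\<close> to be the identity gives \<open>K\<close> itself.
\<close>


section \<open>Boundary points of parallel sets\<close>

text \<open>The map g destroys the recursion: gaps of \<open>F\<close> are not scaled copies of each
  other, so no renewal equation holds for F. Renewal theory is therefore applied to K alone, to its
  counts of gaps; g enters through the mean value theorem, which replaces counts of image gaps by
  counts of gaps of K at rescaled thresholds. The gaps missed by the cylinders of a fixed level are
  bounded in number independently of the scale, so the factor \<open>t powr \<delta>\<close> removes
  them. All limits carry one constant that depends on K and k but not on g; this is why no constant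
  survives in the Radon-Nikodym derivative. For lattice systems the limit without averaging may fail
  to exist. The scaling exponents and the Minkowski dimension therefore rest on two-sided bounds for
  the scaled counts, obtained directly from the recursion. The exponent \<delta> is introduced as
  the root of the Moran equation; that it lies below 1 follows from K being null, and makes the
  weight u^(-\<delta>), which carries k = 0 to k = 1, integrable at 0.\<close>

text \<open>A pair \<open>(a, s)\<close> with \<open>s = 1\<close> or \<open>s = -1\<close> stands for the boundary point \<open>a + s t\<close>. The closed bound
  \<open>u \<le> 2 t\<close> discards the midpoints of gaps of length exactly \<open>2 t\<close>, which are interior to the parallel set.\<close>

definition boundary_dirs :: "real set \<Rightarrow> real \<Rightarrow> (real \<times> real) set" where
  "boundary_dirs Y t = {(a, s). a \<in> Y \<and> (s = 1 \<or> s = -1) \<and> (\<forall>u. 0 < u \<and> u \<le> 2 * t \<longrightarrow> a + s * u \<notin> Y)}"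

definition dir_point :: "real \<Rightarrow> real \<times> real \<Rightarrow> real" where
  "dir_point t e = fst e + snd e * t"

definition all_dirs :: "real set \<Rightarrow> (real \<times> real) set" where
  "all_dirs Y = (\<Union>t\<in>{0<..}. boundary_dirs Y t)"

lemma boundary_dirsI:
  assumes "a \<in> Y" "s = 1 \<or> s = -1" "\<And>u. 0 < u \<Longrightarrow> u \<le> 2 * t \<Longrightarrow> a + s * u \<in> Y \<Longrightarrow> False"
  shows "(a, s) \<in> boundary_dirs Y t"
  using assms unfolding boundary_dirs_def by blast

lemma boundary_dirsD: "(a, s) \<in> boundary_dirs Y t \<Longrightarrow> 0 < u \<Longrightarrow> u \<le> 2 * t \<Longrightarrow> a + s * u \<notin> Y"
  by (simp add: boundary_dirs_def)

lemma boundary_dirs_antimono: "t \<le> t' \<Longrightarrow> boundary_dirs Y t' \<subseteq> boundary_dirs Y t"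
  unfolding boundary_dirs_def by auto

lemma boundary_dirs_subset_all: "0 < t \<Longrightarrow> boundary_dirs Y t \<subseteq> all_dirs Y"
  unfolding all_dirs_def by auto

text \<open>Directions of opposite sign that meet at one point have base points exactly 2t apart,
  which the closed bound in \<open>boundary_dirs\<close> forbids.\<close>

lemma inj_dir_point:
  assumes "t > 0" shows "inj_on (dir_point t) (boundary_dirs Y t)"
proof (rule inj_onI, clarify)
  fix a s b r
  assume A: "(a, s) \<in> boundary_dirs Y t" "(b, r) \<in> boundary_dirs Y t"
    and eq: "dir_point t (a, s) = dir_point t (b, r)"
  show "a = b \<and> s = r"
  proof (cases "s = r")
    case False
    then have "r = - s" using A by (auto simp: boundary_dirs_def)
    then have "b = a + s * (2 * t)" using eq by (simp add: dir_point_def)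
    then have "b \<notin> Y" using A(1) assms unfolding boundary_dirs_def by auto
    then show ?thesis using A(2) unfolding boundary_dirs_def by auto
  qed (use eq in \<open>auto simp: dir_point_def\<close>)
qed

text \<open>A point y of \<open>Y\<close> closer than t would be \<open>a + s * u\<close> with
  \<open>u = s * (y - a)\<close> strictly between 0 and 2t, inside the stretch kept free of
  \<open>Y\<close>.\<close>

lemma infdist_dir_point:
  assumes "t > 0" "e \<in> boundary_dirs Y t"
  shows "infdist (dir_point t e) Y = t"
proof -
  obtain a s where e: "e = (a, s)" by fastforce
  have a: "a \<in> Y" "s = 1 \<or> s = -1" and no: "\<And>u. 0 < u \<Longrightarrow> u \<le> 2 * t \<Longrightarrow> a + s * u \<notin> Y"
    using assms(2) e unfolding boundary_dirs_def by auto
  have 1: "infdist (a + s * t) Y \<le> t"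
    using infdist_le[OF a(1), of "a + s * t"] a(2) \<open>t > 0\<close> by (auto simp: dist_real_def)
  have 2: "t \<le> infdist (a + s * t) Y"
    unfolding infdist_notempty[OF ex_in_conv[THEN iffD1, OF exI, OF a(1)]]
  proof (rule cINF_greatest)
    show "Y \<noteq> {}" using a by auto
    fix y assume y: "y \<in> Y"
    show "t \<le> dist (a + s * t) y"
    proof (rule ccontr)
      assume "\<not> t \<le> dist (a + s * t) y"
      then have "\<bar>a + s * t - y\<bar> < t" by (simp add: dist_real_def)
      then have "0 < s * (y - a)" "s * (y - a) \<le> 2 * t" using a(2) by auto
      then have "a + s * (s * (y - a)) \<notin> Y" by (rule no)
      moreover have "a + s * (s * (y - a)) = y" using a(2) by auto
      ultimately show False using y by simp
    qed
  qed
  show ?thesis using 1 2 by (simp add: e dir_point_def)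
qed

text \<open>The ray from a nearest point y through x is free of \<open>Y\<close> at all distances
  strictly between 0 and 2t. A point of \<open>Y\<close> at distance exactly 2t makes x the midpoint
  of a gap; otherwise y is the base point of a direction.\<close>

lemma infdist_pos_cases:
  assumes "closed Y" "Y \<noteq> {}" "infdist x Y = t" "t > 0"
  shows "x \<in> dir_point t ` boundary_dirs Y t \<or> (x - t \<in> Y \<and> x + t \<in> Y)"
proof -
  obtain y where y: "y \<in> Y" "infdist x Y = dist x y"
    using infdist_attains_inf[OF assms(1,2)] by metis
  have far: "t \<le> dist x z" if "z \<in> Y" for z using infdist_le[OF that, of x] assms(3) by simp
  define s where "s = sgn (x - y)"
  have xy: "\<bar>x - y\<bar> = t" using y(2) assms(3) by (simp add: dist_real_def)
  then have s: "s = 1 \<or> s = -1" and x: "x = y + s * t" using \<open>t > 0\<close>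
    by (auto simp: s_def sgn_if abs_if split: if_splits)
  show ?thesis
  proof (cases "y + s * (2 * t) \<in> Y")
    case True
    moreover have "s = 1 \<Longrightarrow> x - t = y \<and> x + t = y + s * (2 * t)"
      "s = -1 \<Longrightarrow> x + t = y \<and> x - t = y + s * (2 * t)"
      unfolding x by simp_all
    ultimately show ?thesis using y(1) s by metis
  next
    case False
    have "(y, s) \<in> boundary_dirs Y t"
    proof (rule boundary_dirsI[OF y(1) s])
      fix u assume u: "0 < u" "u \<le> 2 * t" "y + s * u \<in> Y"
      then have "u \<noteq> 2 * t" using False by auto
      with far[OF u(3)] x u s show False by (auto simp: dist_real_def)
    qed
    then show ?thesis using x by (force simp: dir_point_def)
  qed
qed

text \<open>The far end \<open>a + s * (2 * t)\<close> lies in the open complement of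
  \<open>Y\<close>. The extension lets the distance to \<open>Y\<close> grow past t along the
  direction, which keeps boundary points out of the interior.\<close>

lemma boundary_dirs_extend:
  assumes "closed Y" "t > 0" "(a, s) \<in> boundary_dirs Y t"
  obtains d where "d > 0" "(a, s) \<in> boundary_dirs Y (t + d)"
proof -
  have a: "a \<in> Y" "s = 1 \<or> s = -1" and no: "\<And>u. 0 < u \<Longrightarrow> u \<le> 2 * t \<Longrightarrow> a + s * u \<notin> Y"
    using assms(3) unfolding boundary_dirs_def by auto
  have "open (- Y)" "a + s * (2 * t) \<in> - Y" using assms no[of "2 * t"] by auto
  then obtain e where e: "e > 0" "\<And>y. dist y (a + s * (2 * t)) < e \<Longrightarrow> y \<in> - Y"
    unfolding open_dist by blast
  have "(a, s) \<in> boundary_dirs Y (t + e / 4)"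
  proof (rule boundary_dirsI[OF a])
    fix u assume u: "0 < u" "u \<le> 2 * (t + e / 4)" "a + s * u \<in> Y"
    then have "\<not> u \<le> 2 * t" using no by auto
    then have "dist (a + s * u) (a + s * (2 * t)) < e"
      using u e(1) a(2) by (auto simp: dist_real_def)
    then show False using e(2) u(3) by auto
  qed
  then show thesis using that[of "e / 4"] e(1) by auto
qed

text \<open>Frontier points have distance exactly t. Among these, midpoints of gaps of length 2t are
  interior, since every nearby point is within t of one of the two ends; points on directions are
  limits of points at distance larger than t.\<close>

lemma frontier_parallel_set:
  assumes "closed Y" "Y \<noteq> {}" "t > 0"
  shows "frontier (parallel_set Y t) = dir_point t ` boundary_dirs Y t"
proof -
  have cl: "closure (parallel_set Y t) = parallel_set Y t"
    using closed_parallel_set by (rule closure_closed)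
  have cont: "continuous_on UNIV (\<lambda>x. infdist x Y)" by (intro continuous_intros)
  show ?thesis
  proof (intro equalityI subsetI)
    fix x assume x: "x \<in> frontier (parallel_set Y t)"
    then have 1: "infdist x Y \<le> t" and ni: "x \<notin> interior (parallel_set Y t)"
      unfolding frontier_def cl by (auto simp: parallel_set_def)
    have "\<not> infdist x Y < t"
    proof
      assume "infdist x Y < t"
      moreover have "open {x. infdist x Y < t}"
        by (intro open_Collect_less continuous_intros)
      ultimately have "x \<in> interior (parallel_set Y t)"
        by (intro interiorI[of "{x. infdist x Y < t}"]) (auto simp: parallel_set_def)
      then show False using ni by simp
    qed
    then have eq: "infdist x Y = t" using 1 by simp
    have "\<not> (x - t \<in> Y \<and> x + t \<in> Y)"
    proof
      assume A: "x - t \<in> Y \<and> x + t \<in> Y"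
      have "x \<in> interior (parallel_set Y t)"
      proof (rule interiorI[of "{x - t <..< x + t}"])
        show "{x - t<..<x + t} \<subseteq> parallel_set Y t"
        proof
          fix z assume z: "z \<in> {x - t<..<x + t}"
          have "infdist z Y \<le> dist z (x - t)" "infdist z Y \<le> dist z (x + t)"
            using A by (auto intro: infdist_le)
          then show "z \<in> parallel_set Y t" using z
            by (auto simp: parallel_set_def dist_real_def)
        qed
      qed (use \<open>t > 0\<close> in auto)
      then show False using ni by simp
    qed
    then show "x \<in> dir_point t ` boundary_dirs Y t"
      using infdist_pos_cases[OF assms(1,2) eq assms(3)] by auto
  next
    fix x assume "x \<in> dir_point t ` boundary_dirs Y t"
    then obtain a s where e: "(a, s) \<in> boundary_dirs Y t" and x: "x = a + s * t"
      by (auto simp: dir_point_def)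
    have s: "s = 1 \<or> s = -1" using e by (auto simp: boundary_dirs_def)
    have d: "infdist x Y = t" using infdist_dir_point[OF assms(3) e] x by (simp add: dir_point_def)
    obtain d where d0: "d > 0" "(a, s) \<in> boundary_dirs Y (t + d)"
      using boundary_dirs_extend[OF assms(1,3) e] .
    have "x \<notin> interior (parallel_set Y t)"
    proof
      assume "x \<in> interior (parallel_set Y t)"
      then obtain h where h: "h > 0" "ball x h \<subseteq> parallel_set Y t"
        using mem_interior by blast
      \<comment> \<open>Small enough for the direction to stay free of \<open>Y\<close> and for the
        shifted point to remain in the ball around x.\<close>
      define \<eta> where "\<eta> = min d (h / 2)"
      have eta: "\<eta> > 0" "\<eta> \<le> d" "\<eta> < h" using h d0 by (auto simp: \<eta>_def)
      have "(a, s) \<in> boundary_dirs Y (t + \<eta>)"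
        using boundary_dirs_antimono[of "t + \<eta>" "t + d" Y] eta d0(2) by auto
      from infdist_dir_point[OF _ this] assms(3) eta
      have "infdist (a + s * (t + \<eta>)) Y = t + \<eta>" by (simp add: dir_point_def)
      moreover have "a + s * (t + \<eta>) \<in> ball x h"
        using s eta x by (auto simp: dist_real_def algebra_simps)
      ultimately show False using h(2) eta by (auto simp: parallel_set_def)
    qed
    then show "x \<in> frontier (parallel_set Y t)"
      using d unfolding frontier_def cl by (simp add: parallel_set_def)
  qed
qed

lemma finite_separated:
  fixes A :: "real set"
  assumes "d > 0" "bounded A" "\<And>x y. x \<in> A \<Longrightarrow> y \<in> A \<Longrightarrow> x < y \<Longrightarrow> d \<le> y - x"
  shows "finite A"
proof -
  obtain B where B: "\<And>x. x \<in> A \<Longrightarrow> \<bar>x\<bar> \<le> B" using assms(2) by (auto simp: bounded_iff)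
  \<comment> \<open>Points at least d apart have different integer parts after division by d, and a
    bounded set produces finitely many integer parts.\<close>
  have inj: "inj_on (\<lambda>x. \<lfloor>x / d\<rfloor>) A"
  proof (rule linorder_inj_onI)
    fix x y assume xy: "x < y" "x \<in> A" "y \<in> A"
    have "(x + d) / d \<le> y / d" using assms(3)[OF xy(2,3,1)] \<open>d > 0\<close> by (intro divide_right_mono) auto
    then have "x / d + 1 \<le> y / d" using \<open>d > 0\<close> by (simp add: add_divide_distrib)
    then show "\<lfloor>x / d\<rfloor> \<noteq> \<lfloor>y / d\<rfloor>" by linarith
  qed auto
  have "(\<lambda>x. \<lfloor>x / d\<rfloor>) ` A \<subseteq> {\<lfloor>- B / d\<rfloor>..\<lfloor>B / d\<rfloor>}"
  proof (rule image_subsetI)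
    fix x assume "x \<in> A"
    then have "-B \<le> x" "x \<le> B" using B[of x] by auto
    then have "- B / d \<le> x / d" "x / d \<le> B / d" using \<open>d > 0\<close> by (simp_all only: divide_right_mono less_imp_le)
    then show "\<lfloor>x / d\<rfloor> \<in> {\<lfloor>- B / d\<rfloor>..\<lfloor>B / d\<rfloor>}"
      unfolding atLeastAtMost_iff by (intro conjI floor_mono)
  qed
  then have "finite ((\<lambda>x. \<lfloor>x / d\<rfloor>) ` A)" by (rule finite_subset) simp
  then show ?thesis using inj finite_imageD by blast
qed

text \<open>For a fixed sign the base points are 2t-separated: of two closer ones, one would lie in
  the free stretch of the other.\<close>

lemma finite_boundary_dirs:
  assumes "bounded Y" "t > 0"
  shows "finite (boundary_dirs Y t)"
proof -
  have "finite {a. (a, s) \<in> boundary_dirs Y t}" if s: "s = 1 \<or> s = -1" for s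
  proof (rule finite_separated[of "2 * t"])
    show "bounded {a. (a, s) \<in> boundary_dirs Y t}"
      by (rule bounded_subset[OF assms(1)]) (auto simp: boundary_dirs_def)
    fix x y assume A: "x \<in> {a. (a, s) \<in> boundary_dirs Y t}" "y \<in> {a. (a, s) \<in> boundary_dirs Y t}" "x < y"
    show "2 * t \<le> y - x"
    proof (rule ccontr)
      assume "\<not> 2 * t \<le> y - x"
      then have "0 < y - x" "y - x \<le> 2 * t" using A by auto
      then have "x + s * (y - x) \<notin> Y" "y + s * (y - x) \<notin> Y"
        using A(1,2) boundary_dirsD by blast+
      moreover have "x + s * (y - x) = y \<or> y + s * (y - x) = x" using s by auto
      moreover have "x \<in> Y" "y \<in> Y" using A by (simp_all add: boundary_dirs_def)
      ultimately show False by metis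
    qed
  qed (use assms in auto)
  then have "finite ((\<lambda>a. (a, 1)) ` {a. (a, 1) \<in> boundary_dirs Y t} \<union> (\<lambda>a. (a, -1)) ` {a. (a, -1) \<in> boundary_dirs Y t})"
    by blast
  then show ?thesis
    by (rule finite_subset[rotated]) (auto simp: boundary_dirs_def)
qed

lemma countable_all_dirs:
  assumes "bounded Y" shows "countable (all_dirs Y)"
proof -
  have "all_dirs Y \<subseteq> (\<Union>n. boundary_dirs Y (1 / real (Suc n)))"
  proof
    fix e assume "e \<in> all_dirs Y"
    then obtain t where t: "t > 0" "e \<in> boundary_dirs Y t" unfolding all_dirs_def by auto
    obtain n where "1 / real (Suc n) < t" using nat_approx_posE[OF t(1)] by auto
    then show "e \<in> (\<Union>n. boundary_dirs Y (1 / real (Suc n)))"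
      using boundary_dirs_antimono[of "1 / real (Suc n)" t Y] t(2) by auto
  qed
  moreover have "countable (\<Union>n. boundary_dirs Y (1 / real (Suc n)))"
    using finite_boundary_dirs[OF assms] by (intro countable_UN) (auto intro: countable_finite)
  ultimately show ?thesis by (rule countable_subset)
qed

lemma nn_integral_curvature_measure_0:
  assumes "compact Y" "Y \<noteq> {}" "t > 0" and [measurable]: "f \<in> borel_measurable borel"
  shows "(\<integral>\<^sup>+x. f x \<partial>curvature_measure 0 Y t) = (\<Sum>e\<in>boundary_dirs Y t. f (dir_point t e))"
proof -
  let ?F = "frontier (parallel_set Y t)"
  have F: "?F = dir_point t ` boundary_dirs Y t"
    using assms by (intro frontier_parallel_set) (auto simp: compact_imp_closed)
  have fin: "finite (boundary_dirs Y t)" using assms by (intro finite_boundary_dirs compact_imp_bounded)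
  have "curvature_measure 0 Y t = distr (count_space ?F) borel (\<lambda>x. x)"
  proof (rule measure_eqI)
    fix B assume "B \<in> sets (curvature_measure 0 Y t)"
    then have B: "B \<in> sets borel" by simp
    have "finite ?F" using F fin by simp
    then show "emeasure (curvature_measure 0 Y t) B = emeasure (distr (count_space ?F) borel (\<lambda>x. x)) B"
      using B by (simp add: emeasure_curvature_measure emeasure_distr emeasure_count_space Int_commute)
  qed simp
  then have "(\<integral>\<^sup>+x. f x \<partial>curvature_measure 0 Y t) = (\<integral>\<^sup>+x. f x \<partial>count_space ?F)"
    by (simp add: nn_integral_distr)
  also have "\<dots> = (\<Sum>x\<in>?F. f x)" using F fin by (subst nn_integral_count_space_finite) auto
  also have "\<dots> = (\<Sum>e\<in>boundary_dirs Y t. f (dir_point t e))"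
    unfolding F by (subst sum.reindex[OF inj_dir_point[OF assms(3)]]) simp
  finally show ?thesis .
qed

text \<open>The sum runs over the countable set \<open>all_dirs Y\<close>, which does not depend on
  t. This yields measurability in t and allows the sum to be exchanged with integrals over
  t.\<close>

lemma nn_integral_curvature_measure_0':
  assumes "compact Y" "Y \<noteq> {}" "t > 0" and [measurable]: "f \<in> borel_measurable borel"
  shows "(\<integral>\<^sup>+x. f x \<partial>curvature_measure 0 Y t) =
    (\<integral>\<^sup>+e. indicator (boundary_dirs Y t) e * f (dir_point t e) \<partial>count_space (all_dirs Y))"
proof -
  have fin: "finite (boundary_dirs Y t)" using assms by (intro finite_boundary_dirs compact_imp_bounded)
  have "(\<integral>\<^sup>+e. indicator (boundary_dirs Y t) e * f (dir_point t e) \<partial>count_space (all_dirs Y)) =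
      (\<Sum>e\<in>boundary_dirs Y t. indicator (boundary_dirs Y t) e * f (dir_point t e))"
    using boundary_dirs_subset_all[OF assms(3)] fin
    by (intro nn_integral_count_space') auto
  also have "\<dots> = (\<Sum>e\<in>boundary_dirs Y t. f (dir_point t e))"
    by (intro sum.cong) auto
  finally show ?thesis using nn_integral_curvature_measure_0[OF assms] by simp
qed

lemma measurable_dir_set [measurable]: "{t. e \<in> boundary_dirs Y t} \<in> sets borel"
proof -
  have "is_interval {t. e \<in> boundary_dirs Y t}"
    using boundary_dirs_antimono[of _ _ Y] unfolding is_interval_1 by blast
  then show ?thesis by (simp add: real_interval_borel_measurable)
qed

lemma borel_measurable_nn_integral_count_space:
  fixes f :: "'i \<Rightarrow> 'a \<Rightarrow> ennreal"
  assumes "countable I" and [measurable]: "\<And>i. i \<in> I \<Longrightarrow> f i \<in> borel_measurable M"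
  shows "(\<lambda>x. \<integral>\<^sup>+i. f i x \<partial>count_space I) \<in> borel_measurable M"
proof cases
  assume "finite I" then show ?thesis
    by (simp add: nn_integral_count_space_finite)
next
  assume "infinite I"
  then have [simp]: "I \<noteq> {}" by auto
  note * = bij_betw_from_nat_into[OF \<open>countable I\<close> \<open>infinite I\<close>]
  have "\<And>f. (\<integral>\<^sup>+i. f i \<partial>count_space I) = (\<Sum>n. f (from_nat_into I n))"
    by (simp add: nn_integral_bij_count_space[symmetric, OF *] nn_integral_count_space_nat)
  then show ?thesis using from_nat_into[of I] by simp
qed

lemma borel_measurable_dirs_integral:
  assumes "bounded Y" and [measurable]: "f \<in> borel_measurable borel"
  shows "(\<lambda>t. \<integral>\<^sup>+e. indicator (boundary_dirs Y t) e * f (dir_point t e) \<partial>count_space (all_dirs Y))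
    \<in> borel_measurable borel"
proof (rule borel_measurable_nn_integral_count_space)
  show "countable (all_dirs Y)" using assms by (intro countable_all_dirs)
  fix e assume "e \<in> all_dirs Y"
  have "(\<lambda>t. indicator (boundary_dirs Y t) e :: ennreal) = indicator {t. e \<in> boundary_dirs Y t}"
    by (auto simp: indicator_def)
  then have [measurable]: "(\<lambda>t. indicator (boundary_dirs Y t) e :: ennreal) \<in> borel_measurable borel"
    by simp
  show "(\<lambda>t. indicator (boundary_dirs Y t) e * f (dir_point t e)) \<in> borel_measurable borel"
    unfolding dir_point_def by measurable
qed

lemma nn_integral_curvature_measure_1:
  assumes [measurable]: "f \<in> borel_measurable borel"
  shows "(\<integral>\<^sup>+x. f x \<partial>curvature_measure 1 Y t) = (\<integral>\<^sup>+x. indicator (parallel_set Y t) x * f x \<partial>lborel)"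
proof -
  have [measurable]: "parallel_set Y t \<in> sets borel" using closed_parallel_set by (rule borel_closed)
  have "curvature_measure 1 Y t = density lborel (indicator (parallel_set Y t))"
  proof (rule measure_eqI)
    fix B assume "B \<in> sets (curvature_measure 1 Y t)"
    then have B[measurable]: "B \<in> sets borel" by simp
    have "emeasure (density lborel (indicator (parallel_set Y t))) B =
        (\<integral>\<^sup>+x. indicator (parallel_set Y t \<inter> B) x \<partial>lborel)"
      by (simp add: emeasure_density indicator_inter_arith del: nn_integral_indicator nn_integral_indicator')
    also have "\<dots> = emeasure lborel (parallel_set Y t \<inter> B)" by (subst nn_integral_indicator) auto
    finally show "emeasure (curvature_measure 1 Y t) B = emeasure (density lborel (indicator (parallel_set Y t))) B"
      using B by (simp add: emeasure_curvature_measure)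
  qed simp
  then show ?thesis by (simp add: nn_integral_density)
qed

text \<open>Off \<open>Y\<close> and off the countable set of midpoints of base points, x has a
  single nearest point. Hence exactly one direction passes through x, at parameter
  \<open>infdist x Y\<close>, and the integral tests whether that parameter is at most
  \<epsilon>.\<close>

lemma count_dirs_through:
  assumes "compact Y" "Y \<noteq> {}" "0 < \<epsilon>"
    and "x \<notin> Y" and "x \<notin> (\<lambda>(e, e'). (fst e + fst e') / 2) ` (all_dirs Y \<times> all_dirs Y)"
  shows "(\<integral>\<^sup>+e. indicator {0<..\<epsilon>} (snd e * (x - fst e)) * indicator (boundary_dirs Y (snd e * (x - fst e))) e
      \<partial>count_space (all_dirs Y)) = (indicator (parallel_set Y \<epsilon>) x :: ennreal)" (is "?I = _")
proof -
  have cl: "closed Y" using assms by (simp add: compact_imp_closed)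
  define \<tau> where "\<tau> = infdist x Y"
  have tau: "\<tau> > 0" using assms cl unfolding \<tau>_def
    by (metis in_closed_iff_infdist_zero infdist_nonneg order_le_less)
  have key: "dir_point (snd e * (x - fst e)) e = x" if "e \<in> all_dirs Y" for e
    using that by (auto simp: all_dirs_def boundary_dirs_def dir_point_def)
  have eq: "snd e * (x - fst e) = \<tau>" if "e \<in> all_dirs Y" "snd e * (x - fst e) > 0"
      "e \<in> boundary_dirs Y (snd e * (x - fst e))" for e
    using infdist_dir_point[OF that(2,3)] key[OF that(1)] by (simp add: \<tau>_def)
  have "\<not> (x - \<tau> \<in> Y \<and> x + \<tau> \<in> Y)"
  proof
    assume A: "x - \<tau> \<in> Y \<and> x + \<tau> \<in> Y"
    have far: "\<tau> \<le> dist x z" if "z \<in> Y" for z using infdist_le[OF that, of x] by (simp add: \<tau>_def)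
    \<comment> \<open>Only membership in \<open>all_dirs\<close> is wanted, so the parameter \<tau>
      / 2 suffices: it asks for a free stretch of length \<tau>, which ends at x.\<close>
    have "(x - \<tau>, 1) \<in> boundary_dirs Y (\<tau> / 2)" "(x + \<tau>, -1) \<in> boundary_dirs Y (\<tau> / 2)"
      using A far tau by (force intro!: boundary_dirsI simp: dist_real_def)+
    then have "(x - \<tau>, 1) \<in> all_dirs Y" "(x + \<tau>, -1) \<in> all_dirs Y"
      using tau boundary_dirs_subset_all[of "\<tau> / 2" Y] by auto
    then have "((x - \<tau>, 1), (x + \<tau>, -1)) \<in> all_dirs Y \<times> all_dirs Y" by simp
    from imageI[OF this, of "\<lambda>(e, e'). (fst e + fst e') / 2"] assms(5) show False by simp
  qed
  then have "x \<in> dir_point \<tau> ` boundary_dirs Y \<tau>"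
    using infdist_pos_cases[OF cl assms(2) \<tau>_def[symmetric] tau] by auto
  then obtain e0 where e0: "e0 \<in> boundary_dirs Y \<tau>" "dir_point \<tau> e0 = x" by auto
  have e0_all: "e0 \<in> all_dirs Y" using e0 tau boundary_dirs_subset_all by auto
  have e0_eq: "snd e0 * (x - fst e0) = \<tau>"
    using e0 by (auto simp: boundary_dirs_def dir_point_def)
  have "?I = (\<Sum>e\<in>{e0}. indicator {0<..\<epsilon>} (snd e * (x - fst e)) * indicator (boundary_dirs Y (snd e * (x - fst e))) e)"
  proof (rule nn_integral_count_space')
    fix e assume e: "e \<in> all_dirs Y" "e \<notin> {e0}"
    show "indicator {0<..\<epsilon>} (snd e * (x - fst e)) * indicator (boundary_dirs Y (snd e * (x - fst e))) e = (0::ennreal)"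
    proof (rule ccontr)
      assume "indicator {0<..\<epsilon>} (snd e * (x - fst e)) * indicator (boundary_dirs Y (snd e * (x - fst e))) e \<noteq> (0::ennreal)"
      then have p: "snd e * (x - fst e) > 0" "e \<in> boundary_dirs Y (snd e * (x - fst e))"
        by (auto simp: indicator_def split: if_splits)
      have "e \<in> boundary_dirs Y \<tau>" "dir_point \<tau> e = x" using eq[OF e(1) p] p key[OF e(1)] by auto
      then have "e = e0" using inj_dir_point[OF tau, of Y] e0 by (auto dest: inj_onD)
      then show False using e by simp
    qed
  qed (use e0_all in auto)
  also have "\<dots> = indicator (parallel_set Y \<epsilon>) x"
    using e0 e0_eq tau by (auto simp: parallel_set_def \<tau>_def[symmetric] indicator_def)
  finally show ?thesis .
qed

text \<open>The parallel set is swept out by the directions: each covers a segment as t runs up to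
  \<epsilon>, and almost every point lies on exactly one of these segments. Points of
  \<open>Y\<close> lie on none, but are negligible by hypothesis.\<close>

lemma nn_integral_curvature_measure_1_eq:
  assumes "compact Y" "Y \<noteq> {}" "emeasure lborel Y = 0" "0 < \<epsilon>"
    and f[measurable]: "f \<in> borel_measurable borel"
  shows "(\<integral>\<^sup>+x. f x \<partial>curvature_measure 1 Y \<epsilon>) =
    (\<integral>\<^sup>+t. indicator {0<..\<epsilon>} t * (\<integral>\<^sup>+x. f x \<partial>curvature_measure 0 Y t) \<partial>lborel)"
proof -
  let ?L = "all_dirs Y"
  have cl: "closed Y" using assms by (simp add: compact_imp_closed)
  have [measurable]: "Y \<in> sets borel" using cl by (rule borel_closed)
  have cL: "countable ?L" using assms by (intro countable_all_dirs compact_imp_bounded)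
  have ind: "(\<lambda>t. indicator (boundary_dirs Y t) e :: ennreal) = indicator {t. e \<in> boundary_dirs Y t}" for e
    by (auto simp: indicator_def)
  then have m1[measurable]: "(\<lambda>t. indicator (boundary_dirs Y t) e :: ennreal) \<in> borel_measurable borel" for e
    by simp
  have m2[measurable]: "(\<lambda>x. indicator (boundary_dirs Y (snd e * (x - fst e))) e :: ennreal) \<in> borel_measurable borel" for e
    using measurable_compose[OF _ m1[of e], of "\<lambda>x. snd e * (x - fst e)" borel] by simp
  let ?g = "\<lambda>e t. indicator {0<..\<epsilon>} t * (indicator (boundary_dirs Y t) e * f (dir_point t e)) :: ennreal"
  have "(\<integral>\<^sup>+t. indicator {0<..\<epsilon>} t * (\<integral>\<^sup>+x. f x \<partial>curvature_measure 0 Y t) \<partial>lborel) =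
      (\<integral>\<^sup>+t. (\<integral>\<^sup>+e. ?g e t \<partial>count_space ?L) \<partial>lborel)"
    using assms by (intro nn_integral_cong)
      (auto simp: nn_integral_curvature_measure_0' nn_integral_cmult indicator_def)
  also have "\<dots> = (\<integral>\<^sup>+e. (\<integral>\<^sup>+t. ?g e t \<partial>lborel) \<partial>count_space ?L)"
    unfolding dir_point_def by (intro nn_integral_count_space_nn_integral cL) measurable
  also have "\<dots> = (\<integral>\<^sup>+e. (\<integral>\<^sup>+x. (indicator {0<..\<epsilon>} (snd e * (x - fst e)) *
      indicator (boundary_dirs Y (snd e * (x - fst e))) e) * f x \<partial>lborel) \<partial>count_space ?L)"
  proof (rule nn_integral_cong)
    fix e assume "e \<in> space (count_space ?L)"
    then have e: "snd e = 1 \<or> snd e = -1" by (auto simp: all_dirs_def boundary_dirs_def)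
    then have dp: "dir_point (snd e * (x - fst e)) e = x" for x by (auto simp: dir_point_def)
    have "?g e \<in> borel_measurable borel" unfolding dir_point_def by measurable
    \<comment> \<open>Change of variables from the distance t to the point x reached on the ray,
      \<open>t = snd e * (x - fst e)\<close>, with slope 1 or -1.\<close>
    then have "(\<integral>\<^sup>+t. ?g e t \<partial>lborel) = ennreal \<bar>snd e\<bar> * (\<integral>\<^sup>+x. ?g e (- snd e * fst e + snd e * x) \<partial>lborel)"
      using e by (intro nn_integral_real_affine) auto
    also have "\<dots> = (\<integral>\<^sup>+x. ?g e (snd e * (x - fst e)) \<partial>lborel)"
    proof -
      have "- snd e * fst e + snd e * x = snd e * (x - fst e)" for x by (simp add: algebra_simps)
      moreover have "ennreal \<bar>snd e\<bar> = 1" using e by auto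
      ultimately show ?thesis by simp
    qed
    finally show "(\<integral>\<^sup>+t. ?g e t \<partial>lborel) = (\<integral>\<^sup>+x. (indicator {0<..\<epsilon>} (snd e * (x - fst e)) *
      indicator (boundary_dirs Y (snd e * (x - fst e))) e) * f x \<partial>lborel)"
      by (simp add: dp mult.assoc)
  qed
  also have "\<dots> = (\<integral>\<^sup>+x. (\<integral>\<^sup>+e. (indicator {0<..\<epsilon>} (snd e * (x - fst e)) *
      indicator (boundary_dirs Y (snd e * (x - fst e))) e) * f x \<partial>count_space ?L) \<partial>lborel)"
    by (intro nn_integral_count_space_nn_integral[symmetric] cL) measurable
  also have "\<dots> = (\<integral>\<^sup>+x. (\<integral>\<^sup>+e. (indicator {0<..\<epsilon>} (snd e * (x - fst e)) *
      indicator (boundary_dirs Y (snd e * (x - fst e))) e) \<partial>count_space ?L) * f x \<partial>lborel)"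
    by (simp add: nn_integral_multc)
  also have "\<dots> = (\<integral>\<^sup>+x. indicator (parallel_set Y \<epsilon>) x * f x \<partial>lborel)"
  proof (rule nn_integral_cong_AE)
    have "countable ((\<lambda>(e, e'). (fst e + fst e') / 2) ` (?L \<times> ?L))"
      using cL by (intro countable_image countable_SIGMA)
    then have "AE x in lborel. x \<notin> (\<lambda>(e, e'). (fst e + fst e') / 2) ` (?L \<times> ?L)"
      by (intro AE_not_in countable_imp_null_set_lborel)
    moreover have "AE x in lborel. x \<notin> Y" using assms(3) by (intro AE_not_in null_setsI) auto
    ultimately show "AE x in lborel. (\<integral>\<^sup>+e. (indicator {0<..\<epsilon>} (snd e * (x - fst e)) *
      indicator (boundary_dirs Y (snd e * (x - fst e))) e) \<partial>count_space ?L) * f x = indicator (parallel_set Y \<epsilon>) x * f x"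
      by eventually_elim (rule arg_cong2[of _ _ _ _ "(*)", OF count_dirs_through[OF assms(1,2,4)] refl])
  qed
  finally show ?thesis using nn_integral_curvature_measure_1[OF f] by simp
qed


section \<open>Mixtures and weak limits of finite measures\<close>

text \<open>Measurability is asked of the weighted masses
  \<open>w t * emeasure (\<kappa> t) B\<close> and not of \<open>\<kappa>\<close> as a kernel: the
  weight may vanish where \<open>\<kappa>\<close> is not controlled, as outside
  \<open>{T..1}\<close> for the averaged curvature measures.\<close>

lemma nn_integral_mixture:
  fixes \<kappa> :: "'a \<Rightarrow> 'b measure"
  assumes sets_\<kappa>: "\<And>t. sets (\<kappa> t) = sets N"
    and meas: "\<And>B. B \<in> sets N \<Longrightarrow> (\<lambda>t. w t * emeasure (\<kappa> t) B) \<in> borel_measurable M"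
    and f: "f \<in> borel_measurable N"
  defines "\<mu> \<equiv> measure_of (space N) (sets N) (\<lambda>B. \<integral>\<^sup>+t. w t * emeasure (\<kappa> t) B \<partial>M)"
  shows "(\<integral>\<^sup>+x. f x \<partial>\<mu>) = (\<integral>\<^sup>+t. w t * (\<integral>\<^sup>+x. f x \<partial>\<kappa> t) \<partial>M)"
proof -
  have sets_\<mu>: "sets \<mu> = sets N" unfolding \<mu>_def by simp
  have em: "emeasure \<mu> B = (\<integral>\<^sup>+t. w t * emeasure (\<kappa> t) B \<partial>M)" if B: "B \<in> sets N" for B
    unfolding \<mu>_def
  proof (rule emeasure_measure_of_sigma)
    show "sigma_algebra (space N) (sets N)" by (rule sets.sigma_algebra_axioms)
    show "positive (sets N) (\<lambda>B. \<integral>\<^sup>+t. w t * emeasure (\<kappa> t) B \<partial>M)"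
      by (simp add: positive_def)
    show "countably_additive (sets N) (\<lambda>B. \<integral>\<^sup>+t. w t * emeasure (\<kappa> t) B \<partial>M)"
    proof (rule countably_additiveI)
      fix A :: "nat \<Rightarrow> 'b set"
      assume A: "range A \<subseteq> sets N" "disjoint_family A"
      have "(\<Sum>i. \<integral>\<^sup>+t. w t * emeasure (\<kappa> t) (A i) \<partial>M) = (\<integral>\<^sup>+t. (\<Sum>i. w t * emeasure (\<kappa> t) (A i)) \<partial>M)"
        using A meas by (intro nn_integral_suminf[symmetric]) auto
      also have "\<dots> = (\<integral>\<^sup>+t. w t * emeasure (\<kappa> t) (\<Union>(range A)) \<partial>M)"
        using A by (intro nn_integral_cong) (simp add: suminf_emeasure sets_\<kappa>)
      finally show "(\<Sum>i. \<integral>\<^sup>+t. w t * emeasure (\<kappa> t) (A i) \<partial>M) = (\<integral>\<^sup>+t. w t * emeasure (\<kappa> t) (\<Union>(range A)) \<partial>M)" .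
    qed
  qed fact
  have mk: "f \<in> borel_measurable (\<kappa> t)" "f \<in> borel_measurable \<mu>" if "f \<in> borel_measurable N" for f :: "'b \<Rightarrow> ennreal" and t
    using that by (simp_all cong: measurable_cong_sets add: sets_\<kappa> sets_\<mu> measurable_cong_sets[OF sets_\<kappa> refl] measurable_cong_sets[OF sets_\<mu> refl])
  have sp: "space (\<kappa> t) = space N" "space \<mu> = space N" for t
    using sets_eq_imp_space_eq[OF sets_\<kappa>] sets_eq_imp_space_eq[OF sets_\<mu>] by auto
  have "(\<lambda>t. w t * (\<integral>\<^sup>+x. f x \<partial>\<kappa> t)) \<in> borel_measurable M \<and>
      (\<integral>\<^sup>+x. f x \<partial>\<mu>) = (\<integral>\<^sup>+t. w t * (\<integral>\<^sup>+x. f x \<partial>\<kappa> t) \<partial>M)" if "f \<in> borel_measurable N" for f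
    using that
  proof (induction rule: borel_measurable_induct)
    case (cong f g)
    have "(\<integral>\<^sup>+x. f x \<partial>\<kappa> t) = (\<integral>\<^sup>+x. g x \<partial>\<kappa> t)" "(\<integral>\<^sup>+x. f x \<partial>\<mu>) = (\<integral>\<^sup>+x. g x \<partial>\<mu>)" for t
      using cong(3) by (auto intro!: nn_integral_cong simp: sp)
    then show ?case using cong by simp
  next
    case (set A)
    then show ?case using meas[of A] em[of A] by (simp add: sets_\<kappa> sets_\<mu>)
  next
    case (mult u c)
    have "w t * (\<integral>\<^sup>+x. c * u x \<partial>\<kappa> t) = c * (w t * (\<integral>\<^sup>+x. u x \<partial>\<kappa> t))" for t
      using mk[OF mult(2)] by (simp add: nn_integral_cmult mult_ac)
    moreover have [measurable]: "(\<lambda>t. w t * (\<integral>\<^sup>+x. u x \<partial>\<kappa> t)) \<in> borel_measurable M" using mult by simp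
    ultimately show ?case using mult mk[OF mult(2)] by (simp add: nn_integral_cmult)
  next
    case (add u v)
    note [measurable] = mk[OF add(1)] mk[OF add(3)]
    have eq: "w t * (\<integral>\<^sup>+x. v x + u x \<partial>\<kappa> t) = w t * (\<integral>\<^sup>+x. v x \<partial>\<kappa> t) + w t * (\<integral>\<^sup>+x. u x \<partial>\<kappa> t)" for t
      by (simp add: nn_integral_add distrib_left)
    have mm: "(\<lambda>t. w t * (\<integral>\<^sup>+x. v x \<partial>\<kappa> t)) \<in> borel_measurable M"
      "(\<lambda>t. w t * (\<integral>\<^sup>+x. u x \<partial>\<kappa> t)) \<in> borel_measurable M" by (fact add.IH(2)[THEN conjunct1], fact add.IH(1)[THEN conjunct1])
    have "(\<integral>\<^sup>+x. v x + u x \<partial>\<mu>) = (\<integral>\<^sup>+x. v x \<partial>\<mu>) + (\<integral>\<^sup>+x. u x \<partial>\<mu>)"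
      by (rule nn_integral_add) measurable
    also have "\<dots> = (\<integral>\<^sup>+t. w t * (\<integral>\<^sup>+x. v x \<partial>\<kappa> t) \<partial>M) + (\<integral>\<^sup>+t. w t * (\<integral>\<^sup>+x. u x \<partial>\<kappa> t) \<partial>M)"
      by (simp only: add.IH(1)[THEN conjunct2] add.IH(2)[THEN conjunct2])
    also have "\<dots> = (\<integral>\<^sup>+t. w t * (\<integral>\<^sup>+x. v x \<partial>\<kappa> t) + w t * (\<integral>\<^sup>+x. u x \<partial>\<kappa> t) \<partial>M)"
      by (rule nn_integral_add[symmetric]) (rule mm)+
    finally show ?case unfolding eq using mm by (intro conjI borel_measurable_add)
  next
    case (seq U)
    have SU: "(\<integral>\<^sup>+x. (SUP i. U i) x \<partial>\<rho>) = (SUP i. \<integral>\<^sup>+x. U i x \<partial>\<rho>)" if "\<And>i. U i \<in> borel_measurable \<rho>" for \<rho> :: "'b measure"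
      unfolding SUP_apply using seq.hyps(3) that by (rule nn_integral_monotone_convergence_SUP)
    have S: "w t * (\<integral>\<^sup>+x. (SUP i. U i) x \<partial>\<kappa> t) = (SUP i. w t * (\<integral>\<^sup>+x. U i x \<partial>\<kappa> t))" for t
      unfolding SU[OF mk(1)[OF seq(1)]] by (rule SUP_mult_left_ennreal)
    have mm: "(\<lambda>t. w t * (\<integral>\<^sup>+x. U i x \<partial>\<kappa> t)) \<in> borel_measurable M" for i
      by (fact seq.IH[THEN conjunct1])
    have "(\<integral>\<^sup>+x. (SUP i. U i) x \<partial>\<mu>) = (SUP i. \<integral>\<^sup>+x. U i x \<partial>\<mu>)"
      by (rule SU[OF mk(2)[OF seq(1)]])
    also have "\<dots> = (SUP i. \<integral>\<^sup>+t. w t * (\<integral>\<^sup>+x. U i x \<partial>\<kappa> t) \<partial>M)"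
      by (simp only: seq.IH[THEN conjunct2])
    also have "\<dots> = (\<integral>\<^sup>+t. (SUP i. w t * (\<integral>\<^sup>+x. U i x \<partial>\<kappa> t)) \<partial>M)"
    proof (rule nn_integral_monotone_convergence_SUP[symmetric])
      show "incseq (\<lambda>i t. w t * (\<integral>\<^sup>+x. U i x \<partial>\<kappa> t))"
        using seq.hyps(3) by (auto simp: incseq_def le_fun_def intro!: mult_left_mono nn_integral_mono)
    qed (rule mm)
    finally show ?case unfolding S using mm by (intro conjI borel_measurable_SUP countableI_type)
  qed
  from this[OF f] show ?thesis by blast
qed

lemma bounded_continuous_integrable:
  fixes f :: "real \<Rightarrow> real"
  assumes "finite_measure M" "sets M = sets borel" "continuous_on UNIV f" "bounded (range f)"
  shows "integrable M f"
proof -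
  interpret finite_measure M by fact
  obtain b where b: "\<And>x. \<bar>f x\<bar> \<le> b" using assms(4) by (auto simp: bounded_iff)
  have "f \<in> borel_measurable M"
    using borel_measurable_continuous_onI[OF assms(3)] assms(2) by (simp cong: measurable_cong_sets)
  then show ?thesis using b by (intro integrable_const_bound[where B = b]) auto
qed

text \<open>A bounded f becomes nonnegative after adding a constant, and the integral of the
  constant is itself covered by the hypothesis. Nonnegative test functions can be handled with
  \<open>nn_integral\<close> throughout.\<close>

lemma is_weak_limitI:
  assumes m: "sets m = sets borel" "finite_measure m"
    and \<nu>: "\<forall>\<^sub>F t in F. sets (\<nu> t) = sets borel \<and> finite_measure (\<nu> t)"
    and lim: "\<And>f. continuous_on UNIV f \<Longrightarrow> bounded (range f) \<Longrightarrow> (\<And>x. 0 \<le> f x) \<Longrightarrow>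
      ((\<lambda>t. enn2real (\<integral>\<^sup>+x. ennreal (f x) \<partial>\<nu> t)) \<longlongrightarrow> enn2real (\<integral>\<^sup>+x. ennreal (f x) \<partial>m)) F"
  shows "is_weak_limit \<nu> m F"
  unfolding is_weak_limit_def
proof (intro conjI allI impI m \<nu>)
  fix f :: "real \<Rightarrow> real" assume f: "continuous_on UNIV f" "bounded (range f)"
  obtain b where b: "\<And>x. \<bar>f x\<bar> \<le> b" using f(2) by (auto simp: bounded_iff)
  have b0: "0 \<le> b" using b[of 0] by simp
  have fb: "continuous_on UNIV (\<lambda>x. f x + b)" "bounded (range (\<lambda>x. f x + b))" "\<And>x. 0 \<le> f x + b"
    using f b by (auto intro!: continuous_intros bounded_plus_comp simp: abs_le_iff) (metis abs_le_D2 minus_le_iff add.commute diff_ge_0_iff_ge diff_minus_eq_add)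
  have bb: "continuous_on UNIV (\<lambda>x::real. b)" "bounded (range (\<lambda>x::real. b))" "\<And>x::real. 0 \<le> b"
    using b0 by (auto intro!: continuous_intros)
  have eq: "(\<integral>x. f x \<partial>M) = enn2real (\<integral>\<^sup>+x. ennreal (f x + b) \<partial>M) - enn2real (\<integral>\<^sup>+x. ennreal b \<partial>M)"
    if M: "sets M = sets borel" "finite_measure M" for M
  proof -
    note I = bounded_continuous_integrable[OF M(2,1)]
    have "(\<integral>x. f x \<partial>M) = (\<integral>x. (f x + b) - b \<partial>M)" by simp
    also have "\<dots> = (\<integral>x. f x + b \<partial>M) - (\<integral>x. b \<partial>M)"
      by (rule Bochner_Integration.integral_diff[OF I[OF fb(1,2)] I[OF bb(1,2)]])
    also have "(\<integral>x. f x + b \<partial>M) = enn2real (\<integral>\<^sup>+x. ennreal (f x + b) \<partial>M)"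
      using I[OF fb(1,2)] fb(3) by (intro integral_eq_nn_integral) auto
    also have "(\<integral>x. b \<partial>M) = enn2real (\<integral>\<^sup>+x. ennreal b \<partial>M)"
      using I[OF bb(1,2)] b0 by (intro integral_eq_nn_integral) auto
    finally show ?thesis .
  qed
  have "((\<lambda>t. enn2real (\<integral>\<^sup>+x. ennreal (f x + b) \<partial>\<nu> t) - enn2real (\<integral>\<^sup>+x. ennreal b \<partial>\<nu> t)) \<longlongrightarrow> (\<integral>x. f x \<partial>m)) F"
    unfolding eq[OF m] by (intro tendsto_diff lim fb bb)
  then show "((\<lambda>t. \<integral>x. f x \<partial>\<nu> t) \<longlongrightarrow> (\<integral>x. f x \<partial>m)) F"
    by (rule Lim_transform_eventually) (use \<nu> in eventually_elim, simp add: eq)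
qed

text \<open>Open half-lines determine a finite Borel measure, and the ramps \<open>f n\<close> are
  bounded continuous functions converging to the indicator of \<open>{a<..}\<close>.\<close>

lemma measure_eqI_continuous:
  fixes m m' :: "real measure"
  assumes m: "sets m = sets borel" "finite_measure m" and m': "sets m' = sets borel" "finite_measure m'"
    and eq: "\<And>f :: real \<Rightarrow> real. continuous_on UNIV f \<Longrightarrow> bounded (range f) \<Longrightarrow> (\<integral>x. f x \<partial>m) = (\<integral>x. f x \<partial>m')"
  shows "m = m'"
proof (rule measure_eqI_lessThan)
  fix a :: real
  define f where "f = (\<lambda>n y. min 1 (real n * max 0 (y - a)))"
  have cont: "continuous_on UNIV (f n)" for n unfolding f_def by (intro continuous_intros)
  have bd: "\<bar>f n y\<bar> \<le> 1" for n y unfolding f_def by auto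
  then have bdd: "bounded (range (f n))" for n by (auto simp: bounded_iff)
  have lim: "(\<lambda>n. f n y) \<longlonglongrightarrow> indicator {a<..} y" for y
  proof (cases "y > a")
    case True
    obtain k :: nat where k: "1 \<le> real k * (y - a)" using ex_less_of_nat_mult[of "y - a" 1] True less_imp_le by (metis diff_gt_0_iff_gt)
    have "\<forall>\<^sub>F n in sequentially. f n y = 1"
    proof (rule eventually_sequentiallyI[of k])
      fix n assume "k \<le> n"
      then have "real k * (y - a) \<le> real n * (y - a)" using True by (intro mult_right_mono) auto
      then have "1 \<le> real n * (y - a)" using k by linarith
      then show "f n y = 1" using True by (simp add: f_def)
    qed
    then show ?thesis using True by (simp add: tendsto_eventually)
  qed (simp add: f_def)
  have conv: "(\<lambda>n. \<integral>x. f n x \<partial>M) \<longlonglongrightarrow> measure M {a<..}" if M: "sets M = sets borel" "finite_measure M" for M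
  proof -
    interpret finite_measure M by fact
    have [measurable]: "f n \<in> borel_measurable M" for n
      using borel_measurable_continuous_onI[OF cont] M(1) by (simp cong: measurable_cong_sets)
    have [measurable]: "{a<..} \<in> sets M" using M(1) by simp
    have "(\<lambda>n. \<integral>x. f n x \<partial>M) \<longlonglongrightarrow> (\<integral>x. indicator {a<..} x \<partial>M)"
      by (rule integral_dominated_convergence[where w = "\<lambda>_. 1"]) (use lim bd in auto)
    then show ?thesis using M sets.sets_into_space[of "{a<..}" M] by (simp add: Int_absorb2)
  qed
  have "measure m {a<..} = measure m' {a<..}"
    by (rule LIMSEQ_unique[OF conv[OF m]], unfold eq[OF cont bdd], rule conv[OF m'])
  then show "emeasure m {a<..} = emeasure m' {a<..}"
    using finite_measure.emeasure_eq_measure[OF m(2)] finite_measure.emeasure_eq_measure[OF m'(2)] by simp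
  show "emeasure m {a<..} < \<infinity>" using finite_measure.emeasure_finite[OF m(2)] by (simp add: top.not_eq_extremum)
qed (use m m' in auto)

lemma is_weak_limit_unique:
  assumes "is_weak_limit \<nu> m F" "is_weak_limit \<nu> m' F" "F \<noteq> bot"
  shows "m = m'"
proof (rule measure_eqI_continuous)
  fix f :: "real \<Rightarrow> real" assume f: "continuous_on UNIV f" "bounded (range f)"
  have "((\<lambda>t. \<integral>x. f x \<partial>\<nu> t) \<longlongrightarrow> (\<integral>x. f x \<partial>m)) F" "((\<lambda>t. \<integral>x. f x \<partial>\<nu> t) \<longlongrightarrow> (\<integral>x. f x \<partial>m')) F"
    using assms f by (simp_all add: is_weak_limit_def)
  then show "(\<integral>x. f x \<partial>m) = (\<integral>x. f x \<partial>m')"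
    by (rule tendsto_unique[OF assms(3)])
qed (use assms in \<open>auto simp: is_weak_limit_def\<close>)

lemma weak_limit_eq:
  assumes "is_weak_limit \<nu> m F" "F \<noteq> bot"
  shows "weak_limit \<nu> F = m"
  unfolding weak_limit_def using assms is_weak_limit_unique by (intro the_equality) auto


section \<open>Integration against dx/x\<close>

definition log_integral :: "(real \<Rightarrow> real) \<Rightarrow> real \<Rightarrow> real \<Rightarrow> real" where
  "log_integral f a b = (\<integral>x. indicator {a..b} x * (f x / x) \<partial>lborel)"

text \<open>The bound is uniform down to 0 but may depend on E, since powers of the scale grow
  without bound at infinity.\<close>

definition locally_bounded_fun :: "(real \<Rightarrow> real) \<Rightarrow> bool" where
  "locally_bounded_fun f \<longleftrightarrow> f \<in> borel_measurable borel \<and> (\<forall>E. \<exists>B. \<forall>x. 0 < x \<longrightarrow> x \<le> E \<longrightarrow> \<bar>f x\<bar> \<le> B)"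

lemma locally_bounded_funI:
  assumes "f \<in> borel_measurable borel" "\<And>E. \<exists>B. \<forall>x. 0 < x \<longrightarrow> x \<le> E \<longrightarrow> \<bar>f x\<bar> \<le> B"
  shows "locally_bounded_fun f"
  using assms unfolding locally_bounded_fun_def by blast

lemma locally_bounded_fun_measurable: "locally_bounded_fun f \<Longrightarrow> f \<in> borel_measurable borel"
  unfolding locally_bounded_fun_def by blast

lemma locally_bounded_fun_bound:
  assumes "locally_bounded_fun f"
  obtains B where "\<And>x. 0 < x \<Longrightarrow> x \<le> E \<Longrightarrow> \<bar>f x\<bar> \<le> B" "0 \<le> B"
proof -
  obtain B where B: "\<forall>x. 0 < x \<longrightarrow> x \<le> E \<longrightarrow> \<bar>f x\<bar> \<le> B"
    using assms unfolding locally_bounded_fun_def by blast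
  show thesis using that[of "\<bar>B\<bar>"] B by force
qed

lemma integrable_bounded_interval:
  fixes f :: "real \<Rightarrow> real"
  assumes "f \<in> borel_measurable borel" "\<And>x. \<bar>f x\<bar> \<le> M * indicator {a..b} x"
  shows "integrable lborel f"
proof (rule Bochner_Integration.integrable_bound)
  have "integrable lborel (\<lambda>x. indicator {a..b} x :: real)"
    by (intro integrable_real_indicator) (auto simp: emeasure_lborel_Icc_eq)
  then show "integrable lborel (\<lambda>x. M * indicator {a..b} x :: real)" by simp
  show "AE x in lborel. norm (f x) \<le> norm (M * indicator {a..b} x)"
  proof (rule AE_I2)
    fix x :: real
    have "\<bar>f x\<bar> \<le> M * indicator {a..b} x" by (rule assms)
    also have "\<dots> \<le> \<bar>M * indicator {a..b} x\<bar>" by (rule abs_ge_self)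
    finally show "norm (f x) \<le> norm (M * indicator {a..b} x)" by simp
  qed
qed (use assms in simp)

lemma integrable_log_integral:
  assumes "locally_bounded_fun f" "0 < a"
  shows "integrable lborel (\<lambda>x. indicator {a..b} x * (f x / x))"
proof -
  note [measurable] = locally_bounded_fun_measurable[OF assms(1)]
  obtain B where B: "\<And>x. 0 < x \<Longrightarrow> x \<le> b \<Longrightarrow> \<bar>f x\<bar> \<le> B" "0 \<le> B"
    using locally_bounded_fun_bound[OF assms(1)] by metis
  show ?thesis
  proof (rule integrable_bounded_interval[where M = "B / a" and a = a and b = b])
    fix x show "\<bar>indicator {a..b} x * (f x / x)\<bar> \<le> B / a * indicator {a..b} x"
      using B(1)[of x] B(2) \<open>0 < a\<close> by (auto simp: indicator_def abs_mult intro!: frac_le)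
  qed measurable
qed

lemma log_integral_add:
  assumes "locally_bounded_fun f" "locally_bounded_fun g" "0 < a"
  shows "log_integral (\<lambda>x. f x + g x) a b = log_integral f a b + log_integral g a b"
  unfolding log_integral_def
  by (subst Bochner_Integration.integral_add[OF integrable_log_integral[OF assms(1,3)] integrable_log_integral[OF assms(2,3)], symmetric])
     (auto intro!: Bochner_Integration.integral_cong simp: algebra_simps add_divide_distrib)

lemma log_integral_cmult: "log_integral (\<lambda>x. c * f x) a b = c * log_integral f a b"
  unfolding log_integral_def by (subst integral_mult_right_zero[symmetric]) (simp add: mult_ac)

lemma log_integral_sum:
  assumes "\<And>i. i \<in> I \<Longrightarrow> locally_bounded_fun (f i)" "0 < a"
  shows "log_integral (\<lambda>x. \<Sum>i\<in>I. f i x) a b = (\<Sum>i\<in>I. log_integral (f i) a b)"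
  unfolding log_integral_def
  by (subst Bochner_Integration.integral_sum[OF integrable_log_integral[OF assms], symmetric])
     (auto intro!: Bochner_Integration.integral_cong simp: sum_distrib_left sum_divide_distrib)

lemma log_integral_mono:
  assumes "locally_bounded_fun f" "locally_bounded_fun g" "0 < a" "\<And>x. a \<le> x \<Longrightarrow> x \<le> b \<Longrightarrow> f x \<le> g x"
  shows "log_integral f a b \<le> log_integral g a b"
  unfolding log_integral_def
  using assms by (intro integral_mono integrable_log_integral) (auto simp: indicator_def divide_right_mono)

lemma log_integral_cong:
  assumes "0 < a" "\<And>x. a \<le> x \<Longrightarrow> x \<le> b \<Longrightarrow> f x = g x"
  shows "log_integral f a b = log_integral g a b"
  unfolding log_integral_def
  using assms by (intro Bochner_Integration.integral_cong) (auto simp: indicator_def)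

text \<open>Dilation invariance of dx/x. It is what turns a recursion over the scales
  \<open>\<epsilon> / r i\<close> into a recursion for integrals.\<close>

lemma log_integral_scale:
  assumes "c > 0"
  shows "log_integral (\<lambda>x. f (x / c)) a b = log_integral f (a / c) (b / c)"
proof -
  have "log_integral f (a / c) (b / c) =
      \<bar>1 / c\<bar> *\<^sub>R (\<integral>x. indicator {a / c..b / c} (0 + 1 / c * x) * (f (0 + 1 / c * x) / (0 + 1 / c * x)) \<partial>lborel)"
    unfolding log_integral_def using assms by (intro lborel_integral_real_affine) auto
  also have "\<dots> = (\<integral>x. (1 / c) * (indicator {a / c..b / c} (x / c) * (f (x / c) / (x / c))) \<partial>lborel)"
    unfolding integral_mult_right_zero using assms by simp
  also have "\<dots> = log_integral (\<lambda>x. f (x / c)) a b"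
    unfolding log_integral_def using assms
    by (intro Bochner_Integration.integral_cong) (auto simp: indicator_def divide_le_cancel)
  finally show ?thesis by simp
qed

lemma log_integral_concat:
  assumes "locally_bounded_fun f" "0 < a" "a \<le> b" "b \<le> c"
  shows "log_integral f a c = log_integral f a b + log_integral f b c"
proof -
  note [measurable] = locally_bounded_fun_measurable[OF assms(1)]
  have "log_integral f a b + log_integral f b c =
      (\<integral>x. indicator {a..b} x * (f x / x) + indicator {b..c} x * (f x / x) \<partial>lborel)"
    unfolding log_integral_def using assms
    by (intro Bochner_Integration.integral_add[symmetric] integrable_log_integral) auto
  also have "\<dots> = log_integral f a c"
    unfolding log_integral_def
  proof (rule integral_cong_AE)
    have "AE x in lborel. x \<noteq> b" by (rule AE_lborel_singleton)
    then show "AE x in lborel. indicator {a..b} x * (f x / x) + indicator {b..c} x * (f x / x) = indicator {a..c} x * (f x / x)"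
      by eventually_elim (use assms in \<open>auto simp: indicator_def\<close>)
  qed measurable
  finally show ?thesis by simp
qed

lemma log_integral_powr:
  assumes "0 < a" "a \<le> b" "d \<noteq> 0"
  shows "log_integral (\<lambda>x. x powr d) a b = (b powr d - a powr d) / d"
proof -
  have "(\<integral>x. indicator {a..b} x *\<^sub>R (x powr (d - 1)) \<partial>lborel) = b powr d / d - a powr d / d"
  proof (rule integral_FTC_Icc)
    show "((\<lambda>x. x powr d / d) has_vector_derivative x powr (d - 1)) (at x within {a..b})" if "a \<le> x" "x \<le> b" for x
      using that assms unfolding has_real_derivative_iff_has_vector_derivative[symmetric]
      by (auto intro!: derivative_eq_intros)
    show "continuous_on {a..b} (\<lambda>x. x powr (d - 1))"
      using assms by (intro continuous_intros) auto
  qed (use assms in auto)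
  also have "(\<integral>x. indicator {a..b} x *\<^sub>R (x powr (d - 1)) \<partial>lborel) = log_integral (\<lambda>x. x powr d) a b"
    unfolding log_integral_def using assms
    by (intro Bochner_Integration.integral_cong) (auto simp: indicator_def powr_diff)
  finally show ?thesis by (simp add: diff_divide_distrib)
qed

lemma log_integral_const:
  assumes "0 < a" "a \<le> b"
  shows "log_integral (\<lambda>x. c) a b = c * ln (b / a)"
proof -
  have "(\<integral>x. indicator {a..b} x *\<^sub>R (c / x) \<partial>lborel) = c * ln b - c * ln a"
  proof (rule integral_FTC_Icc)
    show "((\<lambda>x. c * ln x) has_vector_derivative c / x) (at x within {a..b})" if "a \<le> x" "x \<le> b" for x
      using that assms unfolding has_real_derivative_iff_has_vector_derivative[symmetric]
      by (auto intro!: derivative_eq_intros)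
    show "continuous_on {a..b} (\<lambda>x. c / x)"
      using assms by (intro continuous_intros) auto
  qed (use assms in auto)
  then show ?thesis using assms by (simp add: log_integral_def ln_div right_diff_distrib)
qed

lemma locally_bounded_fun_const [simp]: "locally_bounded_fun (\<lambda>x. c)"
  unfolding locally_bounded_fun_def by auto

lemma locally_bounded_fun_powr [simp]:
  assumes "0 \<le> d" shows "locally_bounded_fun (\<lambda>x. x powr d)"
  by (rule locally_bounded_funI) (use assms in \<open>auto intro!: exI powr_mono2\<close>)

lemma locally_bounded_fun_add:
  assumes f: "locally_bounded_fun f" and g: "locally_bounded_fun g"
  shows "locally_bounded_fun (\<lambda>x. f x + g x)"
proof (rule locally_bounded_funI)
  show "(\<lambda>x. f x + g x) \<in> borel_measurable borel" using assms[THEN locally_bounded_fun_measurable] by measurable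
  fix E
  obtain B C where "\<And>x. 0 < x \<Longrightarrow> x \<le> E \<Longrightarrow> \<bar>f x\<bar> \<le> B" "\<And>x. 0 < x \<Longrightarrow> x \<le> E \<Longrightarrow> \<bar>g x\<bar> \<le> C"
    using locally_bounded_fun_bound[OF f] locally_bounded_fun_bound[OF g] by metis
  then show "\<exists>B. \<forall>x. 0 < x \<longrightarrow> x \<le> E \<longrightarrow> \<bar>f x + g x\<bar> \<le> B"
    by (intro exI[of _ "B + C"]) (smt (verit))
qed

lemma locally_bounded_fun_cmult:
  assumes f: "locally_bounded_fun f"
  shows "locally_bounded_fun (\<lambda>x. c * f x)"
proof (rule locally_bounded_funI)
  show "(\<lambda>x. c * f x) \<in> borel_measurable borel" using assms[THEN locally_bounded_fun_measurable] by measurable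
  fix E
  obtain B where "\<And>x. 0 < x \<Longrightarrow> x \<le> E \<Longrightarrow> \<bar>f x\<bar> \<le> B" using locally_bounded_fun_bound[OF f] by metis
  then show "\<exists>B. \<forall>x. 0 < x \<longrightarrow> x \<le> E \<longrightarrow> \<bar>c * f x\<bar> \<le> B"
    by (intro exI[of _ "\<bar>c\<bar> * B"]) (auto simp: abs_mult mult_left_mono)
qed

lemma locally_bounded_fun_sum:
  assumes "\<And>i. i \<in> I \<Longrightarrow> locally_bounded_fun (f i)"
  shows "locally_bounded_fun (\<lambda>x. \<Sum>i\<in>I. f i x)"
  using assms by (induction I rule: infinite_finite_induct) (auto intro: locally_bounded_fun_add)

lemma locally_bounded_fun_scale:
  assumes f: "locally_bounded_fun f" and "c > 0"
  shows "locally_bounded_fun (\<lambda>x. f (x / c))"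
proof (rule locally_bounded_funI)
  show "(\<lambda>x. f (x / c)) \<in> borel_measurable borel" using assms(1)[THEN locally_bounded_fun_measurable] by measurable
  fix E
  obtain B where "\<And>x. 0 < x \<Longrightarrow> x \<le> E / c \<Longrightarrow> \<bar>f x\<bar> \<le> B" using locally_bounded_fun_bound[OF f] by metis
  then show "\<exists>B. \<forall>x. 0 < x \<longrightarrow> x \<le> E \<longrightarrow> \<bar>f (x / c)\<bar> \<le> B"
    using \<open>c > 0\<close> by (intro exI[of _ B]) (auto simp: divide_right_mono)
qed

lemma log_integral_empty: "b < a \<Longrightarrow> log_integral f a b = 0"
  unfolding log_integral_def by (simp add: atLeastatMost_empty)

section \<open>Ratio systems\<close>

definition word_ratio :: "(nat \<Rightarrow> real) \<Rightarrow> nat list \<Rightarrow> real" where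
  "word_ratio r w = prod_list (map r w)"

lemma word_ratio_simps [simp]: "word_ratio r [] = 1" "word_ratio r (i # w) = r i * word_ratio r w"
  "word_ratio r (u @ v) = word_ratio r u * word_ratio r v"
  by (simp_all add: word_ratio_def)

lemma filterlim_mult_at_right_0:
  "c > 0 \<Longrightarrow> filterlim (\<lambda>x::real. x * c) (at_right 0) (at_right 0)"
  by real_asymp

lemma eventually_scale:
  assumes "eventually P (at_right (0::real))" "c > 0"
  shows "eventually (\<lambda>x. P (x * c)) (at_right 0)"
  using filterlim_mult_at_right_0[OF assms(2)] assms(1) by (simp add: filterlim_iff)

text \<open>Here \<delta> is a root of the Moran equation in (0, 1), which makes
  \<open>r i powr \<delta>\<close> a probability vector. Its identification with the Minkowski
  dimension is \<open>minkowski_dim_F\<close>.\<close>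

locale ratio_system =
  fixes N :: nat and r :: "nat \<Rightarrow> real" and \<delta> :: real
  assumes two_maps: "2 \<le> N" and ratio_pos: "i \<in> {1..N} \<Longrightarrow> 0 < r i" and ratio_less_1: "i \<in> {1..N} \<Longrightarrow> r i < 1"
    and moran: "(\<Sum>i=1..N. r i powr \<delta>) = 1" and dim_pos: "0 < \<delta>" and dim_less_1: "\<delta> < 1"
begin

definition rmax :: real where "rmax = Max (r ` {1..N})"
definition rmin :: real where "rmin = Min (r ` {1..N})"
text \<open>The mean of \<open>ln (1 / r i)\<close> under the probability vector
  \<open>r i powr \<delta>\<close>: the mean step of the renewal process on the logarithmic
  scale.\<close>

definition entropy :: real where "entropy = (\<Sum>i=1..N. r i powr \<delta> * ln (1 / r i))"

lemma letters_ne: "{1..N} \<noteq> {}" using two_maps by auto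

lemma rmax: "0 < rmax" "rmax < 1" "i \<in> {1..N} \<Longrightarrow> r i \<le> rmax"
proof -
  have "rmax \<in> r ` {1..N}" unfolding rmax_def using letters_ne by (intro Max_in) auto
  then show "0 < rmax" "rmax < 1" using ratio_pos ratio_less_1 by auto
qed (auto simp: rmax_def)

lemma rmin: "0 < rmin" "rmin < 1" "i \<in> {1..N} \<Longrightarrow> rmin \<le> r i"
proof -
  have "rmin \<in> r ` {1..N}" unfolding rmin_def using letters_ne by (intro Min_in) auto
  then show "0 < rmin" "rmin < 1" using ratio_pos ratio_less_1 by auto
qed (auto simp: rmin_def)

lemma prob_pos: "i \<in> {1..N} \<Longrightarrow> 0 < r i powr \<delta>" using ratio_pos[of i] by simp

lemma entropy_pos: "0 < entropy"
  unfolding entropy_def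
proof (intro sum_pos mult_pos_pos prob_pos letters_ne)
  fix i assume "i \<in> {1..N}"
  then show "0 < ln (1 / r i)" using ratio_pos[of i] ratio_less_1[of i] by (intro ln_gt_zero) simp
qed auto

lemma word_ratio_pos: "set w \<subseteq> {1..N} \<Longrightarrow> 0 < word_ratio r w"
  by (induction w) (auto simp: ratio_pos)

lemma word_ratio_le: "set w \<subseteq> {1..N} \<Longrightarrow> word_ratio r w \<le> rmax ^ length w"
proof (induction w)
  case (Cons i w)
  then show ?case using rmax ratio_pos[of i] word_ratio_pos[of w] by (auto intro!: mult_mono)
qed simp

text \<open>Each step of the recursion divides the scale by some \<open>r i < 1\<close>, so every scale is reached from the base after
  finitely many steps.\<close>

lemma scale_induct:
  assumes "e0 > 0" "\<epsilon> > 0" and base: "\<And>\<epsilon>. e0 \<le> \<epsilon> \<Longrightarrow> Q \<epsilon>"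
    and step: "\<And>\<epsilon>. 0 < \<epsilon> \<Longrightarrow> \<epsilon> < e0 \<Longrightarrow> (\<And>i. i \<in> {1..N} \<Longrightarrow> Q (\<epsilon> / r i)) \<Longrightarrow> Q \<epsilon>"
  shows "Q \<epsilon>"
proof -
  have *: "\<forall>\<epsilon>. e0 * rmax ^ n \<le> \<epsilon> \<longrightarrow> Q \<epsilon>" for n
  proof (induction n)
    case (Suc n)
    show ?case
    proof (intro allI impI)
      fix \<epsilon> assume e: "e0 * rmax ^ Suc n \<le> \<epsilon>"
      have pos: "0 < \<epsilon>" using e rmax assms(1) by (smt (verit) mult_pos_pos zero_less_power)
      show "Q \<epsilon>"
      proof (cases "e0 \<le> \<epsilon>")
        case False
        show ?thesis
        proof (rule step)
          fix i assume i: "i \<in> {1..N}"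
          have "e0 * rmax ^ n * r i \<le> e0 * rmax ^ n * rmax"
            using rmax[of] rmax(3)[OF i] assms(1) by (intro mult_left_mono) auto
          also have "\<dots> \<le> \<epsilon>" using e by (simp add: mult_ac)
          finally show "Q (\<epsilon> / r i)" using Suc ratio_pos[OF i] by (simp add: pos_le_divide_eq)
        qed (use pos False in auto)
      qed (use base in auto)
    qed
  qed (use base in auto)
  obtain n where "rmax ^ n < \<epsilon> / e0" using real_arch_pow_inv[of "\<epsilon> / e0" rmax] rmax assms by auto
  then have "e0 * rmax ^ n \<le> \<epsilon>" using assms by (simp add: field_simps)
  then show ?thesis using * by blast
qed

text \<open>Ratios decay geometrically in the length of the word, so a bound on the inverse ratio
  bounds the length. The set supplies the finitely many words over which a common tolerance is taken
  in \<open>renewal_upper\<close>.\<close>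

lemma finite_words_ratio: "finite {w. set w \<subseteq> {1..N} \<and> 1 / word_ratio r w \<le> b}"
proof (cases "b > 0")
  case True
  obtain n where n: "rmax ^ n < 1 / b" using real_arch_pow_inv[of "1 / b" rmax] rmax True by auto
  have "{w. set w \<subseteq> {1..N} \<and> 1 / word_ratio r w \<le> b} \<subseteq> {w. set w \<subseteq> {1..N} \<and> length w \<le> n}"
  proof safe
    fix w assume w: "set w \<subseteq> {1..N}" "1 / word_ratio r w \<le> b"
    have "1 / b \<le> word_ratio r w" using w(2) True word_ratio_pos[OF w(1)] by (simp add: field_simps)
    then have "rmax ^ n < rmax ^ length w" using n word_ratio_le[OF w(1)] by linarith
    then have "length w < n" using rmax by (simp add: power_strict_decreasing_iff)
    then show "length w \<le> n" by simp
  qed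
  then show ?thesis by (rule finite_subset) (rule finite_lists_length_le, simp)
next
  case False
  then have empty: "{w. set w \<subseteq> {1..N} \<and> 1 / word_ratio r w \<le> b} = {}"
    using word_ratio_pos by (smt (verit) divide_pos_pos empty_Collect_eq)
  show ?thesis unfolding empty by simp
qed

text \<open>With \<open>d = word_ratio r v / word_ratio r u\<close> slightly above \<open>1\<close> and \<open>V = 1 / word_ratio r v\<close>, the words built from
  \<open>j\<close> copies of \<open>u\<close> and \<open>n - j\<close> copies of \<open>v\<close> have inverse ratios \<open>V\<^sup>n d\<^sup>j\<close>; for large \<open>n\<close> they leave no
  multiplicative hole larger than \<open>d\<close>.\<close>

lemma words_dense:
  assumes nl: "\<And>\<eta>. 1 < \<eta> \<Longrightarrow> \<exists>u v. set u \<subseteq> {1..N} \<and> set v \<subseteq> {1..N} \<and> word_ratio r u < word_ratio r v \<and> word_ratio r v \<le> \<eta> * word_ratio r u"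
    and "1 < \<eta>"
  obtains x0 where "x0 > 0" "\<And>x. x0 \<le> x \<Longrightarrow> \<exists>w. set w \<subseteq> {1..N} \<and> x \<le> 1 / word_ratio r w \<and> 1 / word_ratio r w \<le> \<eta> * x"
proof -
  obtain u' v' where uv': "set u' \<subseteq> {1..N}" "set v' \<subseteq> {1..N}" "word_ratio r u' < word_ratio r v'" "word_ratio r v' \<le> \<eta> * word_ratio r u'"
    using nl[OF assms(2)] by blast
  have one: "1 \<in> {1..N}" using two_maps by auto
  \<comment> \<open>A common first letter leaves the quotient of the two ratios unchanged and
    ensures V > 1 even when \<open>v'\<close> is empty.\<close>
  define u where "u = 1 # u'" define v where "v = 1 # v'"
  define d where "d = word_ratio r v / word_ratio r u"
  define V where "V = 1 / word_ratio r v"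
  have uv: "set u \<subseteq> {1..N}" "set v \<subseteq> {1..N}" using uv' one by (auto simp: u_def v_def)
  note pos = word_ratio_pos[OF uv(1)] word_ratio_pos[OF uv(2)]
  have d: "1 < d" "d \<le> \<eta>"
    using uv' word_ratio_pos[OF uv'(1)] ratio_pos[OF one] by (auto simp: d_def u_def v_def field_simps)
  have "word_ratio r v < 1"
  proof -
    have "word_ratio r v \<le> rmax ^ Suc (length v')" using word_ratio_le[OF uv(2)] by (simp add: v_def)
    also have "\<dots> < 1" using rmax by (intro power_Suc_less_one) auto
    finally show ?thesis .
  qed
  then have V: "1 < V" using pos by (simp add: V_def)
  define W where "W = (\<lambda>n j. concat (replicate j u) @ concat (replicate (n - j) v))"
  have rep: "word_ratio r (concat (replicate j w)) = word_ratio r w ^ j" for j w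
    by (induction j) auto
  have W: "set (W n j) \<subseteq> {1..N}" for n j using uv by (auto simp: W_def split: if_splits)
  have WV: "1 / word_ratio r (W n j) = V ^ n * d ^ j" if "j \<le> n" for n j
  proof -
    have "V ^ n * d ^ j = V ^ (n - j) * (V * d) ^ j"
      using that by (simp add: power_mult_distrib power_add[symmetric] flip: mult.assoc)
    also have "V * d = 1 / word_ratio r u" using pos by (simp add: V_def d_def)
    finally show ?thesis by (simp add: W_def rep V_def power_divide)
  qed
  \<comment> \<open>From this level on, the values \<open>V ^ n * d ^ j\<close> with j \<le> n climb
    from \<open>V ^ n\<close> past \<open>V ^ Suc n\<close>, so consecutive blocks overlap.\<close>
  obtain n0 where n0: "V \<le> d ^ n0" using real_arch_pow[OF d(1), of V] less_imp_le by blast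
  show thesis
  proof (rule that[of "V ^ n0"])
    show "0 < V ^ n0" using V by simp
    fix x assume x: "V ^ n0 \<le> x"
    define n where "n = (LEAST n. x < V ^ Suc n)"
    obtain k where "x < V ^ k" using real_arch_pow[OF V, of x] by auto
    also have "V ^ k < V ^ Suc k" using V by simp
    finally have ex: "x < V ^ Suc k" .
    have n1: "x < V ^ Suc n" unfolding n_def by (rule LeastI[of _ k]) (rule ex)
    have "n0 \<le> n"
    proof (rule ccontr)
      assume "\<not> n0 \<le> n"
      then have "V ^ Suc n \<le> V ^ n0" using V by (intro power_increasing) auto
      then show False using n1 x by simp
    qed
    have n2: "V ^ n \<le> x"
    proof (cases "n = n0")
      case False
      then obtain m where m: "n = Suc m" using \<open>n0 \<le> n\<close> by (cases n) auto
      have "\<not> x < V ^ Suc m" using not_less_Least[of m "\<lambda>n. x < V ^ Suc n"] m unfolding n_def by auto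
      then show ?thesis using m by simp
    qed (use x in simp)
    have x_pos: "0 \<le> x" using n2 V by (smt (verit) zero_le_power)
    have n3: "x \<le> V ^ n * d ^ n"
    proof -
      have "x \<le> V ^ n * V" using n1 by (simp add: mult.commute)
      also have "\<dots> \<le> V ^ n * d ^ n0" using n0 V by simp
      also have "\<dots> \<le> V ^ n * d ^ n" using V d \<open>n0 \<le> n\<close> by (intro mult_left_mono power_increasing) auto
      finally show ?thesis .
    qed
    define j where "j = (LEAST j. x \<le> V ^ n * d ^ j)"
    have j1: "x \<le> V ^ n * d ^ j" unfolding j_def by (rule LeastI[of _ n]) (rule n3)
    have jn: "j \<le> n" unfolding j_def by (rule Least_le) (rule n3)
    have "V ^ n * d ^ j \<le> \<eta> * x"
    proof (cases j)
      case 0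
      then have "V ^ n * d ^ j = 1 * x" using j1 n2 by simp
      also have "\<dots> \<le> \<eta> * x" using assms(2) x_pos by (intro mult_right_mono) auto
      finally show ?thesis .
    next
      case (Suc i)
      have "\<not> x \<le> V ^ n * d ^ i" using not_less_Least[of i "\<lambda>j. x \<le> V ^ n * d ^ j"] Suc unfolding j_def by auto
      then have "d * (V ^ n * d ^ i) \<le> d * x" using d by simp
      also have "\<dots> \<le> \<eta> * x" using d x_pos by (intro mult_right_mono) auto
      finally show ?thesis using Suc by (simp add: mult_ac)
    qed
    then show "\<exists>w. set w \<subseteq> {1..N} \<and> x \<le> 1 / word_ratio r w \<and> 1 / word_ratio r w \<le> \<eta> * x"
      using W[of n j] WV[OF jn] j1 by (intro exI[of _ "W n j"]) simp
  qed
qed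

end


section \<open>The renewal theorem\<close>

context ratio_system
begin

text \<open>An average close to its upper bound \<open>M\<close> forces every single term to be close to \<open>M\<close>.\<close>

lemma word_transfer:
  assumes lim0: "(z \<longlongrightarrow> 0) (at_right 0)"
    and eq: "\<And>\<epsilon>. \<epsilon> > 0 \<Longrightarrow> k \<epsilon> = (\<Sum>i=1..N. r i powr \<delta> * k (\<epsilon> / r i)) + z \<epsilon>"
    and upper: "\<And>\<tau>. \<tau> > 0 \<Longrightarrow> \<forall>\<^sub>F \<epsilon> in at_right 0. k \<epsilon> \<le> M + \<tau>"
    and "set w \<subseteq> {1..N}" "\<kappa> > 0"
  shows "\<exists>\<tau>>0. \<forall>\<^sub>F \<epsilon> in at_right 0. M - \<tau> \<le> k \<epsilon> \<longrightarrow> M - \<kappa> \<le> k (\<epsilon> / word_ratio r w)"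
  using assms(4,5)
proof (induction w arbitrary: \<kappa>)
  case Nil
  then show ?case by (intro exI[of _ \<kappa>]) simp
next
  case (Cons i w)
  then have i: "i \<in> {1..N}" and w: "set w \<subseteq> {1..N}" by auto
  note ri = ratio_pos[OF i]
  let ?p = "\<lambda>j. r j powr \<delta>"
  obtain \<tau>1 where t1: "\<tau>1 > 0" "\<forall>\<^sub>F \<epsilon> in at_right 0. M - \<tau>1 \<le> k \<epsilon> \<longrightarrow> M - \<kappa> \<le> k (\<epsilon> / word_ratio r w)"
    using Cons.IH[OF w Cons.prems(2)] by auto
  \<comment> \<open>Three losses of at most \<tau> occur, in \<open>k \<epsilon>\<close>, in
    \<open>z \<epsilon>\<close> and in the excess of the other terms over M;
    \<open>?p i * \<tau>1\<close> must pay for all of them.\<close>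
  define \<tau> where "\<tau> = \<tau>1 * ?p i / 3"
  have tau: "\<tau> > 0" using t1 prob_pos[OF i] by (simp add: \<tau>_def)
  have "\<forall>\<^sub>F \<epsilon> in at_right 0. M - \<tau>1 \<le> k (\<epsilon> * (1 / r i)) \<longrightarrow> M - \<kappa> \<le> k (\<epsilon> * (1 / r i) / word_ratio r w)"
    using eventually_scale[OF t1(2), of "1 / r i"] ri by simp
  moreover have "\<forall>\<^sub>F \<epsilon> in at_right 0. \<forall>j\<in>{1..N}. k (\<epsilon> * (1 / r j)) \<le> M + \<tau>"
    by (intro eventually_ball_finite ballI eventually_scale[OF upper[OF tau]]) (use ratio_pos in auto)
  moreover have "\<forall>\<^sub>F \<epsilon> in at_right 0. \<bar>z \<epsilon>\<bar> < \<tau>"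
    using tendstoD[OF lim0 tau] by (simp add: dist_real_def)
  moreover have "\<forall>\<^sub>F \<epsilon> in at_right 0. (0::real) < \<epsilon>" by (rule eventually_at_right_less)
  ultimately have "\<forall>\<^sub>F \<epsilon> in at_right 0. M - \<tau> \<le> k \<epsilon> \<longrightarrow> M - \<kappa> \<le> k (\<epsilon> / word_ratio r (i # w))"
  proof eventually_elim
    case (elim \<epsilon>)
    show ?case
    proof
      assume A: "M - \<tau> \<le> k \<epsilon>"
      have split: "(\<Sum>j=1..N. g j) = g i + (\<Sum>j\<in>{1..N} - {i}. g j)" for g :: "nat \<Rightarrow> real"
        using i by (intro sum.remove) auto
      have "(\<Sum>j\<in>{1..N} - {i}. ?p j * k (\<epsilon> / r j)) \<le> (\<Sum>j\<in>{1..N} - {i}. ?p j * (M + \<tau>))"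
        using elim(2) by (intro sum_mono mult_left_mono) auto
      also have "\<dots> = (1 - ?p i) * (M + \<tau>)"
        using split[of ?p] moran by (simp add: sum_distrib_right[symmetric])
      finally have "k \<epsilon> \<le> ?p i * k (\<epsilon> / r i) + (1 - ?p i) * (M + \<tau>) + \<tau>"
        using eq[OF elim(4)] elim(3) split[of "\<lambda>j. ?p j * k (\<epsilon> / r j)"] by simp
      then have "M - \<tau> - \<tau> - (1 - ?p i) * (M + \<tau>) \<le> ?p i * k (\<epsilon> / r i)" using A by simp
      moreover have "?p i * (M - \<tau>1) \<le> M - \<tau> - \<tau> - (1 - ?p i) * (M + \<tau>)"
      proof -
        have "M - \<tau> - \<tau> - (1 - ?p i) * (M + \<tau>) - ?p i * (M - \<tau>1) = ?p i * \<tau>1 + ?p i * \<tau> - 3 * \<tau>"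
          by (simp add: algebra_simps)
        also have "\<dots> = ?p i * \<tau>" by (simp add: \<tau>_def)
        also have "\<dots> \<ge> 0" using tau by simp
        finally show ?thesis by simp
      qed
      ultimately have "?p i * (M - \<tau>1) \<le> ?p i * k (\<epsilon> / r i)" by linarith
      then have "M - \<tau>1 \<le> k (\<epsilon> / r i)" using prob_pos[OF i] by simp
      then show "M - \<kappa> \<le> k (\<epsilon> / word_ratio r (i # w))" using elim(1) by simp
    qed
  qed
  then show ?case using tau by blast
qed

text \<open>Near the upper limit \<open>M\<close>, the function is close to \<open>M\<close> at all scales reached by words, hence on a whole window by
  density; but the increment of the integral over such a window tends to \<open>Z\<close>.\<close>

lemma renewal_upper:
  assumes k: "locally_bounded_fun k" and bd: "\<And>\<epsilon>. \<epsilon> > 0 \<Longrightarrow> \<bar>k \<epsilon>\<bar> \<le> B"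
    and lim0: "(z \<longlongrightarrow> 0) (at_right 0)"
    and eq: "\<And>\<epsilon>. \<epsilon> > 0 \<Longrightarrow> k \<epsilon> = (\<Sum>i=1..N. r i powr \<delta> * k (\<epsilon> / r i)) + z \<epsilon>"
    and H: "((\<lambda>\<epsilon>. \<Sum>i=1..N. r i powr \<delta> * log_integral k \<epsilon> (\<epsilon> / r i)) \<longlongrightarrow> Z) (at_right 0)"
    and dense: "\<And>\<kappa>. \<kappa> > 0 \<Longrightarrow> \<exists>x0>0. \<exists>W. finite W \<and> (\<forall>w\<in>W. set w \<subseteq> {1..N}) \<and>
      (\<forall>\<rho>\<in>{x0..x0 / rmin}. \<exists>w\<in>W. \<forall>\<epsilon>>0. k (\<epsilon> / word_ratio r w) - \<kappa> \<le> k (\<epsilon> * \<rho>))"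
    and "\<kappa>0 > 0"
  shows "\<forall>\<^sub>F \<epsilon> in at_right 0. k \<epsilon> \<le> Z / entropy + \<kappa>0"
proof -
  define S where "S = {c. \<forall>\<^sub>F \<epsilon> in at_right 0. k \<epsilon> \<le> c}"
  \<comment> \<open>The upper limit of k at 0, as the infimum of its eventual upper bounds.\<close>
  define M where "M = Inf S"
  have pos: "\<forall>\<^sub>F \<epsilon> in at_right 0. (0::real) < \<epsilon>" by (rule eventually_at_right_less)
  have "B \<in> S" unfolding S_def using pos by (auto elim!: eventually_mono dest!: bd)
  have "-B \<le> c" if "c \<in> S" for c
  proof -
    have "\<forall>\<^sub>F \<epsilon> in at_right (0::real). -B \<le> c"
      using that[unfolded S_def mem_Collect_eq] pos by eventually_elim (use bd in fastforce)
    then show ?thesis by (simp add: trivial_limit_at_right_real)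
  qed
  then have bdd: "bdd_below S" by (auto simp: bdd_below_def)
  have upper: "\<forall>\<^sub>F \<epsilon> in at_right 0. k \<epsilon> \<le> M + \<tau>" if "\<tau> > 0" for \<tau>
  proof -
    have "Inf S < M + \<tau>" using that by (simp add: M_def)
    then obtain c where "c \<in> S" "c < M + \<tau>" using \<open>B \<in> S\<close> by (metis cInf_lessD empty_iff)
    then show ?thesis by (auto simp: S_def elim!: eventually_mono)
  qed
  have freq: "\<exists>\<^sub>F \<epsilon> in at_right 0. M - \<tau> \<le> k \<epsilon>" if "\<tau> > 0" for \<tau>
  proof (rule ccontr)
    assume "\<not> (\<exists>\<^sub>F \<epsilon> in at_right 0. M - \<tau> \<le> k \<epsilon>)"
    then have "M - \<tau> \<in> S" by (auto simp: S_def frequently_def elim!: eventually_mono)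
    then have "M \<le> M - \<tau>" unfolding M_def using bdd by (rule cInf_lower)
    then show False using that by simp
  qed
  have key: "(M - 2 * \<kappa>) * entropy \<le> Z + \<kappa>" if "\<kappa> > 0" for \<kappa>
  proof -
    \<comment> \<open>The window from x0 to \<open>x0 / rmin\<close> contains every interval from x0
      to \<open>x0 / r i\<close>, so it serves all the integrals in H at once.\<close>
    obtain x0 W where x0: "x0 > 0" and W: "finite W" "\<And>w. w \<in> W \<Longrightarrow> set w \<subseteq> {1..N}"
      and app: "\<And>\<rho>. \<rho> \<in> {x0..x0 / rmin} \<Longrightarrow> \<exists>w\<in>W. \<forall>\<epsilon>>0. k (\<epsilon> / word_ratio r w) - \<kappa> \<le> k (\<epsilon> * \<rho>)"
      using dense[OF \<open>\<kappa> > 0\<close>] by metis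
    have "\<forall>w\<in>W. \<exists>\<tau>. \<tau> > 0 \<and> (\<forall>\<^sub>F \<epsilon> in at_right 0. M - \<tau> \<le> k \<epsilon> \<longrightarrow> M - \<kappa> \<le> k (\<epsilon> / word_ratio r w))"
      using word_transfer[OF lim0 eq upper W(2) \<open>\<kappa> > 0\<close>] by blast
    from bchoice[OF this] obtain T where T: "\<And>w. w \<in> W \<Longrightarrow> T w > 0"
      "\<And>w. w \<in> W \<Longrightarrow> \<forall>\<^sub>F \<epsilon> in at_right 0. M - T w \<le> k \<epsilon> \<longrightarrow> M - \<kappa> \<le> k (\<epsilon> / word_ratio r w)" by blast
    define \<tau> where "\<tau> = Min (insert 1 (T ` W))"
    have tau: "\<tau> > 0" "\<And>w. w \<in> W \<Longrightarrow> \<tau> \<le> T w" using W(1) T(1) by (auto simp: \<tau>_def)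
    have "\<forall>\<^sub>F \<epsilon> in at_right 0. \<forall>w\<in>W. M - T w \<le> k \<epsilon> \<longrightarrow> M - \<kappa> \<le> k (\<epsilon> / word_ratio r w)"
      using T(2) by (intro eventually_ball_finite W) auto
    moreover have "\<forall>\<^sub>F \<epsilon> in at_right 0. (\<Sum>i=1..N. r i powr \<delta> * log_integral k (\<epsilon> * x0) (\<epsilon> * x0 / r i)) < Z + \<kappa>"
      using eventually_scale[OF order_tendstoD(2)[OF H, of "Z + \<kappa>"] x0] that by simp
    ultimately have ev: "\<forall>\<^sub>F \<epsilon> in at_right 0. (\<forall>w\<in>W. M - T w \<le> k \<epsilon> \<longrightarrow> M - \<kappa> \<le> k (\<epsilon> / word_ratio r w)) \<and>
      (\<Sum>i=1..N. r i powr \<delta> * log_integral k (\<epsilon> * x0) (\<epsilon> * x0 / r i)) < Z + \<kappa> \<and> 0 < \<epsilon>"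
      using pos by eventually_elim blast
    have "\<exists>\<epsilon>. M - \<tau> \<le> k \<epsilon> \<and> (\<forall>w\<in>W. M - T w \<le> k \<epsilon> \<longrightarrow> M - \<kappa> \<le> k (\<epsilon> / word_ratio r w)) \<and>
      (\<Sum>i=1..N. r i powr \<delta> * log_integral k (\<epsilon> * x0) (\<epsilon> * x0 / r i)) < Z + \<kappa> \<and> 0 < \<epsilon>"
    proof (rule ccontr)
      assume no: "\<not> ?thesis"
      from ev have "\<forall>\<^sub>F \<epsilon> in at_right 0. \<not> M - \<tau> \<le> k \<epsilon>"
        by eventually_elim (use no in blast)
      then show False using freq[OF tau(1)] by (simp add: frequently_def)
    qed
    then obtain \<epsilon> where e: "M - \<tau> \<le> k \<epsilon>" "\<And>w. w \<in> W \<Longrightarrow> M - T w \<le> k \<epsilon> \<Longrightarrow> M - \<kappa> \<le> k (\<epsilon> / word_ratio r w)"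
      "(\<Sum>i=1..N. r i powr \<delta> * log_integral k (\<epsilon> * x0) (\<epsilon> * x0 / r i)) < Z + \<kappa>" "0 < \<epsilon>"
      by blast
    have low: "M - 2 * \<kappa> \<le> k (\<epsilon> * \<rho>)" if r: "\<rho> \<in> {x0..x0 / rmin}" for \<rho>
    proof -
      obtain w where w: "w \<in> W" "k (\<epsilon> / word_ratio r w) - \<kappa> \<le> k (\<epsilon> * \<rho>)" using app[OF r] e(4) by blast
      have "M - \<kappa> \<le> k (\<epsilon> / word_ratio r w)" using e(1,2) tau(2) w(1) by (smt (verit))
      then show ?thesis using w(2) by linarith
    qed
    have "(M - 2 * \<kappa>) * entropy = (\<Sum>i=1..N. r i powr \<delta> * ((M - 2 * \<kappa>) * ln (1 / r i)))"
      unfolding entropy_def by (simp add: sum_distrib_left mult_ac)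
    also have "\<dots> \<le> (\<Sum>i=1..N. r i powr \<delta> * log_integral k (\<epsilon> * x0) (\<epsilon> * x0 / r i))"
    proof (intro sum_mono mult_left_mono)
      fix i assume i: "i \<in> {1..N}"
      note ri = ratio_pos[OF i] ratio_less_1[OF i]
      have pos: "0 < \<epsilon> * x0" "\<epsilon> * x0 \<le> \<epsilon> * x0 / r i" using e(4) x0 ri by (auto simp: pos_le_divide_eq)
      have "(M - 2 * \<kappa>) * ln (1 / r i) = log_integral (\<lambda>_. M - 2 * \<kappa>) (\<epsilon> * x0) (\<epsilon> * x0 / r i)"
        using pos e(4) x0 by (simp add: log_integral_const)
      also have "\<dots> \<le> log_integral k (\<epsilon> * x0) (\<epsilon> * x0 / r i)"
      proof (rule log_integral_mono[OF _ k pos(1)])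
        fix x assume x: "\<epsilon> * x0 \<le> x" "x \<le> \<epsilon> * x0 / r i"
        have "x0 \<le> x / \<epsilon>" using x(1) e(4) by (simp add: field_simps)
        moreover have "x / \<epsilon> \<le> x0 / rmin"
        proof -
          have "x / \<epsilon> \<le> x0 / r i" using x(2) e(4) ri by (simp add: field_simps)
          also have "\<dots> \<le> x0 / rmin" using rmin x0 i by (intro divide_left_mono) (auto intro: mult_pos_pos ri)
          finally show ?thesis .
        qed
        ultimately show "M - 2 * \<kappa> \<le> k x" using low[of "x / \<epsilon>"] e(4) by simp
      qed simp
      finally show "(M - 2 * \<kappa>) * ln (1 / r i) \<le> log_integral k (\<epsilon> * x0) (\<epsilon> * x0 / r i)" .
    qed auto
    finally show ?thesis using e(3) by linarith
  qed
  have "M \<le> Z / entropy"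
  proof (rule field_le_epsilon)
    fix e :: real assume "e > 0"
    \<comment> \<open>Chosen so that the total error \<open>\<kappa> * (2 * entropy + 1)\<close>
      equals \<open>e * entropy\<close>.\<close>
    define \<kappa> where "\<kappa> = e * entropy / (2 * entropy + 1)"
    have k: "\<kappa> > 0" using \<open>e > 0\<close> entropy_pos by (simp add: \<kappa>_def)
    have "M * entropy \<le> Z + \<kappa> * (2 * entropy + 1)" using key[OF k] by (simp add: algebra_simps)
    also have "\<kappa> * (2 * entropy + 1) = e * entropy" using entropy_pos by (simp add: \<kappa>_def)
    finally have "M * entropy \<le> (Z / entropy + e) * entropy" using entropy_pos by (simp add: distrib_right)
    then show "M \<le> Z / entropy + e" using entropy_pos by simp
  qed
  then show ?thesis using upper[OF \<open>\<kappa>0 > 0\<close>] by (auto elim!: eventually_mono)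
qed

end

section \<open>Bounds and integrated form of a renewal equation for a counting function\<close>

locale renewal = ratio_system +
  fixes cnt q :: "real \<Rightarrow> real" and Q E :: real
  assumes cnt_measurable [measurable]: "cnt \<in> borel_measurable borel" and q_measurable [measurable]: "q \<in> borel_measurable borel"
    and cnt_nonneg: "0 \<le> cnt \<epsilon>" and q_nonneg: "0 \<le> q \<epsilon>" and q_le: "q \<epsilon> \<le> Q"
    and cnt_antimono: "0 < x \<Longrightarrow> x \<le> y \<Longrightarrow> cnt y \<le> cnt x"
    and E_ge_1: "1 \<le> E" and cnt_zero: "E \<le> \<epsilon> \<Longrightarrow> cnt \<epsilon> = 0"
    and cnt_rec: "0 < \<epsilon> \<Longrightarrow> cnt \<epsilon> = (\<Sum>i=1..N. cnt (\<epsilon> / r i)) + q \<epsilon>"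
    and cnt_pos: "\<exists>e>0. 0 < cnt e"
begin

definition scaled_cnt :: "real \<Rightarrow> real" where "scaled_cnt \<epsilon> = \<epsilon> powr \<delta> * cnt \<epsilon>"
definition scaled_q :: "real \<Rightarrow> real" where "scaled_q \<epsilon> = \<epsilon> powr \<delta> * q \<epsilon>"

lemma scaled_cnt_nonneg: "0 \<le> scaled_cnt \<epsilon>" unfolding scaled_cnt_def using cnt_nonneg by simp
lemma Q_nonneg: "0 \<le> Q" using q_nonneg q_le order_trans by blast

lemma scaled_cnt_measurable [measurable]: "scaled_cnt \<in> borel_measurable borel"
  unfolding scaled_cnt_def[abs_def] by measurable

lemma scaled_cnt_zero: "E \<le> \<epsilon> \<Longrightarrow> scaled_cnt \<epsilon> = 0" by (simp add: scaled_cnt_def cnt_zero)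

lemma scaled_cnt_rec: 
  assumes "0 < \<epsilon>" shows "scaled_cnt \<epsilon> = (\<Sum>i=1..N. r i powr \<delta> * scaled_cnt (\<epsilon> / r i)) + scaled_q \<epsilon>"
proof -
  have "r i powr \<delta> * scaled_cnt (\<epsilon> / r i) = \<epsilon> powr \<delta> * cnt (\<epsilon> / r i)" if "i \<in> {1..N}" for i
    using ratio_pos[OF that] assms by (simp add: scaled_cnt_def powr_divide)
  then have "(\<Sum>i=1..N. r i powr \<delta> * scaled_cnt (\<epsilon> / r i)) = (\<Sum>i=1..N. \<epsilon> powr \<delta> * cnt (\<epsilon> / r i))" by (rule sum.cong[OF refl])
  then show ?thesis using cnt_rec[OF assms] by (simp add: scaled_cnt_def scaled_q_def distrib_left sum_distrib_left)
qed

text \<open>Induction on the scale for \<open>cnt \<epsilon> + Q\<close> instead of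
  \<open>cnt \<epsilon>\<close>: as there are at least two maps, \<open>q \<epsilon> + Q\<close> is
  at most \<open>N * Q\<close>, so the source is absorbed and the scaled form is bounded by a convex
  combination of its values at \<open>\<epsilon> / r i\<close>. Scales are confined to
  \<open>\<epsilon> \<le> E / rmin\<close> because \<open>\<epsilon> powr \<delta> * Q\<close> is
  unbounded; all \<open>\<epsilon> / r i\<close> with \<epsilon> < E stay in this range.\<close>

lemma scaled_cnt_bounded: "\<exists>B. \<forall>\<epsilon>>0. scaled_cnt \<epsilon> \<le> B"
proof -
  define B where "B = (E / rmin) powr \<delta> * (cnt E + Q)"
  have E: "E > 0" using E_ge_1 by simp
  have *: "\<epsilon> \<le> E / rmin \<longrightarrow> \<epsilon> powr \<delta> * (cnt \<epsilon> + Q) \<le> B" if "\<epsilon> > 0" for \<epsilon>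
  proof (rule scale_induct[OF E that])
    fix \<epsilon> assume "E \<le> \<epsilon>"
    then show "\<epsilon> \<le> E / rmin \<longrightarrow> \<epsilon> powr \<delta> * (cnt \<epsilon> + Q) \<le> B"
      unfolding B_def using E cnt_antimono[OF E, of \<epsilon>] cnt_nonneg[of \<epsilon>] Q_nonneg dim_pos
      by (auto intro!: mult_mono powr_mono2)
  next
    fix \<epsilon> assume e: "0 < \<epsilon>" "\<epsilon> < E"
      and IH: "\<And>i. i \<in> {1..N} \<Longrightarrow> \<epsilon> / r i \<le> E / rmin \<longrightarrow> (\<epsilon> / r i) powr \<delta> * (cnt (\<epsilon> / r i) + Q) \<le> B"
    have IH': "\<epsilon> powr \<delta> * (cnt (\<epsilon> / r i) + Q) \<le> r i powr \<delta> * B" if i: "i \<in> {1..N}" for i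
    proof -
      have "\<epsilon> / r i \<le> E / rmin"
        using e rmin(1) rmin(3)[OF i] ratio_pos[OF i] by (intro frac_le) auto
      then have "(\<epsilon> / r i) powr \<delta> * (cnt (\<epsilon> / r i) + Q) \<le> B" using IH[OF i] by simp
      then have "r i powr \<delta> * ((\<epsilon> / r i) powr \<delta> * (cnt (\<epsilon> / r i) + Q)) \<le> r i powr \<delta> * B"
        by (intro mult_left_mono) auto
      then show ?thesis using ratio_pos[OF i] e by (simp add: powr_divide)
    qed
    have "q \<epsilon> + Q \<le> real N * Q"
    proof -
      have "2 * Q \<le> real N * Q" using two_maps Q_nonneg by (intro mult_right_mono) auto
      then show ?thesis using q_le[of \<epsilon>] by simp
    qed
    then have "cnt \<epsilon> + Q \<le> (\<Sum>i=1..N. cnt (\<epsilon> / r i) + Q)"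
      using cnt_rec[OF e(1)] by (simp add: sum.distrib)
    then have "\<epsilon> powr \<delta> * (cnt \<epsilon> + Q) \<le> \<epsilon> powr \<delta> * (\<Sum>i=1..N. cnt (\<epsilon> / r i) + Q)"
      by (intro mult_left_mono) auto
    also have "\<dots> = (\<Sum>i=1..N. \<epsilon> powr \<delta> * (cnt (\<epsilon> / r i) + Q))" by (simp add: sum_distrib_left)
    also have "\<dots> \<le> (\<Sum>i=1..N. r i powr \<delta> * B)" by (intro sum_mono IH')
    also have "\<dots> = B" using moran by (simp add: sum_distrib_right[symmetric])
    finally show "\<epsilon> \<le> E / rmin \<longrightarrow> \<epsilon> powr \<delta> * (cnt \<epsilon> + Q) \<le> B" by simp
  qed
  have "0 \<le> B" unfolding B_def using cnt_nonneg Q_nonneg by simp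
  have "scaled_cnt \<epsilon> \<le> B" if "\<epsilon> > 0" for \<epsilon>
  proof (cases "E \<le> \<epsilon>")
    case False
    have "E * rmin \<le> E * 1" using rmin E by (intro mult_left_mono) auto
    then have "E \<le> E / rmin" using rmin by (simp add: pos_le_divide_eq)
    then have "\<epsilon> \<le> E / rmin" using False by simp
    then have "\<epsilon> powr \<delta> * (cnt \<epsilon> + Q) \<le> B" using *[OF that] by simp
    moreover have "0 \<le> \<epsilon> powr \<delta> * Q" using Q_nonneg by simp
    ultimately show ?thesis by (simp add: scaled_cnt_def distrib_left)
  qed (use scaled_cnt_zero \<open>0 \<le> B\<close> in simp)
  then show ?thesis by blast
qed

text \<open>The source is nonnegative and can only help. A lower bound on the band from
  \<open>e1 * rmin\<close> to e1 is inherited by all smaller scales, because dividing by some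
  \<open>r i\<close> cannot jump over the band.\<close>

lemma scaled_cnt_lower: "\<exists>b>0. \<exists>e>0. \<forall>\<epsilon>. 0 < \<epsilon> \<longrightarrow> \<epsilon> \<le> e \<longrightarrow> b \<le> scaled_cnt \<epsilon>"
proof -
  obtain e1 where e1: "e1 > 0" "0 < cnt e1" using cnt_pos by blast
  define e0 where "e0 = e1 * rmin"
  define b where "b = e0 powr \<delta> * cnt e1"
  have e0: "e0 > 0" using e1 rmin by (simp add: e0_def)
  have b: "b > 0" using e0 e1 by (simp add: b_def)
  have "\<epsilon> \<le> e1 \<longrightarrow> b \<le> scaled_cnt \<epsilon>" if "\<epsilon> > 0" for \<epsilon>
  proof (rule scale_induct[OF e0 that])
    fix \<epsilon> assume "e0 \<le> \<epsilon>"
    then show "\<epsilon> \<le> e1 \<longrightarrow> b \<le> scaled_cnt \<epsilon>"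
      unfolding b_def scaled_cnt_def using e0 e1 cnt_antimono[of \<epsilon> e1] dim_pos by (auto intro!: mult_mono powr_mono2 cnt_nonneg)
  next
    fix \<epsilon> assume e: "0 < \<epsilon>" "\<epsilon> < e0" and IH: "\<And>i. i \<in> {1..N} \<Longrightarrow> \<epsilon> / r i \<le> e1 \<longrightarrow> b \<le> scaled_cnt (\<epsilon> / r i)"
    have IH': "b \<le> scaled_cnt (\<epsilon> / r i)" if i: "i \<in> {1..N}" for i
    proof -
      have "\<epsilon> \<le> e1 * rmin" using e by (simp add: e0_def)
      also have "\<dots> \<le> e1 * r i" using rmin(3)[OF i] e1 by (intro mult_left_mono) auto
      finally show ?thesis using IH[OF i] ratio_pos[OF i] by (simp add: pos_divide_le_eq)
    qed
    have "b = (\<Sum>i=1..N. r i powr \<delta> * b)" using moran by (simp add: sum_distrib_right[symmetric])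
    also have "\<dots> \<le> (\<Sum>i=1..N. r i powr \<delta> * scaled_cnt (\<epsilon> / r i))" by (intro sum_mono mult_left_mono IH') auto
    also have "\<dots> \<le> scaled_cnt \<epsilon>" using scaled_cnt_rec[OF e(1)] q_nonneg[of \<epsilon>] by (simp add: scaled_q_def)
    finally show "\<epsilon> \<le> e1 \<longrightarrow> b \<le> scaled_cnt \<epsilon>" by simp
  qed
  then show ?thesis using b e1 by blast
qed

lemma scaled_cnt_lb: "locally_bounded_fun scaled_cnt"
  by (rule locally_bounded_funI) (use scaled_cnt_bounded scaled_cnt_nonneg in auto)

lemma scaled_q_lb: "locally_bounded_fun scaled_q"
proof (rule locally_bounded_funI)
  show "scaled_q \<in> borel_measurable borel" unfolding scaled_q_def[abs_def] by measurable
  fix E' :: real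
  have "\<bar>scaled_q x\<bar> \<le> E' powr \<delta> * Q" if "0 < x" "x \<le> E'" for x
    unfolding scaled_q_def using that q_nonneg[of x] q_le[of x] dim_pos
    by (auto simp: abs_mult intro!: mult_mono powr_mono2)
  then show "\<exists>B. \<forall>x. 0 < x \<longrightarrow> x \<le> E' \<longrightarrow> \<bar>scaled_q x\<bar> \<le> B" by blast
qed

definition tail_integral :: "real \<Rightarrow> real" where "tail_integral \<epsilon> = log_integral scaled_cnt \<epsilon> E"

lemma tail_integral_eq: "0 < a \<Longrightarrow> E \<le> b \<Longrightarrow> log_integral scaled_cnt a b = tail_integral a"
proof (cases "a \<le> E")
  case True
  assume a: "0 < a" "E \<le> b"
  have "log_integral scaled_cnt E b = log_integral (\<lambda>_. 0) E b"
    using E_ge_1 by (intro log_integral_cong) (auto simp: scaled_cnt_zero)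
  also have "\<dots> = 0" by (simp add: log_integral_def)
  finally show ?thesis using log_integral_concat[OF scaled_cnt_lb a(1) True a(2)] by (simp add: tail_integral_def)
next
  case False
  assume a: "0 < a" "E \<le> b"
  have "log_integral scaled_cnt a b = log_integral (\<lambda>_. 0) a b"
    using a False by (intro log_integral_cong) (auto simp: scaled_cnt_zero)
  also have "\<dots> = 0" by (simp add: log_integral_def)
  finally show ?thesis using False by (simp add: tail_integral_def log_integral_empty)
qed

text \<open>The recursion integrated against dx/x. Dilation moves the upper limit to
  \<open>E / r i\<close>, which may be put back to E because the count vanishes beyond E.\<close>

lemma tail_integral_rec:
  assumes "0 < \<epsilon>"
  shows "tail_integral \<epsilon> = (\<Sum>i=1..N. r i powr \<delta> * tail_integral (\<epsilon> / r i)) + log_integral scaled_q \<epsilon> E"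
proof -
  have lb: "locally_bounded_fun (\<lambda>x. r i powr \<delta> * scaled_cnt (x / r i))" if "i \<in> {1..N}" for i
    using ratio_pos[OF that] by (intro locally_bounded_fun_cmult locally_bounded_fun_scale scaled_cnt_lb)
  have "tail_integral \<epsilon> = log_integral (\<lambda>x. (\<Sum>i=1..N. r i powr \<delta> * scaled_cnt (x / r i)) + scaled_q x) \<epsilon> E"
    unfolding tail_integral_def using assms by (intro log_integral_cong scaled_cnt_rec) auto
  also have "\<dots> = log_integral (\<lambda>x. \<Sum>i=1..N. r i powr \<delta> * scaled_cnt (x / r i)) \<epsilon> E + log_integral scaled_q \<epsilon> E"
    by (rule log_integral_add[OF locally_bounded_fun_sum scaled_q_lb assms]) (rule lb)
  also have "log_integral (\<lambda>x. \<Sum>i=1..N. r i powr \<delta> * scaled_cnt (x / r i)) \<epsilon> E =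
      (\<Sum>i=1..N. log_integral (\<lambda>x. r i powr \<delta> * scaled_cnt (x / r i)) \<epsilon> E)"
    by (rule log_integral_sum[OF _ assms]) (rule lb)
  also have "(\<Sum>i=1..N. log_integral (\<lambda>x. r i powr \<delta> * scaled_cnt (x / r i)) \<epsilon> E) = (\<Sum>i=1..N. r i powr \<delta> * tail_integral (\<epsilon> / r i))"
  proof (rule sum.cong[OF refl])
    fix i assume i: "i \<in> {1..N}"
    note ri = ratio_pos[OF i] ratio_less_1[OF i]
    have "E \<le> E / r i" using ri E_ge_1 by (simp add: pos_le_divide_eq)
    then show "log_integral (\<lambda>x. r i powr \<delta> * scaled_cnt (x / r i)) \<epsilon> E = r i powr \<delta> * tail_integral (\<epsilon> / r i)"
      using assms ri by (simp add: log_integral_cmult log_integral_scale tail_integral_eq)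
  qed
  finally show ?thesis .
qed

text \<open>The integral grows as \<epsilon> decreases and is bounded by that of
  \<open>Q * x powr \<delta>\<close> against dx/x, which is finite down to 0 because \<delta> >
  0.\<close>

lemma scaled_q_integral_convergent: "\<exists>L. ((\<lambda>\<epsilon>. log_integral scaled_q \<epsilon> E) \<longlongrightarrow> L) (at_right 0)"
proof -
  let ?f = "\<lambda>\<epsilon>. log_integral scaled_q \<epsilon> E"
  have E: "E > 0" using E_ge_1 by simp
  have mono: "?f b \<le> ?f a" if "0 < a" "a \<le> b" "b \<le> E" for a b
  proof -
    have "0 = log_integral (\<lambda>_. 0) a b" by (simp add: log_integral_def)
    also have "\<dots> \<le> log_integral scaled_q a b"
      using that by (intro log_integral_mono scaled_q_lb) (auto simp: scaled_q_def q_nonneg)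
    finally show ?thesis using log_integral_concat[OF scaled_q_lb that(1,2,3)] by simp
  qed
  have bdd: "?f a \<le> Q * (E powr \<delta> / \<delta>)" if a: "0 < a" "a \<le> E" for a
  proof -
    have "?f a \<le> log_integral (\<lambda>x. Q * x powr \<delta>) a E"
      using a dim_pos by (intro log_integral_mono scaled_q_lb locally_bounded_fun_cmult)
        (auto simp: scaled_q_def mult.commute q_le intro!: mult_right_mono)
    also have "\<dots> = Q * ((E powr \<delta> - a powr \<delta>) / \<delta>)"
      using a dim_pos by (simp add: log_integral_cmult log_integral_powr)
    also have "\<dots> \<le> Q * (E powr \<delta> / \<delta>)"
      using Q_nonneg dim_pos by (intro mult_left_mono divide_right_mono) auto
    finally show ?thesis .
  qed
  define L where "L = Sup (?f ` {0<..E})"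
  have bA: "bdd_above (?f ` {0<..E})" using bdd by (intro bdd_aboveI2) auto
  have "(?f \<longlongrightarrow> L) (at_right 0)"
  proof (rule order_tendstoI)
    fix a assume "a < L"
    then obtain e where e: "0 < e" "e \<le> E" "a < ?f e"
      unfolding L_def using E less_cSup_iff[OF _ bA, of a] by auto
    have "\<forall>\<^sub>F \<epsilon> in at_right 0. 0 < \<epsilon> \<and> \<epsilon> < e" using eventually_at_right_real[OF e(1)] by simp
    then show "\<forall>\<^sub>F \<epsilon> in at_right 0. a < ?f \<epsilon>"
      by eventually_elim (use mono e in \<open>force intro: less_le_trans\<close>)
  next
    fix a assume a: "L < a"
    have "\<forall>\<^sub>F \<epsilon> in at_right 0. 0 < \<epsilon> \<and> \<epsilon> < E"
      using eventually_at_right_real[OF E] by simp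
    then show "\<forall>\<^sub>F \<epsilon> in at_right 0. ?f \<epsilon> < a"
    proof eventually_elim
      case (elim \<epsilon>)
      then have "?f \<epsilon> \<le> L" unfolding L_def by (intro cSup_upper bA imageI) auto
      then show ?case using a by simp
    qed
  qed
  then show ?thesis by blast
qed

text \<open>The improper integral of the source against dx/x. Divided by \<open>entropy\<close> it
  is the constant of the renewal theorem.\<close>

definition source_mass :: real where "source_mass = (SOME L. ((\<lambda>\<epsilon>. log_integral scaled_q \<epsilon> E) \<longlongrightarrow> L) (at_right 0))"

lemma source_mass_limit: "((\<lambda>\<epsilon>. log_integral scaled_q \<epsilon> E) \<longlongrightarrow> source_mass) (at_right 0)"
  unfolding source_mass_def using scaled_q_integral_convergent by (rule someI_ex)

end


section \<open>Averaged limit and nonlattice limit of the scaled count\<close>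

context renewal
begin

lemma tail_integral_nonneg: "0 < \<epsilon> \<Longrightarrow> 0 \<le> tail_integral \<epsilon>"
proof -
  assume e: "0 < \<epsilon>"
  have "0 = log_integral (\<lambda>_. 0) \<epsilon> E" by (simp add: log_integral_def)
  also have "\<dots> \<le> tail_integral \<epsilon>" unfolding tail_integral_def using e by (intro log_integral_mono scaled_cnt_lb) (auto simp: scaled_cnt_nonneg)
  finally show ?thesis .
qed

lemma tail_integral_antimono:
  assumes "0 < a" "a \<le> b" shows "tail_integral b \<le> tail_integral a"
proof -
  have "0 = log_integral (\<lambda>_. 0) a b" by (simp add: log_integral_def)
  also have "\<dots> \<le> log_integral scaled_cnt a b" using assms by (intro log_integral_mono scaled_cnt_lb) (auto simp: scaled_cnt_nonneg)
  finally have "log_integral scaled_cnt b (max b E) \<le> log_integral scaled_cnt a (max b E)"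
    using log_integral_concat[OF scaled_cnt_lb assms, of "max b E"] by simp
  then show ?thesis using assms tail_integral_eq[of a "max b E"] tail_integral_eq[of b "max b E"] by simp
qed

text \<open>The constant is chosen such that the deviation satisfies the homogeneous recursion up to an error tending to \<open>0\<close>;
  a maximum principle then bounds the accumulated error by \<open>\<eta> ln (1 / \<epsilon>)\<close>.\<close>

lemma tail_integral_deviation:
  assumes "\<eta> > 0"
  shows "\<exists>A. \<forall>\<^sub>F \<epsilon> in at_right 0. \<bar>tail_integral \<epsilon> - source_mass / entropy * ln (1 / \<epsilon>)\<bar> \<le> A + \<eta> * ln (1 / \<epsilon>)"
proof -
  define C where "C = source_mass / entropy"
  define G where "G = (\<lambda>\<epsilon>. tail_integral \<epsilon> - C * ln (1 / \<epsilon>))"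
  define amin where "amin = ln (1 / rmax)"
  have amin: "amin > 0" unfolding amin_def using rmax by (intro ln_gt_zero) simp
  have G_rec: "G \<epsilon> = (\<Sum>i=1..N. r i powr \<delta> * G (\<epsilon> / r i)) + (log_integral scaled_q \<epsilon> E - source_mass)" if "\<epsilon> > 0" for \<epsilon>
  proof -
    have "(\<Sum>i=1..N. r i powr \<delta> * G (\<epsilon> / r i)) =
      (\<Sum>i=1..N. r i powr \<delta> * tail_integral (\<epsilon> / r i) - C * (r i powr \<delta> * ln (1 / \<epsilon>)) + C * (r i powr \<delta> * ln (1 / r i)))"
    proof (rule sum.cong[OF refl])
      fix i assume i: "i \<in> {1..N}"
      have "ln (1 / (\<epsilon> / r i)) = ln (1 / \<epsilon>) - ln (1 / r i)"
        using ratio_pos[OF i] that by (simp add: ln_div)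
      then have Geq: "G (\<epsilon> / r i) = tail_integral (\<epsilon> / r i) - C * (ln (1 / \<epsilon>) - ln (1 / r i))" by (simp only: G_def)
      show "r i powr \<delta> * G (\<epsilon> / r i) =
        r i powr \<delta> * tail_integral (\<epsilon> / r i) - C * (r i powr \<delta> * ln (1 / \<epsilon>)) + C * (r i powr \<delta> * ln (1 / r i))"
        unfolding Geq by (simp add: algebra_simps)
    qed
    \<comment> \<open>By the Moran equation the logarithms of \<epsilon> combine to one term; what
      remains is \<open>C * entropy\<close>, and C is chosen so that this matches the limit of the
      source integral.\<close>
    also have "\<dots> = (\<Sum>i=1..N. r i powr \<delta> * tail_integral (\<epsilon> / r i)) - C * ln (1 / \<epsilon>) + C * entropy"
      using moran by (simp add: sum.distrib sum_subtractf entropy_def sum_distrib_left[symmetric] sum_distrib_right[symmetric])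
    also have "C * entropy = source_mass" using entropy_pos by (simp add: C_def)
    finally show ?thesis using tail_integral_rec[OF that] by (simp add: G_def)
  qed
  have "\<forall>\<^sub>F \<epsilon> in at_right 0. \<bar>log_integral scaled_q \<epsilon> E - source_mass\<bar> < \<eta> * amin"
    using tendstoD[OF source_mass_limit, of "\<eta> * amin"] assms amin by (simp add: dist_real_def)
  then obtain b where b: "b > 0" "\<And>\<epsilon>. 0 < \<epsilon> \<Longrightarrow> \<epsilon> < b \<Longrightarrow> \<bar>log_integral scaled_q \<epsilon> E - source_mass\<bar> < \<eta> * amin"
    unfolding eventually_at_right_field by auto
  \<comment> \<open>Division by \<open>r i\<close> sends scales below b to scales of at most E', so
    the induction stays in (0, E'].\<close>
  define E' where "E' = b / rmin"
  have E': "E' > 0" using b rmin by (simp add: E'_def)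
  define A where "A = tail_integral b + \<bar>C\<bar> * (\<bar>ln b\<bar> + \<bar>ln E'\<bar>)"
  have *: "\<epsilon> \<le> E' \<longrightarrow> \<bar>G \<epsilon>\<bar> \<le> A + \<eta> * ln (E' / \<epsilon>)" if "\<epsilon> > 0" for \<epsilon>
  proof (rule scale_induct[OF b(1) that])
    fix \<epsilon> assume e: "b \<le> \<epsilon>"
    show "\<epsilon> \<le> E' \<longrightarrow> \<bar>G \<epsilon>\<bar> \<le> A + \<eta> * ln (E' / \<epsilon>)"
    proof
      assume e': "\<epsilon> \<le> E'"
      have pos: "0 < \<epsilon>" using b(1) e by simp
      have "ln b \<le> ln \<epsilon>" "ln \<epsilon> \<le> ln E'" using e e' b(1) pos by auto
      then have "\<bar>ln (1 / \<epsilon>)\<bar> \<le> \<bar>ln b\<bar> + \<bar>ln E'\<bar>" using pos by (simp add: ln_div)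
      then have "\<bar>C * ln (1 / \<epsilon>)\<bar> \<le> \<bar>C\<bar> * (\<bar>ln b\<bar> + \<bar>ln E'\<bar>)" unfolding abs_mult by (rule mult_left_mono) simp
      moreover have "\<bar>tail_integral \<epsilon>\<bar> \<le> tail_integral b" using tail_integral_nonneg[OF pos] tail_integral_antimono[OF b(1) e] by simp
      ultimately have "\<bar>G \<epsilon>\<bar> \<le> A" unfolding G_def A_def by linarith
      moreover have "0 \<le> \<eta> * ln (E' / \<epsilon>)" using assms e' pos by (intro mult_nonneg_nonneg ln_ge_zero) auto
      ultimately show "\<bar>G \<epsilon>\<bar> \<le> A + \<eta> * ln (E' / \<epsilon>)" by linarith
    qed
  next
    fix \<epsilon> assume e: "0 < \<epsilon>" "\<epsilon> < b"
      and IH: "\<And>i. i \<in> {1..N} \<Longrightarrow> \<epsilon> / r i \<le> E' \<longrightarrow> \<bar>G (\<epsilon> / r i)\<bar> \<le> A + \<eta> * ln (E' / (\<epsilon> / r i))"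
    \<comment> \<open>One recursion step lowers the allowance
      \<open>\<eta> * ln (E' / \<epsilon>)\<close> by at least \<open>\<eta> * amin\<close>, which
      pays for the error of that step.\<close>
    have IH': "\<bar>G (\<epsilon> / r i)\<bar> \<le> A + \<eta> * ln (E' / \<epsilon>) - \<eta> * amin" if i: "i \<in> {1..N}" for i
    proof -
      have "\<epsilon> / r i \<le> E'"
        unfolding E'_def using e rmin(1) rmin(3)[OF i] ratio_pos[OF i] by (intro frac_le) auto
      then have "\<bar>G (\<epsilon> / r i)\<bar> \<le> A + \<eta> * ln (E' / (\<epsilon> / r i))" using IH[OF i] by simp
      also have "ln (E' / (\<epsilon> / r i)) = ln (E' / \<epsilon>) - ln (1 / r i)"
        using e E' ratio_pos[OF i] by (simp add: ln_div ln_mult)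
      also have "\<eta> * (ln (E' / \<epsilon>) - ln (1 / r i)) \<le> \<eta> * (ln (E' / \<epsilon>) - amin)"
        using assms ratio_pos[OF i] rmax(1) rmax(3)[OF i] by (simp add: amin_def ln_div)
      finally show ?thesis by (simp add: algebra_simps)
    qed
    have "\<bar>G \<epsilon>\<bar> \<le> \<bar>\<Sum>i=1..N. r i powr \<delta> * G (\<epsilon> / r i)\<bar> + \<bar>log_integral scaled_q \<epsilon> E - source_mass\<bar>"
      unfolding G_rec[OF e(1)] by (rule abs_triangle_ineq)
    also have "\<dots> \<le> (\<Sum>i=1..N. \<bar>r i powr \<delta> * G (\<epsilon> / r i)\<bar>) + \<eta> * amin"
      using b(2)[OF e] by (intro add_mono sum_abs) auto
    also have "\<dots> \<le> (\<Sum>i=1..N. r i powr \<delta> * (A + \<eta> * ln (E' / \<epsilon>) - \<eta> * amin)) + \<eta> * amin"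
      using IH' by (intro add_right_mono sum_mono) (auto simp: abs_mult intro!: mult_left_mono)
    also have "\<dots> = A + \<eta> * ln (E' / \<epsilon>)" using moran by (simp add: sum_distrib_right[symmetric])
    finally show "\<epsilon> \<le> E' \<longrightarrow> \<bar>G \<epsilon>\<bar> \<le> A + \<eta> * ln (E' / \<epsilon>)" by simp
  qed
  have "\<forall>\<^sub>F \<epsilon> in at_right 0. \<epsilon> \<in> {0<..<E'}" by (rule eventually_at_right_real[OF E'])
  then have "\<forall>\<^sub>F \<epsilon> in at_right 0. \<bar>G \<epsilon>\<bar> \<le> (A + \<eta> * ln E') + \<eta> * ln (1 / \<epsilon>)"
  proof eventually_elim
    case (elim \<epsilon>)
    then have "\<bar>G \<epsilon>\<bar> \<le> A + \<eta> * ln (E' / \<epsilon>)" using * by auto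
    then show ?case using elim by (simp add: ln_div algebra_simps)
  qed
  then show ?thesis unfolding G_def C_def by blast
qed

text \<open>The slope \<eta> in \<open>tail_integral_deviation\<close> is arbitrary, so division by
  \<open>ln (1 / T)\<close> leaves a deviation below any e. Stopping at 1 instead of E changes the
  integral by the constant \<open>tail_integral 1\<close>.\<close>

theorem average_renewal:
  "((\<lambda>T. log_integral scaled_cnt T 1 / \<bar>ln T\<bar>) \<longlongrightarrow> source_mass / entropy) (at_right 0)"
proof (rule tendstoI)
  fix e :: real assume "e > 0"
  define \<eta> where "\<eta> = e / 2"
  have eta: "\<eta> > 0" using \<open>e > 0\<close> by (simp add: \<eta>_def)
  define C where "C = source_mass / entropy"
  obtain A where A: "\<forall>\<^sub>F \<epsilon> in at_right 0. \<bar>tail_integral \<epsilon> - C * ln (1 / \<epsilon>)\<bar> \<le> A + \<eta> * ln (1 / \<epsilon>)"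
    using tail_integral_deviation[OF eta] unfolding C_def by blast
  have "((\<lambda>\<epsilon>. c / ln (1 / \<epsilon>)) \<longlongrightarrow> 0) (at_right 0)" for c :: real by real_asymp
  then have "\<forall>\<^sub>F \<epsilon> in at_right 0. (A + \<bar>tail_integral 1\<bar>) / ln (1 / \<epsilon>) < \<eta>" using eta by (rule order_tendstoD)
  moreover have "\<forall>\<^sub>F \<epsilon> in at_right 0. \<epsilon> \<in> {0<..<1::real}" by (rule eventually_at_right_real) simp
  ultimately show "\<forall>\<^sub>F T in at_right 0. dist (log_integral scaled_cnt T 1 / \<bar>ln T\<bar>) (source_mass / entropy) < e"
    using A
  proof eventually_elim
    case (elim T)
    have T: "0 < T" "T < 1" using elim(2) by auto
    define L where "L = ln (1 / T)"
    have L: "L > 0" "\<bar>ln T\<bar> = L" unfolding L_def using T by (auto simp: ln_div)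
    have "tail_integral T = log_integral scaled_cnt T 1 + tail_integral 1"
      using log_integral_concat[OF scaled_cnt_lb T(1), of 1 E] T E_ge_1 by (simp add: tail_integral_def)
    then have "\<bar>log_integral scaled_cnt T 1 - C * L\<bar> \<le> (A + \<bar>tail_integral 1\<bar>) + \<eta> * L"
      using elim(3) unfolding L_def[symmetric] by linarith
    then have "\<bar>log_integral scaled_cnt T 1 - C * L\<bar> / L \<le> ((A + \<bar>tail_integral 1\<bar>) + \<eta> * L) / L"
      using L by (intro divide_right_mono) auto
    also have "\<dots> = (A + \<bar>tail_integral 1\<bar>) / L + \<eta>" using L by (simp add: add_divide_distrib)
    also have "\<dots> < e" using elim(1) \<eta>_def unfolding L_def[symmetric] by linarith
    also have "\<bar>log_integral scaled_cnt T 1 - C * L\<bar> / L = \<bar>(log_integral scaled_cnt T 1 - C * L) / L\<bar>" using L by simp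
    also have "(log_integral scaled_cnt T 1 - C * L) / L = log_integral scaled_cnt T 1 / L - C" using L by (simp add: field_simps)
    finally show ?case using L by (simp add: dist_real_def C_def)
  qed
qed

lemma limit_constant_nonneg: "0 \<le> source_mass / entropy"
proof (rule tendsto_lowerbound[OF average_renewal])
  have "\<forall>\<^sub>F \<epsilon> in at_right 0. \<epsilon> \<in> {0<..<1::real}" by (rule eventually_at_right_real) simp
  then show "\<forall>\<^sub>F T in at_right 0. 0 \<le> log_integral scaled_cnt T 1 / \<bar>ln T\<bar>"
  proof eventually_elim
    case (elim T)
    have "0 = log_integral (\<lambda>_. 0) T 1" by (simp add: log_integral_def)
    also have "\<dots> \<le> log_integral scaled_cnt T 1" using elim by (intro log_integral_mono scaled_cnt_lb) (auto simp: scaled_cnt_nonneg)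
    finally show ?case by simp
  qed
qed (simp add: trivial_limit_at_right_real)

text \<open>The scaled count jumps, but antitonicity of the count still controls it from one side.
  This replaces uniform continuity in the nonlattice theorem.\<close>

lemma scaled_cnt_scale:
  assumes "0 < x" "1 \<le> l" shows "scaled_cnt (l * x) \<le> l powr \<delta> * scaled_cnt x"
proof -
  have "scaled_cnt (l * x) = l powr \<delta> * (x powr \<delta> * cnt (l * x))" using assms by (simp add: scaled_cnt_def powr_mult mult_ac)
  also have "\<dots> \<le> l powr \<delta> * (x powr \<delta> * cnt x)"
    using assms by (intro mult_left_mono cnt_antimono) (auto simp: mult_le_cancel_right1)
  finally show ?thesis by (simp add: scaled_cnt_def)
qed

text \<open>By the Moran equation the sum is \<open>tail_integral \<epsilon>\<close> minus the
  weighted sum of its values at \<open>\<epsilon> / r i\<close>, which is the integral of the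
  source. The identity is exact once \<open>\<epsilon> < E * rmin\<close>.\<close>

lemma increment_limit: "((\<lambda>\<epsilon>. \<Sum>i=1..N. r i powr \<delta> * log_integral scaled_cnt \<epsilon> (\<epsilon> / r i)) \<longlongrightarrow> source_mass) (at_right 0)"
proof (rule Lim_transform_eventually[OF source_mass_limit])
  have "E * rmin > 0" using E_ge_1 rmin by simp
  then have "\<forall>\<^sub>F \<epsilon> in at_right 0. \<epsilon> \<in> {0<..<E * rmin}" by (rule eventually_at_right_real)
  then show "\<forall>\<^sub>F \<epsilon> in at_right 0. log_integral scaled_q \<epsilon> E = (\<Sum>i=1..N. r i powr \<delta> * log_integral scaled_cnt \<epsilon> (\<epsilon> / r i))"
  proof eventually_elim
    case (elim \<epsilon>)
    have e: "0 < \<epsilon>" "\<epsilon> < E * rmin" using elim by auto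
    have "log_integral scaled_cnt \<epsilon> (\<epsilon> / r i) = tail_integral \<epsilon> - tail_integral (\<epsilon> / r i)" if i: "i \<in> {1..N}" for i
    proof -
      note ri = ratio_pos[OF i] ratio_less_1[OF i]
      have "\<epsilon> \<le> \<epsilon> / r i" using e ri by (simp add: pos_le_divide_eq)
      moreover have "\<epsilon> / r i \<le> E"
      proof -
        have "\<epsilon> \<le> E * rmin" using e by simp
        also have "\<dots> \<le> E * r i" using rmin(3)[OF i] E_ge_1 by (intro mult_left_mono) auto
        finally show ?thesis using ri by (simp add: pos_divide_le_eq)
      qed
      ultimately show ?thesis using log_integral_concat[OF scaled_cnt_lb e(1), of "\<epsilon> / r i" E] by (simp add: tail_integral_def)
    qed
    then have "(\<Sum>i=1..N. r i powr \<delta> * log_integral scaled_cnt \<epsilon> (\<epsilon> / r i)) = (\<Sum>i=1..N. r i powr \<delta> * tail_integral \<epsilon> - r i powr \<delta> * tail_integral (\<epsilon> / r i))"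
      by (intro sum.cong) (auto simp: right_diff_distrib)
    also have "\<dots> = tail_integral \<epsilon> - (\<Sum>i=1..N. r i powr \<delta> * tail_integral (\<epsilon> / r i))"
      using moran by (simp add: sum_subtractf sum_distrib_right[symmetric])
    finally show ?case using tail_integral_rec[OF e(1)] by simp
  qed
qed

lemma scaled_q_limit: "(scaled_q \<longlongrightarrow> 0) (at_right 0)"
proof (rule tendsto_sandwich)
  show "\<forall>\<^sub>F \<epsilon> in at_right 0. 0 \<le> scaled_q \<epsilon>" by (simp add: scaled_q_def q_nonneg)
  show "\<forall>\<^sub>F \<epsilon> in at_right 0. scaled_q \<epsilon> \<le> \<epsilon> powr \<delta> * Q" by (simp add: scaled_q_def q_le mult_left_mono)
  show "((\<lambda>\<epsilon>. \<epsilon> powr \<delta> * Q) \<longlongrightarrow> 0) (at_right 0)" using dim_pos by real_asymp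
qed simp

text \<open>\<open>renewal_upper\<close> is applied to the scaled count and to its negative. Each
  time values at word scales must be compared with values at arbitrary scales from one side only, as
  \<open>scaled_cnt_scale\<close> allows: inverse ratios just above \<rho> serve the upper bound,
  those just below \<rho> the lower bound.\<close>

theorem nonlattice_renewal:
  assumes nl: "\<And>\<eta>. 1 < \<eta> \<Longrightarrow> \<exists>u v. set u \<subseteq> {1..N} \<and> set v \<subseteq> {1..N} \<and> word_ratio r u < word_ratio r v \<and> word_ratio r v \<le> \<eta> * word_ratio r u"
  shows "(scaled_cnt \<longlongrightarrow> source_mass / entropy) (at_right 0)"
proof -
  obtain B where B: "\<And>\<epsilon>. \<epsilon> > 0 \<Longrightarrow> scaled_cnt \<epsilon> \<le> B" using scaled_cnt_bounded by blast
  have B0: "0 \<le> B" using B[of 1] scaled_cnt_nonneg[of 1] by simp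
  have approx: "\<exists>\<eta>>1. \<forall>x l. 0 < x \<longrightarrow> 1 \<le> l \<longrightarrow> l \<le> \<eta> \<longrightarrow> scaled_cnt (l * x) \<le> scaled_cnt x + \<kappa>" if "\<kappa> > 0" for \<kappa>
  proof (intro exI conjI allI impI)
    \<comment> \<open>Makes \<open>\<eta> powr \<delta> - 1\<close> equal to
      \<open>\<kappa> / (B + 1)\<close>, so a growth by this factor costs at most \<kappa>; the
      added 1 keeps the denominator positive.\<close>
    define \<eta> where "\<eta> = (1 + \<kappa> / (B + 1)) powr (1 / \<delta>)"
    show "1 < (1 + \<kappa> / (B + 1)) powr (1 / \<delta>)" using that B0 dim_pos by (intro gr_one_powr) auto
    fix x l :: real assume x: "0 < x" and l: "1 \<le> l" "l \<le> (1 + \<kappa> / (B + 1)) powr (1 / \<delta>)"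
    have "l powr \<delta> \<le> \<eta> powr \<delta>" unfolding \<eta>_def using l dim_pos by (intro powr_mono2) auto
    also have "\<dots> = 1 + \<kappa> / (B + 1)" unfolding \<eta>_def using that B0 dim_pos by (simp add: powr_powr)
    finally have le: "l powr \<delta> - 1 \<le> \<kappa> / (B + 1)" by simp
    have "scaled_cnt (l * x) \<le> scaled_cnt x + (l powr \<delta> - 1) * scaled_cnt x" using scaled_cnt_scale[OF x l(1)] by (simp add: algebra_simps)
    also have "(l powr \<delta> - 1) * scaled_cnt x \<le> \<kappa> / (B + 1) * (B + 1)"
      using le that B0 B[OF x] scaled_cnt_nonneg[of x] by (intro mult_mono) auto
    also have "\<dots> = \<kappa>" using B0 by simp
    finally show "scaled_cnt (l * x) \<le> scaled_cnt x + \<kappa>" by simp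
  qed
  have upper: "\<forall>\<^sub>F \<epsilon> in at_right 0. scaled_cnt \<epsilon> \<le> source_mass / entropy + \<kappa>0" if "\<kappa>0 > 0" for \<kappa>0
  proof (rule renewal_upper[OF scaled_cnt_lb _ scaled_q_limit scaled_cnt_rec increment_limit _ that])
    show "\<bar>scaled_cnt \<epsilon>\<bar> \<le> B" if "\<epsilon> > 0" for \<epsilon> using B[OF that] scaled_cnt_nonneg[of \<epsilon>] by simp
    fix \<kappa> :: real assume "\<kappa> > 0"
    then obtain \<eta> where eta: "\<eta> > 1" and ap: "\<And>x l. 0 < x \<Longrightarrow> 1 \<le> l \<Longrightarrow> l \<le> \<eta> \<Longrightarrow> scaled_cnt (l * x) \<le> scaled_cnt x + \<kappa>"
      using approx by blast
    obtain x0 where x0: "x0 > 0" "\<And>x. x0 \<le> x \<Longrightarrow> \<exists>w. set w \<subseteq> {1..N} \<and> x \<le> 1 / word_ratio r w \<and> 1 / word_ratio r w \<le> \<eta> * x"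
      using words_dense[OF nl eta] by blast
    let ?W = "{w. set w \<subseteq> {1..N} \<and> 1 / word_ratio r w \<le> \<eta> * (x0 / rmin)}"
    show "\<exists>x0>0. \<exists>W. finite W \<and> (\<forall>w\<in>W. set w \<subseteq> {1..N}) \<and>
        (\<forall>\<rho>\<in>{x0..x0 / rmin}. \<exists>w\<in>W. \<forall>\<epsilon>>0. scaled_cnt (\<epsilon> / word_ratio r w) - \<kappa> \<le> scaled_cnt (\<epsilon> * \<rho>))"
    proof (rule exI[of _ x0], intro conjI exI[of _ ?W] finite_words_ratio x0(1) ballI)
      fix \<rho> assume rho: "\<rho> \<in> {x0..x0 / rmin}"
      then obtain w where w: "set w \<subseteq> {1..N}" "\<rho> \<le> 1 / word_ratio r w" "1 / word_ratio r w \<le> \<eta> * \<rho>" using x0(2)[of \<rho>] by auto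
      have rpos: "\<rho> > 0" using rho x0 by simp
      show "\<exists>w\<in>?W. \<forall>\<epsilon>>0. scaled_cnt (\<epsilon> / word_ratio r w) - \<kappa> \<le> scaled_cnt (\<epsilon> * \<rho>)"
      proof (intro bexI[of _ w] allI impI)
        have "\<eta> * \<rho> \<le> \<eta> * (x0 / rmin)" using rho eta by (intro mult_left_mono) auto
        then show "w \<in> ?W" using w by auto
        fix \<epsilon> :: real assume e: "\<epsilon> > 0"
        define l where "l = 1 / word_ratio r w / \<rho>"
        have "1 \<le> l" "l \<le> \<eta>"
          using w(2,3) rpos unfolding l_def by (simp_all only: pos_le_divide_eq pos_divide_le_eq mult_1)
        then have "scaled_cnt (l * (\<epsilon> * \<rho>)) \<le> scaled_cnt (\<epsilon> * \<rho>) + \<kappa>" using e rpos by (intro ap) auto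
        moreover have "l * (\<epsilon> * \<rho>) = \<epsilon> / word_ratio r w" using rpos by (simp add: l_def)
        ultimately show "scaled_cnt (\<epsilon> / word_ratio r w) - \<kappa> \<le> scaled_cnt (\<epsilon> * \<rho>)" by simp
      qed
    qed auto
  qed
  have lower: "\<forall>\<^sub>F \<epsilon> in at_right 0. - scaled_cnt \<epsilon> \<le> (- source_mass) / entropy + \<kappa>0" if "\<kappa>0 > 0" for \<kappa>0
  proof (rule renewal_upper[where z = "\<lambda>\<epsilon>. - scaled_q \<epsilon>", OF _ _ _ _ _ _ that])
    show "locally_bounded_fun (\<lambda>\<epsilon>. - scaled_cnt \<epsilon>)" using locally_bounded_fun_cmult[OF scaled_cnt_lb, of "-1"] by simp
    show "\<bar>- scaled_cnt \<epsilon>\<bar> \<le> B" if "\<epsilon> > 0" for \<epsilon> using B[OF that] scaled_cnt_nonneg[of \<epsilon>] by simp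
    show "((\<lambda>\<epsilon>. - scaled_q \<epsilon>) \<longlongrightarrow> 0) (at_right 0)" using tendsto_minus[OF scaled_q_limit] by simp
    show "- scaled_cnt \<epsilon> = (\<Sum>i=1..N. r i powr \<delta> * - scaled_cnt (\<epsilon> / r i)) + - scaled_q \<epsilon>" if "\<epsilon> > 0" for \<epsilon>
      using scaled_cnt_rec[OF that] by (simp add: sum_negf)
    have "log_integral (\<lambda>\<epsilon>. - scaled_cnt \<epsilon>) a b = - log_integral scaled_cnt a b" for a b
      using log_integral_cmult[of "-1" scaled_cnt a b] by simp
    then show "((\<lambda>\<epsilon>. \<Sum>i=1..N. r i powr \<delta> * log_integral (\<lambda>\<epsilon>. - scaled_cnt \<epsilon>) \<epsilon> (\<epsilon> / r i)) \<longlongrightarrow> - source_mass) (at_right 0)"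
      using tendsto_minus[OF increment_limit] by (simp add: sum_negf)
    fix \<kappa> :: real assume "\<kappa> > 0"
    then obtain \<eta> where eta: "\<eta> > 1" and ap: "\<And>x l. 0 < x \<Longrightarrow> 1 \<le> l \<Longrightarrow> l \<le> \<eta> \<Longrightarrow> scaled_cnt (l * x) \<le> scaled_cnt x + \<kappa>"
      using approx by blast
    obtain x0 where x0: "x0 > 0" "\<And>x. x0 \<le> x \<Longrightarrow> \<exists>w. set w \<subseteq> {1..N} \<and> x \<le> 1 / word_ratio r w \<and> 1 / word_ratio r w \<le> \<eta> * x"
      using words_dense[OF nl eta] by blast
    \<comment> \<open>Raised by the factor \<eta> so that \<open>\<rho> / \<eta>\<close> is still at
      least x0; density then yields an inverse ratio between \<open>\<rho> / \<eta>\<close> and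
      \<rho>.\<close>
    let ?x = "\<eta> * x0"
    let ?W = "{w. set w \<subseteq> {1..N} \<and> 1 / word_ratio r w \<le> ?x / rmin}"
    have xpos: "?x > 0" using x0 eta by simp
    show "\<exists>x0>0. \<exists>W. finite W \<and> (\<forall>w\<in>W. set w \<subseteq> {1..N}) \<and>
        (\<forall>\<rho>\<in>{x0..x0 / rmin}. \<exists>w\<in>W. \<forall>\<epsilon>>0. - scaled_cnt (\<epsilon> / word_ratio r w) - \<kappa> \<le> - scaled_cnt (\<epsilon> * \<rho>))"
    proof (rule exI[of _ ?x], intro conjI exI[of _ ?W] finite_words_ratio xpos ballI)
      fix \<rho> assume rho: "\<rho> \<in> {?x..?x / rmin}"
      have "x0 \<le> \<rho> / \<eta>" using rho eta by (simp add: pos_le_divide_eq mult.commute)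
      then obtain w where w: "set w \<subseteq> {1..N}" "\<rho> / \<eta> \<le> 1 / word_ratio r w" "1 / word_ratio r w \<le> \<eta> * (\<rho> / \<eta>)" using x0(2)[of "\<rho> / \<eta>"] by auto
      have w3: "1 / word_ratio r w \<le> \<rho>" using w(3) eta by simp
      have rpos: "\<rho> > 0" using rho xpos by simp
      note wpos = word_ratio_pos[OF w(1)]
      show "\<exists>w\<in>?W. \<forall>\<epsilon>>0. - scaled_cnt (\<epsilon> / word_ratio r w) - \<kappa> \<le> - scaled_cnt (\<epsilon> * \<rho>)"
      proof (intro bexI[of _ w] allI impI)
        show "w \<in> ?W" using w(1) w3 rho by auto
        fix \<epsilon> :: real assume e: "\<epsilon> > 0"
        define l where "l = \<rho> * word_ratio r w"
        have "1 \<le> l" using w3 wpos unfolding l_def by (simp add: pos_divide_le_eq)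
        moreover have "l \<le> \<eta>" using w(2) wpos eta unfolding l_def by (simp add: field_simps)
        ultimately have "scaled_cnt (l * (\<epsilon> / word_ratio r w)) \<le> scaled_cnt (\<epsilon> / word_ratio r w) + \<kappa>" using e wpos by (intro ap) auto
        moreover have "l * (\<epsilon> / word_ratio r w) = \<epsilon> * \<rho>" using wpos by (simp add: l_def)
        ultimately show "- scaled_cnt (\<epsilon> / word_ratio r w) - \<kappa> \<le> - scaled_cnt (\<epsilon> * \<rho>)" by simp
      qed
    qed auto
  qed
  show ?thesis
  proof (rule tendstoI)
    fix e :: real assume "e > 0"
    then have "e / 2 > 0" by simp
    from upper[OF this] lower[OF this] show "\<forall>\<^sub>F \<epsilon> in at_right 0. dist (scaled_cnt \<epsilon>) (source_mass / entropy) < e"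
    proof eventually_elim
      case (elim \<epsilon>)
      then show ?case using \<open>e > 0\<close> unfolding dist_real_def minus_divide_left[symmetric] by linarith
    qed
  qed
qed

end


section \<open>Limits and logarithmic average limits\<close>

text \<open>The Boolean selects between the logarithmic average of \<open>f\<close> over \<open>[T, 1]\<close> and the plain value \<open>f T\<close>, so that both parts of
  the theorem are treated at once.\<close>

definition mode_value :: "bool \<Rightarrow> (real \<Rightarrow> real) \<Rightarrow> real \<Rightarrow> real" where
  "mode_value avg f T = (if avg then log_integral f T 1 / \<bar>ln T\<bar> else f T)"

definition mode_limit :: "bool \<Rightarrow> (real \<Rightarrow> real) \<Rightarrow> real \<Rightarrow> bool" where
  "mode_limit avg f L \<longleftrightarrow> (mode_value avg f \<longlongrightarrow> L) (at_right 0)"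

lemma eventually_unit_interval: "\<forall>\<^sub>F T in at_right (0::real). 0 < T \<and> T < 1"
  using eventually_at_right_real[of "0::real" 1] by simp

lemma abs_log_integral_le:
  assumes "locally_bounded_fun f" "0 < a" "a \<le> b" "\<And>x. a \<le> x \<Longrightarrow> x \<le> b \<Longrightarrow> \<bar>f x\<bar> \<le> B"
  shows "\<bar>log_integral f a b\<bar> \<le> B * ln (b / a)"
proof -
  have bd: "- B \<le> f x" "f x \<le> B" if "a \<le> x" "x \<le> b" for x
    using assms(4)[OF that] by linarith+
  have "log_integral f a b \<le> log_integral (\<lambda>_. B) a b" "log_integral (\<lambda>_. - B) a b \<le> log_integral f a b"
    by (intro log_integral_mono assms bd locally_bounded_fun_const; assumption)+
  then show ?thesis unfolding log_integral_const[OF assms(2,3)] by linarith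
qed

lemma mode_limit_add:
  assumes "locally_bounded_fun f" "locally_bounded_fun g" "mode_limit avg f L" "mode_limit avg g M"
  shows "mode_limit avg (\<lambda>x. f x + g x) (L + M)"
  unfolding mode_limit_def
proof (rule Lim_transform_eventually[OF tendsto_add[OF assms(3,4)[unfolded mode_limit_def]]])
  show "\<forall>\<^sub>F T in at_right 0. mode_value avg f T + mode_value avg g T = mode_value avg (\<lambda>x. f x + g x) T"
    using eventually_unit_interval
    by eventually_elim (use assms(1,2) in \<open>simp add: mode_value_def log_integral_add add_divide_distrib\<close>)
qed

lemma mode_limit_cmult:
  assumes "mode_limit avg f L" shows "mode_limit avg (\<lambda>x. c * f x) (c * L)"
proof -
  have "mode_value avg (\<lambda>x. c * f x) = (\<lambda>T. c * mode_value avg f T)"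
    by (auto simp: mode_value_def log_integral_cmult)
  then show ?thesis using assms unfolding mode_limit_def by (auto intro!: tendsto_mult_left)
qed

lemma mode_limit_const_0: "mode_limit avg (\<lambda>x. 0) 0"
proof -
  have "mode_value avg (\<lambda>x. 0) = (\<lambda>T. 0)" by (auto simp: mode_value_def log_integral_def)
  then show ?thesis by (simp add: mode_limit_def)
qed

lemma mode_limit_sum:
  assumes "finite I" "\<And>i. i \<in> I \<Longrightarrow> locally_bounded_fun (f i)" "\<And>i. i \<in> I \<Longrightarrow> mode_limit avg (f i) (L i)"
  shows "mode_limit avg (\<lambda>x. \<Sum>i\<in>I. f i x) (\<Sum>i\<in>I. L i)"
  using assms
  by (induction I rule: finite_induct)
     (auto intro!: mode_limit_add locally_bounded_fun_sum simp: mode_limit_const_0)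

lemma mode_limit_powr:
  assumes "d > 0" shows "mode_limit avg (\<lambda>x. x powr d) 0"
proof (cases avg)
  case True
  have "((\<lambda>T. (1 - T powr d) / d / \<bar>ln T\<bar>) \<longlongrightarrow> 0) (at_right 0)" using assms by real_asymp
  then have "(mode_value True (\<lambda>x. x powr d) \<longlongrightarrow> 0) (at_right 0)"
    by (rule Lim_transform_eventually)
       (use eventually_unit_interval in eventually_elim, use assms in \<open>simp add: mode_value_def log_integral_powr\<close>)
  then show ?thesis using True by (simp add: mode_limit_def)
next
  case False
  have "((\<lambda>T. T powr d) \<longlongrightarrow> 0) (at_right 0)" using assms by real_asymp
  then show ?thesis using False by (simp add: mode_limit_def mode_value_def[abs_def])
qed

lemma mode_value_mono:
  assumes "locally_bounded_fun f" "locally_bounded_fun g" "0 < T" "T < 1" "\<And>x. 0 < x \<Longrightarrow> x \<le> 1 \<Longrightarrow> f x \<le> g x"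
  shows "mode_value avg f T \<le> mode_value avg g T"
proof (cases avg)
  case True
  have "log_integral f T 1 \<le> log_integral g T 1" using assms by (intro log_integral_mono) auto
  then show ?thesis using True by (simp add: mode_value_def divide_right_mono)
qed (use assms in \<open>simp add: mode_value_def\<close>)

text \<open>Comparison functions whose limits lie within \<eta> of L suffice for each \<eta>; they
  need not share a limit. Only scales in (0, 1] are compared, since \<open>mode_value\<close> at T <
  1 sees no others.\<close>

lemma mode_limit_squeeze:
  assumes f: "locally_bounded_fun f"
    and sq: "\<And>\<eta>. \<eta> > 0 \<Longrightarrow> \<exists>f1 f2 L1 L2. locally_bounded_fun f1 \<and> locally_bounded_fun f2 \<and>
      mode_limit avg f1 L1 \<and> mode_limit avg f2 L2 \<and> (\<forall>x. 0 < x \<longrightarrow> x \<le> 1 \<longrightarrow> f1 x \<le> f x \<and> f x \<le> f2 x) \<and>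
      L - \<eta> \<le> L1 \<and> L2 \<le> L + \<eta>"
  shows "mode_limit avg f L"
  unfolding mode_limit_def
proof (rule tendstoI)
  fix e :: real assume "e > 0"
  then have "e / 2 > 0" by simp
  from sq[OF this] obtain f1 f2 L1 L2 where lb: "locally_bounded_fun f1" "locally_bounded_fun f2"
    and lim: "mode_limit avg f1 L1" "mode_limit avg f2 L2"
    and le: "\<And>x. 0 < x \<Longrightarrow> x \<le> 1 \<Longrightarrow> f1 x \<le> f x" "\<And>x. 0 < x \<Longrightarrow> x \<le> 1 \<Longrightarrow> f x \<le> f2 x"
    and L: "L - e / 2 \<le> L1" "L2 \<le> L + e / 2" by blast
  have "\<forall>\<^sub>F T in at_right 0. L1 - e / 2 < mode_value avg f1 T"
    using lim(1) \<open>e > 0\<close> unfolding mode_limit_def by (intro order_tendstoD) auto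
  moreover have "\<forall>\<^sub>F T in at_right 0. mode_value avg f2 T < L2 + e / 2"
    using lim(2) \<open>e > 0\<close> unfolding mode_limit_def by (intro order_tendstoD) auto
  ultimately show "\<forall>\<^sub>F T in at_right 0. dist (mode_value avg f T) L < e"
    using eventually_unit_interval
  proof eventually_elim
    case (elim T)
    then have "mode_value avg f1 T \<le> mode_value avg f T" "mode_value avg f T \<le> mode_value avg f2 T"
      using lb f le by (auto intro!: mode_value_mono)
    then show ?case using elim L unfolding dist_real_def by linarith
  qed
qed

text \<open>For the average, dilation shifts both ends of the window by the factor c. This changes
  the integral by a bounded amount, which the division by \<open>\<bar>ln T\<bar>\<close>
  removes.\<close>

lemma mode_limit_scale:
  assumes f: "locally_bounded_fun f" and lim: "mode_limit avg f L" and c: "c > 0"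
  shows "mode_limit avg (\<lambda>x. f (x / c)) L"
proof (cases avg)
  case False
  have "filterlim (\<lambda>x. x * (1 / c)) (at_right 0) (at_right 0)" using c by (intro filterlim_mult_at_right_0) simp
  from filterlim_compose[OF _ this, of f "nhds L"] lim False show ?thesis
    by (simp add: mode_limit_def mode_value_def[abs_def])
next
  case True
  \<comment> \<open>A common upper limit for both integrals, so that their difference near T is an
    integral over the short window between T and \<open>T / c\<close>.\<close>
  define E where "E = max 1 (1 / c)"
  obtain B where B: "\<And>x. 0 < x \<Longrightarrow> x \<le> E \<Longrightarrow> \<bar>f x\<bar> \<le> B" "0 \<le> B" using locally_bounded_fun_bound[OF f] by metis
  define K where "K = \<bar>log_integral f 1 E\<bar> + \<bar>log_integral f (1 / c) E\<bar> + B * \<bar>ln c\<bar>"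
  have shift: "\<bar>log_integral f x E - log_integral f y E\<bar> \<le> B * ln (y / x)" if "0 < x" "x \<le> y" "y \<le> E" for x y
  proof -
    have "log_integral f x E - log_integral f y E = log_integral f x y"
      using log_integral_concat[OF f that] by simp
    then show ?thesis using abs_log_integral_le[OF f that(1,2), of B] B(1) that by simp
  qed
  have diff: "\<bar>log_integral (\<lambda>x. f (x / c)) T 1 - log_integral f T 1\<bar> \<le> K" if T: "0 < T" "T < 1" for T
  proof -
    have 1: "log_integral f T E = log_integral f T 1 + log_integral f 1 E"
      using T by (intro log_integral_concat f) (auto simp: E_def)
    have 2: "log_integral f (T / c) E = log_integral f (T / c) (1 / c) + log_integral f (1 / c) E"
      using T c by (intro log_integral_concat f) (auto simp: E_def divide_right_mono)
    have 3: "\<bar>log_integral f T E - log_integral f (T / c) E\<bar> \<le> B * \<bar>ln c\<bar>"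
    proof (cases "1 \<le> c")
      case True
      have "T / c \<le> T" using True T by (simp add: pos_divide_le_eq)
      then have "\<bar>log_integral f (T / c) E - log_integral f T E\<bar> \<le> B * ln (T / (T / c))"
        using T c by (intro shift) (auto simp: E_def)
      also have "T / (T / c) = c" using T by simp
      finally show ?thesis using True by (simp add: abs_minus_commute)
    next
      case False
      have "T \<le> T / c" using False T c by (simp add: pos_le_divide_eq)
      moreover have "T / c \<le> E" using T c by (simp add: E_def divide_right_mono le_max_iff_disj)
      ultimately have "\<bar>log_integral f T E - log_integral f (T / c) E\<bar> \<le> B * ln (T / c / T)"
        using T c by (intro shift) auto
      also have "T / c / T = 1 / c" using T by simp
      finally show ?thesis using False c by (simp add: ln_div)
    qed
    have "log_integral (\<lambda>x. f (x / c)) T 1 = log_integral f (T / c) (1 / c)" using c by (rule log_integral_scale)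
    then show ?thesis using 1 2 3 unfolding K_def by linarith
  qed
  have "((\<lambda>T. K / ln (1 / T)) \<longlongrightarrow> 0) (at_right 0)" by real_asymp
  then have "((\<lambda>T. mode_value avg (\<lambda>x. f (x / c)) T - mode_value avg f T) \<longlongrightarrow> 0) (at_right 0)"
  proof (rule Lim_null_comparison[rotated])
    show "\<forall>\<^sub>F T in at_right 0. norm (mode_value avg (\<lambda>x. f (x / c)) T - mode_value avg f T) \<le> K / ln (1 / T)"
      using eventually_unit_interval
    proof eventually_elim
      case (elim T)
      then have "\<bar>ln T\<bar> = ln (1 / T)" by (simp add: ln_div)
      then have "norm (mode_value avg (\<lambda>x. f (x / c)) T - mode_value avg f T) =
          \<bar>log_integral (\<lambda>x. f (x / c)) T 1 - log_integral f T 1\<bar> / \<bar>ln T\<bar>"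
        using True by (simp add: mode_value_def diff_divide_distrib[symmetric])
      also have "\<dots> \<le> K / \<bar>ln T\<bar>" using diff elim by (intro divide_right_mono) auto
      finally show ?case using \<open>\<bar>ln T\<bar> = ln (1 / T)\<close> by simp
    qed
  qed
  from tendsto_add[OF this lim[unfolded mode_limit_def]] show ?thesis
    by (simp add: mode_limit_def)
qed

section \<open>Averages over smaller scales with a power weight\<close>

lemma nn_integral_powr_from_0:
  assumes "-1 < a" "0 \<le> c"
  shows "(\<integral>\<^sup>+x. ennreal (x powr a) * indicator {0..c} x \<partial>lborel) = ennreal (c powr (a + 1) / (a + 1))"
  by (rule nn_integral_has_integral_lebesgue') (use assms in \<open>auto intro: has_integral_powr_from_0\<close>)

text \<open>If a density in the distance t is \<open>t powr (- d)\<close> times f(t), its integral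
  up to x is \<open>x powr (1 - d)\<close> times the average of \<open>f (x * u)\<close> under this
  weight.\<close>

definition mellin_weight :: "real \<Rightarrow> real \<Rightarrow> real" where
  "mellin_weight d u = indicator {0..1} u * u powr (- d)"

lemma mellin_weight_measurable [measurable]: "mellin_weight d \<in> borel_measurable borel"
  unfolding mellin_weight_def[abs_def] by measurable

lemma mellin_weight_nonneg: "0 \<le> mellin_weight d u" by (simp add: mellin_weight_def)

lemma nn_integral_mellin_weight:
  assumes "d < 1" shows "(\<integral>\<^sup>+u. ennreal (mellin_weight d u) \<partial>lborel) = ennreal (1 / (1 - d))"
proof -
  have "(\<integral>\<^sup>+u. ennreal (mellin_weight d u) \<partial>lborel) = (\<integral>\<^sup>+x. ennreal (x powr (- d)) * indicator {0..1} x \<partial>lborel)"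
    by (intro nn_integral_cong) (auto simp: mellin_weight_def indicator_def)
  then show ?thesis using nn_integral_powr_from_0[of "- d" 1] assms by simp
qed

lemma integrable_mellin_weight:
  assumes "d < 1" shows "integrable lborel (mellin_weight d)"
  by (rule integrableI_nonneg) (use nn_integral_mellin_weight[OF assms] in \<open>auto simp: mellin_weight_nonneg\<close>)

lemma integral_mellin_weight:
  assumes "d < 1" shows "(\<integral>u. mellin_weight d u \<partial>lborel) = 1 / (1 - d)"
  by (rule integral_eq_nn_integral[THEN trans])
     (use nn_integral_mellin_weight[OF assms] assms in \<open>auto simp: mellin_weight_nonneg\<close>)

definition mellin_average :: "real \<Rightarrow> (real \<Rightarrow> real) \<Rightarrow> real \<Rightarrow> real" where
  "mellin_average d f x = (\<integral>u. mellin_weight d u * f (x * u) \<partial>lborel)"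

lemma mellin_integrand_integrable:
  assumes f: "f \<in> borel_measurable borel" "\<And>x. 0 < x \<Longrightarrow> \<bar>f x\<bar> \<le> B" and d: "d < 1" and "0 < x"
  shows "integrable lborel (\<lambda>u. mellin_weight d u * f (x * u))"
proof (rule Bochner_Integration.integrable_bound)
  show "integrable lborel (\<lambda>u. mellin_weight d u * B)" using integrable_mellin_weight[OF d] by simp
  show "(\<lambda>u. mellin_weight d u * f (x * u)) \<in> borel_measurable lborel" using f(1) by measurable
  show "AE u in lborel. norm (mellin_weight d u * f (x * u)) \<le> norm (mellin_weight d u * B)"
  proof (rule AE_I2)
    fix u show "norm (mellin_weight d u * f (x * u)) \<le> norm (mellin_weight d u * B)"
    proof (cases "u > 0")
      case True
      then have "\<bar>f (x * u)\<bar> \<le> \<bar>B\<bar>" using f(2)[of "x * u"] \<open>0 < x\<close> by simp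
      then show ?thesis by (simp add: abs_mult mult_left_mono)
    qed (auto simp: mellin_weight_def indicator_def)
  qed
qed

lemma mellin_average_bounded:
  assumes f: "f \<in> borel_measurable borel" "\<And>x. 0 < x \<Longrightarrow> \<bar>f x\<bar> \<le> B" and d: "d < 1" and "0 < x"
  shows "\<bar>mellin_average d f x\<bar> \<le> B / (1 - d)"
proof -
  have "\<bar>mellin_average d f x\<bar> \<le> (\<integral>u. norm (mellin_weight d u * f (x * u)) \<partial>lborel)"
    unfolding mellin_average_def using integral_norm_bound[of lborel "\<lambda>u. mellin_weight d u * f (x * u)"] by simp
  also have "\<dots> \<le> (\<integral>u. mellin_weight d u * B \<partial>lborel)"
  proof (rule integral_mono)
    show "integrable lborel (\<lambda>u. norm (mellin_weight d u * f (x * u)))"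
      using mellin_integrand_integrable[OF assms] by (rule integrable_norm)
    show "integrable lborel (\<lambda>u. mellin_weight d u * B)" using integrable_mellin_weight[OF d] by simp
    fix u show "norm (mellin_weight d u * f (x * u)) \<le> mellin_weight d u * B"
    proof (cases "u > 0")
      case True
      then have "\<bar>f (x * u)\<bar> \<le> B" using f(2)[of "x * u"] \<open>0 < x\<close> by simp
      then show ?thesis using mellin_weight_nonneg[of d u] by (simp add: abs_mult mult_left_mono)
    qed (auto simp: mellin_weight_def indicator_def)
  qed
  also have "\<dots> = B / (1 - d)" using integral_mellin_weight[OF d] by simp
  finally show ?thesis .
qed

lemma mellin_average_measurable:
  assumes [measurable]: "f \<in> borel_measurable borel" shows "mellin_average d f \<in> borel_measurable borel"
  unfolding mellin_average_def[abs_def] by measurable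

text \<open>Fubini: logarithmic averaging in x commutes with averaging over the dilations u. The
  bound on f and the lower limit T > 0 give an integrable majorant.\<close>

lemma mode_value_mellin:
  assumes f: "f \<in> borel_measurable borel" "\<And>x. 0 < x \<Longrightarrow> \<bar>f x\<bar> \<le> B" and d: "d < 1" and T: "0 < T" "T < 1"
  shows "mode_value avg (mellin_average d f) T = (\<integral>u. mellin_weight d u * mode_value avg (\<lambda>x. f (x * u)) T \<partial>lborel)"
proof (cases avg)
  case True
  note [measurable] = f(1)
  let ?F = "\<lambda>(u, x). indicator {T..1} x * (mellin_weight d u * f (x * u) / x) :: real"
  have B0: "0 \<le> B" using f(2)[of 1] by simp
  have bd: "norm (?F (u, x)) \<le> mellin_weight d u * (indicator {T..1} x * (B / x))" for u x
  proof (cases "u > 0 \<and> T \<le> x \<and> x \<le> 1")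
    case A: True
    then have "\<bar>f (x * u)\<bar> \<le> B" using f(2)[of "x * u"] T by simp
    then have "mellin_weight d u * (\<bar>f (x * u)\<bar> / x) \<le> mellin_weight d u * (B / x)"
      using A T by (intro mult_left_mono divide_right_mono mellin_weight_nonneg) auto
    then show ?thesis using A T mellin_weight_nonneg[of d u] by (simp add: abs_mult)
  qed (auto simp: mellin_weight_def indicator_def)
  have intx: "integrable lborel (\<lambda>x. indicator {T..1} x * (B / x))"
    using integrable_log_integral[OF locally_bounded_fun_const T(1), of 1 B] .
  have int_F: "integrable (lborel \<Otimes>\<^sub>M lborel) ?F"
  proof (rule lborel_pair.Fubini_integrable)
    show "?F \<in> borel_measurable (lborel \<Otimes>\<^sub>M lborel)" by measurable
    have row: "integrable lborel (\<lambda>x. ?F (u, x))" for u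
    proof (rule Bochner_Integration.integrable_bound[OF integrable_mult_right[OF intx, of "mellin_weight d u"]])
      show "(\<lambda>x. ?F (u, x)) \<in> borel_measurable lborel" by simp measurable
      show "AE x in lborel. norm (?F (u, x)) \<le> norm (mellin_weight d u * (indicator {T..1} x * (B / x)))"
        unfolding real_norm_def by (intro AE_I2 order_trans[OF bd[unfolded real_norm_def] abs_ge_self])
    qed
    then show "AE u in lborel. integrable lborel (\<lambda>x. ?F (u, x))" by simp
    show "integrable lborel (\<lambda>u. \<integral>x. norm (?F (u, x)) \<partial>lborel)"
    proof (rule Bochner_Integration.integrable_bound)
      show "integrable lborel (\<lambda>u. mellin_weight d u * (\<integral>x. indicator {T..1} x * (B / x) \<partial>lborel))"
        using integrable_mellin_weight[OF d] by simp
      show "(\<lambda>u. \<integral>x. norm (?F (u, x)) \<partial>lborel) \<in> borel_measurable lborel" by simp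
      show "AE u in lborel. norm (\<integral>x. norm (?F (u, x)) \<partial>lborel) \<le>
          norm (mellin_weight d u * (\<integral>x. indicator {T..1} x * (B / x) \<partial>lborel))"
      proof (rule AE_I2)
        fix u
        have "(\<integral>x. norm (?F (u, x)) \<partial>lborel) \<le> (\<integral>x. mellin_weight d u * (indicator {T..1} x * (B / x)) \<partial>lborel)"
          by (intro integral_mono integrable_norm row integrable_mult_right intx bd)
        also have "\<dots> = mellin_weight d u * (\<integral>x. indicator {T..1} x * (B / x) \<partial>lborel)"
          by (rule integral_mult_right_zero)
        finally show "norm (\<integral>x. norm (?F (u, x)) \<partial>lborel) \<le>
          norm (mellin_weight d u * (\<integral>x. indicator {T..1} x * (B / x) \<partial>lborel))" by simp
      qed
    qed
  qed
  have "log_integral (mellin_average d f) T 1 = (\<integral>x. (\<integral>u. ?F (u, x) \<partial>lborel) \<partial>lborel)"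
    unfolding log_integral_def mellin_average_def
    by (intro Bochner_Integration.integral_cong) (auto simp flip: integral_mult_right_zero integral_divide_zero)
  also have "\<dots> = (\<integral>u. (\<integral>x. ?F (u, x) \<partial>lborel) \<partial>lborel)"
    using lborel_pair.Fubini_integral[of "\<lambda>u x. ?F (u, x)"] int_F by simp
  also have "\<dots> = (\<integral>u. mellin_weight d u * log_integral (\<lambda>x. f (x * u)) T 1 \<partial>lborel)"
    unfolding log_integral_def
    by (intro Bochner_Integration.integral_cong refl, subst integral_mult_right_zero[symmetric])
       (auto intro!: Bochner_Integration.integral_cong)
  finally show ?thesis using True by (simp add: mode_value_def)
qed (simp add: mode_value_def mellin_average_def)

text \<open>By \<open>mode_limit_scale\<close> every dilate of f has the same limit L, so dominated
  convergence gives L times the mass \<open>1 / (1 - d)\<close> of the weight. The limit is tested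
  along sequences, as dominated convergence requires.\<close>

lemma mode_limit_mellin:
  assumes f: "f \<in> borel_measurable borel" "\<And>x. 0 < x \<Longrightarrow> \<bar>f x\<bar> \<le> B" and d: "d < 1" and lim: "mode_limit avg f L"
  shows "mode_limit avg (mellin_average d f) (L / (1 - d))"
  unfolding mode_limit_def
proof (rule tendsto_at_right_sequentially[of 0 1])
  fix S :: "nat \<Rightarrow> real" assume S: "\<And>n. 0 < S n" "\<And>n. S n < 1" "S \<longlonglongrightarrow> 0"
  note [measurable] = f(1)
  have lb: "locally_bounded_fun f" using f by (intro locally_bounded_funI) blast+
  have S0: "filterlim S (at_right 0) sequentially"
    unfolding filterlim_at using S by (auto simp: less_imp_neq[symmetric])
  have "(\<lambda>n. \<integral>u. mellin_weight d u * mode_value avg (\<lambda>x. f (x * u)) (S n) \<partial>lborel) \<longlonglongrightarrow> (\<integral>u. mellin_weight d u * L \<partial>lborel)"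
  proof (rule integral_dominated_convergence[where w = "\<lambda>u. mellin_weight d u * B"])
    show "(\<lambda>u. mellin_weight d u * mode_value avg (\<lambda>x. f (x * u)) (S n)) \<in> borel_measurable lborel" for n
      unfolding mode_value_def log_integral_def by (cases avg) simp_all
    show "integrable lborel (\<lambda>u. mellin_weight d u * B)" using integrable_mellin_weight[OF d] by simp
    show "AE u in lborel. (\<lambda>n. mellin_weight d u * mode_value avg (\<lambda>x. f (x * u)) (S n)) \<longlonglongrightarrow> mellin_weight d u * L"
    proof (rule AE_I2)
      fix u :: real
      show "(\<lambda>n. mellin_weight d u * mode_value avg (\<lambda>x. f (x * u)) (S n)) \<longlonglongrightarrow> mellin_weight d u * L"
      proof (cases "u > 0")
        case True
        have "mode_limit avg (\<lambda>x. f (x / (1 / u))) L" using True by (intro mode_limit_scale lb lim) simp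
        then have "(mode_value avg (\<lambda>x. f (x * u)) \<longlongrightarrow> L) (at_right 0)" by (simp add: mode_limit_def)
        from filterlim_compose[OF this S0] show ?thesis by (intro tendsto_mult_left)
      qed (auto simp: mellin_weight_def indicator_def)
    qed
    show "AE u in lborel. norm (mellin_weight d u * mode_value avg (\<lambda>x. f (x * u)) (S n)) \<le> mellin_weight d u * B" for n
    proof (rule AE_I2)
      fix u :: real
      show "norm (mellin_weight d u * mode_value avg (\<lambda>x. f (x * u)) (S n)) \<le> mellin_weight d u * B"
      proof (cases "u > 0")
        case True
        have lbu: "locally_bounded_fun (\<lambda>x. f (x * u))" using locally_bounded_fun_scale[OF lb, of "1 / u"] True by simp
        have bu: "\<bar>f (x * u)\<bar> \<le> B" if "x > 0" for x using f(2) True that by simp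
        have "\<bar>mode_value avg (\<lambda>x. f (x * u)) (S n)\<bar> \<le> B"
        proof (cases avg)
          case A: True
          have "\<bar>log_integral (\<lambda>x. f (x * u)) (S n) 1\<bar> \<le> B * ln (1 / S n)"
            using S(1,2)[of n] bu by (intro abs_log_integral_le lbu) auto
          moreover have "ln (1 / S n) = \<bar>ln (S n)\<bar>" "\<bar>ln (S n)\<bar> > 0" using S(1,2)[of n] by (auto simp: ln_div)
          ultimately show ?thesis using A by (simp add: mode_value_def pos_divide_le_eq)
        qed (use bu S in \<open>simp add: mode_value_def\<close>)
        then show ?thesis using mellin_weight_nonneg[of d u] by (simp add: abs_mult mult_left_mono)
      qed (auto simp: mellin_weight_def indicator_def)
    qed
  qed simp
  moreover have "(\<integral>u. mellin_weight d u * L \<partial>lborel) = L / (1 - d)" using integral_mellin_weight[OF d] by simp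
  ultimately show "(\<lambda>n. mode_value avg (mellin_average d f) (S n)) \<longlonglongrightarrow> L / (1 - d)"
    using mode_value_mellin[OF f d S(1,2)] by simp
qed simp


section \<open>Gaps of self-similar sets\<close>

text \<open>Every gap occurs twice, once in each direction; this makes orientation-reversing maps harmless.\<close>

definition directed_gaps :: "real set \<Rightarrow> (real \<times> real) set" where
  "directed_gaps Y = {(a, b). a \<in> Y \<and> b \<in> Y \<and> a \<noteq> b \<and> (\<forall>y\<in>Y. \<not> (min a b < y \<and> y < max a b))}"

definition gap_length :: "real \<times> real \<Rightarrow> real" where
  "gap_length p = \<bar>snd p - fst p\<bar>"

definition long_gaps :: "real set \<Rightarrow> real \<Rightarrow> (real \<times> real) set" where
  "long_gaps Y t = {p \<in> directed_gaps Y. 2 * t < gap_length p}"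

definition gap_dir :: "real \<times> real \<Rightarrow> real \<times> real" where
  "gap_dir p = (fst p, sgn (snd p - fst p))"

lemma directed_gapsD:
  assumes "(a, b) \<in> directed_gaps Y"
  shows "a \<in> Y" "b \<in> Y" "a \<noteq> b" "y \<in> Y \<Longrightarrow> min a b < y \<Longrightarrow> y < max a b \<Longrightarrow> False"
  using assms by (auto simp: directed_gaps_def)

lemma directed_gaps_swap: "(a, b) \<in> directed_gaps Y \<Longrightarrow> (b, a) \<in> directed_gaps Y"
  by (auto simp: directed_gaps_def min.commute max.commute)

lemma gap_length_pos: "p \<in> directed_gaps Y \<Longrightarrow> 0 < gap_length p"
  by (auto simp: directed_gaps_def gap_length_def)

text \<open>Of two different gaps on the same side of a common endpoint, the longer one would
  contain the far end of the shorter.\<close>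

lemma inj_gap_dir: "inj_on gap_dir (directed_gaps Y)"
proof (rule inj_onI, clarify)
  fix a b a' b'
  assume p: "(a, b) \<in> directed_gaps Y" "(a', b') \<in> directed_gaps Y" and eq: "gap_dir (a, b) = gap_dir (a', b')"
  have a: "a' = a" "sgn (b - a) = sgn (b' - a)" using eq by (auto simp: gap_dir_def)
  have ne: "b \<noteq> a" "b' \<noteq> a" using p a by (auto simp: directed_gaps_def)
  have "b = b'"
  proof (rule ccontr)
    assume "b \<noteq> b'"
    then have "(min a b' < b \<and> b < max a b') \<or> (min a b < b' \<and> b' < max a b)"
      using a(2) ne by (auto simp: sgn_if min_def max_def split: if_splits)
    then show False using directed_gapsD[OF p(1)] directed_gapsD[OF p(2)] a(1) by blast
  qed
  then show "a = a' \<and> b = b'" using a by simp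
qed

lemma compact_imp_bdd:
  fixes Y :: "real set" assumes "compact Y" shows "bdd_above Y" "bdd_below Y"
  using compact_imp_bounded[OF assms] by (auto intro: bounded_imp_bdd_above bounded_imp_bdd_below)

text \<open>If \<open>Y\<close> has points on the side of the direction, a nearest one exists by
  compactness and closes a gap longer than 2t. If it has none, the base point is an extreme point of
  \<open>Y\<close>.\<close>

lemma boundary_dirs_eq_gaps:
  assumes "compact Y" "Y \<noteq> {}" "t > 0"
  shows "boundary_dirs Y t = insert (Sup Y, 1) (insert (Inf Y, -1) (gap_dir ` long_gaps Y t))"
proof (intro equalityI subsetI)
  note bd = compact_imp_bdd(1,2)[OF assms(1)]
  fix e assume "e \<in> boundary_dirs Y t"
  then obtain a s where e: "e = (a, s)" and a: "a \<in> Y" and s: "s = 1 \<or> s = -1"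
    and no: "\<And>u. 0 < u \<Longrightarrow> u \<le> 2 * t \<Longrightarrow> a + s * u \<notin> Y"
    by (auto simp: boundary_dirs_def)
  have far: "s * (y - a) > 2 * t" if "y \<in> Y" "s * (y - a) > 0" for y
  proof (rule ccontr)
    assume "\<not> s * (y - a) > 2 * t"
    then have "a + s * (s * (y - a)) \<notin> Y" using no[of "s * (y - a)"] that by auto
    moreover have "a + s * (s * (y - a)) = y" using s by auto
    ultimately show False using that by simp
  qed
  show "e \<in> insert (Sup Y, 1) (insert (Inf Y, -1) (gap_dir ` long_gaps Y t))"
  proof (cases "\<exists>y\<in>Y. s * (y - a) > 0")
    case True
    \<comment> \<open>All points on this side are farther than 2t, so the restriction to distance at
      least 2t loses none of them and makes the set compact.\<close>
    define D where "D = Y \<inter> {y. 2 * t \<le> s * (y - a)}"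
    have "closed {y. 2 * t \<le> s * (y - a)}" by (intro closed_Collect_le continuous_intros)
    then have "compact D" unfolding D_def using assms(1) by (rule compact_Int_closed[rotated])
    moreover have "D \<noteq> {}" using True far by (force simp: D_def intro: less_imp_le)
    moreover have "continuous_on D (\<lambda>y. s * (y - a))" by (intro continuous_intros)
    ultimately obtain b where b: "b \<in> D" "\<And>y. y \<in> D \<Longrightarrow> s * (b - a) \<le> s * (y - a)"
      using continuous_attains_inf by metis
    have b': "b \<in> Y" "0 < s * (b - a)" "2 * t < s * (b - a)" using b(1) assms(3) far by (auto simp: D_def)
    have min: "s * (b - a) \<le> s * (y - a)" if "y \<in> Y" "s * (y - a) > 0" for y
      using b(2)[of y] far[OF that] that by (simp add: D_def)
    have "(a, b) \<in> directed_gaps Y"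
      unfolding directed_gaps_def
    proof (clarsimp simp: a b', intro conjI)
      show "a \<noteq> b" using b'(2) by auto
      show "\<forall>y\<in>Y. min a b < y \<longrightarrow> \<not> y < max a b"
      proof (intro ballI impI notI)
        fix y assume y: "y \<in> Y" "min a b < y" "y < max a b"
        then have "0 < s * (y - a)" "s * (y - a) < s * (b - a)" using s b'(2) by auto
        then show False using min[OF y(1)] by simp
      qed
    qed
    moreover have "gap_length (a, b) = s * (b - a)" using s b'(2) by (auto simp: gap_length_def)
    moreover have "gap_dir (a, b) = (a, s)" using s b'(2) by (auto simp: gap_dir_def sgn_if)
    ultimately have "(a, b) \<in> long_gaps Y t" "gap_dir (a, b) = e" using b'(3) e by (auto simp: long_gaps_def)
    then show ?thesis by blast
  next
    case False
    show ?thesis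
    proof (cases "s = 1")
      case True
      then have "a = Sup Y" using False a by (intro cSup_eq_maximum[symmetric]) (auto simp: not_less)
      then show ?thesis using e True by simp
    next
      case F: False
      then have "a = Inf Y" using False a s by (intro cInf_eq_minimum[symmetric]) (auto simp: not_less)
      then show ?thesis using e F s by simp
    qed
  qed
next
  note bd = compact_imp_bdd(1,2)[OF assms(1)]
  have cl: "closed Y" using assms(1) by (rule compact_imp_closed)
  have ext: "(Sup Y, 1) \<in> boundary_dirs Y t" "(Inf Y, -1) \<in> boundary_dirs Y t"
    using closed_contains_Sup[OF assms(2) bd(1) cl] closed_contains_Inf[OF assms(2) bd(2) cl]
    by (auto intro!: boundary_dirsI dest: cSup_upper[OF _ bd(1)] cInf_lower[OF _ bd(2)])
  fix e assume "e \<in> insert (Sup Y, 1) (insert (Inf Y, -1) (gap_dir ` long_gaps Y t))"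
  then consider "e = (Sup Y, 1)" | "e = (Inf Y, -1)" | "e \<in> gap_dir ` long_gaps Y t" by blast
  then show "e \<in> boundary_dirs Y t"
  proof cases
    case 3
    then obtain a b where p: "(a, b) \<in> directed_gaps Y" "2 * t < \<bar>b - a\<bar>" and e: "e = (a, sgn (b - a))"
      by (auto simp: long_gaps_def gap_length_def gap_dir_def)
    show ?thesis unfolding e
    proof (rule boundary_dirsI)
      show "a \<in> Y" using directed_gapsD[OF p(1)] by simp
      show "sgn (b - a) = 1 \<or> sgn (b - a) = -1" using directed_gapsD[OF p(1)] by (auto simp: sgn_if)
      fix u assume u: "0 < u" "u \<le> 2 * t" "a + sgn (b - a) * u \<in> Y"
      have "min a b < a + sgn (b - a) * u \<and> a + sgn (b - a) * u < max a b"
        using u p(2) directed_gapsD(3)[OF p(1)] by (auto simp: sgn_if min_def max_def)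
      then show False using directed_gapsD(4)[OF p(1) u(3)] by auto
    qed
  qed (use ext in auto)
qed

lemma sum_boundary_dirs:
  fixes f :: "real \<times> real \<Rightarrow> 'a::comm_monoid_add"
  assumes "compact Y" "Y \<noteq> {}" "t > 0"
  shows "(\<Sum>e\<in>boundary_dirs Y t. f e) = f (Sup Y, 1) + (f (Inf Y, -1) + (\<Sum>p\<in>long_gaps Y t. f (gap_dir p)))"
    and "finite (long_gaps Y t)"
proof -
  note bd = compact_imp_bdd(1,2)[OF assms(1)]
  have inj: "inj_on gap_dir (long_gaps Y t)" by (rule inj_on_subset[OF inj_gap_dir]) (auto simp: long_gaps_def)
  have "finite (boundary_dirs Y t)" using assms by (intro finite_boundary_dirs compact_imp_bounded)
  then have fin: "finite (gap_dir ` long_gaps Y t)" unfolding boundary_dirs_eq_gaps[OF assms] by simp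
  then show "finite (long_gaps Y t)" using inj finite_imageD by blast
  have "(Sup Y, 1) \<notin> gap_dir ` long_gaps Y t"
  proof
    assume "(Sup Y, 1) \<in> gap_dir ` long_gaps Y t"
    then obtain b where "(Sup Y, b) \<in> directed_gaps Y" "sgn (b - Sup Y) = 1"
      by (auto simp: long_gaps_def gap_dir_def)
    then have "b \<in> Y" "b > Sup Y" by (auto simp: directed_gaps_def sgn_if split: if_splits)
    then show False using cSup_upper[OF _ bd(1), of b] by simp
  qed
  moreover have "(Inf Y, -1) \<notin> gap_dir ` long_gaps Y t"
  proof
    assume "(Inf Y, -1) \<in> gap_dir ` long_gaps Y t"
    then obtain b where "(Inf Y, b) \<in> directed_gaps Y" "sgn (b - Inf Y) = -1"
      by (auto simp: long_gaps_def gap_dir_def)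
    then have "b \<in> Y" "b < Inf Y" by (auto simp: directed_gaps_def sgn_if split: if_splits)
    then show False using cInf_lower[OF _ bd(2), of b] by simp
  qed
  ultimately show "(\<Sum>e\<in>boundary_dirs Y t. f e) = f (Sup Y, 1) + (f (Inf Y, -1) + (\<Sum>p\<in>long_gaps Y t. f (gap_dir p)))"
    unfolding boundary_dirs_eq_gaps[OF assms] using fin inj by (simp add: sum.reindex o_def)
qed

text \<open>Strict monotonicity of a continuous injection of an interval, phrased with
  \<open>min\<close> and \<open>max\<close> so that increasing and decreasing maps need no
  distinction.\<close>

lemma strict_between_image:
  fixes g :: "real \<Rightarrow> real"
  assumes cont: "continuous_on {A..B} g" and inj: "inj_on g {A..B}" and ab: "a \<in> {A..B}" "b \<in> {A..B}"
    and x: "min a b < x" "x < max a b"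
  shows "min (g a) (g b) < g x \<and> g x < max (g a) (g b)"
proof -
  have "{min a b..max a b} \<subseteq> {A..B}" using ab by auto
  then have "continuous_on {min a b..max a b} g" "inj_on g {min a b..max a b}"
    using cont inj continuous_on_subset inj_on_subset by blast+
  from continuous_inj_imp_mono[OF x this]
  have "(g (min a b) < g x \<and> g x < g (max a b)) \<or> (g (max a b) < g x \<and> g x < g (min a b))" .
  then show ?thesis by (cases "a \<le> b") (auto simp: min_def max_def)
qed

text \<open>Being a gap depends on betweenness alone, which g respects. To see that gaps go to gaps:
  of three distinct points one is in the middle; if y is not between a and b, then a or b is the
  middle point, and it stays so under g.\<close>

lemma directed_gaps_image:
  fixes g :: "real \<Rightarrow> real"
  assumes cont: "continuous_on {A..B} g" and inj: "inj_on g {A..B}" and Y: "Y \<subseteq> {A..B}"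
  shows "directed_gaps (g ` Y) = map_prod g g ` directed_gaps Y"
proof (intro equalityI subsetI)
  fix p assume "p \<in> directed_gaps (g ` Y)"
  then obtain a b where p: "p = (g a, g b)" and ab: "a \<in> Y" "b \<in> Y" "g a \<noteq> g b"
    and no: "\<And>y. y \<in> Y \<Longrightarrow> \<not> (min (g a) (g b) < g y \<and> g y < max (g a) (g b))"
    by (auto simp: directed_gaps_def)
  have "(a, b) \<in> directed_gaps Y"
    unfolding directed_gaps_def using ab no strict_between_image[OF cont inj, of a b] Y by blast
  then show "p \<in> map_prod g g ` directed_gaps Y" using p by force
next
  fix p assume "p \<in> map_prod g g ` directed_gaps Y"
  then obtain a b where p: "p = (g a, g b)" and ab: "(a, b) \<in> directed_gaps Y" by auto
  note D = directed_gapsD[OF ab]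
  have AB: "a \<in> {A..B}" "b \<in> {A..B}" using D Y by auto
  have gne: "g a \<noteq> g b" using inj D(3) AB by (auto dest: inj_onD)
  have "\<not> (min (g a) (g b) < g y \<and> g y < max (g a) (g b))" if y: "y \<in> Y" for y
  proof
    assume btw: "min (g a) (g b) < g y \<and> g y < max (g a) (g b)"
    have yAB: "y \<in> {A..B}" using y Y by auto
    have "y \<noteq> a" "y \<noteq> b" using btw by auto
    moreover have "\<not> (min a b < y \<and> y < max a b)" using D(4)[OF y] by blast
    ultimately have "(min y b < a \<and> a < max y b) \<or> (min a y < b \<and> b < max a y)" using D(3) by linarith
    then have "(min (g y) (g b) < g a \<and> g a < max (g y) (g b)) \<or> (min (g a) (g y) < g b \<and> g b < max (g a) (g y))"
      using strict_between_image[OF cont inj] AB yAB by blast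
    then show False using btw by linarith
  qed
  then show "p \<in> directed_gaps (g ` Y)" unfolding p directed_gaps_def using D gne by auto
qed

section \<open>Recursion for the gaps of an attractor of affine maps\<close>

locale affine_ifs =
  fixes N :: nat and r s c :: "nat \<Rightarrow> real" and A B :: real and K :: "real set"
  assumes two_maps': "2 \<le> N" and ratio_pos': "i \<in> {1..N} \<Longrightarrow> 0 < r i" and ratio_less_1': "i \<in> {1..N} \<Longrightarrow> r i < 1"
    and slope: "i \<in> {1..N} \<Longrightarrow> \<bar>s i\<bar> = r i" and A_less_B: "A < B"
    and maps_to: "i \<in> {1..N} \<Longrightarrow> x \<in> {A..B} \<Longrightarrow> s i * x + c i \<in> {A..B}"
    and disjoint_images: "i \<in> {1..N} \<Longrightarrow> j \<in> {1..N} \<Longrightarrow> i \<noteq> j \<Longrightarrow> x \<in> {A<..<B} \<Longrightarrow> y \<in> {A<..<B} \<Longrightarrow>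
      s i * x + c i \<noteq> s j * y + c j"
    and K_sub: "K \<subseteq> {A..B}" and K_ne: "K \<noteq> {}" and K_compact: "compact K"
    and K_eq: "K = (\<Union>i\<in>{1..N}. (\<lambda>x. s i * x + c i) ` K)"
    and K_null: "emeasure lborel K = 0"
begin

definition S :: "nat \<Rightarrow> real \<Rightarrow> real" where "S i x = s i * x + c i"

lemma slope_ne: "i \<in> {1..N} \<Longrightarrow> s i \<noteq> 0" using slope[of i] ratio_pos'[of i] by auto

lemma S_in_K: "i \<in> {1..N} \<Longrightarrow> x \<in> K \<Longrightarrow> S i x \<in> K"
  by (subst K_eq) (auto simp: S_def)

lemma K_cases: assumes "x \<in> K" obtains i y where "i \<in> {1..N}" "y \<in> K" "x = S i y"
  using assms K_eq unfolding S_def by blast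

lemma S_between:
  assumes "i \<in> {1..N}"
  shows "(min (S i a) (S i b) < S i x \<and> S i x < max (S i a) (S i b)) \<longleftrightarrow> (min a b < x \<and> x < max a b)"
proof (cases "s i > 0")
  case True
  then have "mono (S i)" by (intro monoI) (simp add: S_def)
  then have "min (S i a) (S i b) = S i (min a b)" "max (S i a) (S i b) = S i (max a b)"
    by (simp_all add: min_of_mono max_of_mono)
  then show ?thesis using True by (simp add: S_def)
next
  case False
  then have "s i < 0" using slope_ne[OF assms] by simp
  then have "min (S i a) (S i b) = S i (max a b)" "max (S i a) (S i b) = S i (min a b)"
    by (auto simp: S_def min_def max_def mult_le_cancel_left)
  then show ?thesis using \<open>s i < 0\<close> by (auto simp: S_def)
qed

lemma S_surj_between:
  assumes "i \<in> {1..N}" "min (S i a) (S i b) < z" "z < max (S i a) (S i b)"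
  obtains w where "z = S i w" "min a b < w" "w < max a b"
proof -
  define w where "w = (z - c i) / s i"
  have z: "z = S i w" using slope_ne[OF assms(1)] by (simp add: w_def S_def)
  then show thesis using S_between[OF assms(1), of a b w] assms that by blast
qed

lemma S_eq_iff: "i \<in> {1..N} \<Longrightarrow> S i x = S i y \<longleftrightarrow> x = y"
  using slope_ne by (simp add: S_def)

text \<open>The open set condition speaks of open images only. A common value at an endpoint y is
  perturbed: y is moved towards the midpoint m and x is moved so that the images still agree. For
  small \<theta> both points are in the open interval.\<close>

lemma open_closed_disjoint:
  assumes ij: "i \<in> {1..N}" "j \<in> {1..N}" "i \<noteq> j" and x: "x \<in> {A<..<B}" and y: "y \<in> {A..B}"
  shows "S i x \<noteq> S j y"
proof
  assume eq: "S i x = S j y"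
  define m where "m = (A + B) / 2"
  have "((\<lambda>\<theta>. x + s j / s i * (\<theta> * (m - y))) \<longlongrightarrow> x + s j / s i * (0 * (m - y))) (at_right 0)"
    by (intro tendsto_intros)
  then have "\<forall>\<^sub>F \<theta> in at_right 0. A < x + s j / s i * (\<theta> * (m - y)) \<and> x + s j / s i * (\<theta> * (m - y)) < B"
    using x by (intro eventually_conj order_tendstoD[where y = x]) auto
  moreover have "\<forall>\<^sub>F \<theta> in at_right 0. \<theta> \<in> {0<..<1::real}" by (rule eventually_at_right_real) simp
  ultimately have "\<forall>\<^sub>F \<theta> in at_right (0::real). False"
  proof eventually_elim
    case (elim \<theta>)
    define y' where "y' = (1 - \<theta>) * y + \<theta> * m"
    have "A < m" "m < B" using A_less_B by (auto simp: m_def)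
    have "(1 - \<theta>) * A + \<theta> * A < y'" "y' < (1 - \<theta>) * B + \<theta> * B"
      unfolding y'_def using elim(2) y \<open>A < m\<close> \<open>m < B\<close> by (auto intro!: add_le_less_mono mult_left_mono mult_strict_left_mono)
    then have "y' \<in> {A<..<B}" by (simp add: algebra_simps)
    moreover have "S i (x + s j / s i * (\<theta> * (m - y))) = S j y'"
      using eq slope_ne[OF ij(1)] by (simp add: S_def y'_def algebra_simps)
    ultimately show False using disjoint_images[OF ij, of "x + s j / s i * (\<theta> * (m - y))" y'] elim(1) by (simp add: S_def)
  qed
  then show False by (simp add: trivial_limit_at_right_real)
qed

definition gap_map :: "nat \<Rightarrow> real \<times> real \<Rightarrow> real \<times> real" where
  "gap_map i p = (S i (fst p), S i (snd p))"

lemma gap_length_map: "i \<in> {1..N} \<Longrightarrow> gap_length (gap_map i p) = r i * gap_length p"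
  using slope[of i] by (simp add: gap_length_def gap_map_def S_def abs_mult right_diff_distrib[symmetric])

lemma gap_interior: "(a, b) \<in> directed_gaps K \<Longrightarrow> min a b < w \<Longrightarrow> w < max a b \<Longrightarrow> w \<in> {A<..<B}"
  using directed_gapsD[of a b K] K_sub by fastforce

text \<open>A point of K inside the image of a gap comes from the same map, and then lies in the gap
  itself, or from another map, which \<open>open_closed_disjoint\<close> excludes because gaps lie
  in the open interval.\<close>

lemma gap_map_gaps:
  assumes i: "i \<in> {1..N}" and p: "p \<in> directed_gaps K"
  shows "gap_map i p \<in> directed_gaps K"
proof -
  obtain a b where ab: "p = (a, b)" by fastforce
  note D = directed_gapsD[OF p[unfolded ab]]
  have "\<not> (min (S i a) (S i b) < z \<and> z < max (S i a) (S i b))" if z: "z \<in> K" for z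
  proof
    assume "min (S i a) (S i b) < z \<and> z < max (S i a) (S i b)"
    then obtain w where w: "z = S i w" "min a b < w" "w < max a b" using S_surj_between[OF i] by blast
    obtain j k where jk: "j \<in> {1..N}" "k \<in> K" "z = S j k" using K_cases[OF z] .
    show False
    proof (cases "j = i")
      case True
      then have "k = w" using jk w S_eq_iff[OF i] by simp
      then show False using D(4)[OF jk(2)] w by simp
    next
      case False
      have "w \<in> {A<..<B}" using p w(2,3) unfolding ab by (rule gap_interior)
      then show False using open_closed_disjoint[OF i jk(1) False[symmetric], of w k] jk w K_sub by auto
    qed
  qed
  then show ?thesis unfolding gap_map_def ab directed_gaps_def using D S_in_K[OF i] S_eq_iff[OF i] by auto
qed

lemma inj_gap_map: "i \<in> {1..N} \<Longrightarrow> inj (gap_map i)"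
  by (rule injI) (auto simp: gap_map_def S_eq_iff prod_eq_iff)

text \<open>Affine maps send midpoints of gaps to midpoints, and midpoints of gaps lie in the open
  interval, where the images are disjoint.\<close>

lemma gap_map_disjoint:
  assumes ij: "i \<in> {1..N}" "j \<in> {1..N}" "i \<noteq> j" and p: "p \<in> directed_gaps K" "q \<in> directed_gaps K"
  shows "gap_map i p \<noteq> gap_map j q"
proof
  assume eq: "gap_map i p = gap_map j q"
  have mid: "(fst p + snd p) / 2 \<in> {A<..<B}" if "p \<in> directed_gaps K" for p
    using that directed_gapsD(3)[of "fst p" "snd p" K] by (intro gap_interior[of "fst p" "snd p"]) auto
  have "S i ((fst p + snd p) / 2) = (S i (fst p) + S i (snd p)) / 2" for i and p :: "real \<times> real" by (simp add: S_def field_simps)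
  then have "S i ((fst p + snd p) / 2) = S j ((fst q + snd q) / 2)" using eq unfolding gap_map_def prod.inject by (simp only:)
  then show False using disjoint_images[OF ij mid[OF p(1)] mid[OF p(2)]] by (simp add: S_def)
qed

definition primary_gaps :: "(real \<times> real) set" where
  "primary_gaps = directed_gaps K - (\<Union>i\<in>{1..N}. gap_map i ` directed_gaps K)"

lemma primary_endpoint:
  assumes ab: "(a, b) \<in> directed_gaps K" and i: "i \<in> {1..N}" "a \<in> S i ` K" "b \<notin> S i ` K"
  shows "a = Sup (S i ` K) \<or> a = Inf (S i ` K)"
proof (rule ccontr)
  assume no: "\<not> (a = Sup (S i ` K) \<or> a = Inf (S i ` K))"
  note D = directed_gapsD[OF ab]
  obtain k where k: "k \<in> K" "a = S i k" using i by auto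
  obtain j l where jl: "j \<in> {1..N}" "l \<in> K" "b = S j l" using K_cases[OF D(2)] .
  have ji: "j \<noteq> i" using jl i by auto
  have cont: False if k2: "k2 \<in> K" "min a (S i k2) < b" "b < max a (S i k2)" for k2
  proof -
    obtain w where w: "b = S i w" "min k k2 < w" "w < max k k2"
      using S_surj_between[OF i(1), of k k2 b] k2(2,3) unfolding k(2) by metis
    have "k \<in> {A..B}" "k2 \<in> {A..B}" using k(1) k2(1) K_sub by auto
    then have "w \<in> {A<..<B}" using w by auto
    then show False using open_closed_disjoint[OF i(1) jl(1) ji[symmetric], of w l] jl w K_sub by auto
  qed
  show False
  proof (cases "a < b")
    case True
    have "\<exists>k2\<in>K. a < S i k2"
    proof (rule ccontr)
      assume "\<not> (\<exists>k2\<in>K. a < S i k2)"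
      then have "Sup (S i ` K) = a" using i(2) by (intro cSup_eq_maximum) (auto simp: not_less)
      then show False using no by simp
    qed
    then obtain k2 where k2: "k2 \<in> K" "a < S i k2" by blast
    have "\<not> S i k2 < b" using D(4)[OF S_in_K[OF i(1) k2(1)]] k2 True by auto
    moreover have "S i k2 \<noteq> b" using i(3) k2 by auto
    ultimately show False using cont[OF k2(1)] True k2 by auto
  next
    case False
    then have ba: "b < a" using D(3) by simp
    have "\<exists>k2\<in>K. S i k2 < a"
    proof (rule ccontr)
      assume "\<not> (\<exists>k2\<in>K. S i k2 < a)"
      then have "Inf (S i ` K) = a" using i(2) by (intro cInf_eq_minimum) (auto simp: not_less)
      then show False using no by simp
    qed
    then obtain k2 where k2: "k2 \<in> K" "S i k2 < a" by blast
    have "\<not> b < S i k2" using D(4)[OF S_in_K[OF i(1) k2(1)]] k2 ba by auto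
    moreover have "S i k2 \<noteq> b" using i(3) k2 by auto
    ultimately show False using cont[OF k2(1)] ba k2 by auto
  qed
qed

lemma finite_primary_gaps: "finite primary_gaps"
proof -
  let ?E = "\<Union>i\<in>{1..N}. {Sup (S i ` K), Inf (S i ` K)}"
  have "primary_gaps \<subseteq> ?E \<times> ?E"
  proof clarify
    fix a b assume p: "(a, b) \<in> primary_gaps"
    then have ab: "(a, b) \<in> directed_gaps K" by (simp add: primary_gaps_def)
    note D = directed_gapsD[OF ab]
    have nb: "\<not> (a \<in> S i ` K \<and> b \<in> S i ` K)" if i: "i \<in> {1..N}" for i
    proof
      assume "a \<in> S i ` K \<and> b \<in> S i ` K"
      then obtain a' b' where a'b': "a' \<in> K" "b' \<in> K" "a = S i a'" "b = S i b'" by auto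
      have "\<not> (min a' b' < w \<and> w < max a' b')" if "w \<in> K" for w
        using S_between[OF i, of a' b' w] D(4)[OF S_in_K[OF i that]] a'b' by blast
      then have "(a', b') \<in> directed_gaps K" using a'b' D(3) by (auto simp: directed_gaps_def)
      then have "(a, b) \<in> gap_map i ` directed_gaps K" using a'b' by (force simp: gap_map_def)
      then show False using p i by (auto simp: primary_gaps_def)
    qed
    obtain i where i: "i \<in> {1..N}" "a \<in> S i ` K" using K_cases[OF D(1)] by blast
    obtain j where j: "j \<in> {1..N}" "b \<in> S j ` K" using K_cases[OF D(2)] by blast
    have "a = Sup (S i ` K) \<or> a = Inf (S i ` K)" using primary_endpoint[OF ab i] nb i by blast
    moreover have "b = Sup (S j ` K) \<or> b = Inf (S j ` K)"
      using primary_endpoint[OF directed_gaps_swap[OF ab] j] nb j by blast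
    ultimately show "a \<in> ?E \<and> b \<in> ?E" using i(1) j(1) by blast
  qed
  then show ?thesis by (rule finite_subset) auto
qed

lemma finite_long_gaps: "0 < \<epsilon> \<Longrightarrow> finite (long_gaps K \<epsilon>)"
  using sum_boundary_dirs(2)[OF K_compact K_ne] .

text \<open>Because \<Psi> vanishes on short pairs, the sums over all images can run over one finite
  index set, the long gaps of K, instead of over index sets that depend on i.\<close>

lemma sum_long_gaps_split:
  fixes \<Psi> :: "real \<times> real \<Rightarrow> real"
  assumes e: "0 < \<epsilon>" and van: "\<And>p. gap_length p \<le> 2 * \<epsilon> \<Longrightarrow> \<Psi> p = 0"
  shows "(\<Sum>p\<in>long_gaps K \<epsilon>. \<Psi> p) =
    (\<Sum>i=1..N. \<Sum>p\<in>long_gaps K \<epsilon>. \<Psi> (gap_map i p)) + (\<Sum>p\<in>primary_gaps \<inter> long_gaps K \<epsilon>. \<Psi> p)"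
proof -
  let ?G = "long_gaps K \<epsilon>"
  let ?H = "\<lambda>i. {p \<in> directed_gaps K. 2 * \<epsilon> < r i * gap_length p}"
  have H: "?H i \<subseteq> ?G" if "i \<in> {1..N}" for i
  proof
    fix p assume p: "p \<in> ?H i"
    have "r i * gap_length p \<le> 1 * gap_length p"
      using ratio_less_1'[OF that] by (intro mult_right_mono) (auto simp: gap_length_def)
    then show "p \<in> ?G" using p by (auto simp: long_gaps_def)
  qed
  then have finH: "finite (?H i)" if "i \<in> {1..N}" for i using finite_long_gaps[OF e] that finite_subset by blast
  have G: "?G = (\<Union>i\<in>{1..N}. gap_map i ` ?H i) \<union> (primary_gaps \<inter> ?G)"
    using gap_map_gaps gap_length_map by (auto simp: long_gaps_def primary_gaps_def) 
  have "(\<Sum>p\<in>?G. \<Psi> p) = (\<Sum>p\<in>(\<Union>i\<in>{1..N}. gap_map i ` ?H i). \<Psi> p) + (\<Sum>p\<in>primary_gaps \<inter> ?G. \<Psi> p)"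
  proof (subst G, rule sum.union_disjoint)
    show "(\<Union>i\<in>{1..N}. gap_map i ` ?H i) \<inter> (primary_gaps \<inter> ?G) = {}" by (auto simp: primary_gaps_def)
  qed (use finH finite_long_gaps[OF e] in auto)
  also have "(\<Sum>p\<in>(\<Union>i\<in>{1..N}. gap_map i ` ?H i). \<Psi> p) = (\<Sum>i=1..N. \<Sum>p\<in>gap_map i ` ?H i. \<Psi> p)"
  proof (rule sum.UNION_disjoint)
    show "\<forall>i\<in>{1..N}. finite (gap_map i ` ?H i)" using finH by auto
    show "\<forall>i\<in>{1..N}. \<forall>j\<in>{1..N}. i \<noteq> j \<longrightarrow> gap_map i ` ?H i \<inter> gap_map j ` ?H j = {}"
      using gap_map_disjoint by blast
  qed auto
  also have "\<dots> = (\<Sum>i=1..N. \<Sum>p\<in>?G. \<Psi> (gap_map i p))"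
  proof (rule sum.cong[OF refl])
    fix i assume i: "i \<in> {1..N}"
    have "(\<Sum>p\<in>gap_map i ` ?H i. \<Psi> p) = (\<Sum>p\<in>?H i. \<Psi> (gap_map i p))"
      by (subst sum.reindex) (auto intro: inj_on_subset[OF inj_gap_map[OF i]])
    also have "\<dots> = (\<Sum>p\<in>?G. \<Psi> (gap_map i p))"
      using H[OF i] finite_long_gaps[OF e] van gap_length_map[OF i]
      by (intro sum.mono_neutral_left) (auto simp: long_gaps_def not_less)
    finally show "(\<Sum>p\<in>gap_map i ` ?H i. \<Psi> p) = (\<Sum>p\<in>?G. \<Psi> (gap_map i p))" .
  qed
  finally show ?thesis .
qed

definition gap_count :: "real \<Rightarrow> real" where
  "gap_count \<epsilon> = (if 0 < \<epsilon> then real (card (long_gaps K \<epsilon>)) else 0)"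

definition primary_count :: "real \<Rightarrow> real" where
  "primary_count \<epsilon> = (if 0 < \<epsilon> then real (card (primary_gaps \<inter> long_gaps K \<epsilon>)) else 0)"

text \<open>The splitting applied to an indicator: the image of a gap under map i is longer than
  2\<epsilon> exactly when the gap is longer than \<open>2 * (\<epsilon> / r i)\<close>.\<close>

lemma gap_count_rec:
  assumes e: "0 < \<epsilon>"
  shows "gap_count \<epsilon> = (\<Sum>i=1..N. gap_count (\<epsilon> / r i)) + primary_count \<epsilon>"
proof -
  define \<Psi> where "\<Psi> = (\<lambda>p. if 2 * \<epsilon> < gap_length p then 1 else 0 :: real)"
  have "gap_count \<epsilon> = (\<Sum>p\<in>long_gaps K \<epsilon>. \<Psi> p)"
    using e by (simp add: gap_count_def \<Psi>_def long_gaps_def)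
  also have "\<dots> = (\<Sum>i=1..N. \<Sum>p\<in>long_gaps K \<epsilon>. \<Psi> (gap_map i p)) + (\<Sum>p\<in>primary_gaps \<inter> long_gaps K \<epsilon>. \<Psi> p)"
    using e by (intro sum_long_gaps_split) (auto simp: \<Psi>_def)
  also have "(\<Sum>p\<in>primary_gaps \<inter> long_gaps K \<epsilon>. \<Psi> p) = primary_count \<epsilon>"
    using e by (simp add: primary_count_def \<Psi>_def long_gaps_def)
  also have "(\<Sum>i=1..N. \<Sum>p\<in>long_gaps K \<epsilon>. \<Psi> (gap_map i p)) = (\<Sum>i=1..N. gap_count (\<epsilon> / r i))"
  proof (rule sum.cong[OF refl])
    fix i assume i: "i \<in> {1..N}"
    note ri = ratio_pos'[OF i] ratio_less_1'[OF i]
    have "(\<Sum>p\<in>long_gaps K \<epsilon>. \<Psi> (gap_map i p)) = real (card {p \<in> long_gaps K \<epsilon>. 2 * \<epsilon> < r i * gap_length p})"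
      using finite_long_gaps[OF e] by (simp add: \<Psi>_def gap_length_map[OF i] sum.If_cases Int_def)
    also have "{p \<in> long_gaps K \<epsilon>. 2 * \<epsilon> < r i * gap_length p} = long_gaps K (\<epsilon> / r i)"
    proof -
      have "2 * \<epsilon> < r i * x \<longleftrightarrow> 2 * (\<epsilon> / r i) < x" for x using ri by (simp add: pos_divide_less_eq mult.commute)
      moreover have "2 * \<epsilon> < x" if "2 * (\<epsilon> / r i) < x" for x
      proof -
        have "\<epsilon> \<le> \<epsilon> / r i" using ri e by (simp add: pos_le_divide_eq)
        then show ?thesis using that by simp
      qed
      ultimately show ?thesis unfolding long_gaps_def by auto
    qed
    finally show "(\<Sum>p\<in>long_gaps K \<epsilon>. \<Psi> (gap_map i p)) = gap_count (\<epsilon> / r i)"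
      using e ri by (simp add: gap_count_def)
  qed
  finally show ?thesis .
qed

end


lemma borel_measurable_antimono_pos:
  fixes f :: "real \<Rightarrow> real"
  assumes "\<And>x. x \<le> 0 \<Longrightarrow> f x = 0" "\<And>x y. 0 < x \<Longrightarrow> x \<le> y \<Longrightarrow> f y \<le> f x"
  shows "f \<in> borel_measurable borel"
proof (subst borel_measurable_iff_greater, intro allI)
  fix a
  have "is_interval {x. 0 < x \<and> a < f x}"
    unfolding is_interval_1
  proof (intro ballI allI impI)
    fix u v x assume "u \<in> {x. 0 < x \<and> a < f x}" "v \<in> {x. 0 < x \<and> a < f x}" "u \<le> x \<and> x \<le> v"
    then show "x \<in> {x. 0 < x \<and> a < f x}" using assms(2)[of x v] by auto
  qed
  then have "{x. 0 < x \<and> a < f x} \<in> sets borel" by (rule real_interval_borel_measurable)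
  moreover have "{w \<in> space borel. a < f w} = {x. 0 < x \<and> a < f x} \<union> (if a < 0 then {..0} else {})"
    using assms(1) by (auto simp: not_less split: if_splits) (metis not_le)+
  ultimately show "{w \<in> space borel. a < f w} \<in> sets borel" by auto
qed

section \<open>Existence of gaps and the Moran exponent of a null attractor\<close>

context affine_ifs
begin

lemma S_interior:
  assumes "i \<in> {1..N}" "x \<in> {A<..<B}" shows "S i x \<in> {A<..<B}"
proof -
  have "min (S i A) (S i B) < S i x \<and> S i x < max (S i A) (S i B)"
    using assms(2) by (subst S_between[OF assms(1)]) auto
  moreover have "S i A \<in> {A..B}" "S i B \<in> {A..B}" using maps_to[OF assms(1)] A_less_B by (auto simp: S_def)
  ultimately show ?thesis by auto
qed

text \<open>If \<open>K\<close> were a single point, all maps would fix it and commute, contradicting the disjointness of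
  \<open>S 1 (S 2 m)\<close> and \<open>S 2 (S 1 m)\<close>.\<close>

lemma K_two_points: "\<exists>a\<in>K. \<exists>b\<in>K. a < b"
proof (rule ccontr)
  assume no: "\<not> (\<exists>a\<in>K. \<exists>b\<in>K. a < b)"
  obtain x where x: "x \<in> K" using K_ne by auto
  have one: "y = x" if "y \<in> K" for y using no x that by (metis linorder_neqE_linordered_idom)
  have 12: "1 \<in> {1..N}" "2 \<in> {1..N}" using two_maps' by auto
  have fp: "s i * x + c i = x" if "i \<in> {1..N}" for i using one[OF S_in_K[OF that x]] by (simp add: S_def)
  define m where "m = (A + B) / 2"
  have m: "m \<in> {A<..<B}" using A_less_B by (auto simp: m_def)
  have c: "c i = x - s i * x" if "i \<in> {1..N}" for i using fp[OF that] by simp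
  have "S 1 (S 2 m) = S 2 (S 1 m)" unfolding S_def c[OF 12(1)] c[OF 12(2)] by (simp add: algebra_simps)
  then show False
    using disjoint_images[OF 12 _ S_interior[OF 12(2) m] S_interior[OF 12(1) m]] by (simp add: S_def)
qed

lemma K_interval_not_subset:
  assumes "a < b" shows "\<not> {a<..<b} \<subseteq> K"
proof
  assume "{a<..<b} \<subseteq> K"
  then have "emeasure lborel {a<..<b} \<le> emeasure lborel K"
    using K_compact by (intro emeasure_mono) (auto intro: borel_closed compact_imp_closed)
  then show False using assms K_null by simp
qed

text \<open>Between two points of a null set some point is missing, and the nearest points of K on
  its two sides bound a gap. This makes the count positive somewhere, which starts the lower
  bound.\<close>

lemma directed_gaps_ne: "directed_gaps K \<noteq> {}"
proof -
  obtain a b where ab: "a \<in> K" "b \<in> K" "a < b" using K_two_points by blast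
  obtain x where x: "a < x" "x < b" "x \<notin> K" using K_interval_not_subset[OF ab(3)] unfolding subset_iff greaterThanLessThan_iff by blast
  have comp: "compact (K \<inter> {..x})" "compact (K \<inter> {x..})" using K_compact by (auto intro: compact_Int_closed)
  obtain l where l: "l \<in> K \<inter> {..x}" "\<And>y. y \<in> K \<inter> {..x} \<Longrightarrow> y \<le> l"
    using compact_attains_sup[OF comp(1)] ab x by force
  obtain u where u: "u \<in> K \<inter> {x..}" "\<And>y. y \<in> K \<inter> {x..} \<Longrightarrow> u \<le> y"
    using compact_attains_inf[OF comp(2)] ab x by force
  have "l \<noteq> x" "u \<noteq> x" using l u x by auto
  then have lu: "l < x" "x < u" using l u by auto
  have "\<not> (l < y \<and> y < u)" if "y \<in> K" for y
    using l(2)[of y] u(2)[of y] that by (cases "y \<le> x") auto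
  then have "(l, u) \<in> directed_gaps K"
  proof -
    have "l \<in> K" "u \<in> K" "l \<noteq> u" "min l u = l" "max l u = u" using l(1) u(1) lu by simp_all
    then show ?thesis using \<open>\<And>y. y \<in> K \<Longrightarrow> \<not> (l < y \<and> y < u)\<close> by (simp add: directed_gaps_def)
  qed
  then show ?thesis by auto
qed

lemma S_image_interval:
  assumes "i \<in> {1..N}"
  shows "S i ` {A<..<B} = {min (S i A) (S i B)<..<max (S i A) (S i B)}"
proof (intro equalityI subsetI)
  fix y assume "y \<in> S i ` {A<..<B}"
  then obtain x where x: "A < x" "x < B" "y = S i x" by auto
  then have "min A B < x" "x < max A B" by simp_all
  then show "y \<in> {min (S i A) (S i B)<..<max (S i A) (S i B)}"
    using S_between[OF assms, of A B x] unfolding x(3) greaterThanLessThan_iff by blast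
next
  fix y assume "y \<in> {min (S i A) (S i B)<..<max (S i A) (S i B)}"
  then obtain w where "y = S i w" "min A B < w" "w < max A B" using S_surj_between[OF assms, of A B y]
    unfolding greaterThanLessThan_iff by blast
  then show "y \<in> S i ` {A<..<B}" using A_less_B by auto
qed

text \<open>The nearest point of T is moved within T. The lemma is applied to K and to the whole
  interval.\<close>

lemma infdist_S_le:
  assumes "i \<in> {1..N}" "closed T" "T \<noteq> {}" "S i ` T \<subseteq> T"
  shows "infdist (S i y) T \<le> r i * infdist y T"
proof -
  obtain k where k: "k \<in> T" "infdist y T = dist y k" using infdist_attains_inf[OF assms(2,3)] by metis
  have "infdist (S i y) T \<le> dist (S i y) (S i k)" using k assms(4) by (intro infdist_le) auto
  also have "\<dots> = r i * dist y k"
    using slope[OF assms(1)] by (simp add: S_def dist_real_def abs_mult right_diff_distrib[symmetric])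
  finally show ?thesis using k by simp
qed

text \<open>Otherwise the images of \<open>[A, B]\<close> cover \<open>[A, B]\<close>, and the contraction argument for uniqueness of the attractor makes
  \<open>[A, B]\<close> a subset of the null set \<open>K\<close>.\<close>

lemma sum_ratios_less_1: "(\<Sum>i=1..N. r i) < 1"
proof (rule ccontr)
  assume ge: "\<not> (\<Sum>i=1..N. r i) < 1"
  define V where "V = (\<Union>i\<in>{1..N}. S i ` {A..B})"
  have "continuous_on {A..B} (S i)" for i unfolding S_def by (intro continuous_intros)
  then have cV: "closed V" unfolding V_def
    by (intro closed_UN compact_imp_closed compact_continuous_image ballI compact_Icc) auto
  then have [measurable]: "V \<in> sets borel" by (rule borel_closed)
  have V_sub: "V \<subseteq> {A..B}" unfolding V_def using maps_to by (auto simp: S_def)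
  have "emeasure lborel (S i ` {A<..<B}) = ennreal (r i * (B - A))" if i: "i \<in> {1..N}" for i
  proof -
    have "max (S i A) (S i B) - min (S i A) (S i B) = \<bar>s i * (B - A)\<bar>" by (auto simp: S_def max_def min_def algebra_simps)
    also have "\<dots> = r i * (B - A)" using slope[OF i] A_less_B by (simp add: abs_mult)
    finally show ?thesis unfolding S_image_interval[OF i] by simp
  qed
  then have "(\<Sum>i\<in>{1..N}. emeasure lborel (S i ` {A<..<B})) = (\<Sum>i\<in>{1..N}. ennreal (r i * (B - A)))"
    by (intro sum.cong) auto
  also have "\<dots> = ennreal ((\<Sum>i=1..N. r i) * (B - A))"
    using ratio_pos' A_less_B by (subst sum_ennreal) (auto simp: sum_distrib_right less_imp_le)
  also have "(\<Sum>i\<in>{1..N}. emeasure lborel (S i ` {A<..<B})) = emeasure lborel (\<Union>i\<in>{1..N}. S i ` {A<..<B})"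
  proof (rule sum_emeasure)
    show "disjoint_family_on (\<lambda>i. S i ` {A<..<B}) {1..N}"
      unfolding disjoint_family_on_def using disjoint_images by (fastforce simp: S_def)
  qed (auto simp: S_image_interval)
  finally have eq: "emeasure lborel (\<Union>i\<in>{1..N}. S i ` {A<..<B}) = ennreal ((\<Sum>i=1..N. r i) * (B - A))" .
  have "ennreal (B - A) \<le> ennreal ((\<Sum>i=1..N. r i) * (B - A))"
    using ge A_less_B by (intro ennreal_leI) (simp add: mult_le_cancel_right1)
  also have "\<dots> \<le> emeasure lborel V"
    unfolding eq[symmetric] V_def by (intro emeasure_mono) (use cV in \<open>force simp: V_def intro: borel_closed\<close>)+
  finally have "ennreal (B - A) \<le> emeasure lborel V" .
  moreover have "emeasure lborel {A..B} = emeasure lborel V + emeasure lborel ({A..B} - V)"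
    using V_sub by (subst plus_emeasure) (auto intro!: arg_cong[where f = "emeasure lborel"])
  moreover have "emeasure lborel {A..B} = ennreal (B - A)" using A_less_B by simp
  ultimately have "ennreal (B - A) + emeasure lborel ({A..B} - V) \<le> ennreal (B - A)"
    by (metis add_right_mono)
  then have null: "emeasure lborel ({A..B} - V) = 0"
    by (cases "emeasure lborel ({A..B} - V)") (auto simp: ennreal_plus[symmetric] top_unique simp del: ennreal_plus)
  \<comment> \<open>V is closed, so an uncovered interior point would have an uncovered ball around
    it, of positive measure.\<close>
  have int: "{A<..<B} \<subseteq> V"
  proof
    fix x assume x: "x \<in> {A<..<B}"
    show "x \<in> V"
    proof (rule ccontr)
      assume "x \<notin> V"
      then have "open ({A<..<B} - V)" "x \<in> {A<..<B} - V" using cV x by auto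
      then obtain d where d: "d > 0" "ball x d \<subseteq> {A<..<B} - V" using openE by blast
      have "emeasure lborel (ball x d) \<le> emeasure lborel ({A..B} - V)" using d by (intro emeasure_mono) auto
      then show False using null d(1) by (simp add: ball_eq_greaterThanLessThan)
    qed
  qed
  have V: "{A..B} \<subseteq> V"
    using closure_minimal[OF int cV] A_less_B by simp
  have clK: "closed K" using K_compact by (rule compact_imp_closed)
  have "continuous_on {A..B} (\<lambda>x. infdist x K)" by (intro continuous_intros)
  \<comment> \<open>A point farthest from K is the image under some map of a point that is no
    farther, so its distance is at most \<open>r i\<close> times itself and must be 0.\<close>
  then obtain x where x: "x \<in> {A..B}" "\<And>y. y \<in> {A..B} \<Longrightarrow> infdist y K \<le> infdist x K"
    using continuous_attains_sup[of "{A..B}" "\<lambda>x. infdist x K"] A_less_B by auto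
  obtain i y where i: "i \<in> {1..N}" and y: "y \<in> {A..B}" "x = S i y" using x(1) V by (auto simp: V_def)
  have "infdist x K \<le> r i * infdist y K"
    unfolding y(2) using S_in_K[OF i] by (intro infdist_S_le[OF i clK K_ne]) auto
  also have "\<dots> \<le> r i * infdist x K" using x(2)[OF y(1)] ratio_pos'[OF i] by simp
  finally have "infdist x K * (1 - r i) \<le> 0" by (simp add: algebra_simps)
  then have zero: "infdist x K \<le> 0" using ratio_less_1'[OF i] by (simp add: mult_le_0_iff)
  have "{A<..<B} \<subseteq> K"
  proof
    fix z assume "z \<in> {A<..<B}"
    then have "infdist z K = 0" using x(2)[of z] zero infdist_nonneg[of z K] by auto
    then show "z \<in> K" using in_closed_iff_infdist_zero[OF clK K_ne] by simp
  qed
  then show False using K_interval_not_subset[OF A_less_B] by simp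
qed

text \<open>The sum of the powers falls from N at exponent 0 to the sum of the ratios, which is
  below 1, at exponent 1; the intermediate value theorem applies.\<close>

lemma moran_exponent: "\<exists>\<delta>. 0 < \<delta> \<and> \<delta> < 1 \<and> (\<Sum>i=1..N. r i powr \<delta>) = 1"
proof -
  let ?f = "\<lambda>x. \<Sum>i=1..N. r i powr x"
  have r0: "r i \<noteq> 0" if "i \<in> {1..N}" for i using ratio_pos'[OF that] by simp
  have "continuous_on {0..1} ?f" using r0 by (intro continuous_intros) auto
  moreover have "?f 1 = (\<Sum>i=1..N. r i)" using ratio_pos' by (intro sum.cong) (auto simp: less_imp_le)
  then have f1: "?f 1 < 1" using sum_ratios_less_1 by simp
  moreover have "?f 0 = (\<Sum>i=1..N. 1)" using r0 by (intro sum.cong) auto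
  then have f0: "?f 0 > 1" using two_maps' by simp
  ultimately obtain x where x: "0 \<le> x" "x \<le> 1" "?f x = 1" using IVT2'[of ?f 1 1 0] by auto
  moreover have "x \<noteq> 0" "x \<noteq> 1" using x f0 f1 by auto
  ultimately show ?thesis by (intro exI[of _ x]) auto
qed

end

section \<open>Renewal limit of the gap count\<close>

locale ifs = affine_ifs N r s c A B K + ratio_system N r \<delta>
  for N r s c A B K \<delta>
begin

lemma gap_length_le: "p \<in> directed_gaps K \<Longrightarrow> gap_length p \<le> B - A"
proof -
  assume "p \<in> directed_gaps K"
  then have "fst p \<in> {A..B}" "snd p \<in> {A..B}" using K_sub by (auto simp: directed_gaps_def)
  then show ?thesis by (auto simp: gap_length_def)
qed

lemma renewal_gap_count: "renewal N r \<delta> gap_count primary_count (real (card primary_gaps)) (max 1 (B - A))"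
proof
  show "gap_count \<in> borel_measurable borel"
    by (rule borel_measurable_antimono_pos)
      (auto simp: gap_count_def long_gaps_def intro!: card_mono finite_long_gaps[unfolded long_gaps_def])
  have "primary_count y \<le> primary_count x" if "0 < x" "x \<le> y" for x y
    using that finite_primary_gaps by (auto simp: primary_count_def long_gaps_def intro!: card_mono)
  then show "primary_count \<in> borel_measurable borel"
    by (intro borel_measurable_antimono_pos) (auto simp: primary_count_def)
  show "0 \<le> gap_count \<epsilon>" "0 \<le> primary_count \<epsilon>" for \<epsilon> by (auto simp: gap_count_def primary_count_def)
  show "primary_count \<epsilon> \<le> real (card primary_gaps)" for \<epsilon>
    using finite_primary_gaps by (auto simp: primary_count_def intro!: card_mono)
  show "gap_count y \<le> gap_count x" if "0 < x" "x \<le> y" for x y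
    using that finite_long_gaps[OF that(1)] by (auto simp: gap_count_def long_gaps_def intro!: card_mono)
  show "1 \<le> max 1 (B - A)" by simp
  show "gap_count \<epsilon> = 0" if "max 1 (B - A) \<le> \<epsilon>" for \<epsilon>
  proof -
    have "long_gaps K \<epsilon> = {}" using that gap_length_le A_less_B by (fastforce simp: long_gaps_def)
    then show ?thesis by (simp add: gap_count_def)
  qed
  show "gap_count \<epsilon> = (\<Sum>i=1..N. gap_count (\<epsilon> / r i)) + primary_count \<epsilon>" if "0 < \<epsilon>" for \<epsilon>
    using that by (rule gap_count_rec)
  obtain p where p: "p \<in> directed_gaps K" using directed_gaps_ne by auto
  define e where "e = gap_length p / 4"
  have e: "e > 0" using gap_length_pos[OF p] by (simp add: e_def)
  have "p \<in> long_gaps K e" using p gap_length_pos[OF p] by (simp add: long_gaps_def e_def)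
  then have "0 < card (long_gaps K e)" using finite_long_gaps[OF e] card_gt_0_iff by blast
  then show "\<exists>e>0. 0 < gap_count e" using e by (intro exI[of _ e]) (simp add: gap_count_def)
qed

definition scaled_count :: "real \<Rightarrow> real" where "scaled_count \<epsilon> = \<epsilon> powr \<delta> * gap_count \<epsilon>"

text \<open>The limit of \<open>scaled_count\<close>, averaged or, for nonlattice ratios, plain. It
  is attached to K before any map g is chosen, hence common to all images.\<close>

definition gap_constant :: real where
  "gap_constant = renewal.source_mass \<delta> primary_count (max 1 (B - A)) / entropy"

lemma scaled_count_eq: "scaled_count = renewal.scaled_cnt \<delta> gap_count"
  by (auto simp: scaled_count_def renewal.scaled_cnt_def[OF renewal_gap_count])

lemma scaled_count_lb: "locally_bounded_fun scaled_count"
  unfolding scaled_count_eq by (rule renewal.scaled_cnt_lb[OF renewal_gap_count])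

lemma scaled_count_lower: "\<exists>b>0. \<exists>e>0. \<forall>\<epsilon>. 0 < \<epsilon> \<longrightarrow> \<epsilon> \<le> e \<longrightarrow> b \<le> scaled_count \<epsilon>"
  unfolding scaled_count_eq by (rule renewal.scaled_cnt_lower[OF renewal_gap_count])

lemma gap_constant_nonneg: "0 \<le> gap_constant"
  unfolding gap_constant_def by (rule renewal.limit_constant_nonneg[OF renewal_gap_count])

lemma scaled_count_average: "mode_limit True scaled_count gap_constant"
  unfolding mode_limit_def gap_constant_def scaled_count_eq mode_value_def if_True
  by (rule renewal.average_renewal[OF renewal_gap_count])

text \<open>Different word ratios come multiplicatively arbitrarily close; this is the form in which
  the nonlattice hypothesis enters the renewal theorem.\<close>

definition ratios_nonlattice :: bool where
  "ratios_nonlattice \<longleftrightarrow> (\<forall>\<eta>>1. \<exists>u v. set u \<subseteq> {1..N} \<and> set v \<subseteq> {1..N} \<and>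
     word_ratio r u < word_ratio r v \<and> word_ratio r v \<le> \<eta> * word_ratio r u)"

lemma scaled_count_limit:
  assumes "avg \<or> ratios_nonlattice" shows "mode_limit avg scaled_count gap_constant"
proof (cases avg)
  case False
  have "(scaled_count \<longlongrightarrow> gap_constant) (at_right 0)"
    unfolding gap_constant_def scaled_count_eq
    by (rule renewal.nonlattice_renewal[OF renewal_gap_count]) (use assms False in \<open>auto simp: ratios_nonlattice_def\<close>)
  then show ?thesis using False by (simp add: mode_limit_def mode_value_def[abs_def])
qed (use scaled_count_average in simp)

end


section \<open>Gaps inside the cylinders of a fixed level\<close>

definition words_of_length :: "nat \<Rightarrow> nat \<Rightarrow> nat list set" where
  "words_of_length N n = {w. set w \<subseteq> {1..N} \<and> length w = n}"

lemma finite_words_of_length: "finite (words_of_length N n)"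
  unfolding words_of_length_def by (rule finite_lists_length_eq) simp

lemma words_of_length_0: "words_of_length N 0 = {[]}"
  by (auto simp: words_of_length_def)

lemma sum_words_of_length_Suc:
  "(\<Sum>w\<in>words_of_length N (Suc n). f w) = (\<Sum>i=1..N. \<Sum>w\<in>words_of_length N n. f (i # w))"
proof -
  have "words_of_length N (Suc n) = (\<lambda>(i, w). i # w) ` ({1..N} \<times> words_of_length N n)"
    by (auto simp: words_of_length_def length_Suc_conv image_iff)
  then have "(\<Sum>w\<in>words_of_length N (Suc n). f w) = (\<Sum>(i, w)\<in>{1..N} \<times> words_of_length N n. f (i # w))"
    by (simp add: sum.reindex inj_on_def case_prod_unfold o_def)
  then show ?thesis by (simp add: sum.cartesian_product)
qed

context affine_ifs
begin

definition word_map :: "nat list \<Rightarrow> real \<Rightarrow> real" where "word_map w x = foldr S w x"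

lemma word_map_simps [simp]: "word_map [] x = x" "word_map (i # w) x = S i (word_map w x)"
  by (simp_all add: word_map_def)

definition gap_word :: "nat list \<Rightarrow> real \<times> real \<Rightarrow> real \<times> real" where
  "gap_word w p = (word_map w (fst p), word_map w (snd p))"

lemma gap_word_simps: "gap_word [] p = p" "gap_word (i # w) p = gap_map i (gap_word w p)"
  by (simp_all add: gap_word_def gap_map_def)

lemma word_map_in: "set w \<subseteq> {1..N} \<Longrightarrow> x \<in> {A..B} \<Longrightarrow> word_map w x \<in> {A..B}"
  using maps_to by (induction w) (auto simp: S_def)

lemma dist_word_map: "set w \<subseteq> {1..N} \<Longrightarrow> dist (word_map w x) (word_map w y) = word_ratio r w * dist x y"
proof (induction w)
  case (Cons i w)
  have "dist (S i u) (S i v) = r i * dist u v" for u v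
    using slope[of i] Cons.prems by (simp add: S_def dist_real_def abs_mult right_diff_distrib[symmetric])
  then show ?case using Cons by simp
qed simp

lemma gap_length_word: "set w \<subseteq> {1..N} \<Longrightarrow> gap_length (gap_word w p) = word_ratio r w * gap_length p"
  using dist_word_map[of w "snd p" "fst p"] by (simp add: gap_length_def gap_word_def dist_real_def)

text \<open>The splitting iterated n times. The gaps that are not images under words of length n
  number at most M, and the order of the quantifiers makes M depend on n only, not on \<epsilon> or
  \<Psi>; each of them contributes at most b.\<close>

lemma sum_long_gaps_words:
  "\<exists>M\<ge>0. \<forall>\<epsilon>>0. \<forall>\<Psi> b. (\<forall>p. gap_length p \<le> 2 * \<epsilon> \<longrightarrow> \<Psi> p = 0) \<longrightarrow> (\<forall>p. 0 \<le> \<Psi> p \<and> \<Psi> p \<le> (b::real)) \<longrightarrow>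
    (\<Sum>w\<in>words_of_length N n. \<Sum>p\<in>long_gaps K \<epsilon>. \<Psi> (gap_word w p)) \<le> (\<Sum>p\<in>long_gaps K \<epsilon>. \<Psi> p) \<and>
    (\<Sum>p\<in>long_gaps K \<epsilon>. \<Psi> p) \<le> (\<Sum>w\<in>words_of_length N n. \<Sum>p\<in>long_gaps K \<epsilon>. \<Psi> (gap_word w p)) + b * M"
proof (induction n)
  case 0
  show ?case by (intro exI[of _ 0]) (auto simp: words_of_length_0 gap_word_simps)
next
  case (Suc n)
  then obtain M where M: "M \<ge> 0" and IH: "\<And>\<epsilon> \<Psi> b. \<epsilon> > 0 \<Longrightarrow> (\<And>p. gap_length p \<le> 2 * \<epsilon> \<Longrightarrow> \<Psi> p = 0) \<Longrightarrow> (\<And>p. 0 \<le> \<Psi> p \<and> \<Psi> p \<le> (b::real)) \<Longrightarrow>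
    (\<Sum>w\<in>words_of_length N n. \<Sum>p\<in>long_gaps K \<epsilon>. \<Psi> (gap_word w p)) \<le> (\<Sum>p\<in>long_gaps K \<epsilon>. \<Psi> p) \<and>
    (\<Sum>p\<in>long_gaps K \<epsilon>. \<Psi> p) \<le> (\<Sum>w\<in>words_of_length N n. \<Sum>p\<in>long_gaps K \<epsilon>. \<Psi> (gap_word w p)) + b * M"
    by meson
  \<comment> \<open>One more level repeats the previous error under each of the N maps and adds the
    primary gaps once.\<close>
  show ?case
  proof (intro exI[of _ "real N * M + real (card primary_gaps)"] conjI allI impI)
    show "0 \<le> real N * M + real (card primary_gaps)" using M by simp
    fix \<epsilon> b :: real and \<Psi> :: "real \<times> real \<Rightarrow> real"
    assume e: "\<epsilon> > 0" and van: "\<forall>p. gap_length p \<le> 2 * \<epsilon> \<longrightarrow> \<Psi> p = 0" and bd: "\<forall>p. 0 \<le> \<Psi> p \<and> \<Psi> p \<le> b"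
    let ?G = "long_gaps K \<epsilon>"
    let ?W = "\<lambda>i. \<Sum>w\<in>words_of_length N n. \<Sum>p\<in>?G. \<Psi> (gap_map i (gap_word w p))"
    have split: "(\<Sum>p\<in>?G. \<Psi> p) = (\<Sum>i=1..N. \<Sum>p\<in>?G. \<Psi> (gap_map i p)) + (\<Sum>p\<in>primary_gaps \<inter> ?G. \<Psi> p)"
      using van by (intro sum_long_gaps_split[OF e]) auto
    have eq: "(\<Sum>w\<in>words_of_length N (Suc n). \<Sum>p\<in>?G. \<Psi> (gap_word w p)) = (\<Sum>i=1..N. ?W i)"
      unfolding sum_words_of_length_Suc gap_word_simps ..
    have step: "?W i \<le> (\<Sum>p\<in>?G. \<Psi> (gap_map i p)) \<and> (\<Sum>p\<in>?G. \<Psi> (gap_map i p)) \<le> ?W i + b * M" if i: "i \<in> {1..N}" for i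
    proof (rule IH[OF e])
      \<comment> \<open>The maps shorten pairs, so composing \<Psi> with \<open>gap_map i\<close>
        preserves its vanishing on short pairs, as the induction hypothesis demands.\<close>
      fix p assume p: "gap_length p \<le> 2 * \<epsilon>"
      have "r i * gap_length p \<le> 1 * gap_length p"
        using ratio_less_1'[OF i] by (intro mult_right_mono) (auto simp: gap_length_def)
      then have "gap_length (gap_map i p) \<le> 2 * \<epsilon>" using gap_length_map[OF i, of p] p by linarith
      then show "\<Psi> (gap_map i p) = 0" using van by blast
    qed (use bd in blast)
    have prim: "0 \<le> (\<Sum>p\<in>primary_gaps \<inter> ?G. \<Psi> p)" using bd by (intro sum_nonneg) auto
    have "(\<Sum>p\<in>primary_gaps \<inter> ?G. \<Psi> p) \<le> real (card (primary_gaps \<inter> ?G)) * b"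
      using bd by (intro sum_bounded_above) auto
    also have "\<dots> \<le> real (card primary_gaps) * b"
      using finite_primary_gaps bd[rule_format, of "(0, 0)"] by (intro mult_right_mono of_nat_mono card_mono) auto
    finally have prim2: "(\<Sum>p\<in>primary_gaps \<inter> ?G. \<Psi> p) \<le> real (card primary_gaps) * b" .
    have "(\<Sum>i=1..N. ?W i) \<le> (\<Sum>i=1..N. \<Sum>p\<in>?G. \<Psi> (gap_map i p))"
      using step by (intro sum_mono) blast
    then show "(\<Sum>w\<in>words_of_length N (Suc n). \<Sum>p\<in>?G. \<Psi> (gap_word w p)) \<le> (\<Sum>p\<in>?G. \<Psi> p)"
      unfolding eq split using prim by linarith
    have "(\<Sum>i=1..N. \<Sum>p\<in>?G. \<Psi> (gap_map i p)) \<le> (\<Sum>i=1..N. ?W i + b * M)"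
      using step by (intro sum_mono) blast
    also have "\<dots> = (\<Sum>i=1..N. ?W i) + real N * (b * M)" by (simp add: sum.distrib)
    finally show "(\<Sum>p\<in>?G. \<Psi> p) \<le> (\<Sum>w\<in>words_of_length N (Suc n). \<Sum>p\<in>?G. \<Psi> (gap_word w p)) + b * (real N * M + real (card primary_gaps))"
      unfolding eq split using prim2 by (simp add: algebra_simps)
  qed
qed

end

context ifs
begin

section \<open>The self-similar measure\<close>

definition letter_measure :: "nat measure" where
  "letter_measure = point_measure {1..N} (\<lambda>i. ennreal (r i powr \<delta>))"

lemma letter_measure_basic: "space letter_measure = {1..N}" "sets letter_measure = Pow {1..N}"
  by (simp_all add: letter_measure_def space_point_measure sets_point_measure)

lemma nn_integral_letter: "(\<integral>\<^sup>+i. f i \<partial>letter_measure) = (\<Sum>i=1..N. ennreal (r i powr \<delta>) * f i)"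
  unfolding letter_measure_def by (subst nn_integral_point_measure_finite) auto

lemma prob_space_letter: "prob_space letter_measure"
proof
  have "emeasure letter_measure (space letter_measure) = (\<integral>\<^sup>+i. 1 \<partial>letter_measure)" by simp
  also have "\<dots> = ennreal (\<Sum>i=1..N. r i powr \<delta>)" unfolding nn_integral_letter by (simp add: sum_ennreal)
  finally show "emeasure letter_measure (space letter_measure) = 1" using moran by simp
qed

text \<open>Extension by \<open>0\<close> to all letters makes the coding series converge on all streams.\<close>

definition slope0 :: "nat \<Rightarrow> real" where "slope0 i = (if i \<in> {1..N} then s i else 0)"
definition shift0 :: "nat \<Rightarrow> real" where "shift0 i = (if i \<in> {1..N} then c i else 0)"

text \<open>The terms of the composition of the maps \<open>S (X !! 0)\<close>,
  \<open>S (X !! 1)\<close> and so on, expanded as a series: no base point has to be chosen, and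
  measurability can be checked term by term.\<close>

definition coding_term :: "nat stream \<Rightarrow> nat \<Rightarrow> real" where
  "coding_term X n = (\<Prod>k<n. slope0 (X !! k)) * shift0 (X !! n)"

definition coding :: "nat stream \<Rightarrow> real" where "coding X = (\<Sum>n. coding_term X n)"

definition shift_bound :: real where "shift_bound = Max (insert 0 ((\<lambda>i. \<bar>c i\<bar>) ` {1..N}))"

lemma shift0_le: "\<bar>shift0 i\<bar> \<le> shift_bound" "0 \<le> shift_bound"
  unfolding shift_bound_def shift0_def by auto

lemma coding_term_le: "\<bar>coding_term X n\<bar> \<le> rmax ^ n * shift_bound"
proof -
  have "\<bar>slope0 i\<bar> \<le> rmax" for i using slope rmax by (auto simp: slope0_def)
  then have "\<bar>\<Prod>k<n. slope0 (X !! k)\<bar> \<le> (\<Prod>k<n. rmax)" unfolding abs_prod by (intro prod_mono) auto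
  then show ?thesis using shift0_le rmax unfolding coding_term_def abs_mult by (intro mult_mono) auto
qed

lemma geometric_bound_sums: "(\<lambda>n. rmax ^ n * shift_bound) sums (1 / (1 - rmax) * shift_bound)"
  using rmax by (intro sums_mult2 geometric_sums) auto

lemma coding_summable: "summable (coding_term X)"
  using coding_term_le by (intro summable_comparison_test'[OF sums_summable[OF geometric_bound_sums]]) auto

lemma coding_bounded: "\<bar>coding X\<bar> \<le> 1 / (1 - rmax) * shift_bound"
proof -
  have "norm (suminf (coding_term X)) \<le> (\<Sum>n. rmax ^ n * shift_bound)"
    using coding_term_le by (intro norm_suminf_le sums_summable[OF geometric_bound_sums]) auto
  then show ?thesis using sums_unique[OF geometric_bound_sums] by (simp add: coding_def)
qed

lemma coding_Cons:
  assumes "i \<in> {1..N}" shows "coding (i ## X) = S i (coding X)"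
proof -
  have "coding_term (i ## X) 0 = c i" using assms by (simp add: coding_term_def shift0_def)
  moreover have "coding_term (i ## X) (Suc n) = s i * coding_term X n" for n
  proof -
    have "slope0 i = s i" using assms by (simp add: slope0_def)
    then show ?thesis by (simp add: coding_term_def prod.lessThan_Suc_shift del: prod.lessThan_Suc)
  qed
  ultimately show ?thesis
    unfolding coding_def using suminf_split_head[OF coding_summable[of "i ## X"]] suminf_mult[OF coding_summable[of X], of "s i"]
    by (simp add: S_def)
qed

text \<open>Removing the first letter shows that the distance to [A, B] contracts by
  \<open>rmax\<close>, and D bounds this distance uniformly over all streams. After n letters it is
  at most \<open>rmax ^ n * D\<close>.\<close>

lemma coding_in:
  assumes "X \<in> streams {1..N}" shows "coding X \<in> {A..B}"
proof -
  obtain D where D: "\<And>X. infdist (coding X) {A..B} \<le> D" "0 \<le> D"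
  proof
    fix X show "infdist (coding X) {A..B} \<le> 1 / (1 - rmax) * shift_bound + \<bar>A\<bar>"
    proof -
      have "infdist (coding X) {A..B} \<le> dist (coding X) A" using A_less_B by (intro infdist_le) auto
      also have "\<dots> \<le> \<bar>coding X\<bar> + \<bar>A\<bar>" by (simp add: dist_real_def)
      finally show ?thesis using coding_bounded[of X] by simp
    qed
  next
    show "0 \<le> 1 / (1 - rmax) * shift_bound + \<bar>A\<bar>" using rmax shift0_le by simp
  qed
  have "X \<in> streams {1..N} \<Longrightarrow> infdist (coding X) {A..B} \<le> rmax ^ n * D" for n X
  proof (induction n arbitrary: X)
    case (Suc n)
    obtain i X' where X: "X = i ## X'" by (cases X)
    then have i: "i \<in> {1..N}" and X': "X' \<in> streams {1..N}" using Suc.prems unfolding X streams_Stream by blast+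
    have "infdist (coding X) {A..B} \<le> r i * infdist (coding X') {A..B}"
      unfolding X coding_Cons[OF i] using maps_to[OF i] A_less_B by (intro infdist_S_le[OF i]) (auto simp: S_def)
    also have "\<dots> \<le> rmax * (rmax ^ n * D)"
      using Suc.IH[OF X'] rmax(1) rmax(3)[OF i] infdist_nonneg by (intro mult_mono) auto
    finally show ?case by simp
  qed (use D in simp)
  note le = this[OF assms]
  have "(\<lambda>n. rmax ^ n * D) \<longlonglongrightarrow> 0 * D" using rmax by (intro tendsto_mult_right LIMSEQ_power_zero) auto
  then have "infdist (coding X) {A..B} \<le> 0 * D"
    using le by (intro LIMSEQ_le_const[of "\<lambda>n. rmax ^ n * D"]) auto
  then have "infdist (coding X) {A..B} = 0" using infdist_nonneg[of "coding X" "{A..B}"] by simp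
  then show ?thesis using in_closed_iff_infdist_zero[of "{A..B}" "coding X"] A_less_B by simp
qed

lemma coding_measurable [measurable]: "coding \<in> borel_measurable (stream_space letter_measure)"
proof -
  have [measurable]: "f \<in> borel_measurable letter_measure" for f :: "nat \<Rightarrow> real"
    unfolding letter_measure_def by simp
  have "(\<lambda>X. f (X !! k)) \<in> borel_measurable (stream_space letter_measure)" for f :: "nat \<Rightarrow> real" and k
    by (rule measurable_compose[OF measurable_snth]) measurable
  then show ?thesis unfolding coding_def[abs_def] coding_term_def
    by (intro borel_measurable_suminf borel_measurable_times borel_measurable_prod) auto
qed

definition self_similar_measure :: "real measure" where
  "self_similar_measure = distr (stream_space letter_measure) borel coding"

lemma sets_self_similar_measure [simp, measurable_cong]: "sets self_similar_measure = sets borel"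
  by (simp add: self_similar_measure_def)

lemma prob_space_self_similar_measure: "prob_space self_similar_measure"
  unfolding self_similar_measure_def
  by (intro prob_space.prob_space_distr prob_space.prob_space_stream_space prob_space_letter coding_measurable)

lemma AE_self_similar_measure: "AE x in self_similar_measure. x \<in> {A..B}"
proof -
  have "AE X in stream_space letter_measure. coding X \<in> {A..B}"
    by (rule AE_I2) (simp only: space_stream_space letter_measure_basic coding_in)
  then show ?thesis unfolding self_similar_measure_def by (subst AE_distr_iff) auto
qed

text \<open>A random stream is a random first letter followed by an independent stream of the same
  law; \<open>coding_Cons\<close> turns the letter into a map.\<close>

lemma nn_integral_self_similar:
  assumes [measurable]: "f \<in> borel_measurable borel"
  shows "(\<integral>\<^sup>+x. f x \<partial>self_similar_measure) = (\<Sum>i=1..N. ennreal (r i powr \<delta>) * (\<integral>\<^sup>+x. f (S i x) \<partial>self_similar_measure))"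
proof -
  have [measurable]: "S i \<in> borel_measurable borel" for i unfolding S_def[abs_def] by measurable
  have "(\<integral>\<^sup>+x. f x \<partial>self_similar_measure) = (\<integral>\<^sup>+X. f (coding X) \<partial>stream_space letter_measure)"
    unfolding self_similar_measure_def by (simp add: nn_integral_distr)
  also have "\<dots> = (\<integral>\<^sup>+i. (\<integral>\<^sup>+X. f (coding (i ## X)) \<partial>stream_space letter_measure) \<partial>letter_measure)"
    by (rule prob_space.nn_integral_stream_space[OF prob_space_letter]) measurable
  also have "\<dots> = (\<Sum>i=1..N. ennreal (r i powr \<delta>) * (\<integral>\<^sup>+X. f (S i (coding X)) \<partial>stream_space letter_measure))"
    unfolding nn_integral_letter by (intro sum.cong) (auto simp: coding_Cons)
  also have "\<dots> = (\<Sum>i=1..N. ennreal (r i powr \<delta>) * (\<integral>\<^sup>+x. f (S i x) \<partial>self_similar_measure))"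
    unfolding self_similar_measure_def by (simp add: nn_integral_distr)
  finally show ?thesis .
qed

lemma nn_integral_self_similar_words:
  assumes "f \<in> borel_measurable borel"
  shows "(\<integral>\<^sup>+x. f x \<partial>self_similar_measure) =
    (\<Sum>w\<in>words_of_length N n. ennreal (word_ratio r w powr \<delta>) * (\<integral>\<^sup>+x. f (word_map w x) \<partial>self_similar_measure))"
  using assms
proof (induction n arbitrary: f)
  case 0
  then show ?case by (simp add: words_of_length_0)
next
  case (Suc n)
  have meas: "(\<lambda>x. f (S i x)) \<in> borel_measurable borel" for i
    using Suc.prems unfolding S_def by measurable
  have "(\<integral>\<^sup>+x. f x \<partial>self_similar_measure) = (\<Sum>i=1..N. ennreal (r i powr \<delta>) *
      (\<Sum>w\<in>words_of_length N n. ennreal (word_ratio r w powr \<delta>) * (\<integral>\<^sup>+x. f (S i (word_map w x)) \<partial>self_similar_measure)))"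
    unfolding nn_integral_self_similar[OF Suc.prems] Suc.IH[OF meas] ..
  also have "\<dots> = (\<Sum>i=1..N. \<Sum>w\<in>words_of_length N n. ennreal (word_ratio r (i # w) powr \<delta>) *
      (\<integral>\<^sup>+x. f (word_map (i # w) x) \<partial>self_similar_measure))"
    unfolding sum_distrib_left
  proof (intro sum.cong refl)
    fix i w assume iw: "i \<in> {1..N}" "w \<in> words_of_length N n"
    then have "word_ratio r (i # w) powr \<delta> = r i powr \<delta> * word_ratio r w powr \<delta>"
      using ratio_pos[of i] word_ratio_pos[of w] by (simp add: powr_mult words_of_length_def)
    then show "ennreal (r i powr \<delta>) * (ennreal (word_ratio r w powr \<delta>) * (\<integral>\<^sup>+x. f (S i (word_map w x)) \<partial>self_similar_measure)) =
        ennreal (word_ratio r (i # w) powr \<delta>) * (\<integral>\<^sup>+x. f (word_map (i # w) x) \<partial>self_similar_measure)"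
      by (simp add: ennreal_mult' mult.assoc)
  qed
  finally show ?case by (simp add: sum_words_of_length_Suc)
qed

end


section \<open>Images under conformal maps\<close>

text \<open>The derivative is a parameter, so the identity map with derivative 1 is an instance and
  K and F are treated by the same statements.\<close>

locale conformal_ifs = ifs N r s c A B K \<delta>
  for N r s c A B K \<delta> +
  fixes g dg :: "real \<Rightarrow> real"
  assumes g_deriv: "x \<in> {A..B} \<Longrightarrow> (g has_real_derivative dg x) (at x)"
    and dg_cont: "continuous_on {A..B} dg" and dg_nonzero: "x \<in> {A..B} \<Longrightarrow> dg x \<noteq> 0"
begin

definition F :: "real set" where "F = g ` K"

lemma g_cont: "continuous_on {A..B} g"
  using g_deriv by (intro DERIV_continuous_on[of _ _ dg]) (auto intro: DERIV_subset)

lemma g_mvt: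
  assumes "a \<in> {A..B}" "b \<in> {A..B}" "a \<noteq> b"
  obtains x where "min a b < x" "x < max a b" "\<bar>g b - g a\<bar> = \<bar>dg x\<bar> * \<bar>b - a\<bar>"
proof -
  have "min a b < max a b" using assms(3) by auto
  moreover have "(g has_real_derivative dg x) (at x)" if "min a b \<le> x" "x \<le> max a b" for x
    using that assms by (intro g_deriv) auto
  ultimately obtain x where x: "min a b < x" "x < max a b" "g (max a b) - g (min a b) = (max a b - min a b) * dg x"
    using MVT2[of "min a b" "max a b" g dg] by blast
  have "\<bar>g b - g a\<bar> = \<bar>g (max a b) - g (min a b)\<bar>" "\<bar>b - a\<bar> = \<bar>max a b - min a b\<bar>" by (auto simp: max_def min_def)
  then show thesis using that[OF x(1,2)] x(3) by (simp add: abs_mult)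
qed

lemma g_inj: "inj_on g {A..B}"
proof (rule inj_onI, rule ccontr)
  fix a b assume ab: "a \<in> {A..B}" "b \<in> {A..B}" "g a = g b" "a \<noteq> b"
  obtain x where x: "min a b < x" "x < max a b" "\<bar>g b - g a\<bar> = \<bar>dg x\<bar> * \<bar>b - a\<bar>" using g_mvt[OF ab(1,2,4)] .
  have "x \<in> {A..B}" using x ab by auto
  then show False using x(3) dg_nonzero ab by simp
qed

lemma F_compact: "compact F" and F_ne: "F \<noteq> {}"
  unfolding F_def using K_ne K_compact continuous_on_subset[OF g_cont K_sub] by (auto intro: compact_continuous_image)

lemma gaps_F: "directed_gaps F = map_prod g g ` directed_gaps K"
  unfolding F_def by (rule directed_gaps_image[OF g_cont g_inj K_sub])

lemma inj_map_prod_g: "inj_on (map_prod g g) (directed_gaps K)"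
proof (rule inj_on_subset)
  show "inj_on (map_prod g g) ({A..B} \<times> {A..B})" using g_inj by (rule map_prod_inj_on[OF _ g_inj])
  show "directed_gaps K \<subseteq> {A..B} \<times> {A..B}" using K_sub by (auto simp: directed_gaps_def)
qed

definition cyl :: "nat list \<Rightarrow> real set" where "cyl w = word_map w ` {A..B}"

lemma word_map_cont: "continuous_on UNIV (word_map w)"
proof (induction w)
  case Nil
  have "word_map [] = (\<lambda>x. x)" by auto
  then show ?case by simp
next
  case (Cons i w)
  have "word_map (i # w) = (\<lambda>x. s i * word_map w x + c i)" by (auto simp: S_def)
  then show ?case using Cons by (auto intro!: continuous_intros)
qed

lemma cyl_compact: "compact (cyl w)" and cyl_ne: "cyl w \<noteq> {}" and cyl_interval: "is_interval (cyl w)"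
proof -
  have c: "continuous_on {A..B} (word_map w)" using word_map_cont continuous_on_subset by blast
  show "compact (cyl w)" unfolding cyl_def by (rule compact_continuous_image[OF c]) simp
  show "cyl w \<noteq> {}" unfolding cyl_def using A_less_B by auto
  show "is_interval (cyl w)" unfolding cyl_def is_interval_connected_1 by (rule connected_continuous_image[OF c]) simp
qed

lemma cyl_sub: "set w \<subseteq> {1..N} \<Longrightarrow> cyl w \<subseteq> {A..B}"
  unfolding cyl_def using word_map_in by blast

lemma cyl_between: "a \<in> cyl w \<Longrightarrow> b \<in> cyl w \<Longrightarrow> min a b \<le> x \<Longrightarrow> x \<le> max a b \<Longrightarrow> x \<in> cyl w"
  using cyl_interval[of w] unfolding is_interval_1 by (metis max_def min_def)

lemma cyl_diam:
  assumes "set w \<subseteq> {1..N}" "x \<in> cyl w" "y \<in> cyl w" shows "dist x y \<le> rmax ^ length w * (B - A)"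
proof -
  obtain x' y' where xy: "x' \<in> {A..B}" "y' \<in> {A..B}" "x = word_map w x'" "y = word_map w y'" using assms by (auto simp: cyl_def)
  have "dist x y = word_ratio r w * dist x' y'" using dist_word_map[OF assms(1)] xy by simp
  also have "\<dots> \<le> rmax ^ length w * (B - A)"
    using word_ratio_le[OF assms(1)] word_ratio_pos[OF assms(1)] xy by (intro mult_mono) (auto simp: dist_real_def)
  finally show ?thesis .
qed

definition cyl_sup :: "(real \<Rightarrow> real) \<Rightarrow> nat list \<Rightarrow> real" where "cyl_sup \<phi> w = Sup (\<phi> ` cyl w)"
definition cyl_inf :: "(real \<Rightarrow> real) \<Rightarrow> nat list \<Rightarrow> real" where "cyl_inf \<phi> w = Inf (\<phi> ` cyl w)"

lemma cyl_sup_inf: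
  assumes \<phi>: "continuous_on {A..B} \<phi>" and w: "set w \<subseteq> {1..N}"
  shows "x \<in> cyl w \<Longrightarrow> \<phi> x \<le> cyl_sup \<phi> w" "x \<in> cyl w \<Longrightarrow> cyl_inf \<phi> w \<le> \<phi> x"
    "\<exists>x\<in>cyl w. cyl_sup \<phi> w = \<phi> x" "\<exists>x\<in>cyl w. cyl_inf \<phi> w = \<phi> x"
proof -
  have comp: "compact (\<phi> ` cyl w)"
    using cyl_compact continuous_on_subset[OF \<phi> cyl_sub[OF w]] by (intro compact_continuous_image)
  note bd = compact_imp_bdd[OF comp]
  show "x \<in> cyl w \<Longrightarrow> \<phi> x \<le> cyl_sup \<phi> w" "x \<in> cyl w \<Longrightarrow> cyl_inf \<phi> w \<le> \<phi> x"
    unfolding cyl_sup_def cyl_inf_def using bd by (auto intro: cSup_upper cInf_lower)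
  have ne: "\<phi> ` cyl w \<noteq> {}" using cyl_ne by auto
  show "\<exists>x\<in>cyl w. cyl_sup \<phi> w = \<phi> x" "\<exists>x\<in>cyl w. cyl_inf \<phi> w = \<phi> x"
    using closed_contains_Sup[OF ne bd(1) compact_imp_closed[OF comp]] closed_contains_Inf[OF ne bd(2) compact_imp_closed[OF comp]]
    unfolding cyl_sup_def cyl_inf_def by auto
qed

text \<open>The extremes of the two factors over a cylinder are attained at different points. The
  product is therefore taken as a function of two variables, uniformly continuous on the
  square.\<close>

lemma oscillation:
  assumes "continuous_on {A..B} \<phi>" "continuous_on {A..B} \<theta>" "\<eta> > (0::real)"
  shows "\<exists>n. \<forall>w\<in>words_of_length N n. \<forall>x\<in>cyl w. \<forall>y\<in>cyl w. \<forall>x'\<in>cyl w. \<forall>y'\<in>cyl w. \<bar>\<phi> x * \<theta> y - \<phi> x' * \<theta> y'\<bar> < (\<eta>::real)"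
proof -
  let ?h = "\<lambda>z. \<phi> (fst z) * \<theta> (snd z)"
  have "continuous_on ({A..B} \<times> {A..B}) ?h"
    by (intro continuous_on_mult continuous_on_compose2[OF assms(1)] continuous_on_compose2[OF assms(2)] continuous_intros) auto
  then have "uniformly_continuous_on ({A..B} \<times> {A..B}) ?h"
    by (rule compact_uniformly_continuous) (intro compact_Times compact_Icc)
  then obtain d where d: "d > 0" "\<And>z z'. z \<in> {A..B} \<times> {A..B} \<Longrightarrow> z' \<in> {A..B} \<times> {A..B} \<Longrightarrow> dist z z' < d \<Longrightarrow> dist (?h z) (?h z') < \<eta>"
    using assms(3) unfolding uniformly_continuous_on_def by metis
  have "d / (2 * (B - A)) > 0" using d A_less_B by simp
  \<comment> \<open>Makes cylinders of level n shorter than d / 2, so that the two coordinates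
    together move by less than d.\<close>
  then obtain n where n: "rmax ^ n < d / (2 * (B - A))" using real_arch_pow_inv rmax by metis
  have small: "rmax ^ n * (B - A) < d / 2" using n A_less_B by (simp add: field_simps)
  show ?thesis
  proof (intro exI[of _ n] ballI)
    fix w x y x' y' assume w: "w \<in> words_of_length N n" and xy: "x \<in> cyl w" "y \<in> cyl w" "x' \<in> cyl w" "y' \<in> cyl w"
    have w': "set w \<subseteq> {1..N}" "length w = n" using w by (auto simp: words_of_length_def)
    have "dist (x, y) (x', y') \<le> dist x x' + dist y y'"
      unfolding dist_prod_def by (simp add: sqrt_sum_squares_le_sum)
    also have "\<dots> < d" using cyl_diam[OF w'(1) xy(1,3)] cyl_diam[OF w'(1) xy(2,4)] small w'(2) by simp
    finally have "dist (?h (x, y)) (?h (x', y')) < \<eta>"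
      using xy cyl_sub[OF w'(1)] by (intro d(2)) auto
    then show "\<bar>\<phi> x * \<theta> y - \<phi> x' * \<theta> y'\<bar> < \<eta>" by (simp add: dist_real_def)
  qed
qed

abbreviation adg :: "real \<Rightarrow> real" where "adg \<equiv> \<lambda>x. \<bar>dg x\<bar>"

lemma adg_cont: "continuous_on {A..B} adg" using dg_cont by (intro continuous_intros)

lemma adg_bounds: 
  assumes "set w \<subseteq> {1..N}"
  shows "0 < cyl_inf adg w" "cyl_inf adg w \<le> cyl_sup adg w" "cyl_sup adg w \<le> cyl_sup adg []"
proof -
  note CS = cyl_sup_inf[OF adg_cont assms]
  obtain x where x: "x \<in> cyl w" "cyl_inf adg w = adg x" using CS(4) by blast
  have "x \<in> {A..B}" using x cyl_sub[OF assms] by auto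
  then show "0 < cyl_inf adg w" using dg_nonzero x by simp
  show "cyl_inf adg w \<le> cyl_sup adg w" using CS(1)[OF x(1)] x(2) by simp
  obtain y where y: "y \<in> cyl w" "cyl_sup adg w = adg y" using CS(3) by blast
  have "cyl [] = {A..B}" by (auto simp: cyl_def)
  then have "y \<in> cyl []" using y cyl_sub[OF assms] by auto
  then show "cyl_sup adg w \<le> cyl_sup adg []" using cyl_sup_inf(1)[OF adg_cont, of "[]" y] y by simp
qed

text \<open>By the mean value theorem g multiplies the length of the gap by the value of
  \<open>\<bar>dg\<bar>\<close> at a point of the gap, hence of the cylinder. If the image gap is
  longer than 2t, its boundary point lies inside it, so a test function is evaluated at g of a point
  of the same cylinder.\<close>

lemma gap_image_cyl:
  assumes w: "set w \<subseteq> {1..N}" and p: "p \<in> directed_gaps K"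
  defines "q \<equiv> gap_word w p"
  shows "cyl_inf adg w * (word_ratio r w * gap_length p) \<le> gap_length (map_prod g g q)"
    "gap_length (map_prod g g q) \<le> cyl_sup adg w * (word_ratio r w * gap_length p)"
    "fst q \<in> cyl w" "snd q \<in> cyl w"
    "0 < t \<Longrightarrow> 2 * t < gap_length (map_prod g g q) \<Longrightarrow> \<exists>x\<in>cyl w. dir_point t (gap_dir (map_prod g g q)) = g x"
proof -
  obtain a b where ab: "p = (a, b)" by fastforce
  note D = directed_gapsD[OF p[unfolded ab]]
  have q: "q = (word_map w a, word_map w b)" by (simp add: q_def ab gap_word_def)
  let ?a = "word_map w a" let ?b = "word_map w b"
  have AB: "a \<in> {A..B}" "b \<in> {A..B}" using D K_sub by auto
  then have in_cyl: "?a \<in> cyl w" "?b \<in> cyl w" by (auto simp: cyl_def)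
  then show "fst q \<in> cyl w" "snd q \<in> cyl w" by (simp_all add: q)
  note sub = cyl_sub[OF w]
  have len: "gap_length q = word_ratio r w * gap_length p" unfolding q_def by (rule gap_length_word[OF w])
  have "0 < gap_length q" using len word_ratio_pos[OF w] gap_length_pos[OF p] by simp
  then have ne: "?a \<noteq> ?b" by (auto simp: gap_length_def q)
  obtain x where x: "min ?a ?b < x" "x < max ?a ?b" "\<bar>g ?b - g ?a\<bar> = \<bar>dg x\<bar> * \<bar>?b - ?a\<bar>"
    using g_mvt[OF _ _ ne] in_cyl sub by blast
  have xc: "x \<in> cyl w" using cyl_between[OF in_cyl] x by simp
  have gl: "gap_length (map_prod g g q) = \<bar>dg x\<bar> * gap_length q" using x(3) by (simp add: gap_length_def q)
  note CS = cyl_sup_inf[OF adg_cont w]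
  show "cyl_inf adg w * (word_ratio r w * gap_length p) \<le> gap_length (map_prod g g q)"
    unfolding gl len[symmetric] using CS(2)[OF xc] \<open>0 < gap_length q\<close> by (intro mult_right_mono) auto
  show "gap_length (map_prod g g q) \<le> cyl_sup adg w * (word_ratio r w * gap_length p)"
    unfolding gl len[symmetric] using CS(1)[OF xc] \<open>0 < gap_length q\<close> by (intro mult_right_mono) auto
  assume t: "0 < t" "2 * t < gap_length (map_prod g g q)"
  let ?z = "dir_point t (gap_dir (map_prod g g q))"
  have z: "?z = g ?a + sgn (g ?b - g ?a) * t" by (simp add: q gap_dir_def dir_point_def)
  have "2 * t < \<bar>g ?b - g ?a\<bar>" using t by (simp add: q gap_length_def)
  then have btw: "min (g ?a) (g ?b) \<le> ?z \<and> ?z \<le> max (g ?a) (g ?b)" unfolding z using t(1) by (auto simp: sgn_if)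
  have cont: "continuous_on (cyl w) g" using g_cont sub continuous_on_subset by blast
  have "is_interval (g ` cyl w)" unfolding is_interval_connected_1
    by (rule connected_continuous_image[OF cont]) (use cyl_interval is_interval_connected_1 in blast)
  moreover have "g ?a \<in> g ` cyl w" "g ?b \<in> g ` cyl w" using in_cyl by auto
  ultimately have "?z \<in> g ` cyl w" using btw unfolding is_interval_1 by (metis max_def min_def)
  then show "\<exists>x\<in>cyl w. ?z = g x" by blast
qed

section \<open>Boundary sums of the image, compared with gap counts of K\<close>

definition dirs_sum :: "(real \<Rightarrow> real) \<Rightarrow> real \<Rightarrow> real" where
  "dirs_sum f t = (\<Sum>e\<in>boundary_dirs F t. f (dir_point t e))"

text \<open>The contribution of an image gap, pulled back to a pair of points. The guards make it
  vanish on every short pair and not merely on short gaps, as \<open>sum_long_gaps_words\<close>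
  requires.\<close>

definition gap_weight :: "(real \<Rightarrow> real) \<Rightarrow> real \<Rightarrow> real \<times> real \<Rightarrow> real" where
  "gap_weight f t p = (if fst p \<in> {A..B} \<and> snd p \<in> {A..B} \<and> 2 * t < gap_length (map_prod g g p)
     then f (dir_point t (gap_dir (map_prod g g p))) else 0)"

lemma gap_weight_vanishes:
  assumes "t > 0" "gap_length p \<le> 2 * (t / cyl_sup adg [])" shows "gap_weight f t p = 0"
proof -
  have M: "0 < cyl_sup adg []" using adg_bounds[of "[]"] by simp
  have "\<not> 2 * t < gap_length (map_prod g g p)" if p: "fst p \<in> {A..B}" "snd p \<in> {A..B}"
  proof (cases "fst p = snd p")
    case False
    obtain x where x: "min (fst p) (snd p) < x" "x < max (fst p) (snd p)"
      "\<bar>g (snd p) - g (fst p)\<bar> = \<bar>dg x\<bar> * \<bar>snd p - fst p\<bar>" using g_mvt[OF p False] .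
    have "x \<in> cyl []" using x p by (auto simp: cyl_def)
    then have "\<bar>dg x\<bar> \<le> cyl_sup adg []" using cyl_sup_inf(1)[OF adg_cont, of "[]"] by simp
    then have "gap_length (map_prod g g p) \<le> cyl_sup adg [] * gap_length p"
      using x(3) by (simp add: gap_length_def mult_right_mono)
    also have "\<dots> \<le> cyl_sup adg [] * (2 * (t / cyl_sup adg []))" using assms(2) M by (intro mult_left_mono) auto
    also have "\<dots> = 2 * t" using M by simp
    finally show ?thesis by simp
  qed (use assms(1) in \<open>simp add: gap_length_def\<close>)
  then show ?thesis by (auto simp: gap_weight_def)
qed

text \<open>g stretches by at most \<open>cyl_sup adg []\<close>, so an image gap longer than 2t
  comes from a gap of the index set on the right. The additional gaps there have weight 0.\<close>

lemma dirs_sum_eq: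
  assumes "t > 0"
  shows "dirs_sum f t = f (Sup F + t) + (f (Inf F - t) + (\<Sum>p\<in>long_gaps K (t / cyl_sup adg []). gap_weight f t p))"
proof -
  have M: "0 < cyl_sup adg []" using adg_bounds[of "[]"] by simp
  let ?e = "t / cyl_sup adg []"
  have e: "?e > 0" using assms M by simp
  have L: "long_gaps F t = map_prod g g ` {p \<in> directed_gaps K. 2 * t < gap_length (map_prod g g p)}"
    unfolding long_gaps_def gaps_F by auto
  have guard: "fst p \<in> {A..B}" "snd p \<in> {A..B}" if "p \<in> directed_gaps K" for p
    using that K_sub by (auto simp: directed_gaps_def)
  have "(\<Sum>p\<in>long_gaps F t. f (dir_point t (gap_dir p))) =
      (\<Sum>p\<in>{p \<in> directed_gaps K. 2 * t < gap_length (map_prod g g p)}. f (dir_point t (gap_dir (map_prod g g p))))"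
    unfolding L by (subst sum.reindex) (auto intro: inj_on_subset[OF inj_map_prod_g])
  also have "\<dots> = (\<Sum>p\<in>{p \<in> directed_gaps K. 2 * t < gap_length (map_prod g g p)}. gap_weight f t p)"
    using guard by (intro sum.cong) (auto simp: gap_weight_def)
  also have "\<dots> = (\<Sum>p\<in>long_gaps K ?e. gap_weight f t p)"
  proof (rule sum.mono_neutral_left)
    show "finite (long_gaps K ?e)" using e by (rule finite_long_gaps)
    show "{p \<in> directed_gaps K. 2 * t < gap_length (map_prod g g p)} \<subseteq> long_gaps K ?e"
    proof
      fix p assume p: "p \<in> {p \<in> directed_gaps K. 2 * t < gap_length (map_prod g g p)}"
      have "gap_weight (\<lambda>_. 1) t p = 1" using p guard[of p] by (simp add: gap_weight_def)
      then have "\<not> gap_length p \<le> 2 * ?e" using gap_weight_vanishes[OF assms, of p "\<lambda>_. 1"] by auto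
      then show "p \<in> long_gaps K ?e" using p by (simp add: long_gaps_def)
    qed
  qed (auto simp: gap_weight_def long_gaps_def)
  finally have "(\<Sum>p\<in>long_gaps F t. f (dir_point t (gap_dir p))) = (\<Sum>p\<in>long_gaps K ?e. gap_weight f t p)" .
  then show ?thesis unfolding dirs_sum_def sum_boundary_dirs(1)[OF F_compact F_ne assms] by (simp add: dir_point_def)
qed

lemma sum_threshold:
  assumes "t > 0" "0 < l" "l \<le> L"
  shows "(\<Sum>p\<in>long_gaps K (t / L). if 2 * t < l * gap_length p then v else 0) = v * gap_count (t / l)"
proof -
  have fin: "finite (long_gaps K (t / L))" using assms by (intro finite_long_gaps) auto
  have "{p \<in> long_gaps K (t / L). 2 * t < l * gap_length p} = long_gaps K (t / l)"
  proof -
    have "2 * t < l * x \<longleftrightarrow> 2 * (t / l) < x" for x using assms by (simp add: pos_divide_less_eq mult.commute)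
    moreover have "t / L \<le> t / l" using assms by (intro divide_left_mono) auto
    ultimately show ?thesis unfolding long_gaps_def by force
  qed
  then show ?thesis using fin assms by (simp add: sum.If_cases Int_def gap_count_def mult.commute)
qed

text \<open>The factor 1/2 is \<open>curvature_factor 0\<close>: with the exponent from
  \<open>scaling_exponent_F\<close>, this is the integral of f against the rescaled measure for k =
  0.\<close>

definition scaled_sum :: "(real \<Rightarrow> real) \<Rightarrow> real \<Rightarrow> real" where
  "scaled_sum f t = (if 0 < t then t powr \<delta> / 2 * dirs_sum f t else 0)"

text \<open>In the cylinder of w, the length of an image gap lies between two multiples of the
  length of a gap of K, and f between its extremes over the image. Replacing lengths and values by
  these extremes leaves counts of gaps of K at scaled thresholds.\<close>

lemma scaled_sum_sandwich:
  fixes f :: "real \<Rightarrow> real"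
  assumes f: "continuous_on UNIV f" "\<And>x. 0 \<le> f x" "\<And>x. f x \<le> b"
  shows "\<exists>M. \<forall>t>0.
    (\<Sum>w\<in>words_of_length N n. cyl_inf (\<lambda>x. f (g x)) w * (cyl_inf adg w * word_ratio r w) powr \<delta> / 2 *
      scaled_count (t / (cyl_inf adg w * word_ratio r w))) \<le> scaled_sum f t \<and>
    scaled_sum f t \<le> M * t powr \<delta> +
    (\<Sum>w\<in>words_of_length N n. cyl_sup (\<lambda>x. f (g x)) w * (cyl_sup adg w * word_ratio r w) powr \<delta> / 2 *
      scaled_count (t / (cyl_sup adg w * word_ratio r w)))"
proof -
  let ?W = "words_of_length N n"
  let ?u = "\<lambda>x. f (g x)"
  have u_cont: "continuous_on {A..B} ?u" by (rule continuous_on_compose2[OF f(1) g_cont]) auto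
  obtain M where M: "M \<ge> 0" "\<And>\<epsilon> \<Psi> b. \<epsilon> > 0 \<Longrightarrow> (\<And>p. gap_length p \<le> 2 * \<epsilon> \<Longrightarrow> \<Psi> p = 0) \<Longrightarrow> (\<And>p. 0 \<le> \<Psi> p \<and> \<Psi> p \<le> (b::real)) \<Longrightarrow>
    (\<Sum>w\<in>?W. \<Sum>p\<in>long_gaps K \<epsilon>. \<Psi> (gap_word w p)) \<le> (\<Sum>p\<in>long_gaps K \<epsilon>. \<Psi> p) \<and>
    (\<Sum>p\<in>long_gaps K \<epsilon>. \<Psi> p) \<le> (\<Sum>w\<in>?W. \<Sum>p\<in>long_gaps K \<epsilon>. \<Psi> (gap_word w p)) + b * M"
    using sum_long_gaps_words[of n] by meson
  have b0: "0 \<le> b" using f(2,3)[of 0] by simp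
  define Mx where "Mx = cyl_sup adg []"
  have Mx: "0 < Mx" unfolding Mx_def using adg_bounds[of "[]"] by simp
  \<comment> \<open>Half of \<open>2 * b + b * M\<close>: the two outer points contribute at most
    2b, and the gaps not reached by words of length n at most \<open>b * M\<close>.\<close>
  show ?thesis
  proof (intro exI[of _ "b + b * M / 2"] allI impI)
    fix t :: real assume t: "t > 0"
    let ?e = "t / Mx"
    let ?G = "long_gaps K ?e"
    have e: "?e > 0" using t Mx by simp
    have sandwich: "(\<Sum>w\<in>?W. \<Sum>p\<in>?G. gap_weight f t (gap_word w p)) \<le> (\<Sum>p\<in>?G. gap_weight f t p) \<and>
      (\<Sum>p\<in>?G. gap_weight f t p) \<le> (\<Sum>w\<in>?W. \<Sum>p\<in>?G. gap_weight f t (gap_word w p)) + b * M"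
      by (rule M(2)[OF e]) (use gap_weight_vanishes[OF t] f b0 in \<open>auto simp: Mx_def gap_weight_def\<close>)
    have word: "cyl_inf ?u w * gap_count (t / (cyl_inf adg w * word_ratio r w)) \<le> (\<Sum>p\<in>?G. gap_weight f t (gap_word w p)) \<and>
      (\<Sum>p\<in>?G. gap_weight f t (gap_word w p)) \<le> cyl_sup ?u w * gap_count (t / (cyl_sup adg w * word_ratio r w))" if "w \<in> ?W" for w
    proof -
      have w: "set w \<subseteq> {1..N}" using that by (simp add: words_of_length_def)
      note rw = word_ratio_pos[OF w]
      note ab = adg_bounds[OF w, folded Mx_def]
      have "word_ratio r w \<le> 1" using word_ratio_le[OF w] rmax power_le_one[of rmax "length w"] by linarith
      then have le: "cyl_sup adg w * word_ratio r w \<le> Mx" using ab rw by (smt (verit) mult_left_le)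
      then have le2: "cyl_inf adg w * word_ratio r w \<le> Mx" using ab rw by (smt (verit) mult_right_mono)
      note CS = cyl_sup_inf[OF u_cont w]
      have pos: "0 \<le> cyl_inf ?u w" "0 \<le> cyl_sup ?u w" using CS(3,4) f(2) by metis+
      \<comment> \<open>A counted image gap passes the larger threshold and has its boundary point
        in the image of the cylinder; one that is not counted has weight 0 and fails the smaller
        threshold as well.\<close>
      have pw: "(if 2 * t < (cyl_inf adg w * word_ratio r w) * gap_length p then cyl_inf ?u w else 0) \<le> gap_weight f t (gap_word w p) \<and>
        gap_weight f t (gap_word w p) \<le> (if 2 * t < (cyl_sup adg w * word_ratio r w) * gap_length p then cyl_sup ?u w else 0)"
        if "p \<in> ?G" for p
      proof -
        have p: "p \<in> directed_gaps K" using that by (simp add: long_gaps_def)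
        note gi = gap_image_cyl[OF w p]
        let ?q = "map_prod g g (gap_word w p)"
        have grd: "fst (gap_word w p) \<in> {A..B}" "snd (gap_word w p) \<in> {A..B}" using gi(3,4) cyl_sub[OF w] by auto
        show ?thesis
        proof (cases "2 * t < gap_length ?q")
          case True
          then obtain x where x: "x \<in> cyl w" "dir_point t (gap_dir ?q) = g x" using gi(5)[OF t] by blast
          then have "gap_weight f t (gap_word w p) = ?u x" using True grd by (simp add: gap_weight_def)
          moreover have "2 * t < (cyl_sup adg w * word_ratio r w) * gap_length p" using True gi(2) by (simp add: mult.assoc)
          ultimately show ?thesis using CS(1,2)[OF x(1)] f(2) by auto
        next
          case False
          then have "\<not> 2 * t < (cyl_inf adg w * word_ratio r w) * gap_length p" using gi(1) by (simp add: mult.assoc)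
          then show ?thesis using False pos by (simp add: gap_weight_def)
        qed
      qed
      have "(\<Sum>p\<in>?G. if 2 * t < (cyl_inf adg w * word_ratio r w) * gap_length p then cyl_inf ?u w else 0) \<le> (\<Sum>p\<in>?G. gap_weight f t (gap_word w p))"
        "(\<Sum>p\<in>?G. gap_weight f t (gap_word w p)) \<le> (\<Sum>p\<in>?G. if 2 * t < (cyl_sup adg w * word_ratio r w) * gap_length p then cyl_sup ?u w else 0)"
        using pw by (blast intro: sum_mono)+
      moreover have "0 < cyl_inf adg w * word_ratio r w" "0 < cyl_sup adg w * word_ratio r w" using ab rw by auto
      ultimately show ?thesis using sum_threshold[OF t _ le] sum_threshold[OF t _ le2] by simp
    qed
    have conv: "t powr \<delta> / 2 * (v * gap_count (t / l)) = v * l powr \<delta> / 2 * scaled_count (t / l)" if "l > 0" for v l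
      using that t by (simp add: scaled_count_def powr_divide)
    have lpos: "0 < cyl_inf adg w * word_ratio r w" "0 < cyl_sup adg w * word_ratio r w" if "w \<in> ?W" for w
    proof -
      have w: "set w \<subseteq> {1..N}" using that by (simp add: words_of_length_def)
      show "0 < cyl_inf adg w * word_ratio r w" "0 < cyl_sup adg w * word_ratio r w"
        using adg_bounds[OF w] word_ratio_pos[OF w] by auto
    qed
    have lo: "(\<Sum>w\<in>?W. cyl_inf ?u w * (cyl_inf adg w * word_ratio r w) powr \<delta> / 2 * scaled_count (t / (cyl_inf adg w * word_ratio r w)))
      = t powr \<delta> / 2 * (\<Sum>w\<in>?W. cyl_inf ?u w * gap_count (t / (cyl_inf adg w * word_ratio r w)))"
      unfolding sum_distrib_left by (intro sum.cong refl conv[symmetric] lpos)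
    have hi: "(\<Sum>w\<in>?W. cyl_sup ?u w * (cyl_sup adg w * word_ratio r w) powr \<delta> / 2 * scaled_count (t / (cyl_sup adg w * word_ratio r w)))
      = t powr \<delta> / 2 * (\<Sum>w\<in>?W. cyl_sup ?u w * gap_count (t / (cyl_sup adg w * word_ratio r w)))"
      unfolding sum_distrib_left by (intro sum.cong refl conv[symmetric] lpos)
    have "(\<Sum>w\<in>?W. cyl_inf ?u w * gap_count (t / (cyl_inf adg w * word_ratio r w))) \<le> (\<Sum>w\<in>?W. \<Sum>p\<in>?G. gap_weight f t (gap_word w p))"
      using word by (intro sum_mono) blast
    then have d1: "(\<Sum>w\<in>?W. cyl_inf ?u w * gap_count (t / (cyl_inf adg w * word_ratio r w))) \<le> dirs_sum f t"
      unfolding dirs_sum_eq[OF t] Mx_def[symmetric] using sandwich f(2)[of "Sup F + t"] f(2)[of "Inf F - t"] by linarith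
    have "(\<Sum>w\<in>?W. \<Sum>p\<in>?G. gap_weight f t (gap_word w p)) \<le> (\<Sum>w\<in>?W. cyl_sup ?u w * gap_count (t / (cyl_sup adg w * word_ratio r w)))"
      using word by (intro sum_mono) blast
    then have d2: "dirs_sum f t \<le> 2 * b + b * M + (\<Sum>w\<in>?W. cyl_sup ?u w * gap_count (t / (cyl_sup adg w * word_ratio r w)))"
      unfolding dirs_sum_eq[OF t] Mx_def[symmetric] using sandwich f(3)[of "Sup F + t"] f(3)[of "Inf F - t"] by linarith
    have tp: "0 \<le> t powr \<delta> / 2" by simp
    show "(\<Sum>w\<in>?W. cyl_inf ?u w * (cyl_inf adg w * word_ratio r w) powr \<delta> / 2 *
      scaled_count (t / (cyl_inf adg w * word_ratio r w))) \<le> scaled_sum f t \<and>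
    scaled_sum f t \<le> (b + b * M / 2) * t powr \<delta> +
    (\<Sum>w\<in>?W. cyl_sup ?u w * (cyl_sup adg w * word_ratio r w) powr \<delta> / 2 *
      scaled_count (t / (cyl_sup adg w * word_ratio r w)))"
      unfolding lo hi scaled_sum_def if_P[OF t] using mult_left_mono[OF d1 tp] mult_left_mono[OF d2 tp] by (simp add: algebra_simps)
  qed
qed

end


text \<open>The contribution of the two outer boundary points is unbounded for large \<open>t\<close>; only \<open>t \<le> 1\<close> matters.\<close>

definition unit_trunc :: "(real \<Rightarrow> real) \<Rightarrow> real \<Rightarrow> real" where
  "unit_trunc f x = (if x \<le> 1 then f x else 0)"

lemma mode_limit_cong:
  assumes "\<And>x. 0 < x \<Longrightarrow> x \<le> 1 \<Longrightarrow> f x = f' x"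
  shows "mode_limit avg f L \<longleftrightarrow> mode_limit avg f' L"
proof -
  have "\<forall>\<^sub>F T in at_right 0. mode_value avg f T = mode_value avg f' T"
    using eventually_unit_interval
    by eventually_elim (use assms in \<open>auto simp: mode_value_def intro!: arg_cong2[of _ _ _ _ "(/)"] log_integral_cong\<close>)
  then show ?thesis unfolding mode_limit_def by (rule tendsto_cong)
qed

context ifs
begin

lemma sum_word_prob: "(\<Sum>w\<in>words_of_length N n. word_ratio r w powr \<delta>) = 1"
proof (induction n)
  case (Suc n)
  have "(\<Sum>w\<in>words_of_length N (Suc n). word_ratio r w powr \<delta>) =
      (\<Sum>i=1..N. \<Sum>w\<in>words_of_length N n. r i powr \<delta> * word_ratio r w powr \<delta>)"
    unfolding sum_words_of_length_Suc
    using ratio_pos word_ratio_pos by (intro sum.cong refl) (auto simp: powr_mult words_of_length_def less_imp_le)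
  then show ?case using Suc moran by (simp add: sum_distrib_left[symmetric])
qed (simp add: words_of_length_0)

end

section \<open>Limits of the boundary sums\<close>

context conformal_ifs
begin

lemma nn_integral_curvature_0:
  assumes "f \<in> borel_measurable borel" "\<And>x. 0 \<le> f x" "t > 0"
  shows "(\<integral>\<^sup>+x. ennreal (f x) \<partial>curvature_measure 0 F t) = ennreal (dirs_sum f t)"
  using assms unfolding dirs_sum_def
  by (subst nn_integral_curvature_measure_0[OF F_compact F_ne]) (auto simp: sum_ennreal)

lemma dirs_sum_nonneg: "(\<And>x. 0 \<le> f x) \<Longrightarrow> 0 \<le> dirs_sum f t"
  unfolding dirs_sum_def by (intro sum_nonneg) auto

lemma scaled_sum_nonneg: "(\<And>x. 0 \<le> f x) \<Longrightarrow> 0 \<le> scaled_sum f t"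
  unfolding scaled_sum_def using dirs_sum_nonneg by simp

lemma scaled_sum_measurable:
  assumes [measurable]: "f \<in> borel_measurable borel" and "\<And>x. 0 \<le> f x"
  shows "scaled_sum f \<in> borel_measurable borel"
proof -
  let ?I = "\<lambda>t. \<integral>\<^sup>+e. indicator (boundary_dirs F t) e * ennreal (f (dir_point t e)) \<partial>count_space (all_dirs F)"
  have [measurable]: "?I \<in> borel_measurable borel"
    using compact_imp_bounded[OF F_compact] by (intro borel_measurable_dirs_integral) auto
  have "dirs_sum f t = enn2real (?I t)" if "t > 0" for t
    using nn_integral_curvature_0[OF assms that] nn_integral_curvature_measure_0'[OF F_compact F_ne that, of "\<lambda>x. ennreal (f x)"] dirs_sum_nonneg[of f t] assms(2)
    by simp
  then have "scaled_sum f = (\<lambda>t. if 0 < t then t powr \<delta> / 2 * enn2real (?I t) else 0)"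
    by (auto simp: scaled_sum_def)
  then show ?thesis by simp
qed

lemma count_combination_lb:
  assumes "\<And>w. w \<in> W \<Longrightarrow> 0 < l w"
  shows "locally_bounded_fun (\<lambda>t. \<Sum>w\<in>W. v w * scaled_count (t / l w))"
  using assms by (intro locally_bounded_fun_sum locally_bounded_fun_cmult locally_bounded_fun_scale scaled_count_lb)

lemma count_combination_limit:
  assumes "finite W" "\<And>w. w \<in> W \<Longrightarrow> 0 < l w" "mode_limit avg scaled_count gap_constant"
  shows "mode_limit avg (\<lambda>t. \<Sum>w\<in>W. v w * scaled_count (t / l w)) (\<Sum>w\<in>W. v w * gap_constant)"
  using assms by (intro mode_limit_sum locally_bounded_fun_cmult locally_bounded_fun_scale scaled_count_lb mode_limit_cmult mode_limit_scale)

lemma cyl_scale_pos: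
  assumes "w \<in> words_of_length N n"
  shows "0 < cyl_inf adg w * word_ratio r w" "0 < cyl_sup adg w * word_ratio r w"
proof -
  have w: "set w \<subseteq> {1..N}" using assms by (simp add: words_of_length_def)
  show "0 < cyl_inf adg w * word_ratio r w" "0 < cyl_sup adg w * word_ratio r w"
    using adg_bounds[OF w] word_ratio_pos[OF w] by auto
qed

lemma count_combination_powr_lb:
  "locally_bounded_fun (\<lambda>t. M * t powr \<delta> + (\<Sum>w\<in>words_of_length N n. v w * scaled_count (t / (cyl_sup adg w * word_ratio r w))))"
proof (rule locally_bounded_fun_add)
  show "locally_bounded_fun (\<lambda>t. M * t powr \<delta>)"
    using dim_pos by (intro locally_bounded_fun_cmult locally_bounded_fun_powr) simp
  show "locally_bounded_fun (\<lambda>t. \<Sum>w\<in>words_of_length N n. v w * scaled_count (t / (cyl_sup adg w * word_ratio r w)))"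
    by (rule count_combination_lb) (rule cyl_scale_pos(2))
qed

lemma scaled_sum_lower:
  fixes f :: "real \<Rightarrow> real"
  assumes f: "continuous_on UNIV f" "\<And>x. 0 \<le> f x" "\<And>x. f x \<le> b" and "t > 0"
  shows "(\<Sum>w\<in>words_of_length N n. cyl_inf (\<lambda>x. f (g x)) w * (cyl_inf adg w * word_ratio r w) powr \<delta> / 2 *
      scaled_count (t / (cyl_inf adg w * word_ratio r w))) \<le> scaled_sum f t"
  by (rule exE[OF scaled_sum_sandwich[OF f, of n]])
    (drule spec, drule mp[OF _ \<open>t > 0\<close>], erule conjunct1)

lemma scaled_sum_upper:
  fixes f :: "real \<Rightarrow> real"
  assumes f: "continuous_on UNIV f" "\<And>x. 0 \<le> f x" "\<And>x. f x \<le> b"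
  obtains M where "\<forall>t>0. scaled_sum f t \<le> M * t powr \<delta> +
    (\<Sum>w\<in>words_of_length N n. cyl_sup (\<lambda>x. f (g x)) w * (cyl_sup adg w * word_ratio r w) powr \<delta> / 2 *
      scaled_count (t / (cyl_sup adg w * word_ratio r w)))"
  by (rule exE[OF scaled_sum_sandwich[OF f, of n]])
    (rule that, intro allI impI, drule spec, drule mp, assumption, erule conjunct2)

lemma scaled_sum_lb:
  assumes f: "continuous_on UNIV f" "\<And>x. 0 \<le> f x" "\<And>x. f x \<le> b"
  shows "locally_bounded_fun (scaled_sum f)"
proof (rule locally_bounded_funI)
  show "scaled_sum f \<in> borel_measurable borel"
    using f by (intro scaled_sum_measurable borel_measurable_continuous_onI)
  fix E :: real
  let ?up = "\<lambda>M t. M * t powr \<delta> + (\<Sum>w\<in>words_of_length N 0. cyl_sup (\<lambda>x. f (g x)) w * (cyl_sup adg w * word_ratio r w) powr \<delta> / 2 *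
      scaled_count (t / (cyl_sup adg w * word_ratio r w)))"
  obtain M where M: "\<forall>t>0. scaled_sum f t \<le> ?up M t" by (rule scaled_sum_upper[OF f, where n = 0])
  have "locally_bounded_fun (?up M)"
    by (rule count_combination_powr_lb)
  then have "\<exists>C. \<forall>x. 0 < x \<longrightarrow> x \<le> E \<longrightarrow> \<bar>?up M x\<bar> \<le> C"
    unfolding locally_bounded_fun_def by (rule conjunct2[THEN spec])
  then obtain C where C: "\<forall>x. 0 < x \<longrightarrow> x \<le> E \<longrightarrow> \<bar>?up M x\<bar> \<le> C" by (rule exE)
  have "\<bar>scaled_sum f x\<bar> \<le> C" if "0 < x" "x \<le> E" for x
    unfolding abs_of_nonneg[OF scaled_sum_nonneg[OF f(2)]]
    by (rule order_trans[OF M[rule_format, OF that(1)] order_trans[OF abs_ge_self C[rule_format, OF that]]])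
  then show "\<exists>B. \<forall>x. 0 < x \<longrightarrow> x \<le> E \<longrightarrow> \<bar>scaled_sum f x\<bar> \<le> B" by blast
qed

definition image_density :: "real \<Rightarrow> real" where
  "image_density x = indicator {A..B} x * \<bar>dg x\<bar> powr \<delta>"

text \<open>The indicator makes the integrand Borel measurable, as g and its derivative are
  controlled on [A, B] only; the self-similar measure lives there.\<close>

definition limit_integral :: "(real \<Rightarrow> real) \<Rightarrow> ennreal" where
  "limit_integral f = (\<integral>\<^sup>+x. ennreal (indicator {A..B} x * (f (g x) * \<bar>dg x\<bar> powr \<delta>)) \<partial>self_similar_measure)"

lemma dgpow_cont: "continuous_on {A..B} (\<lambda>x. \<bar>dg x\<bar> powr \<delta>)"
  using dg_nonzero by (intro continuous_intros dg_cont) auto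

lemma limit_integrand_measurable:
  assumes "continuous_on UNIV f"
  shows "(\<lambda>x. indicator {A..B} x * (f (g x) * \<bar>dg x\<bar> powr \<delta>)) \<in> borel_measurable borel"
proof -
  have "continuous_on {A..B} (\<lambda>x. f (g x) * \<bar>dg x\<bar> powr \<delta>)"
    by (intro continuous_on_mult dgpow_cont continuous_on_compose2[OF assms g_cont]) auto
  from borel_measurable_continuous_on_indicator[OF _ this] show ?thesis by simp
qed

text \<open>Self-similarity splits the integral over words with weights
  \<open>word_ratio r w powr \<delta>\<close>, and each integrand lies between the products of
  extremes that occur in \<open>scaled_sum_sandwich\<close>. Limits of sums and the integral thus
  share their bounds.\<close>

lemma limit_integral_bounds:
  assumes f: "continuous_on UNIV f" "\<And>x. 0 \<le> f x"
  defines "lo \<equiv> \<lambda>w. cyl_inf (\<lambda>x. f (g x)) w * cyl_inf adg w powr \<delta>"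
    and "hi \<equiv> \<lambda>w. cyl_sup (\<lambda>x. f (g x)) w * cyl_sup adg w powr \<delta>"
  shows "ennreal (\<Sum>w\<in>words_of_length N n. word_ratio r w powr \<delta> * lo w) \<le> limit_integral f"
    "limit_integral f \<le> ennreal (\<Sum>w\<in>words_of_length N n. word_ratio r w powr \<delta> * hi w)"
proof -
  let ?W = "words_of_length N n"
  let ?\<psi> = "\<lambda>x. indicator {A..B} x * (f (g x) * \<bar>dg x\<bar> powr \<delta>)"
  have u_cont: "continuous_on {A..B} (\<lambda>x. f (g x))" by (rule continuous_on_compose2[OF f(1) g_cont]) auto
  have [measurable]: "(\<lambda>x. ennreal (?\<psi> x)) \<in> borel_measurable borel"
    using limit_integrand_measurable[OF f(1)] by measurable
  have "word_map w \<in> borel_measurable borel" for w using word_map_cont by (rule borel_measurable_continuous_onI)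
  note [measurable] = this
  interpret P: prob_space self_similar_measure by (rule prob_space_self_similar_measure)
  have pw: "ennreal (lo w) \<le> (\<integral>\<^sup>+x. ennreal (?\<psi> (word_map w x)) \<partial>self_similar_measure) \<and>
      (\<integral>\<^sup>+x. ennreal (?\<psi> (word_map w x)) \<partial>self_similar_measure) \<le> ennreal (hi w) \<and> 0 \<le> lo w \<and> 0 \<le> hi w" if "w \<in> ?W" for w
  proof -
    have w: "set w \<subseteq> {1..N}" using that by (simp add: words_of_length_def)
    note CU = cyl_sup_inf[OF u_cont w] and CA = cyl_sup_inf[OF adg_cont w]
    have pos: "0 \<le> cyl_inf (\<lambda>x. f (g x)) w" "0 \<le> cyl_sup (\<lambda>x. f (g x)) w" using CU(3,4) f(2) by metis+
    have bd: "lo w \<le> ?\<psi> (word_map w x) \<and> ?\<psi> (word_map w x) \<le> hi w" if x: "x \<in> {A..B}" for x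
    proof -
      let ?y = "word_map w x"
      have y: "?y \<in> cyl w" "?y \<in> {A..B}" using x word_map_in[OF w] by (auto simp: cyl_def)
      have "cyl_inf adg w powr \<delta> \<le> \<bar>dg ?y\<bar> powr \<delta>" "\<bar>dg ?y\<bar> powr \<delta> \<le> cyl_sup adg w powr \<delta>"
        using CA(1,2)[OF y(1)] adg_bounds[OF w] dim_pos by (auto intro!: powr_mono2)
      then show ?thesis unfolding lo_def hi_def using CU(1,2)[OF y(1)] y(2) pos f(2) by (auto intro!: mult_mono)
    qed
    have "(\<integral>\<^sup>+x. ennreal (lo w) \<partial>self_similar_measure) \<le> (\<integral>\<^sup>+x. ennreal (?\<psi> (word_map w x)) \<partial>self_similar_measure)"
      by (intro nn_integral_mono_AE) (rule AE_mp[OF AE_self_similar_measure], intro AE_I2 impI ennreal_leI, use bd in blast)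
    moreover have "(\<integral>\<^sup>+x. ennreal (?\<psi> (word_map w x)) \<partial>self_similar_measure) \<le> (\<integral>\<^sup>+x. ennreal (hi w) \<partial>self_similar_measure)"
      by (intro nn_integral_mono_AE) (rule AE_mp[OF AE_self_similar_measure], intro AE_I2 impI ennreal_leI, use bd in blast)
    ultimately show ?thesis using P.emeasure_space_1 pos by (simp add: lo_def hi_def)
  qed
  have eq: "limit_integral f = (\<Sum>w\<in>?W. ennreal (word_ratio r w powr \<delta>) * (\<integral>\<^sup>+x. ennreal (?\<psi> (word_map w x)) \<partial>self_similar_measure))"
    unfolding limit_integral_def by (rule nn_integral_self_similar_words) measurable
  have "ennreal (\<Sum>w\<in>?W. word_ratio r w powr \<delta> * lo w) = (\<Sum>w\<in>?W. ennreal (word_ratio r w powr \<delta>) * ennreal (lo w))"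
    using pw by (subst sum_ennreal[symmetric]) (auto simp: ennreal_mult)
  also have "\<dots> \<le> limit_integral f" unfolding eq using pw by (intro sum_mono mult_left_mono) auto
  finally show "ennreal (\<Sum>w\<in>?W. word_ratio r w powr \<delta> * lo w) \<le> limit_integral f" .
  have "limit_integral f \<le> (\<Sum>w\<in>?W. ennreal (word_ratio r w powr \<delta>) * ennreal (hi w))"
    unfolding eq using pw by (intro sum_mono mult_left_mono) auto
  also have "\<dots> = ennreal (\<Sum>w\<in>?W. word_ratio r w powr \<delta> * hi w)"
    using pw by (subst sum_ennreal[symmetric]) (auto simp: ennreal_mult)
  finally show "limit_integral f \<le> ennreal (\<Sum>w\<in>?W. word_ratio r w powr \<delta> * hi w)" .
qed

lemma limit_integral_finite:
  assumes f: "continuous_on UNIV f" "\<And>x. 0 \<le> f x" shows "limit_integral f < \<top>"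
  using limit_integral_bounds(2)[OF f, of 0] by (rule le_less_trans) simp

text \<open>At level n the limits of both sides of the sandwich are \<open>gap_constant / 2\<close>
  times Lo and Hi, the claimed limit lies between them, and uniform continuity makes Hi - Lo
  small.\<close>

theorem scaled_sum_limit:
  assumes f: "continuous_on UNIV f" "\<And>x. 0 \<le> f x" "\<And>x. f x \<le> b"
    and lim: "mode_limit avg scaled_count gap_constant"
  shows "mode_limit avg (scaled_sum f) (gap_constant / 2 * enn2real (limit_integral f))"
proof (rule mode_limit_squeeze[OF scaled_sum_lb[OF f]])
  fix \<eta> :: real assume eta: "\<eta> > 0"
  \<comment> \<open>The added 1 keeps the quotient defined when \<open>gap_constant\<close> is 0,
    while \<open>gap_constant / 2 * \<eta>'\<close> is still at most \<eta>.\<close>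
  define \<eta>' where "\<eta>' = \<eta> / (gap_constant / 2 + 1)"
  have eta': "\<eta>' > 0" "gap_constant / 2 * \<eta>' \<le> \<eta>"
    using eta gap_constant_nonneg by (auto simp: \<eta>'_def field_simps)
  let ?u = "\<lambda>x. f (g x)"
  have u_cont: "continuous_on {A..B} ?u" by (rule continuous_on_compose2[OF f(1) g_cont]) auto
  obtain n where n: "\<And>w x y x' y'. w \<in> words_of_length N n \<Longrightarrow> x \<in> cyl w \<Longrightarrow> y \<in> cyl w \<Longrightarrow> x' \<in> cyl w \<Longrightarrow> y' \<in> cyl w \<Longrightarrow>
    \<bar>?u x * (\<bar>dg y\<bar> powr \<delta>) - ?u x' * (\<bar>dg y'\<bar> powr \<delta>)\<bar> < \<eta>'"
    using oscillation[OF u_cont dgpow_cont eta'(1)] by blast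
  let ?W = "words_of_length N n"
  define lo where "lo = (\<lambda>w. cyl_inf ?u w * cyl_inf adg w powr \<delta>)"
  define hi where "hi = (\<lambda>w. cyl_sup ?u w * cyl_sup adg w powr \<delta>)"
  define Lo where "Lo = (\<Sum>w\<in>?W. word_ratio r w powr \<delta> * lo w)"
  define Hi where "Hi = (\<Sum>w\<in>?W. word_ratio r w powr \<delta> * hi w)"
  let ?J = "enn2real (limit_integral f)"
  have hl: "hi w - lo w \<le> \<eta>'" "0 \<le> lo w" if "w \<in> ?W" for w
  proof -
    have w: "set w \<subseteq> {1..N}" using that by (simp add: words_of_length_def)
    obtain x y x' y' where "x \<in> cyl w" "cyl_sup ?u w = ?u x" "y \<in> cyl w" "cyl_sup adg w = adg y"
      "x' \<in> cyl w" "cyl_inf ?u w = ?u x'" "y' \<in> cyl w" "cyl_inf adg w = adg y'"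
      using cyl_sup_inf(3,4)[OF u_cont w] cyl_sup_inf(3,4)[OF adg_cont w] by blast
    then show "hi w - lo w \<le> \<eta>'" "0 \<le> lo w" using n[OF that, of x y x' y'] f(2) by (auto simp: hi_def lo_def)
  qed
  have Lo0: "0 \<le> Lo" unfolding Lo_def using hl(2) by (intro sum_nonneg mult_nonneg_nonneg) auto
  have "Hi - Lo = (\<Sum>w\<in>?W. word_ratio r w powr \<delta> * (hi w - lo w))"
    unfolding Hi_def Lo_def by (simp add: sum_subtractf right_diff_distrib)
  also have "\<dots> \<le> (\<Sum>w\<in>?W. word_ratio r w powr \<delta> * \<eta>')" using hl by (intro sum_mono mult_left_mono) auto
  also have "\<dots> = \<eta>'" by (simp add: sum_distrib_right[symmetric] sum_word_prob)
  finally have diff: "Hi - Lo \<le> \<eta>'" .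
  have J1: "Lo \<le> ?J"
  proof -
    have "enn2real (ennreal Lo) \<le> ?J"
      unfolding Lo_def lo_def by (rule enn2real_mono[OF limit_integral_bounds(1)[OF f(1,2)] limit_integral_finite[OF f(1,2)]])
    then show ?thesis using Lo0 by simp
  qed
  have J2: "?J \<le> Hi"
  proof -
    have "?J \<le> enn2real (ennreal Hi)"
      unfolding Hi_def hi_def by (rule enn2real_mono[OF limit_integral_bounds(2)[OF f(1,2)]]) simp
    moreover have "0 \<le> Hi" unfolding Hi_def hi_def
    proof (intro sum_nonneg mult_nonneg_nonneg)
      fix w assume "w \<in> ?W"
      then have w: "set w \<subseteq> {1..N}" by (simp add: words_of_length_def)
      then show "0 \<le> cyl_sup ?u w" using cyl_sup_inf(3)[OF u_cont w] f(2) by metis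
    qed auto
    ultimately show ?thesis by simp
  qed
  let ?lof = "\<lambda>t. \<Sum>w\<in>?W. cyl_inf ?u w * (cyl_inf adg w * word_ratio r w) powr \<delta> / 2 * scaled_count (t / (cyl_inf adg w * word_ratio r w))"
  let ?hif = "\<lambda>t. \<Sum>w\<in>?W. cyl_sup ?u w * (cyl_sup adg w * word_ratio r w) powr \<delta> / 2 * scaled_count (t / (cyl_sup adg w * word_ratio r w))"
  obtain M where M: "\<forall>t>0. scaled_sum f t \<le> M * t powr \<delta> + ?hif t"
    by (rule scaled_sum_upper[OF f, where n = n])
  have wpos: "0 \<le> word_ratio r w" "0 \<le> cyl_inf adg w" "0 \<le> cyl_sup adg w" if "w \<in> ?W" for w
    using that adg_bounds[of w] word_ratio_pos[of w] by (auto simp: words_of_length_def)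
  have lim_lo: "mode_limit avg ?lof (gap_constant / 2 * Lo)"
  proof -
    have "(\<Sum>w\<in>?W. cyl_inf ?u w * (cyl_inf adg w * word_ratio r w) powr \<delta> / 2 * gap_constant) = gap_constant / 2 * Lo"
      unfolding Lo_def lo_def sum_distrib_left using wpos by (intro sum.cong) (auto simp: powr_mult)
    from this[symmetric] show ?thesis
      by (rule ssubst) (rule count_combination_limit[OF finite_words_of_length _ lim], rule cyl_scale_pos(1))
  qed
  have lim_hi: "mode_limit avg (\<lambda>t. M * t powr \<delta> + ?hif t) (M * 0 + gap_constant / 2 * Hi)"
  proof -
    have "(\<Sum>w\<in>?W. cyl_sup ?u w * (cyl_sup adg w * word_ratio r w) powr \<delta> / 2 * gap_constant) = gap_constant / 2 * Hi"
      unfolding Hi_def hi_def sum_distrib_left using wpos by (intro sum.cong) (auto simp: powr_mult)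
    from this[symmetric] have "mode_limit avg ?hif (gap_constant / 2 * Hi)"
      by (rule ssubst) (rule count_combination_limit[OF finite_words_of_length _ lim], rule cyl_scale_pos(2))
    moreover have "mode_limit avg (\<lambda>t. M * t powr \<delta>) (M * 0)" by (intro mode_limit_cmult mode_limit_powr dim_pos)
    moreover have "locally_bounded_fun (\<lambda>t. M * t powr \<delta>)"
      using dim_pos by (intro locally_bounded_fun_cmult locally_bounded_fun_powr) simp
    moreover have "locally_bounded_fun ?hif" by (rule count_combination_lb) (rule cyl_scale_pos(2))
    ultimately show ?thesis by (intro mode_limit_add)
  qed
  show "\<exists>f1 f2 L1 L2. locally_bounded_fun f1 \<and> locally_bounded_fun f2 \<and>
      mode_limit avg f1 L1 \<and> mode_limit avg f2 L2 \<and> (\<forall>x. 0 < x \<longrightarrow> x \<le> 1 \<longrightarrow> f1 x \<le> scaled_sum f x \<and> scaled_sum f x \<le> f2 x) \<and>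
      gap_constant / 2 * ?J - \<eta> \<le> L1 \<and> L2 \<le> gap_constant / 2 * ?J + \<eta>"
  proof (intro exI conjI allI impI)
    show "mode_limit avg ?lof (gap_constant / 2 * Lo)" by (rule lim_lo)
    show "mode_limit avg (\<lambda>t. M * t powr \<delta> + ?hif t) (M * 0 + gap_constant / 2 * Hi)" by (rule lim_hi)
    show "locally_bounded_fun ?lof" by (rule count_combination_lb) (rule cyl_scale_pos(1))
    show "locally_bounded_fun (\<lambda>t. M * t powr \<delta> + ?hif t)" by (rule count_combination_powr_lb)
    have gc: "0 \<le> gap_constant / 2" using gap_constant_nonneg by simp
    have "gap_constant / 2 * ?J \<le> gap_constant / 2 * (Lo + \<eta>')" using J2 diff gc by (intro mult_left_mono) auto
    then show "gap_constant / 2 * ?J - \<eta> \<le> gap_constant / 2 * Lo" using eta'(2) by (simp add: algebra_simps)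
    have "gap_constant / 2 * Hi \<le> gap_constant / 2 * (?J + \<eta>')" using J1 diff gc by (intro mult_left_mono) auto
    then show "M * 0 + gap_constant / 2 * Hi \<le> gap_constant / 2 * ?J + \<eta>" using eta'(2) by (simp add: algebra_simps)
    show "?lof x \<le> scaled_sum f x" if "0 < x" for x by (rule scaled_sum_lower[OF f that])
    show "scaled_sum f x \<le> M * x powr \<delta> + ?hif x" if "0 < x" for x by (rule M[rule_format, OF that])
  qed
qed

text \<open>The lower half of the sandwich at level 0, where the empty word is the only one,
  combined with the lower bound for the gap count.\<close>

lemma scaled_sum_one_lower: "\<exists>b>0. \<exists>e>0. \<forall>t. 0 < t \<longrightarrow> t \<le> e \<longrightarrow> b \<le> scaled_sum (\<lambda>_. 1) t"
proof -
  obtain b e where be: "b > 0" "e > 0" "\<And>t. 0 < t \<Longrightarrow> t \<le> e \<Longrightarrow> b \<le> scaled_count t" using scaled_count_lower by blast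
  define m where "m = cyl_inf adg []"
  have m: "m > 0" unfolding m_def using adg_bounds[of "[]"] by simp
  have one: "cyl_inf (\<lambda>x. 1) [] = (1::real)" unfolding cyl_inf_def using cyl_ne[of "[]"] by simp
  have sw: "m powr \<delta> / 2 * scaled_count (t / m) \<le> scaled_sum (\<lambda>_. 1) t" if "t > 0" for t
    using scaled_sum_lower[of "\<lambda>_. 1" 1 t 0, OF _ _ _ that] by (simp add: words_of_length_0 one m_def)
  have "m powr \<delta> / 2 * b \<le> scaled_sum (\<lambda>_. 1) t" if "0 < t" "t \<le> m * e" for t
  proof -
    have "t / m \<le> e" using that m by (simp add: pos_divide_le_eq mult.commute)
    then have "m powr \<delta> / 2 * b \<le> m powr \<delta> / 2 * scaled_count (t / m)" using be(3)[of "t / m"] that m by (intro mult_left_mono) auto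
    then show ?thesis using sw[OF that(1)] by linarith
  qed
  then show ?thesis using be m by (intro exI[of _ "m powr \<delta> / 2 * b"] conjI exI[of _ "m * e"]) auto
qed

end


section \<open>Curvature measures of the image and their weak limits\<close>

context conformal_ifs
begin

lemma F_null: "emeasure lborel F = 0"
proof -
  have KB: "K \<in> sets borel" "F \<in> sets borel" using K_compact F_compact by (auto intro: borel_closed compact_imp_closed)
  have "K \<in> null_sets lebesgue" using K_null KB by (auto intro!: null_sets_completionI null_setsI)
  then have "negligible K" by (simp add: negligible_iff_null_sets)
  moreover have "g differentiable_on K"
    unfolding differentiable_on_def
  proof
    fix x assume "x \<in> K"
    then have "(g has_real_derivative dg x) (at x)" using g_deriv K_sub by auto
    then show "g differentiable at x within K"
      using real_differentiable_def differentiable_at_withinI by blast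
  qed
  ultimately have "negligible F" unfolding F_def by (intro negligible_differentiable_image_negligible) auto
  then have "F \<in> null_sets lebesgue" by (simp add: negligible_iff_null_sets)
  then show ?thesis using KB by (auto simp: null_sets_def)
qed

text \<open>For t in (0, 1] the integral of f against the rescaled k-th curvature measure. The
  factor 2 undoes the 1/2 in \<open>scaled_sum\<close>.\<close>

definition curv_value :: "nat \<Rightarrow> (real \<Rightarrow> real) \<Rightarrow> real \<Rightarrow> real" where
  "curv_value k f t = (if k = 0 then scaled_sum f t else 2 * mellin_average \<delta> (unit_trunc (scaled_sum f)) t)"

text \<open>For k = 1, the constant \<open>gap_constant / 2\<close> of the boundary sums is
  multiplied by 2 and by the mass \<open>1 / (1 - \<delta>)\<close> of the Mellin weight.\<close>

definition curv_const :: "nat \<Rightarrow> real" where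
  "curv_const k = (if k = 0 then gap_constant / 2 else gap_constant / (1 - \<delta>))"

lemma curv_const_nonneg: "0 \<le> curv_const k"
  using gap_constant_nonneg dim_less_1 by (simp add: curv_const_def)

lemma curvature_factor_pos: "0 < curvature_factor k" by (simp add: curvature_factor_def)

context
  fixes f :: "real \<Rightarrow> real" and b :: real
  assumes f: "continuous_on UNIV f" "\<And>x. 0 \<le> f x" "\<And>x. f x \<le> b"
begin

lemma f_meas: "f \<in> borel_measurable borel" using f(1) by (rule borel_measurable_continuous_onI)

lemma trunc_measurable: "unit_trunc (scaled_sum f) \<in> borel_measurable borel"
proof -
  have [measurable]: "scaled_sum f \<in> borel_measurable borel" using f by (intro scaled_sum_measurable f_meas)
  show ?thesis unfolding unit_trunc_def[abs_def] by measurable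
qed

lemma trunc_bounded: "\<exists>C. \<forall>x>0. \<bar>unit_trunc (scaled_sum f) x\<bar> \<le> C"
proof -
  obtain C where C: "\<And>x. 0 < x \<Longrightarrow> x \<le> 1 \<Longrightarrow> \<bar>scaled_sum f x\<bar> \<le> C" "0 \<le> C"
    using locally_bounded_fun_bound[OF scaled_sum_lb[OF f], of 1] by metis
  then show ?thesis by (intro exI[of _ C]) (auto simp: unit_trunc_def)
qed

lemma trunc_nonneg: "0 \<le> unit_trunc (scaled_sum f) x"
  using scaled_sum_nonneg[OF f(2)] by (simp add: unit_trunc_def)

lemma mellin_trunc_nonneg: "0 \<le> mellin_average \<delta> (unit_trunc (scaled_sum f)) t"
  unfolding mellin_average_def using trunc_nonneg mellin_weight_nonneg by (intro Bochner_Integration.integral_nonneg) auto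

lemma curv_value_nonneg: "0 \<le> curv_value k f t"
  using scaled_sum_nonneg[OF f(2)] mellin_trunc_nonneg by (simp add: curv_value_def)

lemma curv_value_lb: "locally_bounded_fun (curv_value k f)"
proof (cases "k = 0")
  case True
  then have "curv_value k f = scaled_sum f" by (auto simp: curv_value_def)
  then show ?thesis using scaled_sum_lb[OF f] by simp
next
  case False
  then have eq: "curv_value k f = (\<lambda>t. 2 * mellin_average \<delta> (unit_trunc (scaled_sum f)) t)" by (auto simp: curv_value_def)
  obtain C where C: "\<And>x. 0 < x \<Longrightarrow> \<bar>unit_trunc (scaled_sum f) x\<bar> \<le> C" using trunc_bounded by blast
  have "locally_bounded_fun (mellin_average \<delta> (unit_trunc (scaled_sum f)))"
    using mellin_average_bounded[OF trunc_measurable C dim_less_1]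
    by (intro locally_bounded_funI mellin_average_measurable trunc_measurable) blast
  then show ?thesis unfolding eq by (rule locally_bounded_fun_cmult)
qed

lemma curv_value_limit:
  assumes "mode_limit avg scaled_count gap_constant"
  shows "mode_limit avg (curv_value k f) (curv_const k * enn2real (limit_integral f))"
proof (cases "k = 0")
  case True
  then have "curv_value k f = scaled_sum f" by (auto simp: curv_value_def)
  then show ?thesis using scaled_sum_limit[OF f assms] True by (simp add: curv_const_def)
next
  case False
  then have eq: "curv_value k f = (\<lambda>t. 2 * mellin_average \<delta> (unit_trunc (scaled_sum f)) t)" by (auto simp: curv_value_def)
  obtain C where C: "\<And>x. 0 < x \<Longrightarrow> \<bar>unit_trunc (scaled_sum f) x\<bar> \<le> C" using trunc_bounded by blast
  have "mode_limit avg (unit_trunc (scaled_sum f)) (gap_constant / 2 * enn2real (limit_integral f))"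
    using scaled_sum_limit[OF f assms] mode_limit_cong[of "unit_trunc (scaled_sum f)" "scaled_sum f"] by (simp add: unit_trunc_def)
  note lim = mode_limit_cmult[OF mode_limit_mellin[OF trunc_measurable C dim_less_1 this], of 2]
  have "2 * (gap_constant / 2 * enn2real (limit_integral f) / (1 - \<delta>)) = curv_const k * enn2real (limit_integral f)"
  proof -
    have "2 * (x / 2 * y / z) = x / z * y" for x y z :: real by simp
    then show ?thesis using False by (simp only: curv_const_def if_False)
  qed
  from this[symmetric] lim show ?thesis unfolding eq by (rule ssubst)
qed

text \<open>The volume is the integral of the boundary sums over distances s \<le> t; the
  substitution s = tu extracts the power of t and leaves the Mellin weight. As t \<le> 1, the
  truncation at 1 is invisible.\<close>

lemma nn_integral_curvature_1:
  assumes t: "0 < t" "t \<le> 1"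
  shows "(\<integral>\<^sup>+x. ennreal (f x) \<partial>curvature_measure 1 F t) =
    ennreal (2 * t powr (1 - \<delta>) * mellin_average \<delta> (unit_trunc (scaled_sum f)) t)"
proof -
  let ?h = "unit_trunc (scaled_sum f)"
  have [measurable]: "scaled_sum f \<in> borel_measurable borel" using f by (intro scaled_sum_measurable f_meas)
  note [measurable] = trunc_measurable f_meas
  obtain C where C: "\<And>x. 0 < x \<Longrightarrow> \<bar>?h x\<bar> \<le> C" using trunc_bounded by blast
  let ?G = "\<lambda>s. ennreal (indicator {0<..t} s * (2 * s powr (- \<delta>) * ?h s))"
  have "(\<integral>\<^sup>+x. ennreal (f x) \<partial>curvature_measure 1 F t) =
      (\<integral>\<^sup>+s. indicator {0<..t} s * (\<integral>\<^sup>+x. ennreal (f x) \<partial>curvature_measure 0 F s) \<partial>lborel)"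
    by (rule nn_integral_curvature_measure_1_eq[OF F_compact F_ne F_null t(1)]) measurable
  also have "\<dots> = (\<integral>\<^sup>+s. ?G s \<partial>lborel)"
  proof (rule nn_integral_cong)
    fix s
    show "indicator {0<..t} s * (\<integral>\<^sup>+x. ennreal (f x) \<partial>curvature_measure 0 F s) = ?G s"
    proof (cases "s \<in> {0<..t}")
      case True
      then have s: "0 < s" "s \<le> 1" "s \<le> t" using t by auto
      have "dirs_sum f s = 2 * s powr (- \<delta>) * ?h s"
        using s by (simp add: unit_trunc_def scaled_sum_def powr_minus field_simps)
      then show ?thesis using nn_integral_curvature_0[OF f_meas f(2) s(1)] s by simp
    qed simp
  qed
  also have "\<dots> = ennreal \<bar>t\<bar> * (\<integral>\<^sup>+u. ?G (0 + t * u) \<partial>lborel)"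
    using t by (intro nn_integral_real_affine) auto
  also have "\<dots> = ennreal t * (\<integral>\<^sup>+u. ennreal (2 * t powr (- \<delta>)) * ennreal (mellin_weight \<delta> u * ?h (t * u)) \<partial>lborel)"
  proof -
    have "?G (0 + t * u) = ennreal (2 * t powr (- \<delta>)) * ennreal (mellin_weight \<delta> u * ?h (t * u))" for u
    proof (cases "0 < u \<and> u \<le> 1")
      case True
      then have "?G (0 + t * u) = ennreal ((2 * t powr (- \<delta>)) * (mellin_weight \<delta> u * ?h (t * u)))"
        using t by (simp add: mellin_weight_def powr_mult mult_ac)
      also have "\<dots> = ennreal (2 * t powr (- \<delta>)) * ennreal (mellin_weight \<delta> u * ?h (t * u))"
        by (rule ennreal_mult') simp
      finally show ?thesis .
    next
      case False
      then have "t * u \<notin> {0<..t}" using t by (auto simp: zero_less_mult_iff mult_le_cancel_left1)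
      moreover have "mellin_weight \<delta> u = 0" using False by (auto simp: mellin_weight_def indicator_def)
      ultimately show ?thesis by simp
    qed
    then show ?thesis using t by simp
  qed
  also have "\<dots> = ennreal t * (ennreal (2 * t powr (- \<delta>)) * (\<integral>\<^sup>+u. ennreal (mellin_weight \<delta> u * ?h (t * u)) \<partial>lborel))"
    by (subst nn_integral_cmult) measurable
  also have "(\<integral>\<^sup>+u. ennreal (mellin_weight \<delta> u * ?h (t * u)) \<partial>lborel) = ennreal (mellin_average \<delta> ?h t)"
    unfolding mellin_average_def
  proof (rule nn_integral_eq_integral)
    show "integrable lborel (\<lambda>u. mellin_weight \<delta> u * ?h (t * u))"
      by (rule mellin_integrand_integrable[OF trunc_measurable C dim_less_1 t(1)])
    show "AE u in lborel. 0 \<le> mellin_weight \<delta> u * ?h (t * u)"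
      by (intro AE_I2 mult_nonneg_nonneg trunc_nonneg mellin_weight_nonneg)
  qed
  also have "ennreal t * (ennreal (2 * t powr (- \<delta>)) * ennreal (mellin_average \<delta> ?h t)) =
      ennreal (t * (2 * t powr (- \<delta>) * mellin_average \<delta> ?h t))"
    using t mellin_trunc_nonneg by (simp add: ennreal_mult)
  also have "t * (2 * t powr (- \<delta>) * mellin_average \<delta> ?h t) = 2 * t powr (1 - \<delta>) * mellin_average \<delta> ?h t"
    using t by (simp add: powr_diff powr_minus field_simps)
  finally show ?thesis .
qed

lemma nn_integral_curvature:
  assumes k: "k \<in> {0, 1}" and t: "0 < t" "t \<le> 1"
  shows "(\<integral>\<^sup>+x. ennreal (f x) \<partial>curvature_measure k F t) =
    ennreal (curv_value k f t * t powr (real k - \<delta>) / curvature_factor k)"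
proof (cases "k = 0")
  case True
  then show ?thesis using nn_integral_curvature_0[OF f_meas f(2) t(1)] t
    by (simp add: curv_value_def curvature_factor_def scaled_sum_def powr_minus field_simps)
next
  case False
  then have "k = 1" using k by simp
  then show ?thesis using nn_integral_curvature_1[OF t] by (simp add: curv_value_def curvature_factor_def mult_ac)
qed

end

text \<open>Two-sided bounds on the rescaled total mass determine the scaling exponent and the
  Minkowski dimension, also for lattice systems, where the rescaled mass need not converge.\<close>

lemma curv_value_one_bounds:
  assumes "k \<in> {0, 1}"
  shows "\<exists>b1 b2 e. 0 < b1 \<and> 0 < e \<and> e \<le> 1 \<and> (\<forall>t. 0 < t \<longrightarrow> t \<le> e \<longrightarrow> b1 \<le> curv_value k (\<lambda>_. 1) t \<and> curv_value k (\<lambda>_. 1) t \<le> b2)"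
proof -
  have f: "continuous_on UNIV (\<lambda>_::real. 1::real)" "\<And>x::real. (0::real) \<le> 1" "\<And>x::real. (1::real) \<le> 1" by auto
  obtain b e0 where b: "b > 0" "e0 > 0" "\<And>t. 0 < t \<Longrightarrow> t \<le> e0 \<Longrightarrow> b \<le> scaled_sum (\<lambda>_. 1) t" using scaled_sum_one_lower by blast
  define e where "e = min e0 1"
  have e: "0 < e" "e \<le> 1" "e \<le> e0" using b by (auto simp: e_def)
  obtain b2 where b2: "\<And>x. 0 < x \<Longrightarrow> x \<le> 1 \<Longrightarrow> \<bar>curv_value k (\<lambda>_. 1) x\<bar> \<le> b2"
    using locally_bounded_fun_bound[OF curv_value_lb[OF f], where E = 1] by metis
  have "\<exists>b1>0. \<forall>t. 0 < t \<longrightarrow> t \<le> e \<longrightarrow> b1 \<le> curv_value k (\<lambda>_. 1) t"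
  proof (cases "k = 0")
    case True
    then show ?thesis using b e by (intro exI[of _ b]) (auto simp: curv_value_def)
  next
    case False
    let ?h = "unit_trunc (scaled_sum (\<lambda>_. 1))"
    obtain C where C: "\<And>x. 0 < x \<Longrightarrow> \<bar>?h x\<bar> \<le> C" using trunc_bounded[OF f] by blast
    have "b / (1 - \<delta>) \<le> mellin_average \<delta> ?h t" if t: "0 < t" "t \<le> e" for t
    proof -
      have "b / (1 - \<delta>) = (\<integral>u. mellin_weight \<delta> u * b \<partial>lborel)" using integral_mellin_weight[OF dim_less_1] by simp
      also have "\<dots> \<le> mellin_average \<delta> ?h t"
        unfolding mellin_average_def
      proof (rule integral_mono)
        show "integrable lborel (\<lambda>u. mellin_weight \<delta> u * b)" using integrable_mellin_weight[OF dim_less_1] by simp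
        show "integrable lborel (\<lambda>u. mellin_weight \<delta> u * ?h (t * u))"
          by (rule mellin_integrand_integrable[OF trunc_measurable[OF f] C dim_less_1 t(1)])
        fix u :: real
        show "mellin_weight \<delta> u * b \<le> mellin_weight \<delta> u * ?h (t * u)"
        proof (cases "0 < u \<and> u \<le> 1")
          case True
          have "t * u \<le> t * 1" using True t by (intro mult_left_mono) auto
          then have "t * u \<le> e" using t by linarith
          moreover have "0 < t * u" using True t by simp
          ultimately have tu: "0 < t * u" "t * u \<le> e" by auto
          then have "b \<le> ?h (t * u)" using b(3)[of "t * u"] e by (simp add: unit_trunc_def)
          then show ?thesis using mellin_weight_nonneg by (intro mult_left_mono)
        qed (auto simp: mellin_weight_def indicator_def)
      qed
      finally show ?thesis .
    qed
    then have "2 * (b / (1 - \<delta>)) \<le> curv_value k (\<lambda>_. 1) t" if "0 < t" "t \<le> e" for t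
      using that False unfolding curv_value_def by (simp only: if_False mult_le_cancel_left_pos zero_less_numeral)
    moreover have "0 < 2 * (b / (1 - \<delta>))" using b dim_less_1 by simp
    ultimately show ?thesis by blast
  qed
  then obtain b1 where b1: "b1 > 0" "\<And>t. 0 < t \<Longrightarrow> t \<le> e \<Longrightarrow> b1 \<le> curv_value k (\<lambda>_. 1) t" by blast
  have "curv_value k (\<lambda>_. 1) t \<le> b2" if "0 < t" "t \<le> e" for t using b2[of t] that e by auto
  then show ?thesis using b1 e by blast
qed

lemma total_mass:
  assumes k: "k \<in> {0, 1}"
  obtains b1 b2 e where "0 < b1" "0 < e" "e \<le> 1"
    "\<And>t. 0 < t \<Longrightarrow> t \<le> e \<Longrightarrow> \<exists>v. b1 \<le> v \<and> v \<le> b2 \<and> emeasure (curvature_measure k F t) UNIV = ennreal (v * t powr (real k - \<delta>))"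
proof -
  obtain b1 b2 e where b: "0 < b1" "0 < e" "e \<le> 1" "\<And>t. 0 < t \<Longrightarrow> t \<le> e \<Longrightarrow> b1 \<le> curv_value k (\<lambda>_. 1) t \<and> curv_value k (\<lambda>_. 1) t \<le> b2"
    using curv_value_one_bounds[OF k] by blast
  let ?c = "curvature_factor k"
  show thesis
  proof (rule that[of "b1 / ?c" e "b2 / ?c"])
    show "0 < b1 / ?c" using b curvature_factor_pos by simp
    fix t assume t: "0 < t" "t \<le> e"
    have sp: "space (curvature_measure k F t) = UNIV" using sets_eq_imp_space_eq[OF sets_curvature_measure] by simp
    have "emeasure (curvature_measure k F t) UNIV = (\<integral>\<^sup>+x. ennreal 1 \<partial>curvature_measure k F t)" by (simp add: sp)
    also have "\<dots> = ennreal (curv_value k (\<lambda>_. 1) t / ?c * t powr (real k - \<delta>))"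
      using t b by (subst nn_integral_curvature[where b = 1, OF _ _ _ k]) auto
    finally show "\<exists>v. b1 / ?c \<le> v \<and> v \<le> b2 / ?c \<and> emeasure (curvature_measure k F t) UNIV = ennreal (v * t powr (real k - \<delta>))"
      using b(4)[OF t] curvature_factor_pos[of k] by (intro exI[of _ "curv_value k (\<lambda>_. 1) t / ?c"]) (auto intro: divide_right_mono)
  qed (use b in auto)
qed

text \<open>By the two-sided mass bounds the exponents with limit 0 form the open half-line above
  \<open>\<delta> - real k\<close>: at this value and below, the product stays away from 0.\<close>

lemma scaling_exponent_F:
  assumes k: "k \<in> {0, 1}" shows "scaling_exponent k F = \<delta> - real k"
proof -
  obtain b1 b2 e where b: "0 < b1" "0 < e" "e \<le> 1"
    and mass: "\<And>t. 0 < t \<Longrightarrow> t \<le> e \<Longrightarrow> \<exists>v. b1 \<le> v \<and> v \<le> b2 \<and> emeasure (curvature_measure k F t) UNIV = ennreal (v * t powr (real k - \<delta>))"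
    by (rule total_mass[OF k]) blast
  let ?P = "\<lambda>s. ((\<lambda>\<epsilon>. ennreal (\<epsilon> powr s) * emeasure (curvature_measure k F \<epsilon>) UNIV) \<longlongrightarrow> 0) (at_right 0)"
  have ev: "\<forall>\<^sub>F t in at_right 0. 0 < t \<and> t \<le> e"
    using eventually_at_right_real[OF b(2)] by eventually_elim auto
  have "{s. ?P s} = {\<delta> - real k<..}"
  proof (intro equalityI subsetI)
    fix s assume "s \<in> {\<delta> - real k<..}"
    then have pos: "s + (real k - \<delta>) > 0" by simp
    have "((\<lambda>t. b2 * t powr (s + (real k - \<delta>))) \<longlongrightarrow> 0) (at_right 0)" using pos by real_asymp
    then have "((\<lambda>t. ennreal (b2 * t powr (s + (real k - \<delta>)))) \<longlongrightarrow> ennreal 0) (at_right 0)" by (rule tendsto_ennrealI)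
    then have lim: "((\<lambda>t. ennreal (b2 * t powr (s + (real k - \<delta>)))) \<longlongrightarrow> 0) (at_right 0)" by simp
    have "?P s"
    proof (rule tendsto_sandwich[OF _ _ tendsto_const lim])
      show "\<forall>\<^sub>F t in at_right 0. ennreal (t powr s) * emeasure (curvature_measure k F t) UNIV \<le> ennreal (b2 * t powr (s + (real k - \<delta>)))"
        using ev
      proof eventually_elim
        case (elim t)
        then obtain v where v: "b1 \<le> v" "v \<le> b2" "emeasure (curvature_measure k F t) UNIV = ennreal (v * t powr (real k - \<delta>))"
          using mass by blast
        have "ennreal (t powr s) * emeasure (curvature_measure k F t) UNIV = ennreal (t powr s * (v * t powr (real k - \<delta>)))"
          using v b by (simp add: ennreal_mult)
        also have "t powr s * (v * t powr (real k - \<delta>)) = v * t powr (s + (real k - \<delta>))" by (simp add: powr_add)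
        also have "ennreal \<dots> \<le> ennreal (b2 * t powr (s + (real k - \<delta>)))" using v by (intro ennreal_leI mult_right_mono) auto
        finally show ?case .
      qed
    qed simp
    then show "s \<in> {s. ?P s}" by simp
  next
    fix s assume "s \<in> {s. ?P s}"
    then have lim: "?P s" by simp
    show "s \<in> {\<delta> - real k<..}"
    proof (rule ccontr)
      assume "s \<notin> {\<delta> - real k<..}"
      then have neg: "s + (real k - \<delta>) \<le> 0" by simp
      have "\<forall>\<^sub>F t in at_right 0. ennreal b1 \<le> ennreal (t powr s) * emeasure (curvature_measure k F t) UNIV"
        using ev
      proof eventually_elim
        case (elim t)
        then obtain v where v: "b1 \<le> v" "v \<le> b2" "emeasure (curvature_measure k F t) UNIV = ennreal (v * t powr (real k - \<delta>))"
          using mass by blast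
        have "1 powr (s + (real k - \<delta>)) \<le> t powr (s + (real k - \<delta>))" using elim b neg by (intro powr_mono2') auto
        then have "b1 * 1 \<le> v * t powr (s + (real k - \<delta>))" using v b by (intro mult_mono) auto
        then have "ennreal b1 \<le> ennreal (t powr s * (v * t powr (real k - \<delta>)))"
          by (intro ennreal_leI) (simp add: powr_add mult_ac)
        also have "\<dots> = ennreal (t powr s) * emeasure (curvature_measure k F t) UNIV"
          using v b by (simp add: ennreal_mult)
        finally show ?case .
      qed
      then have "ennreal b1 \<le> 0" by (rule tendsto_lowerbound[OF lim]) (simp add: trivial_limit_at_right_real)
      then show False using b by simp
    qed
  qed
  then show ?thesis unfolding scaling_exponent_def by simp
qed

text \<open>A continuous function on the whole line that agrees with g on [A, B], so that
  push-forwards can be formed without knowledge of g elsewhere.\<close>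

definition clamped_g :: "real \<Rightarrow> real" where "clamped_g x = g (max A (min B x))"

lemma clamped_g_cont: "continuous_on UNIV clamped_g"
  unfolding clamped_g_def[abs_def] using A_less_B
  by (intro continuous_on_compose2[OF g_cont] continuous_intros) auto

lemma clamped_g_measurable [measurable]: "clamped_g \<in> borel_measurable borel"
  using clamped_g_cont by (rule borel_measurable_continuous_onI)

lemma clamped_g_eq: "x \<in> {A..B} \<Longrightarrow> clamped_g x = g x" by (simp add: clamped_g_def)

lemma image_density_measurable [measurable]: "image_density \<in> borel_measurable borel"
  using borel_measurable_continuous_on_indicator[OF _ dgpow_cont] by (simp add: image_density_def[abs_def])

definition limit_measure :: "nat \<Rightarrow> real measure" where
  "limit_measure k = distr (density self_similar_measure (\<lambda>x. ennreal (curv_const k * image_density x))) borel clamped_g"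

lemma sets_limit_measure [simp]: "sets (limit_measure k) = sets borel" by (simp add: limit_measure_def)

lemma nn_integral_limit_measure:
  assumes "f \<in> borel_measurable borel" "\<And>x. 0 \<le> f x"
  shows "(\<integral>\<^sup>+x. ennreal (f x) \<partial>limit_measure k) = ennreal (curv_const k) * limit_integral f"
proof -
  note [measurable] = assms(1)
  have pt: "ennreal (curv_const k * image_density x) * ennreal (f (clamped_g x)) =
      ennreal (curv_const k) * ennreal (indicator {A..B} x * (f (g x) * \<bar>dg x\<bar> powr \<delta>))" for x
    using curv_const_nonneg assms(2)
    by (cases "x \<in> {A..B}") (auto simp: image_density_def clamped_g_eq ennreal_mult[symmetric] mult_ac)
  have m2: "(\<lambda>x. ennreal (indicator {A..B} x * (f (g x) * \<bar>dg x\<bar> powr \<delta>))) \<in> borel_measurable borel"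
  proof -
    have "(\<lambda>x. ennreal (indicator {A..B} x * (f (g x) * \<bar>dg x\<bar> powr \<delta>))) = (\<lambda>x. ennreal (image_density x * f (clamped_g x)))"
      by (auto simp: image_density_def clamped_g_eq indicator_def mult_ac)
    then show ?thesis by simp
  qed
  have "(\<integral>\<^sup>+x. ennreal (f x) \<partial>limit_measure k) =
      (\<integral>\<^sup>+x. ennreal (curv_const k * image_density x) * ennreal (f (clamped_g x)) \<partial>self_similar_measure)"
  proof -
    have "(\<integral>\<^sup>+x. ennreal (f x) \<partial>limit_measure k) =
        (\<integral>\<^sup>+x. ennreal (f (clamped_g x)) \<partial>density self_similar_measure (\<lambda>x. ennreal (curv_const k * image_density x)))"
      unfolding limit_measure_def by (rule nn_integral_distr) measurable
    also have "\<dots> = (\<integral>\<^sup>+x. ennreal (curv_const k * image_density x) * ennreal (f (clamped_g x)) \<partial>self_similar_measure)"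
      by (rule nn_integral_density) measurable
    finally show ?thesis .
  qed
  also have "\<dots> = (\<integral>\<^sup>+x. ennreal (curv_const k) * ennreal (indicator {A..B} x * (f (g x) * \<bar>dg x\<bar> powr \<delta>)) \<partial>self_similar_measure)"
    unfolding pt ..
  also have "\<dots> = ennreal (curv_const k) * limit_integral f"
    unfolding limit_integral_def by (rule nn_integral_cmult) (use m2 in measurable)
  finally show ?thesis .
qed

lemma finite_limit_measure: "finite_measure (limit_measure k)"
proof
  have sp: "space (limit_measure k) = UNIV" by (simp add: limit_measure_def)
  have "emeasure (limit_measure k) (space (limit_measure k)) = (\<integral>\<^sup>+x. ennreal 1 \<partial>limit_measure k)" by simp
  also have "\<dots> = ennreal (curv_const k) * limit_integral (\<lambda>_. 1)" by (rule nn_integral_limit_measure) auto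
  also have "\<dots> < \<top>" using limit_integral_finite[of "\<lambda>_. 1"] by (auto simp: ennreal_mult_less_top)
  finally show "emeasure (limit_measure k) (space (limit_measure k)) \<noteq> \<infinity>" by simp
qed

text \<open>For k = 0 the mass is a countable sum over directions, a description valid at positive
  distances; hence the restriction to \<open>{T..1}\<close>. For k = 1 it is a parameter integral of
  a jointly measurable function.\<close>

lemma emeasure_curvature_measurable:
  assumes k: "k \<in> {0, 1}" and B: "B' \<in> sets borel" and T: "T > 0"
  shows "(\<lambda>\<epsilon>. indicator {T..1} \<epsilon> * emeasure (curvature_measure k F \<epsilon>) B') \<in> borel_measurable borel"
proof (cases "k = 0")
  case True
  note [measurable] = B
  let ?I = "\<lambda>t. \<integral>\<^sup>+e. indicator (boundary_dirs F t) e * indicator B' (dir_point t e) \<partial>count_space (all_dirs F)"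
  have [measurable]: "?I \<in> borel_measurable borel"
    using compact_imp_bounded[OF F_compact] by (intro borel_measurable_dirs_integral) auto
  have "indicator {T..1} \<epsilon> * emeasure (curvature_measure k F \<epsilon>) B' = indicator {T..1} \<epsilon> * ?I \<epsilon>" for \<epsilon>
  proof (cases "\<epsilon> \<in> {T..1}")
    case e: True
    then have "0 < \<epsilon>" using T by simp
    from nn_integral_curvature_measure_0'[OF F_compact F_ne this, of "indicator B'"]
    show ?thesis using B True by simp
  qed simp
  then show ?thesis by simp
next
  case False
  note [measurable] = B
  have [measurable]: "(\<lambda>x. infdist x F) \<in> borel_measurable borel"
    by (intro borel_measurable_continuous_onI continuous_intros)
  have "emeasure (curvature_measure k F \<epsilon>) B' = (\<integral>\<^sup>+x. (if infdist x F \<le> \<epsilon> then indicator B' x else 0) \<partial>lborel)" for \<epsilon>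
  proof -
    have [measurable]: "parallel_set F \<epsilon> \<in> sets borel" using closed_parallel_set by (rule borel_closed)
    have "emeasure (curvature_measure k F \<epsilon>) B' = (\<integral>\<^sup>+x. indicator (parallel_set F \<epsilon> \<inter> B') x \<partial>lborel)"
      using False B by (simp add: emeasure_curvature_measure)
    also have "\<dots> = (\<integral>\<^sup>+x. (if infdist x F \<le> \<epsilon> then indicator B' x else 0) \<partial>lborel)"
      by (intro nn_integral_cong) (auto simp: parallel_set_def indicator_def)
    finally show ?thesis .
  qed
  moreover have "(\<lambda>\<epsilon>. \<integral>\<^sup>+x. (if infdist x F \<le> \<epsilon> then indicator B' x else 0) \<partial>lborel) \<in> borel_measurable borel"
    by (rule lborel.borel_measurable_nn_integral) measurable
  ultimately show ?thesis by simp
qed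

text \<open>The power of t in the rescaling cancels the order of the curvature measure, so integrals
  of nonnegative test functions are exactly \<open>curv_value\<close>, whose limit is known.\<close>

theorem weak_limit_rescaled:
  assumes k: "k \<in> {0, 1}" and lim: "mode_limit False scaled_count gap_constant"
  shows "is_weak_limit (rescaled_curvature_measure k F) (limit_measure k) (at_right 0)"
proof (rule is_weak_limitI)
  have int: "(\<integral>\<^sup>+x. ennreal (f x) \<partial>rescaled_curvature_measure k F t) = ennreal (curv_value k f t)"
    if t: "0 < t" "t \<le> 1" and f: "continuous_on UNIV f" "\<And>x. 0 \<le> f x" "\<And>x. f x \<le> b" for f b t
  proof -
    have fm: "(\<lambda>x. ennreal (f x)) \<in> borel_measurable (curvature_measure k F t)"
      using borel_measurable_continuous_onI[OF f(1)] by (simp cong: measurable_cong_sets)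
    have "(\<integral>\<^sup>+x. ennreal (f x) \<partial>rescaled_curvature_measure k F t) =
        ennreal (curvature_factor k * t powr (\<delta> - real k)) * ennreal (curv_value k f t * t powr (real k - \<delta>) / curvature_factor k)"
      unfolding rescaled_curvature_measure_def scaling_exponent_F[OF k]
      by (simp add: nn_integral_scale_measure fm nn_integral_curvature[OF f k t])
    also have "\<dots> = ennreal ((curvature_factor k * t powr (\<delta> - real k)) * (curv_value k f t * t powr (real k - \<delta>) / curvature_factor k))"
      using curv_value_nonneg[OF f, of k t] curvature_factor_pos[of k] by (intro ennreal_mult[symmetric]) auto
    also have "(curvature_factor k * t powr (\<delta> - real k)) * (curv_value k f t * t powr (real k - \<delta>) / curvature_factor k) =
        curv_value k f t * (t powr (\<delta> - real k) * t powr (real k - \<delta>))" using curvature_factor_pos[of k] by simp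
    also have "t powr (\<delta> - real k) * t powr (real k - \<delta>) = 1" using t by (simp add: powr_add[symmetric])
    finally show ?thesis by simp
  qed
  have sets: "sets (rescaled_curvature_measure k F t) = sets borel" for t by (simp add: rescaled_curvature_measure_def)
  show "\<forall>\<^sub>F t in at_right 0. sets (rescaled_curvature_measure k F t) = sets borel \<and> finite_measure (rescaled_curvature_measure k F t)"
    using eventually_unit_interval
  proof eventually_elim
    case (elim t)
    have "emeasure (rescaled_curvature_measure k F t) (space (rescaled_curvature_measure k F t)) = (\<integral>\<^sup>+x. ennreal 1 \<partial>rescaled_curvature_measure k F t)"
      by simp
    also have "\<dots> = ennreal (curv_value k (\<lambda>_. 1) t)" using elim by (intro int[of t _ 1]) auto
    finally show ?case using sets by (auto intro!: finite_measureI)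
  qed
  fix f :: "real \<Rightarrow> real" assume f: "continuous_on UNIV f" "bounded (range f)" "\<And>x. 0 \<le> f x"
  obtain b where b: "\<And>x. f x \<le> b" using f(2) unfolding bounded_iff by (auto dest: abs_le_D1)
  have "(curv_value k f \<longlongrightarrow> curv_const k * enn2real (limit_integral f)) (at_right 0)"
    using curv_value_limit[OF f(1,3) b lim, of k] by (simp add: mode_limit_def mode_value_def[abs_def])
  moreover have "enn2real (\<integral>\<^sup>+x. ennreal (f x) \<partial>limit_measure k) = curv_const k * enn2real (limit_integral f)"
    using f curv_const_nonneg by (subst nn_integral_limit_measure) (auto intro: borel_measurable_continuous_onI simp: enn2real_mult)
  ultimately show "((\<lambda>t. enn2real (\<integral>\<^sup>+x. ennreal (f x) \<partial>rescaled_curvature_measure k F t)) \<longlongrightarrow>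
      enn2real (\<integral>\<^sup>+x. ennreal (f x) \<partial>limit_measure k)) (at_right 0)"
    by (simp only:) (erule Lim_transform_eventually, use eventually_unit_interval in eventually_elim,
      use int[OF _ _ f(1,3) b] curv_value_nonneg[OF f(1,3) b] in simp)
qed (simp_all add: finite_limit_measure)

text \<open>The weight \<open>\<epsilon> powr (\<delta> - real k - 1)\<close> times the order
  \<open>\<epsilon> powr (real k - \<delta>)\<close> of the curvature measure is
  \<open>1 / \<epsilon>\<close>, so averaging amounts to \<open>log_integral\<close> of
  \<open>curv_value\<close>.\<close>

theorem weak_limit_averaged:
  assumes k: "k \<in> {0, 1}"
  shows "is_weak_limit (averaged_curvature_measure k F) (limit_measure k) (at_right 0)"
proof (rule is_weak_limitI)
  define \<nu> where "\<nu> = (\<lambda>T. measure_of UNIV (sets borel)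
         (\<lambda>B. \<integral>\<^sup>+\<epsilon>\<in>{T..1}. (ennreal (\<epsilon> powr (scaling_exponent k F - 1)) * emeasure (curvature_measure k F \<epsilon>) B) \<partial>lborel))"
  let ?w = "\<lambda>T \<epsilon>. ennreal (\<epsilon> powr (\<delta> - real k - 1)) * indicator {T..1} \<epsilon>"
  have \<nu>_eq: "\<nu> T = measure_of (space borel) (sets borel) (\<lambda>B. \<integral>\<^sup>+\<epsilon>. ?w T \<epsilon> * emeasure (curvature_measure k F \<epsilon>) B \<partial>lborel)" for T
    unfolding \<nu>_def scaling_exponent_F[OF k] by (simp add: mult_ac)
  have sets_\<nu>: "sets (\<nu> T) = sets borel" for T
    unfolding \<nu>_eq by (rule sets.sets_measure_of_eq)
  have int\<nu>: "(\<integral>\<^sup>+x. ennreal (f x) \<partial>\<nu> T) = ennreal (log_integral (curv_value k f) T 1 / curvature_factor k)"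
    if T: "0 < T" "T < 1" and f: "continuous_on UNIV f" "\<And>x. 0 \<le> f x" "\<And>x. f x \<le> b" for f b T
  proof -
    have fm: "(\<lambda>x. ennreal (f x)) \<in> borel_measurable borel" using borel_measurable_continuous_onI[OF f(1)] by simp
    have meas: "(\<lambda>\<epsilon>. ?w T \<epsilon> * emeasure (curvature_measure k F \<epsilon>) B') \<in> borel_measurable lborel" if "B' \<in> sets borel" for B'
    proof -
      have "(\<lambda>\<epsilon>. ennreal (\<epsilon> powr (\<delta> - real k - 1))) \<in> borel_measurable borel" by measurable
      from borel_measurable_times_ennreal[OF this emeasure_curvature_measurable[OF k that T(1)]]
      show ?thesis by (simp add: mult.assoc)
    qed
    have "(\<integral>\<^sup>+x. ennreal (f x) \<partial>\<nu> T) = (\<integral>\<^sup>+\<epsilon>. ?w T \<epsilon> * (\<integral>\<^sup>+x. ennreal (f x) \<partial>curvature_measure k F \<epsilon>) \<partial>lborel)"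
      unfolding \<nu>_eq by (rule nn_integral_mixture[OF sets_curvature_measure meas fm])
    also have "\<dots> = (\<integral>\<^sup>+\<epsilon>. ennreal (indicator {T..1} \<epsilon> * (curv_value k f \<epsilon> / \<epsilon>) / curvature_factor k) \<partial>lborel)"
    proof (rule nn_integral_cong)
      fix \<epsilon> :: real
      show "?w T \<epsilon> * (\<integral>\<^sup>+x. ennreal (f x) \<partial>curvature_measure k F \<epsilon>) = ennreal (indicator {T..1} \<epsilon> * (curv_value k f \<epsilon> / \<epsilon>) / curvature_factor k)"
      proof (cases "\<epsilon> \<in> {T..1}")
        case True
        then have e: "0 < \<epsilon>" "\<epsilon> \<le> 1" using T by auto
        have "\<epsilon> powr (\<delta> - real k - 1) * (curv_value k f \<epsilon> * \<epsilon> powr (real k - \<delta>) / curvature_factor k) =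
            curv_value k f \<epsilon> * (\<epsilon> powr (\<delta> - real k - 1) * \<epsilon> powr (real k - \<delta>)) / curvature_factor k" by simp
        also have "\<epsilon> powr (\<delta> - real k - 1) * \<epsilon> powr (real k - \<delta>) = 1 / \<epsilon>"
          using e by (simp add: powr_add[symmetric] powr_minus_divide)
        finally have "\<epsilon> powr (\<delta> - real k - 1) * (curv_value k f \<epsilon> * \<epsilon> powr (real k - \<delta>) / curvature_factor k) = curv_value k f \<epsilon> / \<epsilon> / curvature_factor k"
          by simp
        then show ?thesis using True nn_integral_curvature[OF f k e] curv_value_nonneg[OF f, of k \<epsilon>] curvature_factor_pos[of k]
          by (simp add: ennreal_mult[symmetric])
      qed simp
    qed
    also have "\<dots> = ennreal (\<integral>\<epsilon>. indicator {T..1} \<epsilon> * (curv_value k f \<epsilon> / \<epsilon>) / curvature_factor k \<partial>lborel)"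
    proof (rule nn_integral_eq_integral)
      show "integrable lborel (\<lambda>\<epsilon>. indicator {T..1} \<epsilon> * (curv_value k f \<epsilon> / \<epsilon>) / curvature_factor k)"
        by (intro integrable_divide_zero integrable_log_integral[OF curv_value_lb[OF f] T(1)])
      show "AE \<epsilon> in lborel. 0 \<le> indicator {T..1} \<epsilon> * (curv_value k f \<epsilon> / \<epsilon>) / curvature_factor k"
        using T curv_value_nonneg[OF f] curvature_factor_pos[of k] by (intro AE_I2) (auto simp: indicator_def)
    qed
    also have "(\<integral>\<epsilon>. indicator {T..1} \<epsilon> * (curv_value k f \<epsilon> / \<epsilon>) / curvature_factor k \<partial>lborel) = log_integral (curv_value k f) T 1 / curvature_factor k"
      unfolding log_integral_def by (rule integral_divide_zero)
    finally show ?thesis .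
  qed
  have avg_def: "averaged_curvature_measure k F T = scale_measure (ennreal (curvature_factor k / \<bar>ln T\<bar>)) (\<nu> T)" for T
    by (simp add: averaged_curvature_measure_def \<nu>_def)
  have log_nonneg: "0 \<le> log_integral (curv_value k f) T 1"
    if T: "0 < T" "T < 1" and f: "continuous_on UNIV f" "\<And>x. 0 \<le> f x" "\<And>x. f x \<le> b" for f b T
  proof -
    have "0 = log_integral (\<lambda>_. 0) T 1" by (simp add: log_integral_def)
    also have "\<dots> \<le> log_integral (curv_value k f) T 1"
      using T by (intro log_integral_mono curv_value_lb[OF f] curv_value_nonneg[OF f]) auto
    finally show ?thesis .
  qed
  have int: "(\<integral>\<^sup>+x. ennreal (f x) \<partial>averaged_curvature_measure k F T) = ennreal (mode_value True (curv_value k f) T)"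
    if T: "0 < T" "T < 1" and f: "continuous_on UNIV f" "\<And>x. 0 \<le> f x" "\<And>x. f x \<le> b" for f b T
  proof -
    have fm: "(\<lambda>x. ennreal (f x)) \<in> borel_measurable (\<nu> T)"
      using borel_measurable_continuous_onI[OF f(1)] sets_\<nu> by (simp cong: measurable_cong_sets)
    have "(\<integral>\<^sup>+x. ennreal (f x) \<partial>averaged_curvature_measure k F T) =
        ennreal (curvature_factor k / \<bar>ln T\<bar>) * ennreal (log_integral (curv_value k f) T 1 / curvature_factor k)"
      unfolding avg_def nn_integral_scale_measure[OF fm] int\<nu>[OF T f] ..
    also have "\<dots> = ennreal (curvature_factor k / \<bar>ln T\<bar> * (log_integral (curv_value k f) T 1 / curvature_factor k))"
      using curvature_factor_pos[of k] log_nonneg[OF T f] by (intro ennreal_mult[symmetric]) auto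
    finally show ?thesis using curvature_factor_pos[of k] by (simp add: mode_value_def)
  qed
  have sets: "sets (averaged_curvature_measure k F T) = sets borel" for T by (simp add: avg_def sets_\<nu>)
  show "\<forall>\<^sub>F T in at_right 0. sets (averaged_curvature_measure k F T) = sets borel \<and> finite_measure (averaged_curvature_measure k F T)"
    using eventually_unit_interval
  proof eventually_elim
    case (elim T)
    have "emeasure (averaged_curvature_measure k F T) (space (averaged_curvature_measure k F T)) = (\<integral>\<^sup>+x. ennreal 1 \<partial>averaged_curvature_measure k F T)"
      by simp
    also have "\<dots> = ennreal (mode_value True (curv_value k (\<lambda>_. 1)) T)" using elim by (intro int[of T _ 1]) auto
    finally show ?case using sets by (auto intro!: finite_measureI)
  qed
  fix f :: "real \<Rightarrow> real" assume f: "continuous_on UNIV f" "bounded (range f)" "\<And>x. 0 \<le> f x"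
  obtain b where b: "\<And>x. f x \<le> b" using f(2) unfolding bounded_iff by (auto dest: abs_le_D1)
  have "(mode_value True (curv_value k f) \<longlongrightarrow> curv_const k * enn2real (limit_integral f)) (at_right 0)"
    using curv_value_limit[OF f(1,3) b scaled_count_average, of k] by (simp add: mode_limit_def)
  moreover have "enn2real (\<integral>\<^sup>+x. ennreal (f x) \<partial>limit_measure k) = curv_const k * enn2real (limit_integral f)"
    using f curv_const_nonneg by (subst nn_integral_limit_measure) (auto intro: borel_measurable_continuous_onI simp: enn2real_mult)
  moreover have "\<forall>\<^sub>F T in at_right 0. mode_value True (curv_value k f) T = enn2real (\<integral>\<^sup>+x. ennreal (f x) \<partial>averaged_curvature_measure k F T)"
    using eventually_unit_interval
  proof eventually_elim
    case (elim T)
    have "0 \<le> mode_value True (curv_value k f) T" unfolding mode_value_def if_True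
      using elim by (intro divide_nonneg_nonneg log_nonneg[OF _ _ f(1,3) b]) auto
    then show ?case using int[OF _ _ f(1,3) b, of T] elim by simp
  qed
  ultimately show "((\<lambda>T. enn2real (\<integral>\<^sup>+x. ennreal (f x) \<partial>averaged_curvature_measure k F T)) \<longlongrightarrow>
      enn2real (\<integral>\<^sup>+x. ennreal (f x) \<partial>limit_measure k)) (at_right 0)"
    by (simp only:) (erule Lim_transform_eventually)
qed (simp_all add: finite_limit_measure)

end


section \<open>Minkowski dimension and Radon-Nikodym derivative\<close>

context conformal_ifs
begin

text \<open>The volume of the parallel set is \<open>t powr (1 - \<delta>)\<close> up to a factor v
  between positive constants, and \<open>ln v / ln t\<close> tends to 0. With g the identity this
  turns the Moran exponent into the Minkowski dimension of K.\<close>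

lemma minkowski_dim_F: "minkowski_dim F = \<delta>"
proof -
  obtain b1 b2 e where b: "0 < b1" "0 < e" "e \<le> 1"
    and mass: "\<And>t. 0 < t \<Longrightarrow> t \<le> e \<Longrightarrow> \<exists>v. b1 \<le> v \<and> v \<le> b2 \<and> emeasure (curvature_measure 1 F t) UNIV = ennreal (v * t powr (real 1 - \<delta>))"
    by (rule total_mass[of 1]) blast+
  define C where "C = \<bar>ln b1\<bar> + \<bar>ln b2\<bar>"
  have "((\<lambda>t. C / \<bar>ln t\<bar>) \<longlongrightarrow> 0) (at_right 0)" by real_asymp
  moreover have "\<forall>\<^sub>F t in at_right 0. norm (ln (measure lborel (parallel_set F t)) / ln t - (1 - \<delta>)) \<le> C / \<bar>ln t\<bar>"
    using eventually_at_right_real[OF b(2)] eventually_unit_interval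
  proof eventually_elim
    case (elim t)
    then obtain v where v: "b1 \<le> v" "v \<le> b2" "emeasure (curvature_measure 1 F t) UNIV = ennreal (v * t powr (real 1 - \<delta>))"
      using mass[of t] by auto
    have v0: "0 < v" using v b by simp
    have "emeasure lborel (parallel_set F t) = ennreal (v * t powr (1 - \<delta>))"
      using v(3) by (simp add: emeasure_curvature_measure)
    then have "measure lborel (parallel_set F t) = v * t powr (1 - \<delta>)" using v0 by (simp add: measure_def)
    then have "ln (measure lborel (parallel_set F t)) = ln v + (1 - \<delta>) * ln t"
      using v0 elim by (simp add: ln_mult ln_powr)
    moreover have lt: "ln t \<noteq> 0" using elim by simp
    ultimately have "ln (measure lborel (parallel_set F t)) / ln t - (1 - \<delta>) = ln v / ln t" by (simp add: add_divide_distrib)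
    moreover have "\<bar>ln v\<bar> \<le> C"
    proof -
      have "ln b1 \<le> ln v" "ln v \<le> ln b2" using v b v0 by auto
      then show ?thesis unfolding C_def by linarith
    qed
    ultimately show ?case by (simp add: divide_right_mono)
  qed
  ultimately have "((\<lambda>t. ln (measure lborel (parallel_set F t)) / ln t - (1 - \<delta>)) \<longlongrightarrow> 0) (at_right 0)"
    by (rule Lim_null_comparison[rotated])
  then have "((\<lambda>t. ln (measure lborel (parallel_set F t)) / ln t) \<longlongrightarrow> 1 - \<delta>) (at_right 0)" by (rule Lim_null[THEN iffD2])
  then have "Lim (at_right 0) (\<lambda>t. ln (measure lborel (parallel_set F t)) / ln t) = 1 - \<delta>"
    by (rule tendsto_Lim[OF trivial_limit_at_right_real])
  then show ?thesis unfolding minkowski_dim_def by linarith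
qed

text \<open>m stands for the limit measure of the identity, given by its integrals since only one
  map g is fixed in this context. Both measures have the same factor \<open>curv_const k\<close>, so
  the density that relates them is the power of the derivative alone.\<close>

lemma limit_measure_RN:
  assumes sub: "{A..B} \<subseteq> U" and U: "open U" and g_contU: "continuous_on U g" and g_injU: "inj_on g U"
    and dg: "\<And>x. x \<in> {A..B} \<Longrightarrow> deriv g x = dg x"
    and m: "sets m = sets borel" "finite_measure m"
    and int_m: "\<And>f. f \<in> borel_measurable borel \<Longrightarrow>
      (\<integral>\<^sup>+x. f x \<partial>m) = (\<integral>\<^sup>+x. ennreal (curv_const k * indicator {A..B} x) * f x \<partial>self_similar_measure)"
  shows "ac_with_RN_derivative (limit_measure k) (push_forward U g m) (\<lambda>y. \<bar>deriv g (the_inv_into U g y)\<bar> powr \<delta>)"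
proof -
  let ?P = "push_forward U g m"
  let ?I = "g ` {A..B}"
  \<comment> \<open>Inverting g on the compact interval gives a continuous inverse, so h is Borel
    measurable; the inverse on U is brought in only almost everywhere.\<close>
  define h where "h y = indicator ?I y * (\<bar>dg (the_inv_into {A..B} g y)\<bar> powr \<delta>)" for y
  have UB: "U \<in> sets borel" using U by (rule borel_open)
  have sp: "space m = UNIV" using sets_eq_imp_space_eq[OF m(1)] by simp
  have compI: "compact ?I" by (rule compact_continuous_image[OF g_cont]) simp
  then have IB[measurable]: "?I \<in> sets borel" by (intro borel_closed compact_imp_closed)
  have inv_cont: "continuous_on ?I (the_inv_into {A..B} g)"
    by (rule continuous_on_inv_into[OF g_cont _ g_inj]) simp
  have "continuous_on ?I (\<lambda>y. \<bar>dg (the_inv_into {A..B} g y)\<bar> powr \<delta>)"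
    by (rule continuous_on_compose2[OF dgpow_cont inv_cont]) (auto simp: the_inv_into_f_f[OF g_inj])
  from borel_measurable_continuous_on_indicator[OF IB this]
  have hm[measurable]: "h \<in> borel_measurable borel" by (simp add: h_def[abs_def])
  have h_g: "h (g x) = \<bar>dg x\<bar> powr \<delta>" if "x \<in> {A..B}" for x
    using that by (simp add: h_def the_inv_into_f_f[OF g_inj])
  have "g \<in> borel_measurable (restrict_space borel U)"
    by (rule borel_measurable_continuous_on_restrict[OF g_contU])
  then have gm: "g \<in> borel_measurable (restrict_space m U)"
    using m(1) by (simp cong: measurable_cong_sets add: sets_restrict_space)
  have sets_P: "sets ?P = sets borel" by (simp add: push_forward_def)
  have int_P: "(\<integral>\<^sup>+y. f y \<partial>?P) = (\<integral>\<^sup>+x. ennreal (curv_const k * indicator {A..B} x) * f (clamped_g x) \<partial>self_similar_measure)"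
    if [measurable]: "f \<in> borel_measurable borel" for f :: "real \<Rightarrow> ennreal"
  proof -
    have "(\<integral>\<^sup>+y. f y \<partial>?P) = (\<integral>\<^sup>+x. f (g x) \<partial>restrict_space m U)"
      unfolding push_forward_def by (rule nn_integral_distr[OF gm]) measurable
    also have "\<dots> = (\<integral>\<^sup>+x. f (g x) * indicator U x \<partial>m)"
      using UB m(1) sp by (intro nn_integral_restrict_space) simp
    also have "\<dots> = (\<integral>\<^sup>+x. ennreal (curv_const k * indicator {A..B} x) * (f (g x) * indicator U x) \<partial>self_similar_measure)"
    proof (rule int_m)
      have "(\<lambda>x. f (g x)) \<in> borel_measurable (restrict_space borel U)"
        by (rule measurable_compose[OF borel_measurable_continuous_on_restrict[OF g_contU]]) measurable
      then show "(\<lambda>x. f (g x) * indicator U x) \<in> borel_measurable borel"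
        using UB by (subst (asm) borel_measurable_restrict_space_iff_ennreal) auto
    qed
    also have "\<dots> = (\<integral>\<^sup>+x. ennreal (curv_const k * indicator {A..B} x) * f (clamped_g x) \<partial>self_similar_measure)"
      using sub by (intro nn_integral_cong) (auto simp: indicator_def clamped_g_eq)
    finally show ?thesis .
  qed
  have "finite_measure ?P"
  proof
    have "emeasure ?P (space ?P) = emeasure (restrict_space m U) (space (restrict_space m U))"
      unfolding push_forward_def using gm by (subst emeasure_distr) auto
    also have "\<dots> = emeasure m U" using UB m(1) sp by (simp add: space_restrict_space emeasure_restrict_space)
    finally show "emeasure ?P (space ?P) \<noteq> \<infinity>" using finite_measure.emeasure_finite[OF m(2)] by simp
  qed
  then interpret P: finite_measure ?P .
  have hP: "(\<lambda>y. ennreal (h y)) \<in> borel_measurable ?P" using sets_P by (simp cong: measurable_cong_sets)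
  have dens: "density ?P (\<lambda>y. ennreal (h y)) = limit_measure k"
  proof (rule measure_eqI)
    show "sets (density ?P (\<lambda>y. ennreal (h y))) = sets (limit_measure k)" using sets_P by simp
    fix D assume "D \<in> sets (density ?P (\<lambda>y. ennreal (h y)))"
    then have D[measurable]: "D \<in> sets borel" using sets_P by simp
    have "emeasure (density ?P (\<lambda>y. ennreal (h y))) D = (\<integral>\<^sup>+y. ennreal (h y) * indicator D y \<partial>?P)"
      using hP D sets_P by (intro emeasure_density) auto
    also have "\<dots> = (\<integral>\<^sup>+x. ennreal (curv_const k * indicator {A..B} x) * (ennreal (h (clamped_g x)) * indicator D (clamped_g x)) \<partial>self_similar_measure)"
      by (rule int_P) measurable
    also have "\<dots> = (\<integral>\<^sup>+x. ennreal (curv_const k * image_density x) * indicator D (clamped_g x) \<partial>self_similar_measure)"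
    proof (rule nn_integral_cong)
      fix x show "ennreal (curv_const k * indicator {A..B} x) * (ennreal (h (clamped_g x)) * indicator D (clamped_g x)) =
          ennreal (curv_const k * image_density x) * indicator D (clamped_g x)"
      proof (cases "x \<in> {A..B}")
        case True
        then have "h (clamped_g x) = \<bar>dg x\<bar> powr \<delta>" by (simp only: clamped_g_eq h_g)
        then show ?thesis using True curv_const_nonneg[of k] by (simp add: image_density_def ennreal_mult mult.assoc)
      qed (simp add: image_density_def)
    qed
    also have "\<dots> = emeasure (limit_measure k) D"
    proof -
      have "emeasure (limit_measure k) D = emeasure (density self_similar_measure (\<lambda>x. ennreal (curv_const k * image_density x))) (clamped_g -` D)"
        unfolding limit_measure_def using sets_eq_imp_space_eq[OF sets_self_similar_measure] by (subst emeasure_distr) auto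
      also have "\<dots> = (\<integral>\<^sup>+x. ennreal (curv_const k * image_density x) * indicator (clamped_g -` D) x \<partial>self_similar_measure)"
        using measurable_sets[OF clamped_g_measurable D] by (intro emeasure_density) auto
      finally show ?thesis by (simp add: indicator_def)
    qed
    finally show "emeasure (density ?P (\<lambda>y. ennreal (h y))) D = emeasure (limit_measure k) D" .
  qed
  have ac: "absolutely_continuous ?P (limit_measure k)"
    using absolutely_continuousI_density[OF hP] by (simp add: dens)
  have "finite_measure (limit_measure k)" by (rule finite_limit_measure)
  then have "sigma_finite_measure (limit_measure k)" by (simp add: finite_measure_def)
  then have RN: "AE y in ?P. ennreal (h y) = RN_deriv ?P (limit_measure k) y"
    by (rule RN_deriv_unique_sigma_finite[OF hP dens])
  \<comment> \<open>The push-forward does not charge the complement of the image of [A, B], and on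
    that image the two inverses agree.\<close>
  have "(\<integral>\<^sup>+y. indicator (- ?I) y \<partial>?P) = (\<integral>\<^sup>+x. ennreal (curv_const k * indicator {A..B} x) * indicator (- ?I) (clamped_g x) \<partial>self_similar_measure)"
    by (rule int_P) measurable
  also have "\<dots> = (\<integral>\<^sup>+x. 0 \<partial>self_similar_measure)"
    by (intro nn_integral_cong) (auto simp: indicator_def clamped_g_eq)
  finally have "emeasure ?P (- ?I) = 0" using sets_P IB by (subst (asm) nn_integral_indicator) auto
  then have AEI: "AE y in ?P. y \<in> ?I"
    using sets_P IB by (intro AE_I[of _ _ "- ?I"]) auto
  have "AE y in ?P. RN_deriv ?P (limit_measure k) y = ennreal (\<bar>deriv g (the_inv_into U g y)\<bar> powr \<delta>)"
    using RN AEI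
  proof eventually_elim
    case (elim y)
    then obtain x where x: "x \<in> {A..B}" "y = g x" by auto
    then have "the_inv_into U g y = x" using sub the_inv_into_f_f[OF g_injU] by auto
    then have "h y = \<bar>deriv g (the_inv_into U g y)\<bar> powr \<delta>" unfolding x(2) h_g[OF x(1)] using dg[OF x(1)] x(2) by simp
    then show ?case using elim(1) by simp
  qed
  then show ?thesis using ac by (simp add: ac_with_RN_derivative_def)
qed

end

section \<open>The identity map, and nonlattice systems\<close>

context ifs
begin

lemma conformal_ifs_id: "conformal_ifs N r s c A B K \<delta> (\<lambda>x. x) (\<lambda>_. 1)"
  by unfold_locales auto

interpretation id: conformal_ifs N r s c A B K \<delta> "\<lambda>x. x" "\<lambda>_. 1" by (rule conformal_ifs_id)

text \<open>For the identity the density reduces to an indicator and clamping changes nothing on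
  [A, B]. The result has the form of the hypothesis \<open>int_m\<close> in
  \<open>limit_measure_RN\<close>.\<close>

lemma id_nn_integral_limit_measure:
  assumes [measurable]: "f \<in> borel_measurable borel"
  shows "(\<integral>\<^sup>+x. f x \<partial>id.limit_measure k) = (\<integral>\<^sup>+x. ennreal (id.curv_const k * indicator {A..B} x) * f x \<partial>self_similar_measure)"
proof -
  have "(\<integral>\<^sup>+x. f x \<partial>id.limit_measure k) =
      (\<integral>\<^sup>+x. ennreal (id.curv_const k * id.image_density x) * f (id.clamped_g x) \<partial>self_similar_measure)"
  proof -
    have "(\<integral>\<^sup>+x. f x \<partial>id.limit_measure k) =
        (\<integral>\<^sup>+x. f (id.clamped_g x) \<partial>density self_similar_measure (\<lambda>x. ennreal (id.curv_const k * id.image_density x)))"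
      unfolding id.limit_measure_def by (rule nn_integral_distr) measurable
    also have "\<dots> = (\<integral>\<^sup>+x. ennreal (id.curv_const k * id.image_density x) * f (id.clamped_g x) \<partial>self_similar_measure)"
      by (rule nn_integral_density) measurable
    finally show ?thesis .
  qed
  also have "\<dots> = (\<integral>\<^sup>+x. ennreal (id.curv_const k * indicator {A..B} x) * f x \<partial>self_similar_measure)"
    by (intro nn_integral_cong) (auto simp: id.image_density_def id.clamped_g_eq indicator_def)
  finally show ?thesis .
qed

text \<open>If the ratios are not multiplicatively dense, the differences of the logarithms of word ratios form a discrete subgroup
  containing the range of the geometric potential, which is then its own lattice representative (with \<open>\<psi> = 0\<close>).\<close>

lemma nonlattice_ratios:
  assumes "\<not> lattice_ifs N r" shows ratios_nonlattice
proof (rule ccontr)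
  assume "\<not> ratios_nonlattice"
  then obtain \<eta> where eta: "\<eta> > 1" and no: "\<And>u v. set u \<subseteq> {1..N} \<Longrightarrow> set v \<subseteq> {1..N} \<Longrightarrow>
     \<not> (word_ratio r u < word_ratio r v \<and> word_ratio r v \<le> \<eta> * word_ratio r u)"
    unfolding ratios_nonlattice_def by blast
  define H where "H = {ln (word_ratio r u) - ln (word_ratio r v) | u v. set u \<subseteq> {1..N} \<and> set v \<subseteq> {1..N}}"
  have gap: "ln \<eta> < ln (word_ratio r v) - ln (word_ratio r u)"
    if "set u \<subseteq> {1..N}" "set v \<subseteq> {1..N}" "word_ratio r u < word_ratio r v" for u v
  proof -
    have "\<eta> * word_ratio r u < word_ratio r v" using no[OF that(1,2)] that(3) by auto
    moreover have pos: "0 < \<eta> * word_ratio r u" using eta word_ratio_pos[OF that(1)] by simp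
    ultimately have "ln (\<eta> * word_ratio r u) < ln (word_ratio r v)" by simp
    then show ?thesis using eta word_ratio_pos[OF that(1)] by (simp add: ln_mult)
  qed
  have diff: "x - y \<in> H" if xy: "x \<in> H" "y \<in> H" for x y
  proof -
    obtain u v u' v' where w: "set u \<subseteq> {1..N}" "set v \<subseteq> {1..N}" "set u' \<subseteq> {1..N}" "set v' \<subseteq> {1..N}"
      "x = ln (word_ratio r u) - ln (word_ratio r v)" "y = ln (word_ratio r u') - ln (word_ratio r v')"
      using xy unfolding H_def by blast
    \<comment> \<open>Concatenation multiplies ratios, so a difference of two logarithmic quotients
      is again the logarithmic quotient of two words.\<close>
    have "x - y = ln (word_ratio r (u @ v')) - ln (word_ratio r (v @ u'))"
      using w word_ratio_pos[OF w(1)] word_ratio_pos[OF w(2)] word_ratio_pos[OF w(3)] word_ratio_pos[OF w(4)]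
      by (simp add: ln_mult)
    moreover have "set (u @ v') \<subseteq> {1..N}" "set (v @ u') \<subseteq> {1..N}" using w by auto
    ultimately show ?thesis unfolding H_def by blast
  qed
  have sep: "ln \<eta> < \<bar>x\<bar>" if x: "x \<in> H" "x \<noteq> 0" for x
  proof -
    obtain u v where w: "set u \<subseteq> {1..N}" "set v \<subseteq> {1..N}" "x = ln (word_ratio r u) - ln (word_ratio r v)"
      using x(1) unfolding H_def by blast
    then have "word_ratio r u \<noteq> word_ratio r v" using x(2) by auto
    then show ?thesis using gap[OF w(1,2)] gap[OF w(2,1)] w(3) by (cases "word_ratio r u < word_ratio r v") auto
  qed
  have zero: "0 \<in> H"
  proof -
    have "0 = ln (word_ratio r []) - ln (word_ratio r [])" by simp
    then show ?thesis unfolding H_def by (intro CollectI exI[of _ "[]"]) auto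
  qed
  have dsg: "discrete_subgroup H"
    unfolding discrete_subgroup_def
  proof (intro conjI ballI zero diff Isolated.discreteI)
    fix x assume x: "x \<in> H"
    have "ball x (ln \<eta>) \<inter> H = {x}"
    proof -
      have "y = x" if "y \<in> H" "dist x y < ln \<eta>" for y
        using sep[OF diff[OF x that(1)]] that(2) by (auto simp: dist_real_def)
      then show ?thesis using x eta by auto
    qed
    then show "x isolated_in H" unfolding isolated_in_def using x by blast
  qed
  have cont: "continuous_on (words N) (geometric_potential r)"
  proof -
    have 1: "continuous_on (words N) (\<lambda>\<omega>::nat \<Rightarrow> nat. \<omega> 0)"
      by (rule continuous_on_subset[OF continuous_on_product_coordinates]) simp
    have 2: "continuous_on UNIV (\<lambda>n::nat. - ln (r n))"
      unfolding continuous_on_topological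
    proof (intro ballI allI impI)
      fix n :: nat and D assume "- ln (r n) \<in> D"
      then show "\<exists>V. open V \<and> n \<in> V \<and> (\<forall>y\<in>UNIV. y \<in> V \<longrightarrow> - ln (r y) \<in> D)"
        by (intro exI[of _ "{n}"]) (simp add: discrete_topology_class.open_discrete)
    qed
    show ?thesis unfolding geometric_potential_def[abs_def] by (rule continuous_on_compose2[OF 2 1]) simp
  qed
  have range: "geometric_potential r ` words N \<subseteq> H"
  proof
    fix x assume "x \<in> geometric_potential r ` words N"
    then obtain \<omega> where w: "\<omega> \<in> words N" "x = - ln (r (\<omega> 0))" by (auto simp: geometric_potential_def)
    have "set [\<omega> 0] \<subseteq> {1..N}" using w(1) by (simp add: words_def)
    moreover have "x = ln (word_ratio r []) - ln (word_ratio r [\<omega> 0])" using w by simp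
    ultimately show "x \<in> H" unfolding H_def by (intro CollectI exI[of _ "[]"] exI[of _ "[\<omega> 0]"]) auto
  qed
  have "lattice_ifs N r"
    unfolding lattice_ifs_def
    by (rule exI[of _ "geometric_potential r"], rule exI[of _ "\<lambda>_. 0"], rule exI[of _ H])
      (use cont dsg range in auto)
  then show False using assms by simp
qed

end

text \<open>The distances of \<open>R x\<close> from the images of A and B add up to the distance
  between these images, so \<open>R x\<close> lies between them at a determined place. The
  orientation is read off at the endpoints.\<close>

lemma similarity_affine:
  fixes R :: "real \<Rightarrow> real"
  assumes "A < B" "0 < \<rho>" and R: "\<And>x y. x \<in> {A..B} \<Longrightarrow> y \<in> {A..B} \<Longrightarrow> dist (R x) (R y) = \<rho> * dist x y"
  shows "\<exists>s c. \<bar>s\<bar> = \<rho> \<and> (\<forall>x\<in>{A..B}. R x = s * x + c)"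
proof -
  define \<sigma> where "\<sigma> = sgn (R B - R A)"
  have AB: "\<bar>R B - R A\<bar> = \<rho> * (B - A)" using R[of B A] assms(1) by (simp add: dist_real_def)
  have pos: "0 < \<rho> * (B - A)" using assms by simp
  then have s: "\<sigma> = 1 \<or> \<sigma> = -1" using AB by (auto simp: \<sigma>_def sgn_if)
  have RB: "\<sigma> * (R B - R A) = \<rho> * (B - A)" unfolding \<sigma>_def AB[symmetric] by (simp add: sgn_if abs_if)
  have "R x = \<sigma> * \<rho> * x + (R A - \<sigma> * \<rho> * A)" if x: "x \<in> {A..B}" for x
  proof -
    have 1: "\<bar>R x - R A\<bar> = \<rho> * (x - A)" using R[of x A] x by (simp add: dist_real_def)
    have 2: "\<bar>R B - R x\<bar> = \<rho> * (B - x)" using R[of B x] x by (simp add: dist_real_def abs_minus_commute)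
    have "\<rho> * (B - A) = \<rho> * (x - A) + \<rho> * (B - x)" by (simp add: algebra_simps)
    then have "\<sigma> * (R x - R A) = \<rho> * (x - A)" using s RB 1 2 by auto
    then have "R x - R A = \<sigma> * (\<rho> * (x - A))" using s by auto
    then show ?thesis by (simp add: algebra_simps)
  qed
  moreover have "\<bar>\<sigma> * \<rho>\<bar> = \<rho>" using s assms(2) by auto
  ultimately show ?thesis by blast
qed

theorem theorem2p13:
  fixes N :: nat and R :: "nat \<Rightarrow> real \<Rightarrow> real" and r :: "nat \<Rightarrow> real"
    and X K U F :: "real set" and g :: "real \<Rightarrow> real" and \<alpha> \<delta> :: real
  assumes "similarity_ifs N R r X"
    and "self_similar_set N R X K"
    and "open_set_condition N R (interior X)"
    and "\<delta> = minkowski_dim K"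
    and "X \<subseteq> U" and "open U" and "connected U"
    and "\<alpha> > 0" and "C1_hoelder \<alpha> U g"
    and "\<exists>c>0. \<forall>x\<in>U. c \<le> \<bar>deriv g x\<bar>"
    and "emeasure lborel K = 0"
    and "F = g ` K"
  shows "(\<forall>k\<in>{0, 1}.
           avg_frac_curv_exists k K \<and> avg_frac_curv_exists k F \<and>
           ac_with_RN_derivative (avg_frac_curv k F) (push_forward U g (avg_frac_curv k K))
             (\<lambda>y. \<bar>deriv g (the_inv_into U g y)\<bar> powr \<delta>)) \<and>
         (\<not> lattice_ifs N r \<longrightarrow>
           (\<forall>k\<in>{0, 1}.
             frac_curv_exists k K \<and> frac_curv_exists k F \<and>
             ac_with_RN_derivative (frac_curv k F) (push_forward U g (frac_curv k K))
               (\<lambda>y. \<bar>deriv g (the_inv_into U g y)\<bar> powr \<delta>)))"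
proof -
  note sim = assms(1)[unfolded similarity_ifs_def]
  note self = assms(2)[unfolded self_similar_set_def]
  note osc = assms(3)[unfolded open_set_condition_def]
  have "connected X" "compact X" "X \<noteq> {}" using sim by (auto simp: is_interval_connected_1)
  then obtain A B where X: "X = {A..B}" using connected_compact_interval_1[of X] by auto
  have AB: "A < B"
  proof (rule ccontr)
    assume "\<not> A < B"
    then have "interior X = {}" unfolding X by (simp add: interior_atLeastAtMost_real)
    then show False using osc by simp
  qed
  have int_X: "interior X = {A<..<B}" unfolding X by (rule interior_atLeastAtMost_real)
  have "\<forall>i\<in>{1..N}. \<exists>sc. \<bar>fst sc\<bar> = r i \<and> (\<forall>x\<in>{A..B}. R i x = fst sc * x + snd sc)"
  proof
    fix i assume i: "i \<in> {1..N}"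
    have "\<exists>s c. \<bar>s\<bar> = r i \<and> (\<forall>x\<in>{A..B}. R i x = s * x + c)"
      using sim i X by (intro similarity_affine[OF AB]) auto
    then obtain s c where "\<bar>s\<bar> = r i \<and> (\<forall>x\<in>{A..B}. R i x = s * x + c)" by blast
    then show "\<exists>sc. \<bar>fst sc\<bar> = r i \<and> (\<forall>x\<in>{A..B}. R i x = fst sc * x + snd sc)" by (intro exI[of _ "(s, c)"]) simp
  qed
  from bchoice[OF this] obtain sc where sc: "\<And>i. i \<in> {1..N} \<Longrightarrow> \<bar>fst (sc i)\<bar> = r i"
    "\<And>i x. i \<in> {1..N} \<Longrightarrow> x \<in> {A..B} \<Longrightarrow> R i x = fst (sc i) * x + snd (sc i)" by blast
  define s where "s i = fst (sc i)" for i
  define c where "c i = snd (sc i)" for i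
  have Raff: "R i x = s i * x + c i" if "i \<in> {1..N}" "x \<in> {A..B}" for i x using sc(2)[OF that] by (simp add: s_def c_def)
  interpret affine_ifs N r s c A B K
  proof
    show "2 \<le> N" "compact K" "K \<noteq> {}" "A < B" "emeasure lborel K = 0" "K \<subseteq> {A..B}"
      using sim self AB assms(11) X by auto
    show "0 < r i" "r i < 1" "\<bar>s i\<bar> = r i" if "i \<in> {1..N}" for i using sim sc(1) that by (auto simp: s_def)
    show "s i * x + c i \<in> {A..B}" if "i \<in> {1..N}" "x \<in> {A..B}" for i x
      using sim that X Raff[OF that] by (metis image_subset_iff)
    show "s i * x + c i \<noteq> s j * y + c j"
      if "i \<in> {1..N}" "j \<in> {1..N}" "i \<noteq> j" "x \<in> {A<..<B}" "y \<in> {A<..<B}" for i j x y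
    proof -
      have "R i ` {A<..<B} \<inter> R j ` {A<..<B} = {}" using osc that int_X by blast
      then have "R i x \<noteq> R j y" using that(4,5) by blast
      then show ?thesis using Raff[OF that(1), of x] Raff[OF that(2), of y] that(4,5) by simp
    qed
    have "R i ` K = (\<lambda>x. s i * x + c i) ` K" if "i \<in> {1..N}" for i
      using Raff[OF that] self X by (intro image_cong) auto
    then have "(\<Union>i\<in>{1..N}. R i ` K) = (\<Union>i\<in>{1..N}. (\<lambda>x. s i * x + c i) ` K)" by (intro SUP_cong) auto
    then show "K = (\<Union>i\<in>{1..N}. (\<lambda>x. s i * x + c i) ` K)" using self by metis
  qed
  \<comment> \<open>The Moran root d has to be kept apart from \<delta> at first; they are
    identified through the Minkowski dimension of K, computed with the identity as map.\<close>
  obtain d where d: "0 < d" "d < 1" "(\<Sum>i=1..N. r i powr d) = 1" using moran_exponent by blast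
  interpret ifs N r s c A B K d
    by unfold_locales (use d two_maps' ratio_pos' ratio_less_1' in auto)
  note hoel = assms(9)[unfolded C1_hoelder_def]
  obtain C where C: "\<And>x y. x \<in> U \<Longrightarrow> y \<in> U \<Longrightarrow> \<bar>deriv g x - deriv g y\<bar> \<le> C * \<bar>x - y\<bar> powr \<alpha>" using hoel by blast
  have der: "(g has_real_derivative deriv g x) (at x)" if "x \<in> U" for x
    using hoel that by (simp add: DERIV_deriv_iff_real_differentiable)
  have dne: "deriv g x \<noteq> 0" if "x \<in> U" for x using assms(10) that by force
  have sub: "{A..B} \<subseteq> U" using assms(5) X by simp
  \<comment> \<open>The Hoelder bound tends to 0 as the two points approach each other.\<close>
  have dcont: "continuous_on U (deriv g)"
    unfolding continuous_on_def
  proof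
    fix x assume x: "x \<in> U"
    have "((\<lambda>y. C * \<bar>y - x\<bar> powr \<alpha>) \<longlongrightarrow> C * (\<bar>x - x\<bar> powr \<alpha>)) (at x within U)"
      using assms(8) by (intro tendsto_intros tendsto_powr') auto
    then have "((\<lambda>y. C * \<bar>y - x\<bar> powr \<alpha>) \<longlongrightarrow> 0) (at x within U)" by simp
    then have "((\<lambda>y. deriv g y - deriv g x) \<longlongrightarrow> 0) (at x within U)"
    proof (rule Lim_null_comparison[rotated])
      show "\<forall>\<^sub>F y in at x within U. norm (deriv g y - deriv g x) \<le> C * \<bar>y - x\<bar> powr \<alpha>"
        unfolding eventually_at_filter using C x by (intro always_eventually) auto
    qed
    then show "(deriv g \<longlongrightarrow> deriv g x) (at x within U)" by (rule Lim_null[THEN iffD2])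
  qed
  interpret G: conformal_ifs N r s c A B K d g "deriv g"
    by unfold_locales (use der dne sub continuous_on_subset[OF dcont sub] in auto)
  interpret I: conformal_ifs N r s c A B K d "\<lambda>x. x" "\<lambda>_. 1" by (rule conformal_ifs_id)
  have GF: "G.F = F" using assms(12) by (simp add: G.F_def)
  have IF: "I.F = K" by (simp add: I.F_def)
  have d_eq: "d = \<delta>" using I.minkowski_dim_F assms(4) by (simp add: IF)
  have g_contU: "continuous_on U g"
    using der by (intro DERIV_continuous_on[of _ _ "deriv g"]) (auto intro: DERIV_subset)
  \<comment> \<open>U is an interval and the derivative has no zero, so the mean value theorem
    separates values; \<open>the_inv_into U g\<close> is then a true inverse.\<close>
  have g_injU: "inj_on g U"
  proof (rule linorder_inj_onI)
    fix a b assume ab: "a < b" "a \<in> U" "b \<in> U"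
    have sub': "{a..b} \<subseteq> U" using assms(7) ab connected_contains_Icc by blast
    obtain z where z: "a < z" "z < b" and gz: "g b - g a = (b - a) * deriv g z"
      using MVT2[OF ab(1), of g "deriv g"] der sub' by (meson atLeastAtMost_iff subsetD)
    have "z \<in> U" using sub' z by auto
    then show "g a \<noteq> g b" using dne[of z] ab(1) gz by auto
  qed auto
  \<comment> \<open>The averaged and the plain limits are the same measures
    \<open>limit_measure k\<close>, so one comparison serves both parts.\<close>
  have RN: "ac_with_RN_derivative (G.limit_measure k) (push_forward U g (I.limit_measure k))
      (\<lambda>y. \<bar>deriv g (the_inv_into U g y)\<bar> powr \<delta>)" for k
    unfolding d_eq[symmetric]
    by (rule G.limit_measure_RN[OF sub assms(6) g_contU g_injU refl I.sets_limit_measure I.finite_limit_measure])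
      (rule id_nn_integral_limit_measure)
  have nb: "at_right (0::real) \<noteq> bot" by (rule trivial_limit_at_right_real)
  show ?thesis
  proof (intro conjI impI ballI)
    fix k :: nat assume k: "k \<in> {0, 1}"
    note wK = I.weak_limit_averaged[OF k, unfolded IF] and wF = G.weak_limit_averaged[OF k, unfolded GF]
    show "avg_frac_curv_exists k K" "avg_frac_curv_exists k F"
      using wK wF unfolding avg_frac_curv_exists_def weakly_convergent_def by blast+
    show "ac_with_RN_derivative (avg_frac_curv k F) (push_forward U g (avg_frac_curv k K))
             (\<lambda>y. \<bar>deriv g (the_inv_into U g y)\<bar> powr \<delta>)"
      unfolding avg_frac_curv_def weak_limit_eq[OF wK nb] weak_limit_eq[OF wF nb] by (rule RN)
  next
    fix k :: nat assume nl: "\<not> lattice_ifs N r" and k: "k \<in> {0, 1}"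
    have lim: "mode_limit False scaled_count gap_constant"
      using nonlattice_ratios[OF nl] by (intro scaled_count_limit) simp
    note wK = I.weak_limit_rescaled[OF k lim, unfolded IF] and wF = G.weak_limit_rescaled[OF k lim, unfolded GF]
    show "frac_curv_exists k K" "frac_curv_exists k F"
      using wK wF unfolding frac_curv_exists_def weakly_convergent_def by blast+
    show "ac_with_RN_derivative (frac_curv k F) (push_forward U g (frac_curv k K))
             (\<lambda>y. \<bar>deriv g (the_inv_into U g y)\<bar> powr \<delta>)"
      unfolding frac_curv_def weak_limit_eq[OF wK nb] weak_limit_eq[OF wF nb] by (rule RN)
  qed
qed

end
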